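(* Let $K$ be a field of characteristic zero, let $m,n,t$ be positive integers with $2\le t\le \min\{m,n\}$ and $t<\max\{m,n\}$, let $X=(X_{i,j})_{1\le i\le m,\,1\le j\le n}$ be an $m\times n$ matrix of indeterminates, and let $R=K[X]$ be the standard graded polynomial ring. Let $I_t\subseteq R$ be the ideal generated by the $t$-minors of $X$, and let $\mathrm{in}(I_t)$ be the initial ideal of $I_t$ with respect to a diagonal monomial order. (a) If $t=\min\{m,n\}$, then $R/\mathrm{in}(I_t)$ has the strong Lefschetz property. (b) If $t<\min\{m,n\}$, then $R/\mathrm{in}(I_t)$ fails the weak Lefschetz property whenever one of the following conditions holds: (i) $t=2$ and $mn\ge 16$; (ii) $t=3$ and $mn\ge 24$; (iii) $t\ge 4$ and $mn\ge (t+1)(t+2)$.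
   Context: A monomial order on $R=K[X]$ is diagonal if the initial monomial of any minor of $X$ is the product of the indeterminates along its main diagonal. Let $S$ be a standard graded polynomial ring over $K$, $I\subseteq S$ a homogeneous ideal, and $d=\dim S/I$ (Krull dimension). $S/I$ has the weak Lefschetz property (WLP) if $S/I$ is Cohen–Macaulay and there exist a linear system of parameters $\underline\theta=\theta_1,\dots,\theta_d\in S_1$ of $S/I$ and a linear form $L\in S_1$ such that the multiplication map $\times L:(S/(I,\underline\theta))_j\to (S/(I,\underline\theta))_{j+1}$ has maximal rank (i.e. is injective or surjective) for all $j$. $S/I$ has the strong Lefschetz property (SLP) if $S/I$ is Cohen–Macaulay and there exist such $\underline\theta$ and $L$ for which $\times L^s:(S/(I,\underline\theta))_j\to (S/(I,\underline\theta))_{j+s}$ has maximal rank for all $j$ and all $s\ge 1$. *)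

theory Defs
  imports
    "HOL-Library.Poly_Mapping"
    "HOL-Library.Extended_Nat"
    "HOL-Algebra.QuotRing"
    "Jordan_Normal_Form.Determinant"
    "Jordan_Normal_Form.DL_Submatrix"
begin

section \<open>Polynomial rings\<close>

text \<open>A monomial is its exponent vector, written additively; a polynomial is a finitely
  supported family of coefficients indexed by monomials.\<close>

type_synonym 'v monomial = "'v \<Rightarrow>\<^sub>0 nat"
type_synonym ('v, 'k) mpoly = "'v monomial \<Rightarrow>\<^sub>0 'k"

definition monomials_in :: "'v set \<Rightarrow> 'v monomial set" where
  "monomials_in V = {u. Poly_Mapping.keys u \<subseteq> V}"

definition mon_degree :: "'v monomial \<Rightarrow> nat" where
  "mon_degree u = (\<Sum>v\<in>Poly_Mapping.keys u. Poly_Mapping.lookup u v)"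

definition monom_poly :: "'v monomial \<Rightarrow> ('v, 'k::comm_ring_1) mpoly" where
  "monom_poly u = Poly_Mapping.single u 1"

definition indet :: "'v \<Rightarrow> ('v, 'k::comm_ring_1) mpoly" where
  "indet v = monom_poly (Poly_Mapping.single v 1)"

definition mpoly_ring :: "'v set \<Rightarrow> ('v, 'k::comm_ring_1) mpoly ring" where
  "mpoly_ring V =
    \<lparr>carrier = {p. Poly_Mapping.keys p \<subseteq> monomials_in V},
     monoid.mult = (*), one = 1, zero = 0, add = (+)\<rparr>"

definition homog_part :: "'v set \<Rightarrow> nat \<Rightarrow> ('v, 'k::comm_ring_1) mpoly set" where
  "homog_part V j = {p \<in> carrier (mpoly_ring V). \<forall>u\<in>Poly_Mapping.keys p. mon_degree u = j}"

definition irrelevant_ideal :: "'v set \<Rightarrow> ('v, 'k::comm_ring_1) mpoly set" where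
  "irrelevant_ideal V = {p \<in> carrier (mpoly_ring V). Poly_Mapping.lookup p 0 = 0}"

lemma monomials_in_zero: "0 \<in> monomials_in V"
  by (simp add: monomials_in_def)

lemma monomials_in_add:
  "u \<in> monomials_in V \<Longrightarrow> w \<in> monomials_in V \<Longrightarrow> u + w \<in> monomials_in V"
  using Poly_Mapping.keys_add[of u w] by (auto simp: monomials_in_def)

lemma cring_mpoly_ring: "cring (mpoly_ring V :: ('v, 'k::comm_ring_1) mpoly ring)"
proof (rule cringI)
  show "abelian_group (mpoly_ring V :: ('v, 'k) mpoly ring)"
  proof (rule abelian_groupI)
    fix x y :: "('v, 'k) mpoly"
    assume "x \<in> carrier (mpoly_ring V)" "y \<in> carrier (mpoly_ring V)"
    then show "x \<oplus>\<^bsub>mpoly_ring V\<^esub> y \<in> carrier (mpoly_ring V)"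
      using Poly_Mapping.keys_add[of x y] by (auto simp: mpoly_ring_def)
  next
    fix x :: "('v, 'k) mpoly"
    assume "x \<in> carrier (mpoly_ring V)"
    then have "- x \<in> carrier (mpoly_ring V)" "- x \<oplus>\<^bsub>mpoly_ring V\<^esub> x = \<zero>\<^bsub>mpoly_ring V\<^esub>"
      by (auto simp: mpoly_ring_def)
    then show "\<exists>y\<in>carrier (mpoly_ring V). y \<oplus>\<^bsub>mpoly_ring V\<^esub> x = \<zero>\<^bsub>mpoly_ring V\<^esub>"
      by blast
  qed (auto simp: mpoly_ring_def algebra_simps)
  show "comm_monoid (mpoly_ring V :: ('v, 'k) mpoly ring)"
  proof (rule comm_monoidI)
    fix x y :: "('v, 'k) mpoly"
    assume "x \<in> carrier (mpoly_ring V)" "y \<in> carrier (mpoly_ring V)"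
    then show "x \<otimes>\<^bsub>mpoly_ring V\<^esub> y \<in> carrier (mpoly_ring V)"
      using Poly_Mapping.keys_mult[of x y] monomials_in_add
      by (fastforce simp: mpoly_ring_def)
  qed (auto simp: mpoly_ring_def monomials_in_zero algebra_simps)
qed (auto simp: mpoly_ring_def algebra_simps)


section \<open>Dimension, depth and Cohen--Macaulayness\<close>

text \<open>Convention: the zero ring gets dimension 0, the supremum of the empty set.\<close>

definition krull_dim :: "('a, 'b) ring_scheme \<Rightarrow> enat" where
  "krull_dim A = Sup {enat l | l. \<exists>P :: nat \<Rightarrow> 'a set.
     (\<forall>i\<le>l. primeideal (P i) A) \<and> (\<forall>i<l. P i \<subset> P (Suc i))}"

definition regular_sequence :: "('a, 'b) ring_scheme \<Rightarrow> 'a list \<Rightarrow> bool" where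
  "regular_sequence A fs \<longleftrightarrow>
     set fs \<subseteq> carrier A \<and>
     (\<forall>i<length fs. \<forall>x\<in>carrier A.
        fs ! i \<otimes>\<^bsub>A\<^esub> x \<in> Idl\<^bsub>A\<^esub> (set (take i fs)) \<longrightarrow> x \<in> Idl\<^bsub>A\<^esub> (set (take i fs))) \<and>
     Idl\<^bsub>A\<^esub> (set fs) \<noteq> carrier A"

text \<open>Here and below \<open>S = mpoly_ring V\<close> and \<open>I\<close> is meant to be a homogeneous ideal of \<open>S\<close>.
  The depth of the standard graded algebra \<open>S/I\<close> is taken in its graded maximal ideal,
  and \<open>S/I\<close> is Cohen--Macaulay if its depth equals its Krull dimension.\<close>

definition graded_depth :: "'v set \<Rightarrow> ('v, 'k::field) mpoly set \<Rightarrow> enat" where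
  "graded_depth V I = Sup {enat (length fs) | fs.
     regular_sequence (mpoly_ring V Quot I) fs \<and>
     set fs \<subseteq> (\<lambda>f. I +>\<^bsub>mpoly_ring V\<^esub> f) ` irrelevant_ideal V}"

definition cohen_macaulay :: "'v set \<Rightarrow> ('v, 'k::field) mpoly set \<Rightarrow> bool" where
  "cohen_macaulay V I \<longleftrightarrow> graded_depth V I = krull_dim (mpoly_ring V Quot I)"


section \<open>Lefschetz properties\<close>

definition quot_part :: "'v set \<Rightarrow> ('v, 'k::field) mpoly set \<Rightarrow> nat \<Rightarrow> ('v, 'k) mpoly set set" where
  "quot_part V J j = (\<lambda>f. J +>\<^bsub>mpoly_ring V\<^esub> f) ` homog_part V j"

definition extended_ideal ::
    "'v set \<Rightarrow> ('v, 'k::field) mpoly set \<Rightarrow> ('v, 'k) mpoly list \<Rightarrow> ('v, 'k) mpoly set" where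
  "extended_ideal V I \<theta> = Idl\<^bsub>mpoly_ring V\<^esub> (I \<union> set \<theta>)"

definition linear_sop ::
    "'v set \<Rightarrow> ('v, 'k::field) mpoly set \<Rightarrow> ('v, 'k) mpoly list \<Rightarrow> bool" where
  "linear_sop V I \<theta> \<longleftrightarrow>
     set \<theta> \<subseteq> homog_part V 1 \<and>
     enat (length \<theta>) = krull_dim (mpoly_ring V Quot I) \<and>
     krull_dim (mpoly_ring V Quot extended_ideal V I \<theta>) = 0"

text \<open>Multiplication by \<open>L ^ s\<close> from degree \<open>j\<close> to degree \<open>j + s\<close> of \<open>S/J\<close>,
  for a linear form \<open>L\<close>.\<close>

definition has_maximal_rank ::
    "'v set \<Rightarrow> ('v, 'k::field) mpoly set \<Rightarrow> ('v, 'k) mpoly \<Rightarrow> nat \<Rightarrow> nat \<Rightarrow> bool" where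
  "has_maximal_rank V J L s j \<longleftrightarrow>
     (let A = mpoly_ring V Quot J;
          \<phi> = (\<lambda>x. ((J +>\<^bsub>mpoly_ring V\<^esub> L) [^]\<^bsub>A\<^esub> s) \<otimes>\<^bsub>A\<^esub> x)
      in inj_on \<phi> (quot_part V J j) \<or> \<phi> ` quot_part V J j = quot_part V J (j + s))"

definition weak_lefschetz :: "'v set \<Rightarrow> ('v, 'k::field) mpoly set \<Rightarrow> bool" where
  "weak_lefschetz V I \<longleftrightarrow>
     cohen_macaulay V I \<and>
     (\<exists>\<theta> L. linear_sop V I \<theta> \<and> L \<in> homog_part V 1 \<and>
        (\<forall>j. has_maximal_rank V (extended_ideal V I \<theta>) L 1 j))"

definition strong_lefschetz :: "'v set \<Rightarrow> ('v, 'k::field) mpoly set \<Rightarrow> bool" where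
  "strong_lefschetz V I \<longleftrightarrow>
     cohen_macaulay V I \<and>
     (\<exists>\<theta> L. linear_sop V I \<theta> \<and> L \<in> homog_part V 1 \<and>
        (\<forall>j. \<forall>s\<ge>1. has_maximal_rank V (extended_ideal V I \<theta>) L s j))"


section \<open>Initial ideals\<close>

text \<open>\<open>(u, w) \<in> r\<close> means that \<open>u\<close> is at most \<open>w\<close>.\<close>

definition monomial_order :: "'v set \<Rightarrow> ('v monomial \<times> 'v monomial) set \<Rightarrow> bool" where
  "monomial_order V r \<longleftrightarrow>
     linear_order_on (monomials_in V) r \<and>
     (\<forall>u\<in>monomials_in V. (0, u) \<in> r) \<and>
     (\<forall>u w. \<forall>x\<in>monomials_in V. (u, w) \<in> r \<longrightarrow> (u + x, w + x) \<in> r)"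

text \<open>Only meaningful for nonzero \<open>p\<close>.\<close>

definition initial_monomial ::
    "('v monomial \<times> 'v monomial) set \<Rightarrow> ('v, 'k::comm_ring_1) mpoly \<Rightarrow> 'v monomial" where
  "initial_monomial r p = (THE w. w \<in> Poly_Mapping.keys p \<and> (\<forall>u\<in>Poly_Mapping.keys p. (u, w) \<in> r))"

definition initial_ideal ::
    "'v set \<Rightarrow> ('v monomial \<times> 'v monomial) set \<Rightarrow> ('v, 'k::field) mpoly set \<Rightarrow> ('v, 'k) mpoly set"
  where
  "initial_ideal V r I =
     Idl\<^bsub>mpoly_ring V\<^esub> {monom_poly (initial_monomial r f) | f. f \<in> I \<and> f \<noteq> 0}"


section \<open>Generic matrices and determinantal ideals\<close>

text \<open>Rows and columns are numbered from 0, as usual for type \<open>mat\<close>.\<close>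

definition matrix_vars :: "nat \<Rightarrow> nat \<Rightarrow> (nat \<times> nat) set" where
  "matrix_vars m n = {..<m} \<times> {..<n}"

definition generic_matrix :: "nat \<Rightarrow> nat \<Rightarrow> (nat \<times> nat, 'k::field) mpoly mat" where
  "generic_matrix m n = mat m n indet"

definition minor_index :: "'a mat \<Rightarrow> nat \<Rightarrow> nat set \<Rightarrow> nat set \<Rightarrow> bool" where
  "minor_index X s A B \<longleftrightarrow>
     A \<subseteq> {..<dim_row X} \<and> B \<subseteq> {..<dim_col X} \<and> card A = s \<and> card B = s"

definition minors :: "'a::comm_ring_1 mat \<Rightarrow> nat \<Rightarrow> 'a set" where
  "minors X s = {det (submatrix X A B) | A B. minor_index X s A B}"

definition determinantal_ideal ::
    "nat \<Rightarrow> nat \<Rightarrow> nat \<Rightarrow> (nat \<times> nat, 'k::field) mpoly set" where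
  "determinantal_ideal m n t =
     Idl\<^bsub>mpoly_ring (matrix_vars m n)\<^esub> (minors (generic_matrix m n) t)"

text \<open>The field enters through the coefficients of the minors, hence the \<open>itself\<close> argument.\<close>

definition diagonal_order ::
    "'k::field itself \<Rightarrow> nat \<Rightarrow> nat \<Rightarrow> ((nat \<times> nat) monomial \<times> (nat \<times> nat) monomial) set \<Rightarrow> bool"
  where
  "diagonal_order TYPE('k) m n r \<longleftrightarrow>
     monomial_order (matrix_vars m n) r \<and>
     (let X = generic_matrix m n :: (nat \<times> nat, 'k) mpoly mat in
      \<forall>s\<ge>1. \<forall>A B. minor_index X s A B \<longrightarrow>
        (monom_poly (initial_monomial r (det (submatrix X A B))) :: (nat \<times> nat, 'k) mpoly) =
          (\<Prod>k<s. submatrix X A B $$ (k, k)))"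

end

theory Submission
  imports Defs "HOL-Library.Product_Lexorder"
begin

text \<open>
  If \<open>t < min m n\<close>, maximal rank fails already for \<open>L\<close> from degree \<open>t - 1\<close> to degree \<open>t\<close>. Modulo a linear
  system of parameters the product of the first \<open>t - 1\<close> entries of the main diagonal is a nonzero socle
  element, so the map is not injective. It is not surjective because, with \<open>c = (m - t + 1) * (n - t + 1)\<close>,
  killing \<open>L\<close> as well leaves \<open>c - 1\<close> variables, and the diagonals of the \<open>t\<close>-minors are too few to span
  the forms of degree \<open>t\<close> in them; a tie in this count is decided by a linear dependence, and the only case
  with too many minors, \<open>t = 4\<close> and \<open>{m, n} = {5, 6}\<close>, by several.

  If \<open>t = min m n\<close>, replacing the last row by a generic combination of the others kills the ideal but no
  polynomial whose monomials all avoid the full main diagonals; hence the latter generate the initial ideal.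
  Identifying the entries of each full diagonal of the matrix and killing the two corners is a regular
  sequence: adding a variable or dividing by it leads to ideals of the same kind, and finally to ideals
  generated by variables. The quotient is \<open>K[x\<^sub>1, \<dots>, x\<^sub>c]\<close> modulo all forms of degree \<open>t\<close>, on which
  the powers of \<open>x\<^sub>1\<close> have maximal rank.
\<close>

\<comment> \<open>For \<open>t < min m n\<close> the initial ideal itself is never determined. Two
  facts replace a Groebner basis: its degree-\<open>t\<close> part is spanned by the diagonals of
  the \<open>t\<close>-minors, and it lies in \<open>t\<close> primes, each generated by the
  \<open>c\<close> variables of a rectangular box, the \<open>k\<close>-th box containing the
  position \<open>(k, k)\<close>. The second fact comes from evaluating at a generic matrix of rank
  below \<open>t\<close>. It explains why the socle element is nonzero: modulo a system of
  parameters, of length at most \<open>m * n - c\<close>, the variables of any box span all linear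
  forms, so none of them can vanish for reasons of number; and in degrees below \<open>t\<close> the
  quotient is a polynomial ring, hence products of nonzero linear forms survive. Apart from the
  exceptional case, the bounds on \<open>m * n\<close> say that there are at most as many
  \<open>t\<close>-minors as monomials of degree \<open>t\<close> in \<open>c - 1\<close> variables.
  Equality does occur, for instance for \<open>t = 2\<close>, \<open>m = n = 4\<close> and for
  \<open>t = 5\<close>, \<open>m = 6\<close>, \<open>n = 7\<close>, so plain counting does not
  decide everything. Krull dimension and depth share one upper bound, because prime chains and
  regular sequences both provide nonzerodivisors along a chain of ideals.\<close>
alias keys = Poly_Mapping.keys
alias lookup = Poly_Mapping.lookup
alias single = Poly_Mapping.single

declare One_nat_def [simp del]

section \<open>Polynomials and substitution\<close>

definition polys :: "'v set \<Rightarrow> ('v, 'k::comm_ring_1) mpoly set" where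
  "polys V = {p. keys p \<subseteq> monomials_in V}"

definition scalar :: "'k \<Rightarrow> ('v, 'k::comm_ring_1) mpoly" where
  "scalar c = single 0 c"

definition mon_subst :: "('v \<Rightarrow> 'a::comm_monoid_mult) \<Rightarrow> 'v monomial \<Rightarrow> 'a" where
  "mon_subst \<rho> u = (\<Prod>v\<in>keys u. \<rho> v ^ lookup u v)"

definition subst :: "('v \<Rightarrow> ('w, 'k) mpoly) \<Rightarrow> ('v, 'k::comm_ring_1) mpoly \<Rightarrow> ('w, 'k) mpoly" where
  "subst \<rho> p = (\<Sum>u\<in>keys p. scalar (lookup p u) * mon_subst \<rho> u)"

lemma mring_simps [simp]:
  "carrier (mpoly_ring V) = polys V" "x \<otimes>\<^bsub>mpoly_ring V\<^esub> y = x * y"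
  "x \<oplus>\<^bsub>mpoly_ring V\<^esub> y = x + y" "\<one>\<^bsub>mpoly_ring V\<^esub> = 1" "\<zero>\<^bsub>mpoly_ring V\<^esub> = 0"
  by (simp_all add: mpoly_ring_def polys_def)

lemma sum_single: "(\<Sum>u\<in>keys p. single u (lookup p u)) = (p :: 'a \<Rightarrow>\<^sub>0 'b::comm_monoid_add)"
proof (rule poly_mapping_eqI)
  fix k
  have "lookup (\<Sum>u\<in>keys p. single u (lookup p u)) k = (\<Sum>u\<in>keys p. if k = u then lookup p u else 0)"
    by (simp add: lookup_sum lookup_single when_def eq_commute cong: sum.cong)
  then show "lookup (\<Sum>u\<in>keys p. single u (lookup p u)) k = lookup p k"
    by (simp add: in_keys_iff)
qed

lemma mpoly_induct [case_names single add]: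
  fixes p :: "'a \<Rightarrow>\<^sub>0 'b::comm_monoid_add"
  assumes "\<And>u c. P (single u c)" and "\<And>p q. P p \<Longrightarrow> P q \<Longrightarrow> P (p + q)"
  shows "P p"
proof -
  have "P (\<Sum>u\<in>A. single u (f u))" if "finite A" for A and f :: "'a \<Rightarrow> 'b"
    using that by induction (use assms(1)[of undefined 0] assms in auto)
  from this[of "keys p" "lookup p"] show ?thesis by (simp add: sum_single)
qed

lemma scalar_simps [simp]: "scalar 0 = 0" "scalar 1 = 1"
  by (simp_all add: scalar_def)

lemma scalar_add: "scalar (a + b) = scalar a + scalar b" and scalar_mult: "scalar (a * b) = scalar a * scalar b"
  and scalar_uminus: "scalar (- a) = - scalar a"
  by (simp_all add: scalar_def single_add mult_single single_uminus)

lemma lookup_scalar_mult [simp]: "lookup (scalar c * p) u = c * lookup p u"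
proof (induction p rule: mpoly_induct)
  case (single w d)
  show ?case by (simp add: scalar_def mult_single lookup_single when_def)
qed (simp add: distrib_left lookup_add)

lemma single_conv: "single u c = scalar c * monom_poly u"
  by (simp add: scalar_def monom_poly_def mult_single)

lemma monom_poly_add: "monom_poly (u + w) = monom_poly u * (monom_poly w :: ('v, 'k::comm_ring_1) mpoly)"
  by (simp add: monom_poly_def mult_single)

lemma monom_poly_0 [simp]: "monom_poly 0 = 1"
  by (simp add: monom_poly_def)

lemma keys_monom_poly [simp]: "keys (monom_poly u :: ('v, 'k::comm_ring_1) mpoly) = {u}"
  by (simp add: monom_poly_def)

lemma lookup_monom_poly: "lookup (monom_poly u :: ('v, 'k::comm_ring_1) mpoly) w = (if u = w then 1 else 0)"
  by (simp add: monom_poly_def lookup_single when_def)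

lemma lookup_monom_mult:
  "lookup (monom_poly w * p :: ('v, 'k::comm_ring_1) mpoly) (w + u) = lookup p u"
proof (induction p rule: mpoly_induct)
  case (single z d)
  show ?case by (simp add: monom_poly_def mult_single lookup_single when_def)
qed (simp add: distrib_left lookup_add)

lemma monom_poly_eq_iff [simp]: "monom_poly u = (monom_poly w :: ('v, 'k::comm_ring_1) mpoly) \<longleftrightarrow> u = w"
  by (metis keys_monom_poly singleton_inject)

lemma mpoly_expand: "p = (\<Sum>u\<in>keys p. scalar (lookup p u) * monom_poly u)"
  by (subst sum_single[of p, symmetric]) (simp only: single_conv)

lemma mon_subst_superset:
  "finite A \<Longrightarrow> keys u \<subseteq> A \<Longrightarrow> mon_subst \<rho> u = (\<Prod>v\<in>A. \<rho> v ^ lookup u v)"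
  unfolding mon_subst_def by (rule prod.mono_neutral_left) (auto simp: in_keys_iff)

lemma mon_subst_0 [simp]: "mon_subst \<rho> 0 = 1"
  by (simp add: mon_subst_def)

lemma mon_subst_single [simp]: "mon_subst \<rho> (single v k) = \<rho> v ^ k"
  by (simp add: mon_subst_def)

lemma keys_add_nat: "keys (u + w :: 'v monomial) = keys u \<union> keys w"
  by (auto simp: in_keys_iff lookup_add)

lemma mon_subst_add: "mon_subst \<rho> (u + w) = mon_subst \<rho> u * mon_subst \<rho> w"
proof -
  let ?A = "keys u \<union> keys w"
  show ?thesis
    using mon_subst_superset[of ?A "u + w" \<rho>] mon_subst_superset[of ?A u \<rho>] mon_subst_superset[of ?A w \<rho>]
    by (simp add: keys_add_nat lookup_add power_add prod.distrib)
qed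

lemma mon_subst_sum: "mon_subst \<rho> (\<Sum>i\<in>A. u i) = (\<Prod>i\<in>A. mon_subst \<rho> (u i))"
  by (induction A rule: infinite_finite_induct) (auto simp: mon_subst_add)

lemma mon_subst_cong: "(\<And>v. v \<in> keys u \<Longrightarrow> \<rho> v = \<rho>' v) \<Longrightarrow> mon_subst \<rho> u = mon_subst \<rho>' u"
  by (simp add: mon_subst_def)

lemma subst_superset:
  "finite A \<Longrightarrow> keys p \<subseteq> A \<Longrightarrow> subst \<rho> p = (\<Sum>u\<in>A. scalar (lookup p u) * mon_subst \<rho> u)"
  unfolding subst_def by (rule sum.mono_neutral_left) (auto simp: in_keys_iff)

lemma subst_add: "subst \<rho> (p + q) = subst \<rho> p + subst \<rho> q"
proof -
  let ?A = "keys p \<union> keys q"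
  show ?thesis
    using subst_superset[of ?A "p + q" \<rho>] subst_superset[of ?A p \<rho>] subst_superset[of ?A q \<rho>] keys_add[of p q]
    by (simp add: lookup_add scalar_add distrib_right sum.distrib)
qed

lemma subst_single: "subst \<rho> (single u c) = scalar c * mon_subst \<rho> u"
  by (simp add: subst_def)

lemma subst_0 [simp]: "subst \<rho> 0 = 0"
  by (simp add: subst_def)

lemma subst_mult: "subst \<rho> (p * q) = subst \<rho> p * subst \<rho> q"
proof (induction p rule: mpoly_induct)
  case (single u c)
  show ?case
  proof (induction q rule: mpoly_induct)
    case (single w d)
    show ?case by (simp add: mult_single subst_single mon_subst_add scalar_mult mult_ac)
  qed (simp add: distrib_left subst_add)
qed (simp add: distrib_right subst_add)

lemma subst_1 [simp]: "subst \<rho> 1 = 1"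
  using subst_single[of \<rho> 0 1] by simp

lemma subst_scalar [simp]: "subst \<rho> (scalar c) = scalar c"
  using subst_single[of \<rho> 0 c] by (simp add: scalar_def)

lemma subst_monom_poly [simp]: "subst \<rho> (monom_poly u) = mon_subst \<rho> u"
  by (simp add: monom_poly_def subst_single)

lemma subst_indet [simp]: "subst \<rho> (indet v) = \<rho> v"
  by (simp add: indet_def)

lemma subst_uminus: "subst \<rho> (- p) = - subst \<rho> p"
  by (rule minus_unique[symmetric]) (simp flip: subst_add)

lemma subst_minus: "subst \<rho> (p - q) = subst \<rho> p - subst \<rho> q"
  by (simp only: diff_conv_add_uminus subst_add subst_uminus)

lemma subst_sum: "subst \<rho> (\<Sum>i\<in>A. f i) = (\<Sum>i\<in>A. subst \<rho> (f i))"
  by (induction A rule: infinite_finite_induct) (auto simp: subst_add)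

lemma subst_prod: "subst \<rho> (\<Prod>i\<in>A. f i) = (\<Prod>i\<in>A. subst \<rho> (f i))"
  by (induction A rule: infinite_finite_induct) (auto simp: subst_mult)

lemma subst_power: "subst \<rho> (p ^ k) = subst \<rho> p ^ k"
  by (induction k) (auto simp: subst_mult)

lemmas subst_simps = subst_add subst_mult subst_uminus subst_minus subst_sum subst_prod subst_power

lemma subst_mon_subst: "subst \<sigma> (mon_subst \<rho> u) = mon_subst (\<lambda>v. subst \<sigma> (\<rho> v)) u"
  by (simp add: mon_subst_def subst_simps)

lemma subst_subst: "subst \<sigma> (subst \<rho> p) = subst (\<lambda>v. subst \<sigma> (\<rho> v)) p"
  by (induction p rule: mpoly_induct) (simp_all add: subst_single subst_simps subst_mon_subst)

lemma indet_power: "indet v ^ k = monom_poly (single v k)"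
proof (induction k)
  case (Suc k)
  have "single v (Suc k) = single v 1 + single v k" unfolding single_add[symmetric] by (simp only: plus_1_eq_Suc)
  with Suc show ?case by (simp add: indet_def monom_poly_add)
qed simp

lemma monom_poly_sum: "monom_poly (\<Sum>i\<in>A. u i) = (\<Prod>i\<in>A. monom_poly (u i) :: ('v, 'k::comm_ring_1) mpoly)"
  by (induction A rule: infinite_finite_induct) (auto simp: monom_poly_add)

lemma mon_subst_indet [simp]: "mon_subst indet u = monom_poly u"
proof -
  have "mon_subst indet u = monom_poly (\<Sum>v\<in>keys u. single v (lookup u v))"
    by (simp add: mon_subst_def monom_poly_sum indet_power)
  then show ?thesis by (simp add: sum_single)
qed

lemma subst_id [simp]: "subst indet p = p"
  by (subst (2) mpoly_expand) (simp add: subst_def)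

lemma subst_cong:
  assumes "p \<in> polys V" "\<And>v. v \<in> V \<Longrightarrow> \<rho> v = \<rho>' v"
  shows "subst \<rho> p = subst \<rho>' p"
  unfolding subst_def
  by (intro sum.cong refl arg_cong2[where f = "(*)"] mon_subst_cong)
    (use assms in \<open>auto simp: polys_def monomials_in_def\<close>)

lemma comm_ring_hom_subst: "comm_ring_hom (subst \<rho>)"
  by standard (simp_all add: subst_add subst_mult)

lemma polys_0 [simp]: "0 \<in> polys V" and polys_1 [simp]: "1 \<in> polys V" and polys_scalar [simp]: "scalar c \<in> polys V"
  by (auto simp: polys_def scalar_def monomials_in_zero)

lemma polys_add: "p \<in> polys V \<Longrightarrow> q \<in> polys V \<Longrightarrow> p + q \<in> polys V"
  using keys_add[of p q] by (auto simp: polys_def)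

lemma polys_uminus: "p \<in> polys V \<Longrightarrow> - p \<in> polys V"
  by (simp add: polys_def)

lemma polys_minus: "p \<in> polys V \<Longrightarrow> q \<in> polys V \<Longrightarrow> p - q \<in> polys V"
  using keys_diff[of p q] by (auto simp: polys_def)

lemma polys_mult: "p \<in> polys V \<Longrightarrow> q \<in> polys V \<Longrightarrow> p * q \<in> polys V"
  using keys_mult[of p q] monomials_in_add by (fastforce simp: polys_def)

lemma polys_power: "p \<in> polys V \<Longrightarrow> p ^ k \<in> polys V"
  by (induction k) (auto intro: polys_mult)

lemma polys_sum: "(\<And>i. i \<in> A \<Longrightarrow> f i \<in> polys V) \<Longrightarrow> (\<Sum>i\<in>A. f i) \<in> polys V"
  by (induction A rule: infinite_finite_induct) (auto intro: polys_add)

lemma polys_prod: "(\<And>i. i \<in> A \<Longrightarrow> f i \<in> polys V) \<Longrightarrow> (\<Prod>i\<in>A. f i) \<in> polys V"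
  by (induction A rule: infinite_finite_induct) (auto intro: polys_mult)

lemma polys_monom_poly [simp]: "monom_poly u \<in> polys V \<longleftrightarrow> u \<in> monomials_in V"
  by (simp add: polys_def)

lemma polys_indet [simp]: "indet v \<in> polys V \<longleftrightarrow> v \<in> V"
  by (simp add: indet_def monomials_in_def)

lemmas polys_intros = polys_add polys_uminus polys_minus polys_mult polys_power polys_sum polys_prod

lemma polys_mono: "V \<subseteq> W \<Longrightarrow> polys V \<subseteq> polys W"
  by (auto simp: polys_def monomials_in_def)

lemma polys_mon_subst: "(\<And>v. v \<in> keys u \<Longrightarrow> \<rho> v \<in> polys W) \<Longrightarrow> mon_subst \<rho> u \<in> polys W"
  unfolding mon_subst_def by (intro polys_intros) auto

lemma polys_subst:
  assumes "\<And>v. v \<in> V \<Longrightarrow> \<rho> v \<in> polys W" "p \<in> polys V"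
  shows "subst \<rho> p \<in> polys W"
  unfolding subst_def
  by (intro polys_intros polys_mon_subst polys_scalar) (use assms in \<open>auto simp: polys_def monomials_in_def\<close>)

section \<open>Degrees and linear forms\<close>

lemma mon_degree_superset: "finite A \<Longrightarrow> keys u \<subseteq> A \<Longrightarrow> mon_degree u = (\<Sum>v\<in>A. lookup u v)"
  unfolding mon_degree_def by (rule sum.mono_neutral_left) (auto simp: in_keys_iff)

lemma mon_degree_add: "mon_degree (u + w) = mon_degree u + mon_degree w"
proof -
  let ?A = "keys u \<union> keys w"
  show ?thesis
    using mon_degree_superset[of ?A "u + w"] mon_degree_superset[of ?A u] mon_degree_superset[of ?A w]
    by (simp add: keys_add_nat lookup_add sum.distrib)
qed

lemma mon_degree_simps [simp]: "mon_degree 0 = 0" "mon_degree (single v k) = k"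
  by (simp_all add: mon_degree_def)

lemma mon_degree_sum: "mon_degree (\<Sum>i\<in>A. u i) = (\<Sum>i\<in>A. mon_degree (u i))"
  by (induction A rule: infinite_finite_induct) (auto simp: mon_degree_add)

lemma lookup_le_mon_degree: "lookup u v \<le> mon_degree u"
  by (cases "v \<in> keys u") (auto simp: mon_degree_def in_keys_iff intro!: member_le_sum)

lemma mon_degree_eq_0 [simp]: "mon_degree u = 0 \<longleftrightarrow> u = 0"
  by (auto simp: mon_degree_def poly_mapping_eq_iff fun_eq_iff in_keys_iff)

lemma in_keys_split: "v \<in> keys u \<Longrightarrow> \<exists>w. u = w + single v (1::nat)"
  by (intro exI[of _ "u - single v 1"] poly_mapping_eqI)
    (auto simp: lookup_add lookup_minus lookup_single in_keys_iff when_def)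

lemma mon_degree_Suc: "mon_degree u = Suc k \<Longrightarrow> \<exists>v w. v \<in> keys u \<and> u = w + single v 1 \<and> mon_degree w = k"
proof -
  assume a: "mon_degree u = Suc k"
  then have "u \<noteq> 0" by auto
  then obtain v where v: "v \<in> keys u" by fastforce
  from in_keys_split[OF this] obtain w where w: "u = w + single v 1" by blast
  with a have "mon_degree w = k" by (simp add: mon_degree_add)
  with v w show ?thesis by blast
qed

lemma homog_iff: "p \<in> homog_part V j \<longleftrightarrow> p \<in> polys V \<and> (\<forall>u\<in>keys p. mon_degree u = j)"
  by (simp add: homog_part_def)

lemma homog_polys: "p \<in> homog_part V j \<Longrightarrow> p \<in> polys V"
  by (simp add: homog_iff)

lemma homog_0 [simp]: "0 \<in> homog_part V j"
  by (simp add: homog_iff)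

lemma homog_add: "p \<in> homog_part V j \<Longrightarrow> q \<in> homog_part V j \<Longrightarrow> p + q \<in> homog_part V j"
  using keys_add[of p q] by (auto simp: homog_iff polys_add)

lemma homog_uminus: "p \<in> homog_part V j \<Longrightarrow> - p \<in> homog_part V j"
  by (simp add: homog_iff polys_uminus)

lemma homog_minus: "p \<in> homog_part V j \<Longrightarrow> q \<in> homog_part V j \<Longrightarrow> p - q \<in> homog_part V j"
  using keys_diff[of p q] by (auto simp: homog_iff polys_minus)

lemma homog_mult: "p \<in> homog_part V i \<Longrightarrow> q \<in> homog_part V j \<Longrightarrow> p * q \<in> homog_part V (i + j)"
  using keys_mult[of p q] by (fastforce simp: homog_iff polys_mult mon_degree_add)

lemma homog_scalar: "scalar c \<in> homog_part V 0"
proof -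
  have "keys (scalar c) \<subseteq> {0}" by (simp add: scalar_def)
  then show ?thesis unfolding homog_iff by (metis mon_degree_simps(1) polys_scalar singletonD subsetD)
qed

lemma homog_scalar_mult: "p \<in> homog_part V j \<Longrightarrow> scalar c * p \<in> homog_part V j"
  using homog_mult[OF homog_scalar] by fastforce

lemma homog_sum: "(\<And>i. i \<in> A \<Longrightarrow> f i \<in> homog_part V j) \<Longrightarrow> (\<Sum>i\<in>A. f i) \<in> homog_part V j"
  by (induction A rule: infinite_finite_induct) (auto intro: homog_add)

lemma homog_1: "1 \<in> homog_part V 0"
  using homog_scalar[of 1] by simp

lemma homog_prod: "(\<And>i. i \<in> A \<Longrightarrow> f i \<in> homog_part V (d i)) \<Longrightarrow> (\<Prod>i\<in>A. f i) \<in> homog_part V (\<Sum>i\<in>A. d i)"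
  by (induction A rule: infinite_finite_induct) (auto intro: homog_mult homog_1)

lemma homog_power: "p \<in> homog_part V j \<Longrightarrow> p ^ k \<in> homog_part V (k * j)"
  by (induction k) (auto intro: homog_mult homog_1)

lemma homog_monom_poly [simp]: "monom_poly u \<in> homog_part V j \<longleftrightarrow> u \<in> monomials_in V \<and> mon_degree u = j"
  by (auto simp: homog_iff)

lemma homog_indet [simp]: "indet v \<in> homog_part V j \<longleftrightarrow> v \<in> V \<and> j = 1"
  by (auto simp: indet_def monomials_in_def)

lemma homog_mono: "V \<subseteq> W \<Longrightarrow> homog_part V j \<subseteq> homog_part W j"
  using polys_mono[of V W] by (auto simp: homog_iff)

lemma homog_mon_subst:
  assumes "\<And>v. v \<in> keys u \<Longrightarrow> \<rho> v \<in> homog_part W 1"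
  shows "mon_subst \<rho> u \<in> homog_part W (mon_degree u)"
  unfolding mon_subst_def mon_degree_def
  by (intro homog_prod) (use homog_power[OF assms] in auto)

lemma homog_subst:
  assumes "\<And>v. v \<in> V \<Longrightarrow> \<rho> v \<in> homog_part W 1" "p \<in> homog_part V j"
  shows "subst \<rho> p \<in> homog_part W j"
  unfolding subst_def
proof (intro homog_sum homog_scalar_mult)
  fix u assume "u \<in> keys p"
  then have "mon_degree u = j" "keys u \<subseteq> V"
    using assms(2) by (auto simp: homog_iff polys_def monomials_in_def)
  then show "mon_subst \<rho> u \<in> homog_part W j"
    using homog_mon_subst[of u \<rho> W] assms(1) by auto
qed

lemma mon_degree_1: "mon_degree u = 1 \<Longrightarrow> \<exists>v. u = single v 1"
proof -
  assume "mon_degree u = 1"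
  then obtain v w where "u = w + single v 1" "mon_degree w = 0"
    using mon_degree_Suc[of u 0] unfolding One_nat_def by blast
  then have "u = single v 1" by (simp only: mon_degree_eq_0 add_0_left)
  then show ?thesis by blast
qed

lemma single_1_eq_iff: "single v (1::nat) = single w 1 \<longleftrightarrow> v = w"
proof
  assume "single v (1::nat) = single w 1"
  then have "keys (single v (1::nat)) = keys (single w (1::nat))" by simp
  then show "v = w" by simp
qed simp

lemma linear_form_expand:
  assumes "finite V" "p \<in> homog_part V 1"
  shows "p = (\<Sum>v\<in>V. scalar (lookup p (single v 1)) * indet v)"
proof (rule poly_mapping_eqI)
  fix u
  have *: "lookup (indet v) u = (if u = single v 1 then 1 else (0::'b))" for v :: 'a and u
    by (auto simp: indet_def lookup_monom_poly)
  have inj: "single v (1::nat) = single w 1 \<longleftrightarrow> v = w" for v w :: 'a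
    by (rule single_1_eq_iff)
  show "lookup p u = lookup (\<Sum>v\<in>V. scalar (lookup p (single v 1)) * indet v) u"
  proof (cases "\<exists>v\<in>V. u = single v 1")
    case True
    then obtain v where "v \<in> V" "u = single v 1" by blast
    have "lookup (\<Sum>v\<in>V. scalar (lookup p (single v 1)) * indet v) u =
      (\<Sum>w\<in>V. if w = v then lookup p (single w 1) else 0)"
      unfolding lookup_sum by (rule sum.cong) (auto simp: * inj \<open>u = _\<close> simp del: One_nat_def)
    with assms(1) \<open>v \<in> V\<close> \<open>u = _\<close> show ?thesis by (simp del: One_nat_def)
  next
    case False
    have "u \<notin> keys p"
    proof
      assume u: "u \<in> keys p"
      then obtain v where v: "u = single v 1"
        using assms(2) mon_degree_1[of u] by (auto simp: homog_iff)
      with u assms(2) have "keys (single v (1::nat)) \<subseteq> V"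
        by (auto simp: homog_iff polys_def monomials_in_def)
      then have "v \<in> V" by simp
      with False v show False by blast
    qed
    moreover have "lookup (\<Sum>v\<in>V. scalar (lookup p (single v 1)) * indet v) u = 0"
      unfolding lookup_sum using False by (intro sum.neutral) (auto simp: *)
    ultimately show ?thesis by (simp add: in_keys_iff)
  qed
qed

section \<open>Ideals and quotients\<close>

abbreviation gen_ideal :: "'v set \<Rightarrow> ('v, 'k::comm_ring_1) mpoly set \<Rightarrow> ('v, 'k) mpoly set" where
  "gen_ideal V X \<equiv> Idl\<^bsub>mpoly_ring V\<^esub> X"

text \<open>An elementwise form of \<open>ideal\<close>. A containment of a generated ideal is
  usually proved by checking that the set with the desired property is an ideal containing the
  generators; such sets appear below as \<open>?P\<close>.\<close>

definition is_ideal :: "'v set \<Rightarrow> ('v, 'k::comm_ring_1) mpoly set \<Rightarrow> bool" where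
  "is_ideal V P \<longleftrightarrow> P \<subseteq> polys V \<and> 0 \<in> P \<and> (\<forall>x\<in>P. \<forall>y\<in>P. x + y \<in> P) \<and>
     (\<forall>a\<in>polys V. \<forall>x\<in>P. a * x \<in> P)"

lemma is_idealI:
  "P \<subseteq> polys V \<Longrightarrow> 0 \<in> P \<Longrightarrow> (\<And>x y. x \<in> P \<Longrightarrow> y \<in> P \<Longrightarrow> x + y \<in> P) \<Longrightarrow>
   (\<And>a x. a \<in> polys V \<Longrightarrow> x \<in> P \<Longrightarrow> a * x \<in> P) \<Longrightarrow> is_ideal V P"
  by (simp add: is_ideal_def)

lemma is_ideal_polys: "is_ideal V P \<Longrightarrow> x \<in> P \<Longrightarrow> x \<in> polys V"
  and is_ideal_0: "is_ideal V P \<Longrightarrow> 0 \<in> P"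
  and is_ideal_add: "is_ideal V P \<Longrightarrow> x \<in> P \<Longrightarrow> y \<in> P \<Longrightarrow> x + y \<in> P"
  and is_ideal_mult: "is_ideal V P \<Longrightarrow> a \<in> polys V \<Longrightarrow> x \<in> P \<Longrightarrow> a * x \<in> P"
  by (auto simp: is_ideal_def)

lemma is_ideal_mult_right: "is_ideal V P \<Longrightarrow> a \<in> polys V \<Longrightarrow> x \<in> P \<Longrightarrow> x * a \<in> P"
  using is_ideal_mult[of V P a x] by (simp add: mult.commute)

lemma is_ideal_uminus: "is_ideal V P \<Longrightarrow> x \<in> P \<Longrightarrow> - x \<in> P"
  using is_ideal_mult[of V P "- 1" x] by (simp add: polys_uminus)

lemma is_ideal_minus: "is_ideal V P \<Longrightarrow> x \<in> P \<Longrightarrow> y \<in> P \<Longrightarrow> x - y \<in> P"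
  using is_ideal_add[of V P x "- y"] is_ideal_uminus[of V P y] by simp

lemma is_ideal_sum: "is_ideal V P \<Longrightarrow> (\<And>i. i \<in> A \<Longrightarrow> f i \<in> P) \<Longrightarrow> (\<Sum>i\<in>A. f i) \<in> P"
  by (induction A rule: infinite_finite_induct) (auto intro: is_ideal_add is_ideal_0)

lemma is_ideal_diff_cancel: "is_ideal V P \<Longrightarrow> x - y \<in> P \<Longrightarrow> y \<in> P \<Longrightarrow> x \<in> P"
  using is_ideal_add[of V P "x - y" y] by simp

lemma cring_mring: "cring (mpoly_ring V)"
  by (rule cring_mpoly_ring)

lemma a_inv_mring:
  fixes x :: "('v, 'k::comm_ring_1) mpoly"
  shows "x \<in> polys V \<Longrightarrow> \<ominus>\<^bsub>mpoly_ring V\<^esub> x = - x"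
proof -
  interpret cring "mpoly_ring V :: ('v, 'k) mpoly ring" by (rule cring_mring)
  assume "x \<in> polys V"
  then show ?thesis by (intro minus_equality) (auto simp: polys_uminus)
qed

lemma ideal_iff: "ideal P (mpoly_ring V) \<longleftrightarrow> is_ideal V P"
proof
  assume "ideal P (mpoly_ring V)"
  then interpret ideal P "mpoly_ring V" .
  show "is_ideal V P"
  proof (rule is_idealI)
    show "P \<subseteq> polys V" using a_subset by simp
    show "0 \<in> P" using additive_subgroup.zero_closed[OF is_additive_subgroup] by simp
    show "x + y \<in> P" if "x \<in> P" "y \<in> P" for x y
      using additive_subgroup.a_closed[OF is_additive_subgroup that] by simp
    show "a * x \<in> P" if "a \<in> polys V" "x \<in> P" for a x
      using I_l_closed[of x a] that by simp
  qed
next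
  assume I: "is_ideal V P"
  interpret cring "mpoly_ring V :: ('a, 'b) mpoly ring" by (rule cring_mring)
  show "ideal P (mpoly_ring V)"
  proof (rule idealI)
    show "ring (mpoly_ring V :: ('a, 'b) mpoly ring)" by (rule ring_axioms)
    show "subgroup P (add_monoid (mpoly_ring V))"
    proof
      show "inv\<^bsub>add_monoid (mpoly_ring V)\<^esub> x \<in> P" if "x \<in> P" for x
        using is_ideal_uminus[OF I that] a_inv_mring[of x V] is_ideal_polys[OF I that]
        by (simp add: a_inv_def)
    qed (use I in \<open>auto simp: is_ideal_def\<close>)
  qed (use is_ideal_mult[OF I] is_ideal_mult_right[OF I] in auto)
qed

lemma is_ideal_gen:
  fixes X :: "('v, 'k::comm_ring_1) mpoly set"
  shows "X \<subseteq> polys V \<Longrightarrow> is_ideal V (gen_ideal V X)"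
proof -
  interpret cring "mpoly_ring V :: ('v, 'k) mpoly ring" by (rule cring_mring)
  show "X \<subseteq> polys V \<Longrightarrow> ?thesis"
    using genideal_ideal[of X] by (simp add: ideal_iff)
qed

lemma gen_ideal_superset:
  fixes X :: "('v, 'k::comm_ring_1) mpoly set"
  shows "X \<subseteq> polys V \<Longrightarrow> X \<subseteq> gen_ideal V X"
proof -
  interpret cring "mpoly_ring V :: ('v, 'k) mpoly ring" by (rule cring_mring)
  show "X \<subseteq> polys V \<Longrightarrow> ?thesis"
    using genideal_self[of X] by simp
qed

lemma gen_idealI: "X \<subseteq> polys V \<Longrightarrow> x \<in> X \<Longrightarrow> x \<in> gen_ideal V X"
  using gen_ideal_superset by blast

lemma gen_ideal_least: "is_ideal V P \<Longrightarrow> X \<subseteq> P \<Longrightarrow> gen_ideal V X \<subseteq> P"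
  by (auto simp: genideal_def ideal_iff)

lemma gen_ideal_mono: "Y \<subseteq> polys V \<Longrightarrow> X \<subseteq> gen_ideal V Y \<Longrightarrow> gen_ideal V X \<subseteq> gen_ideal V Y"
  by (rule gen_ideal_least[OF is_ideal_gen])

lemma gen_ideal_mono': "Y \<subseteq> polys V \<Longrightarrow> X \<subseteq> Y \<Longrightarrow> gen_ideal V X \<subseteq> gen_ideal V Y"
  using gen_ideal_superset[of Y V] gen_ideal_mono[of Y V X] by blast

lemma gen_ideal_polys: "X \<subseteq> polys V \<Longrightarrow> gen_ideal V X \<subseteq> polys V"
  using is_ideal_gen is_ideal_polys by blast

lemma gen_ideal_eqI: "is_ideal V P \<Longrightarrow> X \<subseteq> P \<Longrightarrow> P \<subseteq> gen_ideal V X \<Longrightarrow> gen_ideal V X = P"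
  using gen_ideal_least by blast

lemma gen_ideal_ideal: "is_ideal V P \<Longrightarrow> gen_ideal V P = P"
  by (rule gen_ideal_eqI) (auto intro: gen_idealI dest: is_ideal_polys)

lemma is_ideal_vimage_subst:
  fixes \<rho> :: "'v \<Rightarrow> ('w, 'k::comm_ring_1) mpoly"
  assumes "is_ideal W P" "\<And>v. v \<in> V \<Longrightarrow> \<rho> v \<in> polys W"
  shows "is_ideal V {f \<in> polys V. subst \<rho> f \<in> P}"
proof (rule is_idealI)
  fix a x :: "('v, 'k) mpoly" assume "a \<in> polys V" "x \<in> {f \<in> polys V. subst \<rho> f \<in> P}"
  then show "a * x \<in> {f \<in> polys V. subst \<rho> f \<in> P}"
    using is_ideal_mult[OF assms(1), of "subst \<rho> a" "subst \<rho> x"] polys_subst[of V \<rho> W a] assms(2)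
    by (auto simp: subst_mult polys_mult)
qed (use assms in \<open>auto simp: subst_add polys_add intro: is_ideal_0 is_ideal_add\<close>)

lemma is_ideal_zero: "is_ideal V {0}"
  by (rule is_idealI) auto

lemma polys_UNIV [simp]: "polys UNIV = UNIV"
  by (auto simp: polys_def monomials_in_def)

lemma is_ideal_kernel: "is_ideal V {f \<in> polys V. subst \<rho> f = 0}"
  using is_ideal_vimage_subst[of UNIV "{0}" V \<rho>]
  by (simp add: is_ideal_zero)

definition prime_ideal :: "'v set \<Rightarrow> ('v, 'k::comm_ring_1) mpoly set \<Rightarrow> bool" where
  "prime_ideal V P \<longleftrightarrow> is_ideal V P \<and> 1 \<notin> P \<and>
     (\<forall>x\<in>polys V. \<forall>y\<in>polys V. x * y \<in> P \<longrightarrow> x \<in> P \<or> y \<in> P)"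

text \<open>Every prime constructed in this development is the kernel of an evaluation into a
  polynomial ring over a field. The order on \<open>'w\<close> makes the monomials linearly ordered,
  which is how the target is seen to be a domain; for matrix positions it is the lexicographic
  order.\<close>

lemma prime_ideal_kernel:
  fixes \<rho> :: "'v \<Rightarrow> ('w::linorder, 'k::idom) mpoly"
  shows "prime_ideal V {f \<in> polys V. subst \<rho> f = 0}"
  unfolding prime_ideal_def using is_ideal_kernel[of V \<rho>] by (auto simp: subst_mult)

section \<open>Quotient rings translated into the polynomial ring\<close>

definition prime_chain :: "'v set \<Rightarrow> ('v, 'k::comm_ring_1) mpoly set \<Rightarrow> nat \<Rightarrow> bool" where
  "prime_chain V I l \<longleftrightarrow> (\<exists>P. (\<forall>i\<le>l. prime_ideal V (P i) \<and> I \<subseteq> P i) \<and> (\<forall>i<l. P i \<subset> P (Suc i)))"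

abbreviation coset :: "'v set \<Rightarrow> ('v, 'k::comm_ring_1) mpoly set \<Rightarrow> ('v, 'k) mpoly \<Rightarrow> ('v, 'k) mpoly set" where
  "coset V I f \<equiv> I +>\<^bsub>mpoly_ring V\<^esub> f"

context
  fixes V :: "'v set" and I :: "('v, 'k::comm_ring_1) mpoly set"
  assumes I: "is_ideal V I"
begin

interpretation S: cring "mpoly_ring V :: ('v, 'k) mpoly ring" by (rule cring_mring)
interpretation SI: ideal I "mpoly_ring V" using I by (simp add: ideal_iff)

lemma coset_eq_iff: "f \<in> polys V \<Longrightarrow> g \<in> polys V \<Longrightarrow> coset V I f = coset V I g \<longleftrightarrow> f - g \<in> I"
proof -
  assume fg: "f \<in> polys V" "g \<in> polys V"
  have *: "coset V I f = {h + f | h. h \<in> I}" for f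
    by (auto simp: a_r_coset_def r_coset_def mpoly_ring_def)
  show ?thesis
  proof
    assume "coset V I f = coset V I g"
    moreover have "f \<in> coset V I f" using is_ideal_0[OF I] by (auto simp: *)
    ultimately show "f - g \<in> I" by (auto simp: *)
  next
    assume d: "f - g \<in> I"
    have "x + f \<in> coset V I g" if "x \<in> I" for x
    proof -
      have "x + f = (x + (f - g)) + g" by simp
      then show ?thesis unfolding * using is_ideal_add[OF I that d] by blast
    qed
    moreover have "x + g \<in> coset V I f" if "x \<in> I" for x
    proof -
      have "x + g = (x - (f - g)) + f" by simp
      then show ?thesis unfolding * using is_ideal_minus[OF I that d] by blast
    qed
    ultimately show "coset V I f = coset V I g" by (auto simp: *)
  qed
qed

lemma carrier_Quot: "carrier (mpoly_ring V Quot I) = coset V I ` polys V"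
  by (auto simp: FactRing_def A_RCOSETS_def')

lemma mult_Quot: "f \<in> polys V \<Longrightarrow> g \<in> polys V \<Longrightarrow>
    coset V I f \<otimes>\<^bsub>mpoly_ring V Quot I\<^esub> coset V I g = coset V I (f * g)"
  using SI.rcoset_mult_add[of f g] by (simp add: FactRing_def)

lemma add_Quot: "f \<in> polys V \<Longrightarrow> g \<in> polys V \<Longrightarrow>
    coset V I f \<oplus>\<^bsub>mpoly_ring V Quot I\<^esub> coset V I g = coset V I (f + g)"
  using SI.a_rcos_sum[of f g] by (simp add: FactRing_def)

lemma one_Quot: "\<one>\<^bsub>mpoly_ring V Quot I\<^esub> = coset V I 1"
  by (simp add: FactRing_def)

lemma coset_0: "coset V I 0 = I"
  using is_ideal_polys[OF I] by (auto simp: a_r_coset_def r_coset_def mpoly_ring_def)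

lemma zero_Quot: "\<zero>\<^bsub>mpoly_ring V Quot I\<^esub> = coset V I 0"
  unfolding coset_0 by (simp add: FactRing_def)

lemma cring_Quot: "cring (mpoly_ring V Quot I)"
  by (rule SI.quotient_is_cring) (rule S.is_cring)

lemma pow_Quot: "f \<in> polys V \<Longrightarrow> coset V I f [^]\<^bsub>mpoly_ring V Quot I\<^esub> (s::nat) = coset V I (f ^ s)"
proof -
  interpret Q: cring "mpoly_ring V Quot I" by (rule cring_Quot)
  assume f: "f \<in> polys V"
  show ?thesis
    by (induction s) (use f in \<open>auto simp: one_Quot mult_Quot polys_power mult.commute\<close>)
qed

definition pullback :: "('v, 'k) mpoly set set \<Rightarrow> ('v, 'k) mpoly set" where
  "pullback P = {f \<in> polys V. coset V I f \<in> P}"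

lemma ideal_pullback:
  assumes "ideal P (mpoly_ring V Quot I)"
  shows "is_ideal V (pullback P)" "I \<subseteq> pullback P" "P = coset V I ` pullback P"
proof -
  interpret P: ideal P "mpoly_ring V Quot I" by (rule assms)
  show "is_ideal V (pullback P)"
  proof (rule is_idealI)
    show "0 \<in> pullback P"
      using additive_subgroup.zero_closed[OF P.is_additive_subgroup] by (simp add: pullback_def zero_Quot)
  next
    fix x y assume "x \<in> pullback P" "y \<in> pullback P"
    then show "x + y \<in> pullback P"
      using additive_subgroup.a_closed[OF P.is_additive_subgroup, of "coset V I x" "coset V I y"]
      by (auto simp: pullback_def add_Quot polys_add)
  next
    fix a x :: "('v, 'k) mpoly" assume "a \<in> polys V" "x \<in> pullback P"
    then show "a * x \<in> pullback P"
      using P.I_l_closed[of "coset V I x" "coset V I a"]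
      by (auto simp: pullback_def mult_Quot polys_mult carrier_Quot)
  qed (auto simp: pullback_def)
  show "I \<subseteq> pullback P"
  proof
    fix x assume x: "x \<in> I"
    then have "coset V I x = coset V I 0" "x \<in> polys V"
      using is_ideal_polys[OF I] by (auto simp: coset_eq_iff)
    then show "x \<in> pullback P"
      using additive_subgroup.zero_closed[OF P.is_additive_subgroup] by (simp add: pullback_def zero_Quot)
  qed
  show "P = coset V I ` pullback P"
    using P.a_subset by (auto simp: pullback_def carrier_Quot)
qed

lemma ideal_image:
  assumes "is_ideal V P"
  shows "ideal (coset V I ` P) (mpoly_ring V Quot I)"
proof -
  interpret Q: cring "mpoly_ring V Quot I" by (rule cring_Quot)
  note sub = is_ideal_polys[OF assms]
  have inv: "\<ominus>\<^bsub>mpoly_ring V Quot I\<^esub> coset V I x = coset V I (- x)" if "x \<in> polys V" for x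
    using that by (intro Q.minus_equality) (auto simp: add_Quot zero_Quot carrier_Quot polys_uminus)
  show ?thesis
  proof (rule idealI)
    show "ring (mpoly_ring V Quot I)" by (rule Q.ring_axioms)
    show "subgroup (coset V I ` P) (add_monoid (mpoly_ring V Quot I))"
    proof
      show "inv\<^bsub>add_monoid (mpoly_ring V Quot I)\<^esub> x \<in> coset V I ` P" if "x \<in> coset V I ` P" for x
        using that inv sub is_ideal_uminus[OF assms] by (auto simp: a_inv_def)
    next
      show "\<one>\<^bsub>add_monoid (mpoly_ring V Quot I)\<^esub> \<in> coset V I ` P"
        using is_ideal_0[OF assms] by (auto simp: zero_Quot)
    next
      show "coset V I ` P \<subseteq> carrier (add_monoid (mpoly_ring V Quot I))"
        using sub by (auto simp: carrier_Quot)
    next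
      fix x y assume "x \<in> coset V I ` P" "y \<in> coset V I ` P"
      then show "x \<otimes>\<^bsub>add_monoid (mpoly_ring V Quot I)\<^esub> y \<in> coset V I ` P"
        using sub is_ideal_add[OF assms] by (auto simp: add_Quot)
    qed
    fix a x assume "a \<in> coset V I ` P" "x \<in> carrier (mpoly_ring V Quot I)"
    then obtain b y where "a = coset V I b" "b \<in> P" "x = coset V I y" "y \<in> polys V"
      by (auto simp: carrier_Quot)
    with sub is_ideal_mult[OF assms, of y b] is_ideal_mult_right[OF assms, of y b]
    show "x \<otimes>\<^bsub>mpoly_ring V Quot I\<^esub> a \<in> coset V I ` P" "a \<otimes>\<^bsub>mpoly_ring V Quot I\<^esub> x \<in> coset V I ` P"
      by (auto simp: mult_Quot)
  qed
qed

lemma coset_in_image: "is_ideal V P \<Longrightarrow> I \<subseteq> P \<Longrightarrow> f \<in> polys V \<Longrightarrow> coset V I f \<in> coset V I ` P \<longleftrightarrow> f \<in> P"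
proof
  assume P: "is_ideal V P" "I \<subseteq> P" "f \<in> polys V" and "coset V I f \<in> coset V I ` P"
  then obtain g where "g \<in> P" "f - g \<in> I"
    using coset_eq_iff is_ideal_polys by blast
  with P show "f \<in> P" using is_ideal_diff_cancel by blast
qed auto

lemma prime_pullback:
  assumes "primeideal P (mpoly_ring V Quot I)"
  shows "prime_ideal V (pullback P)"
proof -
  interpret P: primeideal P "mpoly_ring V Quot I" by (rule assms)
  have id: "ideal P (mpoly_ring V Quot I)" by (rule P.is_ideal)
  have "1 \<notin> pullback P"
    using P.one_imp_carrier P.I_notcarr by (auto simp: pullback_def one_Quot)
  moreover have "x \<in> pullback P \<or> y \<in> pullback P"
    if "x \<in> polys V" "y \<in> polys V" "x * y \<in> pullback P" for x y
    using that P.I_prime[of "coset V I x" "coset V I y"] by (auto simp: pullback_def mult_Quot carrier_Quot)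
  ultimately show ?thesis
    using ideal_pullback(1)[OF id] by (auto simp: prime_ideal_def)
qed

lemma prime_image:
  assumes "prime_ideal V P" "I \<subseteq> P"
  shows "primeideal (coset V I ` P) (mpoly_ring V Quot I)"
proof (rule primeidealI)
  have P: "is_ideal V P" using assms(1) by (simp add: prime_ideal_def)
  show "ideal (coset V I ` P) (mpoly_ring V Quot I)" by (rule ideal_image[OF P])
  show "cring (mpoly_ring V Quot I)" by (rule cring_Quot)
  show "carrier (mpoly_ring V Quot I) \<noteq> coset V I ` P"
  proof
    assume "carrier (mpoly_ring V Quot I) = coset V I ` P"
    then have "coset V I 1 \<in> coset V I ` P" unfolding carrier_Quot by (metis imageI polys_1)
    then show False using coset_in_image[OF P assms(2), of 1] assms(1) by (simp add: prime_ideal_def)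
  qed
  fix a b assume "a \<in> carrier (mpoly_ring V Quot I)" "b \<in> carrier (mpoly_ring V Quot I)"
    and ab: "a \<otimes>\<^bsub>mpoly_ring V Quot I\<^esub> b \<in> coset V I ` P"
  then obtain x y where xy: "a = coset V I x" "x \<in> polys V" "b = coset V I y" "y \<in> polys V"
    by (auto simp: carrier_Quot)
  with ab coset_in_image[OF P assms(2), of "x * y"] have "x * y \<in> P" by (simp add: mult_Quot polys_mult)
  with assms(1) xy show "a \<in> coset V I ` P \<or> b \<in> coset V I ` P" by (auto simp: prime_ideal_def)
qed

text \<open>The correspondence between primes of the quotient and primes above \<open>I\<close>, via
  \<open>pullback\<close> and image. Dimension arguments can then be carried out inside the
  polynomial ring.\<close>

lemma krull_dim_Quot: "krull_dim (mpoly_ring V Quot I) = Sup {enat l | l. prime_chain V I l}"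
proof -
  have "(\<exists>P. (\<forall>i\<le>l. primeideal (P i) (mpoly_ring V Quot I)) \<and> (\<forall>i<l. P i \<subset> P (Suc i))) \<longleftrightarrow> prime_chain V I l" for l
  proof
    assume "\<exists>P. (\<forall>i\<le>l. primeideal (P i) (mpoly_ring V Quot I)) \<and> (\<forall>i<l. P i \<subset> P (Suc i))"
    then obtain P where P: "\<And>i. i \<le> l \<Longrightarrow> primeideal (P i) (mpoly_ring V Quot I)"
      "\<And>i. i < l \<Longrightarrow> P i \<subset> P (Suc i)" by blast
    have id: "ideal (P i) (mpoly_ring V Quot I)" if "i \<le> l" for i
      using P(1)[OF that] by (rule primeideal.axioms)
    have "pullback (P i) \<subset> pullback (P (Suc i))" if "i < l" for i
    proof -
      have "pullback (P i) \<subseteq> pullback (P (Suc i))" using P(2)[OF that] by (auto simp: pullback_def)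
      moreover have "pullback (P i) \<noteq> pullback (P (Suc i))"
        using P(2)[OF that] ideal_pullback(3)[OF id[of i]] ideal_pullback(3)[OF id[of "Suc i"]] that by auto
      ultimately show ?thesis by blast
    qed
    then show "prime_chain V I l"
      unfolding prime_chain_def
      by (intro exI[of _ "\<lambda>i. pullback (P i)"]) (use prime_pullback P(1) ideal_pullback(2)[OF id] in auto)
  next
    assume "prime_chain V I l"
    then obtain P where P: "\<And>i. i \<le> l \<Longrightarrow> prime_ideal V (P i)" "\<And>i. i \<le> l \<Longrightarrow> I \<subseteq> P i"
      "\<And>i. i < l \<Longrightarrow> P i \<subset> P (Suc i)" unfolding prime_chain_def by blast
    have "coset V I ` P i \<subset> coset V I ` P (Suc i)" if i: "i < l" for i
    proof -
      obtain x where x: "x \<in> P (Suc i)" "x \<notin> P i" using P(3)[OF i] by blast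
      have id: "is_ideal V (P i)" "is_ideal V (P (Suc i))" using P(1)[of i] P(1)[of "Suc i"] i by (auto simp: prime_ideal_def)
      have "x \<in> polys V" using is_ideal_polys[OF id(2) x(1)] .
      then have "coset V I x \<notin> coset V I ` P i"
        using coset_in_image[OF id(1) P(2)[of i], of x] x(2) i by simp
      then show ?thesis using P(3)[OF i] x(1) by blast
    qed
    then show "\<exists>P. (\<forall>i\<le>l. primeideal (P i) (mpoly_ring V Quot I)) \<and> (\<forall>i<l. P i \<subset> P (Suc i))"
      by (intro exI[of _ "\<lambda>i. coset V I ` P i"]) (use prime_image P in auto)
  qed
  then show ?thesis by (simp add: krull_dim_def)
qed

lemma gen_Quot:
  assumes "X \<subseteq> polys V" "x \<in> polys V"
  shows "coset V I x \<in> Idl\<^bsub>mpoly_ring V Quot I\<^esub> (coset V I ` X) \<longleftrightarrow> x \<in> gen_ideal V (I \<union> X)"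
proof -
  interpret Q: cring "mpoly_ring V Quot I" by (rule cring_Quot)
  have sub: "I \<union> X \<subseteq> polys V" using assms is_ideal_polys[OF I] by auto
  have subQ: "coset V I ` X \<subseteq> carrier (mpoly_ring V Quot I)" using assms by (auto simp: carrier_Quot)
  let ?G = "Idl\<^bsub>mpoly_ring V Quot I\<^esub> (coset V I ` X)"
  have G: "ideal ?G (mpoly_ring V Quot I)" by (rule Q.genideal_ideal[OF subQ])
  show ?thesis
  proof
    assume "coset V I x \<in> ?G"
    moreover have "?G \<subseteq> coset V I ` gen_ideal V (I \<union> X)"
      by (rule Q.genideal_minimal[OF ideal_image[OF is_ideal_gen[OF sub]]])
        (use gen_ideal_superset[OF sub] in auto)
    ultimately show "x \<in> gen_ideal V (I \<union> X)"
      using coset_in_image[OF is_ideal_gen[OF sub] _ assms(2)] gen_ideal_superset[OF sub] by blast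
  next
    assume x: "x \<in> gen_ideal V (I \<union> X)"
    have "gen_ideal V (I \<union> X) \<subseteq> pullback ?G"
      by (rule gen_ideal_least[OF ideal_pullback(1)[OF G]])
        (use ideal_pullback(2)[OF G] Q.genideal_self[OF subQ] assms in \<open>auto simp: pullback_def\<close>)
    with x show "coset V I x \<in> ?G" by (auto simp: pullback_def)
  qed
qed

lemma regular_sequence_Quot:
  assumes "set fs \<subseteq> polys V"
  shows "regular_sequence (mpoly_ring V Quot I) (map (coset V I) fs) \<longleftrightarrow>
     (\<forall>i<length fs. \<forall>x\<in>polys V. fs ! i * x \<in> gen_ideal V (I \<union> set (take i fs)) \<longrightarrow>
        x \<in> gen_ideal V (I \<union> set (take i fs))) \<and> 1 \<notin> gen_ideal V (I \<union> set fs)"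
proof -
  have tk: "set (take i fs) \<subseteq> polys V" for i using assms set_take_subset[of i fs] by blast
  have im: "set (take i (map (coset V I) fs)) = coset V I ` set (take i fs)" for i
    by (simp add: take_map)
  have "Idl\<^bsub>mpoly_ring V Quot I\<^esub> (set (map (coset V I) fs)) \<noteq> carrier (mpoly_ring V Quot I) \<longleftrightarrow>
    1 \<notin> gen_ideal V (I \<union> set fs)"
  proof -
    interpret Q: cring "mpoly_ring V Quot I" by (rule cring_Quot)
    have "ideal (Idl\<^bsub>mpoly_ring V Quot I\<^esub> (coset V I ` set fs)) (mpoly_ring V Quot I)"
      by (rule Q.genideal_ideal) (use assms in \<open>auto simp: carrier_Quot\<close>)
    then interpret G: ideal "Idl\<^bsub>mpoly_ring V Quot I\<^esub> (coset V I ` set fs)" "mpoly_ring V Quot I" .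
    show ?thesis
      using gen_Quot[OF assms, of 1] G.one_imp_carrier by (auto simp: one_Quot carrier_Quot)
  qed
  moreover have "(\<forall>x\<in>carrier (mpoly_ring V Quot I).
      map (coset V I) fs ! i \<otimes>\<^bsub>mpoly_ring V Quot I\<^esub> x \<in> Idl\<^bsub>mpoly_ring V Quot I\<^esub> (set (take i (map (coset V I) fs))) \<longrightarrow>
      x \<in> Idl\<^bsub>mpoly_ring V Quot I\<^esub> (set (take i (map (coset V I) fs)))) \<longleftrightarrow>
    (\<forall>x\<in>polys V. fs ! i * x \<in> gen_ideal V (I \<union> set (take i fs)) \<longrightarrow>
        x \<in> gen_ideal V (I \<union> set (take i fs)))" if i: "i < length fs" for i
  proof -
    have fi: "fs ! i \<in> polys V" using assms i nth_mem by blast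
    show ?thesis
      unfolding carrier_Quot ball_simps im
      using gen_Quot[OF tk[of i]] fi by (auto simp: mult_Quot polys_mult i)
  qed
  ultimately show ?thesis
    unfolding regular_sequence_def using assms by (auto simp: carrier_Quot)
qed

text \<open>Additivity reduces injectivity to a trivial kernel. Both alternatives of maximal rank
  become membership statements about representatives.\<close>

lemma has_maximal_rank_iff:
  fixes s j :: nat and L :: "('v, 'k) mpoly"
  defines "\<phi> \<equiv> \<lambda>x. ((coset V I L) [^]\<^bsub>mpoly_ring V Quot I\<^esub> s) \<otimes>\<^bsub>mpoly_ring V Quot I\<^esub> x"
  assumes L: "L \<in> homog_part V 1"
  shows "inj_on \<phi> (coset V I ` homog_part V j) \<longleftrightarrow> (\<forall>f\<in>homog_part V j. L ^ s * f \<in> I \<longrightarrow> f \<in> I)"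
    and "\<phi> ` coset V I ` homog_part V j = coset V I ` homog_part V (j + s) \<longleftrightarrow>
      (\<forall>g\<in>homog_part V (j + s). \<exists>f\<in>homog_part V j. g - L ^ s * f \<in> I)"
proof -
  have Lp: "L ^ s \<in> polys V" "L ^ s \<in> homog_part V s"
    using homog_power[OF L, of s] by (auto dest: homog_polys)
  have \<phi>: "\<phi> (coset V I f) = coset V I (L ^ s * f)" if "f \<in> homog_part V j" for f
    using L Lp that by (simp add: \<phi>_def pow_Quot mult_Quot homog_polys)
  have hp: "L ^ s * f \<in> homog_part V (j + s)" if "f \<in> homog_part V j" for f
    using homog_mult[OF Lp(2) that] by (simp add: add.commute)
  have eq: "coset V I (L ^ s * f) = coset V I (L ^ s * g) \<longleftrightarrow> L ^ s * (f - g) \<in> I"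
    if "f \<in> homog_part V j" "g \<in> homog_part V j" for f g
    using coset_eq_iff[OF homog_polys[OF hp[OF that(1)]] homog_polys[OF hp[OF that(2)]]]
    by (simp add: right_diff_distrib)
  show "inj_on \<phi> (coset V I ` homog_part V j) \<longleftrightarrow> (\<forall>f\<in>homog_part V j. L ^ s * f \<in> I \<longrightarrow> f \<in> I)"
  proof
    assume inj: "inj_on \<phi> (coset V I ` homog_part V j)"
    show "\<forall>f\<in>homog_part V j. L ^ s * f \<in> I \<longrightarrow> f \<in> I"
    proof safe
      fix f assume f: "f \<in> homog_part V j" "L ^ s * f \<in> I"
      then have "\<phi> (coset V I f) = \<phi> (coset V I 0)"
        using hp[OF f(1)] by (simp add: \<phi> coset_eq_iff homog_polys)
      then have "coset V I f = coset V I 0"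
        by (rule inj_onD[OF inj]) (use f in auto)
      then show "f \<in> I" using f by (simp add: coset_eq_iff homog_polys)
    qed
  next
    assume a: "\<forall>f\<in>homog_part V j. L ^ s * f \<in> I \<longrightarrow> f \<in> I"
    show "inj_on \<phi> (coset V I ` homog_part V j)"
    proof (rule inj_onI)
      fix x y assume "x \<in> coset V I ` homog_part V j" "y \<in> coset V I ` homog_part V j" "\<phi> x = \<phi> y"
      then obtain f g where xy: "x = coset V I f" "y = coset V I g"
        and fg: "f \<in> homog_part V j" "g \<in> homog_part V j" "\<phi> (coset V I f) = \<phi> (coset V I g)"
        by blast
      then have "L ^ s * (f - g) \<in> I" using eq by (simp add: \<phi>)
      then have "f - g \<in> I" using a homog_minus[OF fg(1,2)] by simp
      then show "x = y"
        using coset_eq_iff[OF homog_polys[OF fg(1)] homog_polys[OF fg(2)]] xy by simp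
    qed
  qed
  show "\<phi> ` coset V I ` homog_part V j = coset V I ` homog_part V (j + s) \<longleftrightarrow>
      (\<forall>g\<in>homog_part V (j + s). \<exists>f\<in>homog_part V j. g - L ^ s * f \<in> I)"
  proof -
    have "\<phi> ` coset V I ` homog_part V j = (\<lambda>f. coset V I (L ^ s * f)) ` homog_part V j"
      unfolding image_image by (rule image_cong) (auto simp: \<phi>)
    moreover have "\<dots> \<subseteq> coset V I ` homog_part V (j + s)" using hp by blast
    ultimately have "\<phi> ` coset V I ` homog_part V j = coset V I ` homog_part V (j + s) \<longleftrightarrow>
      coset V I ` homog_part V (j + s) \<subseteq> (\<lambda>f. coset V I (L ^ s * f)) ` homog_part V j" by auto
    also have "\<dots> \<longleftrightarrow> (\<forall>g\<in>homog_part V (j + s). \<exists>f\<in>homog_part V j. coset V I g = coset V I (L ^ s * f))"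
      by blast
    also have "\<dots> \<longleftrightarrow> (\<forall>g\<in>homog_part V (j + s). \<exists>f\<in>homog_part V j. g - L ^ s * f \<in> I)"
      by (intro ball_cong bex_cong refl coset_eq_iff) (use hp in \<open>auto dest: homog_polys\<close>)
    finally show ?thesis .
  qed
qed

end

section \<open>Elimination of linear forms\<close>

text \<open>Replacing the factors of a monomial one at a time changes it at each stage by a multiple
  of some \<open>indet v - \<rho> v\<close>; this telescopes by induction on the degree.\<close>

lemma subst_diff_ideal:
  assumes P: "is_ideal V P" and \<rho>: "\<And>v. v \<in> V \<Longrightarrow> \<rho> v \<in> polys V" "\<And>v. v \<in> V \<Longrightarrow> indet v - \<rho> v \<in> P"
    and f: "f \<in> polys V"
  shows "f - subst \<rho> f \<in> P"
proof -
  have mon: "monom_poly u - mon_subst \<rho> u \<in> P" if "u \<in> monomials_in V" for u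
    using that
  proof (induction "mon_degree u" arbitrary: u)
    case 0
    then show ?case using is_ideal_0[OF P] by simp
  next
    case (Suc k)
    obtain v w where vw: "v \<in> keys u" "u = w + single v 1" "mon_degree w = k"
      using mon_degree_Suc[of u k] Suc.hyps(2) by metis
    with Suc.prems have v: "v \<in> V" and w: "w \<in> monomials_in V"
      by (auto simp: monomials_in_def keys_add_nat)
    have "monom_poly u - mon_subst \<rho> u
      = monom_poly w * (indet v - \<rho> v) + \<rho> v * (monom_poly w - mon_subst \<rho> w)"
      by (simp add: vw(2) monom_poly_add mon_subst_add indet_def algebra_simps)
    also have "\<dots> \<in> P"
      using Suc.hyps(1)[of w] vw(3) v w \<rho> by (intro is_ideal_add[OF P] is_ideal_mult[OF P]) auto
    finally show ?case .
  qed
  have "f - subst \<rho> f = (\<Sum>u\<in>keys f. scalar (lookup f u) * (monom_poly u - mon_subst \<rho> u))"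
    by (subst mpoly_expand[of f]) (simp add: subst_def sum_subtractf right_diff_distrib)
  also have "\<dots> \<in> P"
    by (intro is_ideal_sum[OF P] is_ideal_mult[OF P] mon polys_scalar) (use f in \<open>auto simp: polys_def\<close>)
  finally show ?thesis .
qed

text \<open>Gaussian elimination. The variables in \<open>B\<close> remain as coordinates; since
  \<rho> kills \<open>ls\<close> and moves variables only within the ideal of \<open>ls\<close>,
  that ideal is exactly the kernel of \<open>subst \<rho>\<close> on \<open>polys V\<close>. The
  count is an inequality because the given forms may be dependent.\<close>

lemma linear_elim:
  fixes ls :: "('v, 'k::field) mpoly list"
  assumes "finite V" "set ls \<subseteq> homog_part V 1"
  shows "\<exists>B \<rho>. B \<subseteq> V \<and> card V \<le> card B + length ls \<and> (\<forall>v\<in>V. \<rho> v \<in> homog_part B 1) \<and>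
    (\<forall>b\<in>B. \<rho> b = indet b) \<and> (\<forall>l\<in>set ls. subst \<rho> l = 0) \<and>
    (\<forall>v\<in>V. indet v - \<rho> v \<in> gen_ideal V (set ls))"
  using assms(2)
proof (induction ls)
  case Nil
  have "0 \<in> gen_ideal V {}" by (rule is_ideal_0[OF is_ideal_gen]) simp
  then show ?case by (intro exI[of _ V] exI[of _ indet]) auto
next
  case (Cons l ls)
  from Cons obtain B \<rho> where *: "B \<subseteq> V" "card V \<le> card B + length ls" "\<forall>v\<in>V. \<rho> v \<in> homog_part B 1"
    "\<forall>b\<in>B. \<rho> b = indet b" "\<forall>l\<in>set ls. subst \<rho> l = 0"
    "\<forall>v\<in>V. indet v - \<rho> v \<in> gen_ideal V (set ls)" by auto
  note B = *(1,2)
  have \<rho>: "\<And>v. v \<in> V \<Longrightarrow> \<rho> v \<in> homog_part B 1" "\<And>b. b \<in> B \<Longrightarrow> \<rho> b = indet b"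
      "\<And>l. l \<in> set ls \<Longrightarrow> subst \<rho> l = 0" "\<And>v. v \<in> V \<Longrightarrow> indet v - \<rho> v \<in> gen_ideal V (set ls)"
    using * by auto
  let ?G = "gen_ideal V (set (l # ls))"
  have sub: "set (l # ls) \<subseteq> polys V" using Cons.prems homog_polys by blast
  note G = is_ideal_gen[OF sub]
  have GG: "gen_ideal V (set ls) \<subseteq> ?G" by (rule gen_ideal_mono'[OF sub]) auto
  have finB: "finite B" using B(1) assms(1) finite_subset by blast
  have \<rho>V: "\<rho> v \<in> polys V" if "v \<in> V" for v
    using \<rho>(1)[OF that] homog_mono[OF B(1)] homog_polys by blast
  define l' where "l' = subst \<rho> l"
  have l'B: "l' \<in> homog_part B 1"
    unfolding l'_def by (rule homog_subst[OF \<rho>(1)]) (use Cons.prems in auto)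
  show ?case
  proof (cases "l' = 0")
    case True
    with B \<rho> GG show ?thesis by (intro exI[of _ B] exI[of _ \<rho>]) (auto simp: l'_def)
  next
    case False
    have "\<exists>b\<in>B. lookup l' (single b 1) \<noteq> 0"
    proof (rule ccontr)
      assume "\<not> ?thesis"
      then have "l' = 0" by (subst linear_form_expand[OF finB l'B]) simp
      with False show False by simp
    qed
    then obtain b where b: "b \<in> B" "lookup l' (single b 1) \<noteq> 0" by blast
    define a where "a = lookup l' (single b 1)"
    \<comment> \<open>The equation \<open>l' = 0\<close> is solved for the pivot \<open>b\<close>:
      dividing by the coefficient \<open>a\<close> makes \<open>b\<close> cancel in
      \<open>\<sigma> b\<close>.\<close>
    define \<sigma> where "\<sigma> = (\<lambda>v. if v = b then indet b - scalar (1 / a) * l' else indet v)"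
    have \<sigma>f: "subst \<sigma> f = f - scalar (lookup f (single b 1) / a) * l'" if "f \<in> homog_part B 1" for f
    proof -
      let ?k = "\<lambda>v. scalar (lookup f (single v 1))"
      have "subst \<sigma> f = (\<Sum>v\<in>B. ?k v * \<sigma> v)"
        by (subst linear_form_expand[OF finB that]) (simp add: subst_simps)
      also have "\<dots> = (\<Sum>v\<in>B. ?k v * indet v - (if v = b then ?k b * (scalar (1 / a) * l') else 0))"
        by (rule sum.cong) (auto simp: \<sigma>_def right_diff_distrib)
      also have "\<dots> = f - ?k b * (scalar (1 / a) * l')"
        unfolding sum_subtractf linear_form_expand[OF finB that, symmetric] using b finB by simp
      also have "?k b * (scalar (1 / a) * l') = scalar (lookup f (single b 1) / a) * l'"
        by (simp add: mult.assoc[symmetric] scalar_mult[symmetric])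
      finally show ?thesis .
    qed
    have \<sigma>b: "\<sigma> b \<in> homog_part (B - {b}) 1"
    proof -
      have "l' = scalar a * indet b + (\<Sum>v\<in>B - {b}. scalar (lookup l' (single v 1)) * indet v)"
        using linear_form_expand[OF finB l'B] b finB unfolding a_def by (simp add: sum.remove)
      moreover have "scalar (1 / a) * scalar a = (1 :: ('v, 'k) mpoly)"
        using b by (simp add: a_def flip: scalar_mult)
      ultimately have "\<sigma> b = - (scalar (1 / a) * (\<Sum>v\<in>B - {b}. scalar (lookup l' (single v 1)) * indet v))"
        by (simp add: \<sigma>_def) (metis (no_types, lifting) add_diff_cancel_left' distrib_left minus_diff_eq mult.assoc mult_1)
      then show ?thesis by (auto intro!: homog_uminus homog_scalar_mult homog_sum)
    qed
    have \<sigma>B: "\<sigma> v \<in> homog_part (B - {b}) 1" if "v \<in> B" for v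
      using that \<sigma>b by (cases "v = b") (auto simp: \<sigma>_def)
    define \<rho>' where "\<rho>' v = subst \<sigma> (\<rho> v)" for v
    have l'G: "l' \<in> ?G"
    proof -
      have "l - subst \<rho> l \<in> ?G"
        by (rule subst_diff_ideal[OF G \<rho>V]) (use \<rho>(4) GG sub in auto)
      moreover have "l \<in> ?G" using gen_idealI[OF sub] by simp
      ultimately show ?thesis using is_ideal_minus[OF G, of l "l - l'"] by (simp add: l'_def)
    qed
    have "card V \<le> card (B - {b}) + length (l # ls)" using B(2) b finB by (simp add: card_Diff_singleton_if)
    moreover have "\<rho>' v \<in> homog_part (B - {b}) 1" if "v \<in> V" for v
      unfolding \<rho>'_def by (rule homog_subst[OF \<sigma>B \<rho>(1)[OF that]])
    moreover have "\<rho>' v = indet v" if "v \<in> B - {b}" for v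
      using that by (simp add: \<rho>'_def \<rho>(2) \<sigma>_def)
    moreover have "subst \<rho>' k = 0" if "k \<in> set (l # ls)" for k
    proof -
      have eq: "subst \<rho>' k = subst \<sigma> (subst \<rho> k)" by (simp add: subst_subst \<rho>'_def[abs_def])
      show ?thesis
      proof (cases "k = l")
        case True
        have "subst \<sigma> l' = 0" using \<sigma>f[OF l'B] b by (simp add: a_def)
        with eq True show ?thesis by (simp add: l'_def)
      next
        case False
        with that \<rho>(3) eq show ?thesis by simp
      qed
    qed
    moreover have "indet v - \<rho>' v \<in> ?G" if "v \<in> V" for v
    proof -
      have "indet v - \<rho>' v = (indet v - \<rho> v) + scalar (lookup (\<rho> v) (single b 1) / a) * l'"
        by (simp add: \<rho>'_def \<sigma>f[OF \<rho>(1)[OF that]])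
      also have "\<dots> \<in> ?G"
        using \<rho>(4)[OF that] GG l'G by (intro is_ideal_add[OF G] is_ideal_mult[OF G]) auto
      finally show ?thesis .
    qed
    ultimately show ?thesis using B(1) by (intro exI[of _ "B - {b}"] exI[of _ \<rho>']) auto
  qed
qed

section \<open>Linear dependence and counting of monomials\<close>

text \<open>A homogeneous system with more unknowns than equations has a nontrivial solution: each
  equation is used to eliminate one unknown \<open>a0\<close>.\<close>

lemma linear_relation:
  fixes M :: "'a \<Rightarrow> 'e \<Rightarrow> 'k::field"
  assumes "finite E" "finite A" "card E < card A"
  shows "\<exists>c. (\<exists>a\<in>A. c a \<noteq> 0) \<and> (\<forall>e\<in>E. (\<Sum>a\<in>A. c a * M a e) = 0)"
  using assms
proof (induction E arbitrary: A M rule: finite_induct)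
  case empty
  then obtain a where "a \<in> A" by fastforce
  then show ?case by (intro exI[of _ "\<lambda>_. 1"]) auto
next
  case (insert e E)
  show ?case
  proof (cases "\<forall>a\<in>A. M a e = 0")
    case True
    obtain c where "\<exists>a\<in>A. c a \<noteq> 0" "\<forall>x\<in>E. (\<Sum>a\<in>A. c a * M a x) = 0"
      using insert.IH[of A M] insert.prems insert.hyps by auto
    with True show ?thesis by (intro exI[of _ c]) auto
  next
    case False
    then obtain a0 where a0: "a0 \<in> A" "M a0 e \<noteq> 0" by blast
    define A' where "A' = A - {a0}"
    have A: "A = insert a0 A'" "a0 \<notin> A'" "finite A'" using a0 insert.prems by (auto simp: A'_def)
    have "card E < card A'" using insert.prems insert.hyps A by simp
    then obtain c where c: "\<exists>a\<in>A'. c a \<noteq> 0"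
      "\<forall>x\<in>E. (\<Sum>a\<in>A'. c a * (M a x - M a e / M a0 e * M a0 x)) = 0"
      using insert.IH[of A' "\<lambda>a x. M a x - M a e / M a0 e * M a0 x"] A by auto
    define c' where "c' = c(a0 := - (\<Sum>a\<in>A'. c a * M a e) / M a0 e)"
    have c'A: "(\<Sum>a\<in>A'. c' a * M a x) = (\<Sum>a\<in>A'. c a * M a x)" for x
      by (rule sum.cong) (use A in \<open>auto simp: c'_def\<close>)
    have "(\<Sum>a\<in>A. c' a * M a x) = 0" if "x \<in> insert e E" for x
    proof (cases "x = e")
      case True
      then show ?thesis using A a0 c'A by (simp add: c'_def)
    next
      case False
      then have "(\<Sum>a\<in>A'. c a * M a x) = (\<Sum>a\<in>A'. c a * M a e) / M a0 e * M a0 x"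
        using c(2) that
        by (simp add: right_diff_distrib sum_subtractf sum_divide_distrib sum_distrib_right mult.assoc)
      then show ?thesis using A c'A by (simp add: c'_def)
    qed
    moreover have "\<exists>a\<in>A. c' a \<noteq> 0" using c(1) A by (auto simp: c'_def)
    ultimately show ?thesis by blast
  qed
qed

definition mons :: "'v set \<Rightarrow> nat \<Rightarrow> 'v monomial set" where
  "mons B j = {u \<in> monomials_in B. mon_degree u = j}"

lemma mons_0: "mons B 0 = {0}"
  by (auto simp: mons_def monomials_in_zero)

lemma mons_empty: "mons {} (Suc j) = {}"
proof -
  have "u = 0" if "keys u \<subseteq> {}" for u :: "'a monomial" using that by simp
  then show ?thesis by (force simp: mons_def monomials_in_def)
qed

lemma mons_insert:
  assumes "b \<notin> B"
  shows "mons (insert b B) (Suc j) = mons B (Suc j) \<union> (\<lambda>u. u + single b 1) ` mons (insert b B) j"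
proof (intro equalityI subsetI)
  fix u assume u: "u \<in> mons (insert b B) (Suc j)"
  show "u \<in> mons B (Suc j) \<union> (\<lambda>u. u + single b 1) ` mons (insert b B) j"
  proof (cases "b \<in> keys u")
    case True
    from in_keys_split[OF this] obtain w where w: "u = w + single b 1" by blast
    then have "w \<in> mons (insert b B) j"
      using u by (auto simp: mons_def monomials_in_def keys_add_nat mon_degree_add)
    with w show ?thesis by blast
  qed (use u in \<open>auto simp: mons_def monomials_in_def\<close>)
next
  fix u assume "u \<in> mons B (Suc j) \<union> (\<lambda>u. u + single b 1) ` mons (insert b B) j"
  then show "u \<in> mons (insert b B) (Suc j)"
    by (auto simp: mons_def monomials_in_def keys_add_nat mon_degree_add)
qed

lemma card_mons: "finite B \<Longrightarrow> finite (mons B j) \<and> card (mons B j) = (card B + j - 1 choose j)"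
proof (induction B arbitrary: j rule: finite_induct)
  case empty
  show ?case by (cases j) (simp_all add: mons_0 mons_empty)
next
  case (insert b B)
  show ?case
  proof (induction j)
    case 0
    show ?case by (simp add: mons_0)
  next
    case (Suc j)
    let ?f = "\<lambda>u. u + single b (1::nat)"
    have inj: "inj_on ?f (mons (insert b B) j)" by (rule inj_onI) simp
    have "u + single b 1 \<notin> mons B (Suc j)" for u
      using insert.hyps(2) by (auto simp: mons_def monomials_in_def keys_add_nat)
    then have disj: "mons B (Suc j) \<inter> ?f ` mons (insert b B) j = {}" by blast
    have "card (mons (insert b B) (Suc j)) = card (mons B (Suc j)) + card (mons (insert b B) j)"
      unfolding mons_insert[OF insert.hyps(2)]
      using insert.IH[of "Suc j"] Suc by (simp add: card_Un_disjoint[OF _ _ disj] card_image[OF inj])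
    then show ?case
      using insert.IH[of "Suc j"] Suc insert.hyps mons_insert[OF insert.hyps(2), of j] by simp
  qed
qed

lemma finite_mons_le: "finite B \<Longrightarrow> finite {u \<in> monomials_in B. mon_degree u \<le> j}"
proof -
  assume "finite B"
  then have "finite (\<Union>i\<le>j. mons B i)" using card_mons by blast
  moreover have "{u \<in> monomials_in B. mon_degree u \<le> j} \<subseteq> (\<Union>i\<le>j. mons B i)" by (auto simp: mons_def)
  ultimately show ?thesis using finite_subset by blast
qed

section \<open>Dimension and depth are bounded by the growth of the quotient\<close>

text \<open>Consider the terms by their exponent of \<open>f i\<close>. The lowest power of
  \<open>f i\<close> can be divided out because \<open>f i\<close> is a nonzerodivisor modulo
  \<open>p i\<close>; modulo \<open>p (Suc i)\<close> the terms with a higher power then disappear.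
  Repeating this up to \<open>l\<close> leaves a single nonzero constant, so a polynomial relation
  between the \<open>f i\<close> is impossible as long as \<open>p l\<close> is proper.\<close>

lemma lowest_term:
  fixes p :: "nat \<Rightarrow> ('v, 'k::field) mpoly set" and f :: "nat \<Rightarrow> ('v, 'k) mpoly"
  assumes ideal: "\<And>i. i \<le> l \<Longrightarrow> is_ideal V (p i)" and mono: "\<And>i. i < l \<Longrightarrow> p i \<subseteq> p (Suc i)"
    and f: "\<And>i. i < l \<Longrightarrow> f i \<in> p (Suc i)" "\<And>i. i < l \<Longrightarrow> f i \<in> polys V"
    and nzd: "\<And>i x. i < l \<Longrightarrow> x \<in> polys V \<Longrightarrow> f i * x \<in> p i \<Longrightarrow> x \<in> p i"
    and K: "finite K" "K \<noteq> {}" "\<And>\<beta>. \<beta> \<in> K \<Longrightarrow> c \<beta> \<noteq> 0"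
      "\<And>\<beta> \<gamma>. \<beta> \<in> K \<Longrightarrow> \<gamma> \<in> K \<Longrightarrow> (\<And>j. i \<le> j \<Longrightarrow> j < l \<Longrightarrow> \<beta> j = \<gamma> j) \<Longrightarrow> \<beta> = \<gamma>"
    and i: "i \<le> l" and sum: "(\<Sum>\<beta>\<in>K. scalar (c \<beta>) * (\<Prod>j=i..<l. f j ^ \<beta> j)) \<in> p i"
  shows "1 \<in> p l"
  using K i sum
proof (induction "l - i" arbitrary: i K)
  case 0
  then have "i = l" by simp
  from \<open>K \<noteq> {}\<close> obtain \<beta> where \<beta>: "\<beta> \<in> K" by blast
  with "0.prems"(4) \<open>i = l\<close> have "K = {\<beta>}" by fastforce
  with "0.prems" \<open>i = l\<close> have "scalar (c \<beta>) \<in> p l" by simp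
  then have "scalar (1 / c \<beta>) * scalar (c \<beta>) \<in> p l"
    by (intro is_ideal_mult[OF ideal]) auto
  with "0.prems"(3)[OF \<beta>] show ?case by (simp flip: scalar_mult)
next
  case (Suc k)
  then have il: "i < l" by simp
  \<comment> \<open>The terms with exponent exactly \<open>e\<close> form \<open>K'\<close> below.
    They agree at \<open>i\<close>, so they are still told apart by the exponents from
    \<open>Suc i\<close> on.\<close>
  define e where "e = Min ((\<lambda>\<beta>. \<beta> i) ` K)"
  have e: "e \<le> \<beta> i" if "\<beta> \<in> K" for \<beta> using Suc.prems(1) that by (simp add: e_def)
  have "e \<in> (\<lambda>\<beta>. \<beta> i) ` K" unfolding e_def by (rule Min_in) (use Suc.prems in auto)
  define T where "T \<beta> = scalar (c \<beta>) * (\<Prod>j=Suc i..<l. f j ^ \<beta> j)" for \<beta>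
  have T: "T \<beta> \<in> polys V" for \<beta> unfolding T_def by (intro polys_intros polys_scalar f) auto
  define S where "S = (\<Sum>\<beta>\<in>K. f i ^ (\<beta> i - e) * T \<beta>)"
  have S: "S \<in> polys V" unfolding S_def by (intro polys_intros f T il)
  have "(\<Sum>\<beta>\<in>K. scalar (c \<beta>) * (\<Prod>j=i..<l. f j ^ \<beta> j)) = f i ^ e * S"
    unfolding S_def sum_distrib_left
  proof (rule sum.cong)
    fix \<beta> assume "\<beta> \<in> K"
    then have "f i ^ \<beta> i = f i ^ e * f i ^ (\<beta> i - e)" using e[of \<beta>] by (simp flip: power_add)
    then show "scalar (c \<beta>) * (\<Prod>j=i..<l. f j ^ \<beta> j) = f i ^ e * (f i ^ (\<beta> i - e) * T \<beta>)"
      by (simp add: prod.atLeast_Suc_lessThan[OF il] T_def mult_ac)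
  qed simp
  with Suc.prems(6) have "f i ^ e * S \<in> p i" by simp
  then have "S \<in> p i"
  proof (induction e)
    case (Suc e)
    have "f i ^ e * S \<in> polys V" using f(2)[OF il] S by (intro polys_mult polys_power)
    moreover have "f i * (f i ^ e * S) \<in> p i" using Suc.prems by (simp add: mult.assoc)
    ultimately show ?case using nzd[OF il] Suc.IH by blast
  qed simp
  then have S': "S \<in> p (Suc i)" using mono[OF il] by blast
  define K' where "K' = {\<beta> \<in> K. \<beta> i = e}"
  have "S = (\<Sum>\<beta>\<in>K'. T \<beta>) + (\<Sum>\<beta>\<in>K - K'. f i ^ (\<beta> i - e) * T \<beta>)"
  proof -
    have "S = (\<Sum>\<beta>\<in>K'. f i ^ (\<beta> i - e) * T \<beta>) + (\<Sum>\<beta>\<in>K - K'. f i ^ (\<beta> i - e) * T \<beta>)"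
      unfolding S_def by (subst sum.subset_diff[of K' K]) (use Suc.prems(1) in \<open>auto simp: K'_def\<close>)
    also have "(\<Sum>\<beta>\<in>K'. f i ^ (\<beta> i - e) * T \<beta>) = (\<Sum>\<beta>\<in>K'. T \<beta>)"
      by (rule sum.cong) (auto simp: K'_def)
    finally show ?thesis .
  qed
  moreover have "(\<Sum>\<beta>\<in>K - K'. f i ^ (\<beta> i - e) * T \<beta>) \<in> p (Suc i)"
  proof (rule is_ideal_sum)
    show "is_ideal V (p (Suc i))" using ideal il by simp
    fix \<beta> assume "\<beta> \<in> K - K'"
    then have "e < \<beta> i" using e[of \<beta>] by (auto simp: K'_def)
    then obtain d where "\<beta> i - e = Suc d" by (cases "\<beta> i - e") auto
    then have "f i ^ (\<beta> i - e) * T \<beta> = (f i ^ d * T \<beta>) * f i" by (simp add: mult_ac)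
    also have "\<dots> \<in> p (Suc i)"
      by (rule is_ideal_mult[OF ideal]) (use il f T in \<open>auto intro!: polys_intros\<close>)
    finally show "f i ^ (\<beta> i - e) * T \<beta> \<in> p (Suc i)" .
  qed
  ultimately have "(\<Sum>\<beta>\<in>K'. T \<beta>) \<in> p (Suc i)"
    using is_ideal_minus[OF ideal[of "Suc i"] S'] il by fastforce
  then show ?case
  proof (intro Suc.hyps(1)[of "Suc i" K'])
    show "K' \<noteq> {}" using \<open>e \<in> _\<close> by (auto simp: K'_def)
    fix \<beta> \<gamma> assume *: "\<beta> \<in> K'" "\<gamma> \<in> K'" "\<And>j. Suc i \<le> j \<Longrightarrow> j < l \<Longrightarrow> \<beta> j = \<gamma> j"
    show "\<beta> = \<gamma>"
    proof (rule Suc.prems(4))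
      show "\<beta> j = \<gamma> j" if "i \<le> j" "j < l" for j
        using * that by (cases "j = i") (auto simp: K'_def)
    qed (use * in \<open>auto simp: K'_def\<close>)
  qed (use Suc il in \<open>auto simp: K'_def T_def\<close>)
qed

definition deg_le :: "('v, 'k::zero) mpoly \<Rightarrow> nat \<Rightarrow> bool" where
  "deg_le p N \<longleftrightarrow> (\<forall>u\<in>keys p. mon_degree u \<le> N)"

lemma deg_le_mult:
  fixes p q :: "('v, 'k::comm_ring_1) mpoly"
  shows "deg_le p N \<Longrightarrow> deg_le q M \<Longrightarrow> deg_le (p * q) (N + M)"
  using keys_mult[of p q] unfolding deg_le_def by (fastforce simp: mon_degree_add intro: add_mono)

lemma deg_le_1: "deg_le (1 :: ('v, 'k::comm_ring_1) mpoly) 0"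
  by (simp add: deg_le_def)

lemma deg_le_power: "deg_le (p :: ('v, 'k::comm_ring_1) mpoly) N \<Longrightarrow> deg_le (p ^ k) (k * N)"
  by (induction k) (auto intro: deg_le_mult deg_le_1)

lemma deg_le_prod:
  fixes f :: "'i \<Rightarrow> ('v, 'k::comm_ring_1) mpoly"
  shows "(\<And>i. i \<in> A \<Longrightarrow> deg_le (f i) (d i)) \<Longrightarrow> deg_le (\<Prod>i\<in>A. f i) (\<Sum>i\<in>A. d i)"
  by (induction A rule: infinite_finite_induct) (auto intro: deg_le_mult deg_le_1)

lemma deg_le_mono: "deg_le p N \<Longrightarrow> N \<le> M \<Longrightarrow> deg_le p M"
  by (auto simp: deg_le_def)

text \<open>Choose the support among at most \<open>2 ^ card V\<close> sets and then at most
  \<open>d\<close> exponents up to \<open>N\<close>. What matters is that the growth in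
  \<open>N\<close> has degree \<open>d\<close> only.\<close>

lemma card_sparse_mons:
  fixes V :: "'v set"
  assumes "finite V"
  shows "card {u \<in> monomials_in V. mon_degree u \<le> N \<and> card (keys u) \<le> d} \<le> 2 ^ card V * (N + 1) ^ d"
proof -
  define E where "E F = {u. keys u \<subseteq> F \<and> (\<forall>v. lookup u v \<le> N)}" for F :: "'v set"
  have E: "finite (E F) \<and> card (E F) \<le> (N + 1) ^ d" if "F \<subseteq> V" "card F \<le> d" for F
  proof -
    have F: "finite F" using that assms finite_subset by blast
    let ?g = "\<lambda>u. restrict (lookup u) F"
    have inj: "inj_on ?g (E F)"
    proof (rule inj_onI)
      fix u w assume uw: "u \<in> E F" "w \<in> E F" "?g u = ?g w"
      show "u = w"
      proof (rule poly_mapping_eqI)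
        fix v show "lookup u v = lookup w v"
        proof (cases "v \<in> F")
          case True
          then show ?thesis using fun_cong[OF uw(3), of v] by simp
        next
          case False
          then have "v \<notin> keys u" "v \<notin> keys w" using uw by (auto simp: E_def)
          then show ?thesis by (simp add: in_keys_iff)
        qed
      qed
    qed
    have sub: "?g ` E F \<subseteq> PiE F (\<lambda>_. {..N})" by (auto simp: E_def)
    have fin: "finite (PiE F (\<lambda>_. {..N}))" using F by (intro finite_PiE) auto
    have "card (E F) = card (?g ` E F)" by (rule card_image[OF inj, symmetric])
    also have "\<dots> \<le> card (PiE F (\<lambda>_. {..N}))" by (rule card_mono[OF fin sub])
    also have "\<dots> = (N + 1) ^ card F" using F by (simp add: card_PiE Suc_eq_plus1)
    also have "\<dots> \<le> (N + 1) ^ d" using that by (intro power_increasing) auto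
    finally have "card (E F) \<le> (N + 1) ^ d" .
    moreover have "finite (E F)" using finite_subset[OF sub fin] inj by (rule finite_imageD)
    ultimately show ?thesis by blast
  qed
  let ?P = "{F. F \<subseteq> V \<and> card F \<le> d}"
  have P: "finite ?P" using assms by simp
  have "{u \<in> monomials_in V. mon_degree u \<le> N \<and> card (keys u) \<le> d} \<subseteq> (\<Union>F\<in>?P. E F)"
  proof
    fix u assume u: "u \<in> {u \<in> monomials_in V. mon_degree u \<le> N \<and> card (keys u) \<le> d}"
    then have "u \<in> E (keys u)" "keys u \<in> ?P"
      using lookup_le_mon_degree[of u] by (auto simp: E_def monomials_in_def intro: order_trans)
    then show "u \<in> (\<Union>F\<in>?P. E F)" by blast
  qed
  then have "card {u \<in> monomials_in V. mon_degree u \<le> N \<and> card (keys u) \<le> d} \<le> card (\<Union>F\<in>?P. E F)"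
    by (rule card_mono[rotated]) (use E P in auto)
  also have "\<dots> \<le> (\<Sum>F\<in>?P. card (E F))" by (rule card_UN_le[OF P])
  also have "\<dots> \<le> (\<Sum>F\<in>?P. (N + 1) ^ d)" by (rule sum_mono) (use E in auto)
  also have "\<dots> = card ?P * (N + 1) ^ d" by simp
  also have "card ?P \<le> card (Pow V)" by (rule card_mono) (use assms in auto)
  also have "card (Pow V) = 2 ^ card V" by (rule card_Pow[OF assms])
  finally show ?thesis by simp
qed

text \<open>Pigeonhole: the monomials in the given elements grow like \<open>k ^ l\<close> with \<open>l > d\<close>, the quotient
  only like \<open>k ^ d\<close>.\<close>

lemma algebraic_relation:
  fixes I :: "('v, 'k::field) mpoly set" and f :: "nat \<Rightarrow> ('v, 'k) mpoly"
  assumes V: "finite V" and I: "is_ideal V I"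
    and sparse: "\<And>u. u \<in> monomials_in V \<Longrightarrow> d < card (keys u) \<Longrightarrow> monom_poly u \<in> I"
    and f: "\<And>i. i < l \<Longrightarrow> f i \<in> polys V" and dl: "d < l"
  shows "\<exists>K c. finite K \<and> K \<noteq> {} \<and> (\<forall>\<beta>\<in>K. c \<beta> \<noteq> 0) \<and>
    (\<forall>\<beta>\<in>K. \<forall>\<gamma>\<in>K. (\<forall>j<l. \<beta> j = \<gamma> j) \<longrightarrow> \<beta> = \<gamma>) \<and>
    (\<Sum>\<beta>\<in>K. scalar (c \<beta>) * (\<Prod>j<l. f j ^ \<beta> j)) \<in> I"
proof -
  define \<delta> where "\<delta> = (\<Sum>i<l. \<Sum>u\<in>keys (f i). mon_degree u)"
  have \<delta>: "deg_le (f i) \<delta>" if "i < l" for i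
    unfolding deg_le_def
  proof
    fix u assume "u \<in> keys (f i)"
    then have "mon_degree u \<le> (\<Sum>u\<in>keys (f i). mon_degree u)" by (intro member_le_sum) auto
    also have "\<dots> \<le> \<delta>" unfolding \<delta>_def using that
      by (intro member_le_sum[of i "{..<l}" "\<lambda>i. \<Sum>u\<in>keys (f i). mon_degree u"]) auto
    finally show "mon_degree u \<le> \<delta>" .
  qed
  \<comment> \<open>Chosen to make the count close: with \<open>N = l * (k * \<delta>)\<close> one
    has \<open>N + 1 \<le> (l * \<delta> + 1) * (k + 1)\<close>, so there are at most
    \<open>k * (k + 1) ^ d\<close> sparse monomials of degree up to \<open>N\<close>, fewer than the
    \<open>(k + 1) ^ l\<close> exponent vectors in \<open>A\<close>.\<close>
  define k where "k = 2 ^ card V * (l * \<delta> + 1) ^ d"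
  define A where "A = PiE {..<l} (\<lambda>_. {..k})"
  define N where "N = l * (k * \<delta>)"
  define E where "E = {u \<in> monomials_in V. mon_degree u \<le> N \<and> card (keys u) \<le> d}"
  define F where "F \<beta> = (\<Prod>j<l. f j ^ \<beta> j)" for \<beta>
  have finE: "finite E" using finite_mons_le[OF V, of N] by (rule rev_finite_subset) (auto simp: E_def)
  have finA: "finite A" unfolding A_def by (intro finite_PiE) auto
  have "card E \<le> 2 ^ card V * (N + 1) ^ d" unfolding E_def by (rule card_sparse_mons[OF V])
  also have "\<dots> \<le> 2 ^ card V * ((l * \<delta> + 1) * (k + 1)) ^ d"
    by (intro mult_left_mono power_mono) (auto simp: N_def algebra_simps)
  also have "\<dots> = k * (k + 1) ^ d" by (simp add: k_def power_mult_distrib mult_ac)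
  also have "\<dots> < (k + 1) ^ Suc d" by simp
  also have "\<dots> \<le> (k + 1) ^ l" using dl by (intro power_increasing) auto
  also have "\<dots> = card A" by (simp add: A_def card_PiE Suc_eq_plus1)
  finally obtain c where c: "\<exists>\<beta>\<in>A. c \<beta> \<noteq> 0" "\<forall>e\<in>E. (\<Sum>\<beta>\<in>A. c \<beta> * lookup (F \<beta>) e) = 0"
    using linear_relation[OF finE finA, of "\<lambda>\<beta>. lookup (F \<beta>)"] by blast
  have FV: "F \<beta> \<in> polys V" for \<beta> unfolding F_def by (intro polys_intros f) auto
  have Fd: "deg_le (F \<beta>) N" if "\<beta> \<in> A" for \<beta>
  proof -
    have "deg_le (F \<beta>) (\<Sum>j<l. \<beta> j * \<delta>)" unfolding F_def by (intro deg_le_prod deg_le_power \<delta>) auto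
    moreover have "(\<Sum>j<l. \<beta> j * \<delta>) \<le> (\<Sum>j<l. k * \<delta>)"
      using that by (intro sum_mono mult_right_mono) (auto simp: A_def)
    ultimately show ?thesis unfolding N_def by (simp add: deg_le_mono)
  qed
  define K where "K = {\<beta> \<in> A. c \<beta> \<noteq> 0}"
  define p where "p = (\<Sum>\<beta>\<in>K. scalar (c \<beta>) * F \<beta>)"
  have p: "p = (\<Sum>\<beta>\<in>A. scalar (c \<beta>) * F \<beta>)"
    unfolding p_def K_def by (rule sum.mono_neutral_left) (use finA in auto)
  have "monom_poly u \<in> I" if u: "u \<in> keys p" for u
  proof -
    have "u \<in> (\<Union>\<beta>\<in>A. keys (scalar (c \<beta>) * F \<beta>))" using u keys_sum[of "\<lambda>\<beta>. scalar (c \<beta>) * F \<beta>" A] p by auto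
    then obtain \<beta> where "\<beta> \<in> A" "u \<in> keys (F \<beta>)" by (auto simp: in_keys_iff)
    then have uV: "u \<in> monomials_in V" and "mon_degree u \<le> N"
      using FV[of \<beta>] Fd by (auto simp: polys_def deg_le_def)
    moreover have "lookup p e = 0" if "e \<in> E" for e using c(2) that by (simp add: p lookup_sum)
    ultimately have "\<not> card (keys u) \<le> d" using u by (auto simp: E_def in_keys_iff)
    with sparse[OF uV] show ?thesis by simp
  qed
  then have "p \<in> I"
    by (subst mpoly_expand) (auto intro!: is_ideal_sum[OF I] is_ideal_mult[OF I])
  moreover have "\<beta> = \<gamma>" if "\<beta> \<in> K" "\<gamma> \<in> K" "\<forall>j<l. \<beta> j = \<gamma> j" for \<beta> \<gamma>
  proof
    fix j show "\<beta> j = \<gamma> j" using that by (cases "j < l") (auto simp: K_def A_def PiE_def extensional_def)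
  qed
  ultimately show ?thesis
    using c(1) finA by (intro exI[of _ K] exI[of _ c]) (auto simp: K_def p_def F_def)
qed

text \<open>The common source of the bounds on dimension and depth. A strict step of primes and a
  member of a regular sequence both give an element of the next ideal that is a nonzerodivisor
  modulo the current one. If \<open>l\<close> exceeded \<open>d\<close>, a relation between these
  elements inside \<open>I\<close> would force \<open>1 \<in> p l\<close> by
  \<open>lowest_term\<close>.\<close>

lemma chain_length_le:
  fixes p :: "nat \<Rightarrow> ('v, 'k::field) mpoly set" and f :: "nat \<Rightarrow> ('v, 'k) mpoly"
  assumes V: "finite V" and I: "is_ideal V I"
    and sparse: "\<And>u. u \<in> monomials_in V \<Longrightarrow> d < card (keys u) \<Longrightarrow> monom_poly u \<in> I"
    and ideal: "\<And>i. i \<le> l \<Longrightarrow> is_ideal V (p i)" and mono: "\<And>i. i < l \<Longrightarrow> p i \<subseteq> p (Suc i)"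
    and f: "\<And>i. i < l \<Longrightarrow> f i \<in> p (Suc i)"
    and nzd: "\<And>i x. i < l \<Longrightarrow> x \<in> polys V \<Longrightarrow> f i * x \<in> p i \<Longrightarrow> x \<in> p i"
    and "I \<subseteq> p 0" "1 \<notin> p l"
  shows "l \<le> d"
proof (rule ccontr)
  assume "\<not> l \<le> d"
  have fV: "f i \<in> polys V" if "i < l" for i
    using f[OF that] is_ideal_polys[OF ideal[of "Suc i"]] that by simp
  from \<open>\<not> l \<le> d\<close> have "d < l" by simp
  with algebraic_relation[OF V I sparse, where d = d and f = f and l = l] fV
  have "\<exists>K c. finite K \<and> K \<noteq> {} \<and> (\<forall>\<beta>\<in>K. c \<beta> \<noteq> 0) \<and>
    (\<forall>\<beta>\<in>K. \<forall>\<gamma>\<in>K. (\<forall>j<l. \<beta> j = \<gamma> j) \<longrightarrow> \<beta> = \<gamma>) \<and>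
    (\<Sum>\<beta>\<in>K. scalar (c \<beta>) * (\<Prod>j<l. f j ^ \<beta> j)) \<in> I" by simp
  then obtain K c where K: "finite K" "K \<noteq> {}" "\<forall>\<beta>\<in>K. c \<beta> \<noteq> 0"
    "\<forall>\<beta>\<in>K. \<forall>\<gamma>\<in>K. (\<forall>j<l. \<beta> j = \<gamma> j) \<longrightarrow> \<beta> = \<gamma>"
    "(\<Sum>\<beta>\<in>K. scalar (c \<beta>) * (\<Prod>j<l. f j ^ \<beta> j)) \<in> I" by (elim exE conjE)
  have "1 \<in> p l"
    by (rule lowest_term[of l V p f K c 0])
      (use ideal mono f fV nzd K \<open>I \<subseteq> p 0\<close> in \<open>auto simp: lessThan_atLeast0\<close>)
  with \<open>1 \<notin> p l\<close> show False by simp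
qed

lemma prime_chain_le:
  fixes I :: "('v, 'k::field) mpoly set"
  assumes "finite V" "is_ideal V I"
    and sparse: "\<And>u. u \<in> monomials_in V \<Longrightarrow> d < card (keys u) \<Longrightarrow> monom_poly u \<in> I"
    and "prime_chain V I l"
  shows "l \<le> d"
proof -
  obtain P where P: "\<And>i. i \<le> l \<Longrightarrow> prime_ideal V (P i)" "\<And>i. i \<le> l \<Longrightarrow> I \<subseteq> P i"
    "\<And>i. i < l \<Longrightarrow> P i \<subset> P (Suc i)"
    using assms(4) unfolding prime_chain_def by blast
  have "\<exists>x. x \<in> P (Suc i) \<and> x \<notin> P i" if "i < l" for i using P(3)[OF that] by blast
  then obtain f where f: "\<And>i. i < l \<Longrightarrow> f i \<in> P (Suc i)" "\<And>i. i < l \<Longrightarrow> f i \<notin> P i" by metis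
  have fV: "f i \<in> polys V" if "i < l" for i
    using f(1)[OF that] P(1)[of "Suc i"] that is_ideal_polys by (auto simp: prime_ideal_def)
  show ?thesis
  proof (rule chain_length_le[OF assms(1,2) sparse, where p = P and f = f])
    fix i x assume "i < l" "x \<in> polys V" "f i * x \<in> P i"
    then show "x \<in> P i" using P(1)[of i] f(2)[of i] fV[of i] unfolding prime_ideal_def by auto
  next
    show "P i \<subseteq> P (Suc i)" if "i < l" for i using P(3)[OF that] by (rule psubset_imp_subset)
  qed (use P f in \<open>auto simp: prime_ideal_def\<close>)
qed

lemma krull_dim_le:
  fixes I :: "('v, 'k::field) mpoly set"
  assumes "finite V" "is_ideal V I"
    and "\<And>u. u \<in> monomials_in V \<Longrightarrow> d < card (keys u) \<Longrightarrow> monom_poly u \<in> I"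
  shows "krull_dim (mpoly_ring V Quot I) \<le> enat d"
  unfolding krull_dim_Quot[OF assms(2)]
  by (rule Sup_least) (use prime_chain_le[OF assms] in auto)

lemma irrelevant_iff: "f \<in> irrelevant_ideal V \<longleftrightarrow> f \<in> polys V \<and> lookup f 0 = 0"
  by (simp add: irrelevant_ideal_def)

lemma graded_depth_le:
  fixes I :: "('v, 'k::field) mpoly set"
  assumes "finite V" "is_ideal V I"
    and sparse: "\<And>u. u \<in> monomials_in V \<Longrightarrow> d < card (keys u) \<Longrightarrow> monom_poly u \<in> I"
  shows "graded_depth V I \<le> enat d"
  unfolding graded_depth_def
proof (rule Sup_least)
  fix x assume "x \<in> {enat (length fs) | fs. regular_sequence (mpoly_ring V Quot I) fs \<and>
     set fs \<subseteq> coset V I ` irrelevant_ideal V}"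
  then obtain fs where x: "x = enat (length fs)" and reg: "regular_sequence (mpoly_ring V Quot I) fs"
    and "set fs \<subseteq> coset V I ` irrelevant_ideal V" by blast
  then have "\<forall>f\<in>set fs. \<exists>g. g \<in> polys V \<and> f = coset V I g" unfolding irrelevant_ideal_def by fastforce
  then obtain g where g: "\<And>f. f \<in> set fs \<Longrightarrow> g f \<in> polys V \<and> f = coset V I (g f)" by metis
  define gs where "gs = map g fs"
  have fs: "fs = map (coset V I) gs" unfolding gs_def using g by (simp add: map_idI)
  have gsV: "set gs \<subseteq> polys V" using g by (auto simp: gs_def)
  have R: "\<And>i x. i < length gs \<Longrightarrow> x \<in> polys V \<Longrightarrow> gs ! i * x \<in> gen_ideal V (I \<union> set (take i gs)) \<Longrightarrow>
        x \<in> gen_ideal V (I \<union> set (take i gs))" "1 \<notin> gen_ideal V (I \<union> set gs)"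
    using reg regular_sequence_Quot[OF assms(2) gsV] fs by auto
  have sub: "I \<union> set (take i gs) \<subseteq> polys V" for i
    using gsV set_take_subset[of i gs] is_ideal_polys[OF assms(2)] by blast
  have "length gs \<le> d"
  proof (rule chain_length_le[OF assms(1,2) sparse, where p = "\<lambda>i. gen_ideal V (I \<union> set (take i gs))" and f = "\<lambda>i. gs ! i"])
    show "is_ideal V (gen_ideal V (I \<union> set (take i gs)))" for i by (rule is_ideal_gen[OF sub])
    show "gen_ideal V (I \<union> set (take i gs)) \<subseteq> gen_ideal V (I \<union> set (take (Suc i) gs))" for i
      by (rule gen_ideal_mono'[OF sub]) (use set_take_subset_set_take[of i "Suc i" gs] in auto)
    show "gs ! i \<in> gen_ideal V (I \<union> set (take (Suc i) gs))" if "i < length gs" for i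
      by (rule gen_idealI[OF sub]) (use that in \<open>auto simp: take_Suc_conv_app_nth\<close>)
    show "I \<subseteq> gen_ideal V (I \<union> set (take 0 gs))" using gen_ideal_superset[OF sub[of 0]] by simp
  qed (use R in auto)
  then show "x \<le> enat d" by (simp add: x gs_def)
qed

section \<open>Monomial orders and monomial ideals\<close>

lemma lookup_times:
  fixes p q :: "('v, 'k::comm_ring_1) mpoly"
  shows "lookup (p * q) x = (\<Sum>u\<in>keys p. \<Sum>w\<in>keys q. if x = u + w then lookup p u * lookup q w else 0)"
proof -
  have "p * q = (\<Sum>u\<in>keys p. \<Sum>w\<in>keys q. single u (lookup p u) * single w (lookup q w))"
    by (metis (no_types) sum_product sum_single)
  also have "lookup \<dots> x = (\<Sum>u\<in>keys p. \<Sum>w\<in>keys q. if x = u + w then lookup p u * lookup q w else 0)"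
    unfolding lookup_sum by (intro sum.cong refl) (auto simp: mult_single lookup_single)
  finally show ?thesis .
qed

lemma gen_monomial_ideal:
  fixes M :: "'v monomial set"
  assumes "M \<subseteq> monomials_in V"
  shows "gen_ideal V (monom_poly ` M :: ('v, 'k::comm_ring_1) mpoly set) =
    {f \<in> polys V. \<forall>u\<in>keys f. \<exists>w\<in>M. \<exists>x\<in>monomials_in V. u = x + w}" (is "?G = ?R")
proof (rule gen_ideal_eqI)
  show "is_ideal V ?R"
  proof (rule is_idealI)
    fix x y assume "x \<in> ?R" "y \<in> ?R"
    then show "x + y \<in> ?R" using keys_add[of x y] by (auto simp: polys_add)
  next
    fix a x :: "('v, 'k) mpoly" assume a: "a \<in> polys V" and x: "x \<in> ?R"
    show "a * x \<in> ?R"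
    proof (intro CollectI conjI ballI)
      show "a * x \<in> polys V" using a x by (simp add: polys_mult)
      fix u assume "u \<in> keys (a * x)"
      then obtain b c where bc: "u = b + c" "b \<in> keys a" "c \<in> keys x" using keys_mult[of a x] by blast
      then obtain w y where w: "w \<in> M" "y \<in> monomials_in V" "c = y + w" using x by blast
      have "b + y \<in> monomials_in V" using bc a w by (auto simp: polys_def intro: monomials_in_add)
      moreover have "u = (b + y) + w" using bc w by (simp add: add.assoc)
      ultimately show "\<exists>w\<in>M. \<exists>x\<in>monomials_in V. u = x + w" using w(1) by blast
    qed
  qed auto
  show "monom_poly ` M \<subseteq> ?R"
  proof (rule image_subsetI)
    fix w assume "w \<in> M"
    moreover have "w = 0 + w" "0 \<in> monomials_in V" by (simp_all add: monomials_in_zero)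
    ultimately have "\<exists>w'\<in>M. \<exists>x\<in>monomials_in V. w = x + w'" by blast
    with \<open>w \<in> M\<close> show "monom_poly w \<in> ?R" using assms by auto
  qed
  have sub: "monom_poly ` M \<subseteq> (polys V :: ('v, 'k) mpoly set)" using assms by auto
  note G = is_ideal_gen[OF sub]
  show "?R \<subseteq> ?G"
  proof
    fix f assume f: "f \<in> ?R"
    have "monom_poly u \<in> ?G" if "u \<in> keys f" for u
    proof -
      from f that obtain w x where wx: "w \<in> M" "x \<in> monomials_in V" "u = x + w" by blast
      then have "(monom_poly w :: ('v, 'k) mpoly) \<in> ?G" by (intro gen_idealI[OF sub]) blast
      with wx show ?thesis by (simp add: monom_poly_add is_ideal_mult[OF G])
    qed
    then show "f \<in> ?G"
      by (subst mpoly_expand) (auto intro!: is_ideal_sum[OF G] is_ideal_mult[OF G])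
  qed
qed

locale mon_order =
  fixes V :: "'v set" and r :: "('v monomial \<times> 'v monomial) set"
  assumes order: "monomial_order V r"
begin

abbreviation le :: "'v monomial \<Rightarrow> 'v monomial \<Rightarrow> bool" (infix "\<preceq>" 50) where
  "u \<preceq> w \<equiv> (u, w) \<in> r"

lemma lin: "linear_order_on (monomials_in V) r"
  using order by (simp add: monomial_order_def)

lemma le_refl: "u \<in> monomials_in V \<Longrightarrow> u \<preceq> u"
  using lin by (auto simp: linear_order_on_def partial_order_on_def preorder_on_def refl_on_def)

lemma le_trans: "u \<preceq> w \<Longrightarrow> w \<preceq> x \<Longrightarrow> u \<preceq> x"
  using lin by (auto simp: linear_order_on_def partial_order_on_def preorder_on_def dest: transD)

lemma le_antisym: "u \<preceq> w \<Longrightarrow> w \<preceq> u \<Longrightarrow> u = w"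
  using lin by (auto simp: linear_order_on_def partial_order_on_def dest: antisymD)

lemma le_total: "u \<in> monomials_in V \<Longrightarrow> w \<in> monomials_in V \<Longrightarrow> u \<preceq> w \<or> w \<preceq> u"
  using lin le_refl by (cases "u = w") (auto simp: linear_order_on_def total_on_def)

lemma le_in: "u \<preceq> w \<Longrightarrow> u \<in> monomials_in V \<and> w \<in> monomials_in V"
  using lin by (auto simp: linear_order_on_def partial_order_on_def preorder_on_def)

lemma le_add_right: "u \<preceq> w \<Longrightarrow> x \<in> monomials_in V \<Longrightarrow> u + x \<preceq> w + x"
  using order by (auto simp: monomial_order_def)

lemma le_add: "u \<preceq> w \<Longrightarrow> x \<preceq> y \<Longrightarrow> u + x \<preceq> w + y"
  using le_add_right[of u w x] le_add_right[of x y w] le_in[of u w] le_in[of x y]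
  by (metis add.commute le_trans)

text \<open>A product of two monomials reaches the product of their bounds only if both factors do.
  This is what makes leading coefficients multiplicative in \<open>below_mult\<close>.\<close>

lemma le_add_eq: "u \<preceq> w \<Longrightarrow> x \<preceq> y \<Longrightarrow> u + x = w + y \<Longrightarrow> u = w \<and> x = y"
proof -
  assume a: "u \<preceq> w" "x \<preceq> y" "u + x = w + y"
  have "u + x \<preceq> w + x" "w + x \<preceq> w + y"
    using le_add_right[OF a(1), of x] le_add_right[OF a(2), of w] le_in[OF a(1)] le_in[OF a(2)]
    by (auto simp: add.commute)
  with a(3) have "u + x = w + x" by (metis le_antisym)
  with a(3) show ?thesis by simp
qed

lemma finite_max:
  assumes "finite A" "A \<noteq> {}" "A \<subseteq> monomials_in V"
  shows "\<exists>w\<in>A. \<forall>u\<in>A. u \<preceq> w"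
  using assms
proof (induction rule: finite_ne_induct)
  case (singleton x)
  then show ?case by (auto intro: le_refl)
next
  case (insert x F)
  then obtain w where w: "w \<in> F" "\<forall>u\<in>F. u \<preceq> w" by auto
  consider "x \<preceq> w" | "w \<preceq> x" using le_total[of x w] insert.prems w by blast
  then show ?case
  proof cases
    case 1
    with w show ?thesis by auto
  next
    case 2
    with w insert.prems show ?thesis by (intro bexI[of _ x]) (auto intro: le_trans le_refl)
  qed
qed

lemma initial_monomialI:
  "w \<in> keys p \<Longrightarrow> (\<And>u. u \<in> keys p \<Longrightarrow> u \<preceq> w) \<Longrightarrow> initial_monomial r p = w"
  unfolding initial_monomial_def by (rule the_equality) (auto intro: le_antisym)

lemma initial_monomial:
  fixes p :: "('v, 'k::comm_ring_1) mpoly"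
  assumes "p \<in> polys V" "p \<noteq> 0"
  shows "initial_monomial r p \<in> keys p" "\<And>u. u \<in> keys p \<Longrightarrow> u \<preceq> initial_monomial r p"
proof -
  obtain w where w: "w \<in> keys p" "\<forall>u\<in>keys p. u \<preceq> w"
    using finite_max[of "keys p"] assms by (auto simp: polys_def)
  then have "initial_monomial r p = w" by (intro initial_monomialI) auto
  with w show "initial_monomial r p \<in> keys p" "\<And>u. u \<in> keys p \<Longrightarrow> u \<preceq> initial_monomial r p" by auto
qed

text \<open>Only a bound: the coefficient at \<open>a\<close> itself may be zero. This matters for
  \<open>low_rank\<close>, whose two summands have cancelling leading terms inside the box.\<close>

definition below :: "'v monomial \<Rightarrow> ('v, 'k::comm_ring_1) mpoly \<Rightarrow> bool" where
  "below a p \<longleftrightarrow> a \<in> monomials_in V \<and> (\<forall>u\<in>keys p. u \<preceq> a)"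

lemma below_mult:
  assumes "below a p" "below b q"
  shows "below (a + b) (p * q)" "lookup (p * q) (a + b) = lookup p a * lookup q b"
proof -
  show "below (a + b) (p * q)"
    using assms keys_mult[of p q] monomials_in_add by (fastforce simp: below_def intro: le_add)
  have "lookup (p * q) (a + b) =
    (\<Sum>u\<in>keys p. \<Sum>w\<in>keys q. if u = a then if w = b then lookup p u * lookup q w else 0 else 0)"
    unfolding lookup_times
  proof (intro sum.cong refl)
    fix u w assume "u \<in> keys p" "w \<in> keys q"
    then have "a + b = u + w \<longleftrightarrow> u = a \<and> w = b"
      using le_add_eq[of u a w b] assms by (auto simp: below_def)
    then show "(if a + b = u + w then lookup p u * lookup q w else 0) =
      (if u = a then if w = b then lookup p u * lookup q w else 0 else 0)" by simp
  qed
  also have "\<dots> = (\<Sum>u\<in>keys p. if u = a then \<Sum>w\<in>keys q. if w = b then lookup p u * lookup q w else 0 else 0)"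
    by (intro sum.cong) auto
  also have "\<dots> = lookup p a * lookup q b" by (auto simp: in_keys_iff)
  finally show "lookup (p * q) (a + b) = lookup p a * lookup q b" .
qed

lemma below_1: "below 0 1"
  using le_refl[of 0] by (simp add: below_def monomials_in_zero)

lemma below_indet: "v \<in> V \<Longrightarrow> below (single v 1) (indet v)"
  using le_refl[of "single v 1"] by (simp add: below_def indet_def monomials_in_def)

lemma below_minus: "below a p \<Longrightarrow> below a q \<Longrightarrow> below a (p - q)"
  using keys_diff[of p q] by (auto simp: below_def)

definition init_mons :: "('v, 'k::field) mpoly set \<Rightarrow> 'v monomial set" where
  "init_mons I = {initial_monomial r f | f. f \<in> I \<and> f \<noteq> 0}"

lemma init_mons_in: "I \<subseteq> polys V \<Longrightarrow> init_mons I \<subseteq> monomials_in V"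
proof
  fix x assume I: "I \<subseteq> polys V" and "x \<in> init_mons I"
  then obtain f where "f \<in> I" "f \<noteq> 0" "x = initial_monomial r f" by (auto simp: init_mons_def)
  with I initial_monomial(1)[of f] show "x \<in> monomials_in V" by (auto simp: polys_def)
qed

lemma initial_ideal_eq:
  fixes I :: "('v, 'k::field) mpoly set"
  shows "I \<subseteq> polys V \<Longrightarrow> initial_ideal V r I =
    {f \<in> polys V. \<forall>u\<in>keys f. \<exists>w\<in>init_mons I. \<exists>x\<in>monomials_in V. u = x + w}"
proof -
  have "{monom_poly (initial_monomial r f) | f. f \<in> I \<and> f \<noteq> 0} = (monom_poly ` init_mons I :: ('v, 'k) mpoly set)"
    by (auto simp: init_mons_def)
  then show "I \<subseteq> polys V \<Longrightarrow> ?thesis"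
    unfolding initial_ideal_def using gen_monomial_ideal[OF init_mons_in, of I] by simp
qed

lemma init_mons_monom_poly:
  fixes I :: "('v, 'k::field) mpoly set"
  shows "I \<subseteq> polys V \<Longrightarrow> u \<in> init_mons I \<Longrightarrow> x \<in> monomials_in V \<Longrightarrow> monom_poly (x + u) \<in> initial_ideal V r I"
  using init_mons_in[of I] by (auto simp: initial_ideal_eq intro: monomials_in_add)

lemma is_ideal_initial: "I \<subseteq> polys V \<Longrightarrow> is_ideal V (initial_ideal V r (I :: ('v, 'k::field) mpoly set))"
  unfolding initial_ideal_def by (rule is_ideal_gen) (use init_mons_in[of I] in \<open>auto simp: init_mons_def\<close>)

end

section \<open>Minors of the generic matrix\<close>

text \<open>Rows and columns of a minor are selected by increasing functions rather than by sets, so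
  that its main diagonal consists of the positions \<open>(f k, g k)\<close>. The function
  \<open>pick\<close> translates the index sets of \<open>minors\<close> into this form.\<close>

definition incr :: "nat \<Rightarrow> nat \<Rightarrow> (nat \<Rightarrow> nat) \<Rightarrow> bool" where
  "incr s N f \<longleftrightarrow> (\<forall>i<s. f i < N) \<and> (\<forall>i j. i < j \<longrightarrow> j < s \<longrightarrow> f i < f j)"

definition minor_of :: "nat \<Rightarrow> (nat \<Rightarrow> nat) \<Rightarrow> (nat \<Rightarrow> nat) \<Rightarrow> (nat \<times> nat, 'k::comm_ring_1) mpoly" where
  "minor_of s f g = det (mat s s (\<lambda>(p, q). indet (f p, g q)))"

definition diag_mon :: "nat \<Rightarrow> (nat \<Rightarrow> nat) \<Rightarrow> (nat \<Rightarrow> nat) \<Rightarrow> (nat \<times> nat) monomial" where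
  "diag_mon s f g = (\<Sum>k<s. single (f k, g k) 1)"

lemma incr_inj: "incr s N f \<Longrightarrow> i < s \<Longrightarrow> j < s \<Longrightarrow> f i = f j \<Longrightarrow> i = j"
  unfolding incr_def by (metis less_irrefl linorder_neqE_nat)

lemma incr_inj_on: "incr s N f \<Longrightarrow> inj_on f {..<s}"
  by (rule inj_onI) (auto dest: incr_inj)

lemma incr_pick:
  assumes "A \<subseteq> {..<N}" "card A = s"
  shows "incr s N (pick A)" "pick A ` {..<s} = A"
proof -
  have fin: "finite A" using assms(1) finite_subset by blast
  show i: "incr s N (pick A)"
    unfolding incr_def
  proof (intro conjI allI impI)
    show "pick A i < N" if "i < s" for i using pick_in_set_le[of i A] that assms by blast
    show "pick A i < pick A j" if "i < j" "j < s" for i j using pick_mono_le[of j A i] that assms by simp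
  qed
  have "pick A ` {..<s} \<subseteq> A" using assms(2) pick_in_set_le[of _ A] by auto
  moreover have "card (pick A ` {..<s}) = card A" using card_image[OF incr_inj_on[OF i]] assms(2) by simp
  ultimately show "pick A ` {..<s} = A" by (intro card_subset_eq[OF fin])
qed

lemma pick_incr:
  assumes "incr s N f" "p < s"
  shows "pick (f ` {..<s}) p = f p"
proof -
  have mono: "f a < f b \<longleftrightarrow> a < b" if "a < s" "b < s" for a b
  proof -
    have lt: "f i < f j" if "i < j" "j < s" for i j using assms(1) that by (simp add: incr_def)
    show ?thesis
      using lt[of a b] lt[of b a] that by (cases a b rule: linorder_cases) auto
  qed
  have "{a \<in> f ` {..<s}. a < f p} = f ` {..<p}"
  proof (intro equalityI subsetI)
    fix x assume "x \<in> {a \<in> f ` {..<s}. a < f p}"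
    then obtain i where "x = f i" "i < s" "f i < f p" by blast
    then show "x \<in> f ` {..<p}" using mono[of i p] assms(2) by blast
  next
    fix x assume "x \<in> f ` {..<p}"
    then obtain i where "x = f i" "i < p" by blast
    moreover from this have "i < s" using assms(2) by simp
    ultimately show "x \<in> {a \<in> f ` {..<s}. a < f p}" using mono[of i p] assms(2) by blast
  qed
  moreover have "inj_on f {..<p}"
    by (rule inj_on_subset[OF incr_inj_on[OF assms(1)]]) (use assms(2) in simp)
  ultimately have "card {a \<in> f ` {..<s}. a < f p} = p" by (simp only: card_image card_lessThan)
  with pick_card_in_set[of "f p" "f ` {..<s}"] assms(2) show ?thesis by simp
qed

lemma incr_minor_index:
  assumes "incr s m f" "incr s n g"
  shows "minor_index (generic_matrix m n) s (f ` {..<s}) (g ` {..<s})"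
  using assms incr_inj_on[OF assms(1)] incr_inj_on[OF assms(2)]
  by (auto simp: minor_index_def generic_matrix_def card_image incr_def)

lemma submatrix_generic:
  assumes "minor_index (generic_matrix m n :: (nat \<times> nat, 'k::field) mpoly mat) s A B"
  shows "submatrix (generic_matrix m n :: (nat \<times> nat, 'k) mpoly mat) A B = mat s s (\<lambda>(p, q). indet (pick A p, pick B q))"
    and "incr s m (pick A)" "incr s n (pick B)"
proof -
  have AB: "A \<subseteq> {..<m}" "B \<subseteq> {..<n}" "card A = s" "card B = s"
    using assms by (auto simp: minor_index_def generic_matrix_def)
  then show *: "incr s m (pick A)" "incr s n (pick B)" using incr_pick by auto
  have "{i. i < m \<and> i \<in> A} = A" "{i. i < n \<and> i \<in> B} = B" using AB by auto
  then show "submatrix (generic_matrix m n :: (nat \<times> nat, 'k) mpoly mat) A B = mat s s (\<lambda>(p, q). indet (pick A p, pick B q))"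
    using * AB unfolding submatrix_def generic_matrix_def by (intro eq_matI) (auto simp: incr_def)
qed

lemma minors_eq:
  "minors (generic_matrix m n :: (nat \<times> nat, 'k::field) mpoly mat) s = {minor_of s f g | f g. incr s m f \<and> incr s n g}"
proof (intro equalityI subsetI)
  fix x assume "x \<in> minors (generic_matrix m n :: (nat \<times> nat, 'k) mpoly mat) s"
  then obtain A B where x: "x = det (submatrix (generic_matrix m n) A B)"
    and mi: "minor_index (generic_matrix m n :: (nat \<times> nat, 'k) mpoly mat) s A B" by (auto simp: minors_def)
  have "x = minor_of s (pick A) (pick B)" unfolding x submatrix_generic(1)[OF mi] minor_of_def ..
  with submatrix_generic(2,3)[OF mi] show "x \<in> {minor_of s f g | f g. incr s m f \<and> incr s n g}" by blast
next
  fix x :: "(nat \<times> nat, 'k) mpoly" assume "x \<in> {minor_of s f g | f g. incr s m f \<and> incr s n g}"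
  then obtain f g where x: "x = minor_of s f g" and fg: "incr s m f" "incr s n g" by blast
  note mi = incr_minor_index[OF fg]
  have eq: "mat s s (\<lambda>(p, q). indet (pick (f ` {..<s}) p, pick (g ` {..<s}) q)) =
    (mat s s (\<lambda>(p, q). indet (f p, g q)) :: (nat \<times> nat, 'k) mpoly mat)"
    by (intro eq_matI) (auto simp: pick_incr[OF fg(1)] pick_incr[OF fg(2)])
  have "x = det (submatrix (generic_matrix m n) (f ` {..<s}) (g ` {..<s}))"
    unfolding x submatrix_generic(1)[OF mi] eq minor_of_def ..
  with mi show "x \<in> minors (generic_matrix m n) s" by (auto simp: minors_def)
qed

lemma signof_cases: "signof p = (1 :: 'a::comm_ring_1) \<or> signof p = (-1 :: 'a)"
  by (auto simp: sign_def)

lemma minor_of_expand: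
  "minor_of s f g = (\<Sum>p | p permutes {0..<s}. signof p * monom_poly (\<Sum>i<s. single (f i, g (p i)) 1))"
  unfolding minor_of_def
  by (subst det_def'[where n = s])
    (auto simp: monom_poly_sum indet_def permutes_in_image lessThan_atLeast0 intro!: sum.cong prod.cong arg_cong2[where f = "(*)"])

text \<open>Rows and columns are distinct, so a permutation producing the diagonal monomial must fix
  every index; only the identity contributes.\<close>

lemma lookup_diag_minor:
  assumes "incr s m f" "incr s n g"
  shows "lookup (minor_of s f g :: (nat \<times> nat, 'k::comm_ring_1) mpoly) (diag_mon s f g) = 1"
proof -
  let ?T = "\<lambda>p. signof p * monom_poly (\<Sum>i<s. single (f i, g (p i)) 1) :: (nat \<times> nat, 'k) mpoly"
  let ?P = "{p. p permutes {0..<s}}"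
  have z: "lookup (?T p) (diag_mon s f g) = 0" if p: "p \<in> ?P - {id}" for p
  proof -
    have "(\<Sum>i<s. single (f i, g (p i)) 1) \<noteq> diag_mon s f g"
    proof
      assume eq: "(\<Sum>i<s. single (f i, g (p i)) 1) = diag_mon s f g"
      have "p i = i" if i: "i < s" for i
      proof -
        have "lookup (\<Sum>i<s. single (f i, g (p i)) (1::nat)) (f i, g (p i)) \<ge> 1"
          unfolding lookup_sum using i
          by (intro order_trans[OF _ member_le_sum[of i]]) auto
        then have "lookup (diag_mon s f g) (f i, g (p i)) \<noteq> 0" using eq by simp
        then obtain k where k: "k < s" "f k = f i" "g k = g (p i)"
          by (auto simp: diag_mon_def lookup_sum lookup_single when_def split: if_splits)
        have pi: "p i < s" using p i permutes_in_image[of p "{0..<s}" i] by auto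
        from k incr_inj[OF assms(1)] i have "k = i" by blast
        with k incr_inj[OF assms(2)] i pi show "p i = i" by metis
      qed
      then have "p = id" using p by (intro ext) (metis DiffD1 atLeastLessThan_iff id_apply le0 mem_Collect_eq permutes_def)
      with p show False by simp
    qed
    then show ?thesis using signof_cases[of p, where 'a = "(nat \<times> nat, 'k) mpoly"] by (auto simp: lookup_monom_poly)
  qed
  have fin: "finite ?P" by (rule finite_permutations) simp
  have "lookup (minor_of s f g :: (nat \<times> nat, 'k) mpoly) (diag_mon s f g) = (\<Sum>p\<in>?P. lookup (?T p) (diag_mon s f g))"
    by (simp add: minor_of_expand lookup_sum)
  also have "\<dots> = lookup (?T id) (diag_mon s f g)"
    using fin z by (subst sum.remove[of ?P id]) (auto simp: permutes_id)
  also have "\<dots> = 1" by (simp add: diag_mon_def lookup_monom_poly)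
  finally show ?thesis .
qed

lemma diag_mon_in: "(\<And>i. i < s \<Longrightarrow> (f i, g i) \<in> V) \<Longrightarrow> diag_mon s f g \<in> monomials_in V"
  unfolding diag_mon_def by (induction s) (auto simp: monomials_in_zero intro!: monomials_in_add, auto simp: monomials_in_def)

lemma mon_degree_diag [simp]: "mon_degree (diag_mon s f g) = s"
  by (simp add: diag_mon_def mon_degree_sum)

lemma keys_diag_mon: "keys (diag_mon s f g) = (\<lambda>k. (f k, g k)) ` {..<s}"
  unfolding diag_mon_def by (induction s) (auto simp: keys_add_nat lessThan_Suc)

lemma minor_of_homog:
  assumes "\<And>i j. i < s \<Longrightarrow> j < s \<Longrightarrow> (f i, g j) \<in> V"
  shows "(minor_of s f g :: (nat \<times> nat, 'k::comm_ring_1) mpoly) \<in> homog_part V s"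
  unfolding minor_of_expand
proof (rule homog_sum)
  fix p assume p: "p \<in> {p. p permutes {0..<s}}"
  have "p i < s" if "i < s" for i using p that permutes_in_image[of p "{0..<s}" i] by auto
  then have "monom_poly (diag_mon s f (\<lambda>i. g (p i))) \<in> homog_part V s"
    using assms by (simp add: diag_mon_in)
  then have h: "(monom_poly (\<Sum>i<s. single (f i, g (p i)) 1) :: (nat \<times> nat, 'k) mpoly) \<in> homog_part V s"
    by (simp only: diag_mon_def)
  from signof_cases[of p, where 'a = "(nat \<times> nat, 'k) mpoly"]
  show "signof p * (monom_poly (\<Sum>i<s. single (f i, g (p i)) 1) :: (nat \<times> nat, 'k) mpoly) \<in> homog_part V s"
  proof
    assume "signof p = (- 1 :: (nat \<times> nat, 'k) mpoly)"
    with homog_uminus[OF h] show ?thesis by (simp only: mult_minus1)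
  qed (use h in \<open>simp only: mult_1\<close>)
qed

lemma subst_minor_of: "subst \<rho> (minor_of s f g) = det (mat s s (\<lambda>(p, q). \<rho> (f p, g q)))"
proof -
  interpret h: comm_ring_hom "subst \<rho>" by (rule comm_ring_hom_subst)
  have "map_mat (subst \<rho>) (mat s s (\<lambda>(p, q). indet (f p, g q))) = mat s s (\<lambda>(p, q). \<rho> (f p, g q))"
    by (intro eq_matI) auto
  then show ?thesis unfolding minor_of_def by (simp flip: h.hom_det)
qed

text \<open>The matrix factors through dimension \<open>s - 1\<close>. Padding the factors by a zero
  column and a zero row makes both square, and the second then has determinant zero.\<close>

lemma det_low_rank:
  fixes L Y :: "nat \<Rightarrow> nat \<Rightarrow> 'a::comm_ring_1"
  assumes M: "\<And>p q. p < s \<Longrightarrow> q < s \<Longrightarrow> M (p, q) = (\<Sum>k<s - 1. L p k * Y k q)" and "0 < s"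
  shows "det (mat s s M) = 0"
proof -
  define A where "A = mat s s (\<lambda>(p, k). if k < s - 1 then L p k else 0)"
  define B where "B = mat s s (\<lambda>(k, q). if k < s - 1 then Y k q else 0)"
  have AB: "A \<in> carrier_mat s s" "B \<in> carrier_mat s s" by (auto simp: A_def B_def)
  have "{0..<s} = insert (s - 1) {..<s - 1}" using \<open>0 < s\<close> by auto
  then have "mat s s M = A * B"
    by (intro eq_matI) (auto simp: A_def B_def scalar_prod_def M)
  moreover have "det B = 0"
    using laplace_expansion_row[OF AB(2), of "s - 1"] \<open>0 < s\<close> by (simp add: B_def)
  ultimately show ?thesis using det_mult[OF AB] by simp
qed

lemma det_submatrix_incr:
  assumes "incr s m f" "incr s n g"
  shows "det (submatrix (generic_matrix m n) (f ` {..<s}) (g ` {..<s})) = (minor_of s f g :: (nat \<times> nat, 'k::field) mpoly)"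
    and "k < s \<Longrightarrow> submatrix (generic_matrix m n) (f ` {..<s}) (g ` {..<s}) $$ (k, k) = (indet (f k, g k) :: (nat \<times> nat, 'k) mpoly)"
proof -
  have "mat s s (\<lambda>(p, q). indet (pick (f ` {..<s}) p, pick (g ` {..<s}) q)) =
    (mat s s (\<lambda>(p, q). indet (f p, g q)) :: (nat \<times> nat, 'k) mpoly mat)"
    by (intro eq_matI) (auto simp: pick_incr[OF assms(1)] pick_incr[OF assms(2)])
  then have *: "submatrix (generic_matrix m n) (f ` {..<s}) (g ` {..<s}) =
    (mat s s (\<lambda>(p, q). indet (f p, g q)) :: (nat \<times> nat, 'k) mpoly mat)"
    by (simp only: submatrix_generic(1)[OF incr_minor_index[OF assms]])
  show "det (submatrix (generic_matrix m n) (f ` {..<s}) (g ` {..<s})) = (minor_of s f g :: (nat \<times> nat, 'k::field) mpoly)"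
    by (simp only: * minor_of_def)
  show "k < s \<Longrightarrow> submatrix (generic_matrix m n) (f ` {..<s}) (g ` {..<s}) $$ (k, k) = (indet (f k, g k) :: (nat \<times> nat, 'k) mpoly)"
    by (simp add: *)
qed

lemma diag_mon_Suc: "diag_mon (Suc s) f g = diag_mon s f g + single (f s, g s) 1"
  by (simp add: diag_mon_def add.commute)

lemma diag_mon_divides:
  assumes "\<And>i j. i < j \<Longrightarrow> j < s \<Longrightarrow> f i \<noteq> f j" "\<And>i. i < s \<Longrightarrow> (f i, g i) \<in> keys u"
  shows "\<exists>x. u = x + diag_mon s f g"
  using assms
proof (induction s)
  case 0
  then show ?case by (simp add: diag_mon_def)
next
  case (Suc s)
  then obtain x where x: "u = x + diag_mon s f g" by fastforce
  have "(f s, g s) \<notin> keys (diag_mon s f g)"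
    unfolding keys_diag_mon using Suc.prems(1)[of _ s] by fastforce
  moreover have "(f s, g s) \<in> keys u" using Suc.prems(2) by simp
  ultimately have "(f s, g s) \<in> keys x" using x by (simp add: keys_add_nat)
  from in_keys_split[OF this] obtain y where "x = y + single (f s, g s) 1" by blast
  with x show ?case by (intro exI[of _ y]) (simp add: diag_mon_Suc ac_simps)
qed

lemma finite_matrix_vars [simp]: "finite (matrix_vars m n)" and card_matrix_vars [simp]: "card (matrix_vars m n) = m * n"
  by (simp_all add: matrix_vars_def card_cartesian_product)

text \<open>Along each diagonal \<open>j - i = e\<close> the set contains at most \<open>t - 1\<close> variables; this is also attained,
  or the diagonal exhausted, by the union of the first \<open>t - 1\<close> rows and columns.\<close>

lemma card_no_chain:
  assumes F: "F \<subseteq> matrix_vars m n" and t: "0 < t" "t \<le> m" "t \<le> n"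
    and no: "\<And>f g. incr t m f \<Longrightarrow> incr t n g \<Longrightarrow> \<exists>k<t. (f k, g k) \<notin> F"
  shows "card F \<le> m * n - (m - t + 1) * (n - t + 1)"
proof -
  define G where "G = {v \<in> matrix_vars m n. fst v < t - 1 \<or> snd v < t - 1}"
  define dg where "dg v = int (snd v) - int (fst v)" for v :: "nat \<times> nat"
  define D where "D = dg ` matrix_vars m n"
  have finD: "finite D" by (simp add: D_def)
  have decomp: "card H = (\<Sum>e\<in>D. card {v \<in> H. dg v = e})" if "H \<subseteq> matrix_vars m n" for H
  proof -
    have fin: "finite H" using that by (rule finite_subset) simp
    have "H = (\<Union>e\<in>D. {v \<in> H. dg v = e})" using that by (auto simp: D_def)
    then have "card H = card (\<Union>e\<in>D. {v \<in> H. dg v = e})" by simp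
    also have "\<dots> = (\<Sum>e\<in>D. card {v \<in> H. dg v = e})"
      by (rule card_UN_disjoint) (use finD fin in auto)
    finally show ?thesis .
  qed
  have GV: "G \<subseteq> matrix_vars m n" by (auto simp: G_def)
  have le: "card {v \<in> F. dg v = e} \<le> card {v \<in> G. dg v = e}" for e
  proof (cases "{v \<in> F. dg v = e} \<subseteq> G")
    case True
    then show ?thesis using GV by (intro card_mono) (auto intro: finite_subset)
  next
    case False
    then obtain i j where ij: "(i, j) \<in> F" "dg (i, j) = e" "(i, j) \<notin> G" by auto
    then have ijV: "i < m" "j < n" "t - 1 \<le> i" "t - 1 \<le> j" using F by (auto simp: G_def matrix_vars_def)
    \<comment> \<open>From \<open>t\<close> members of \<open>F\<close> on one diagonal, the row
      indices \<open>A\<close> and the columns shifted by \<open>e\<close> would both be increasing,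
      giving the chain that \<open>no\<close> forbids.\<close>
    have small: "card {v \<in> F. dg v = e} \<le> t - 1"
    proof (rule ccontr)
      assume "\<not> ?thesis"
      moreover have inj: "inj_on fst {v \<in> F. dg v = e}" by (rule inj_onI) (auto simp: dg_def prod_eq_iff)
      ultimately have "t \<le> card (fst ` {v \<in> F. dg v = e})" using t by (simp add: card_image)
      then obtain A where A: "A \<subseteq> fst ` {v \<in> F. dg v = e}" "card A = t"
        by (rule obtain_subset_with_card_n)
      have "fst ` {v \<in> F. dg v = e} \<subseteq> {..<m}" using F by (auto simp: matrix_vars_def)
      with A(1) have Am: "A \<subseteq> {..<m}" by blast
      note p = incr_pick[OF Am A(2)]
      define g where "g k = nat (int (pick A k) + e)" for k
      have g: "(pick A k, g k) \<in> F \<and> int (g k) = int (pick A k) + e" if "k < t" for k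
      proof -
        have "pick A k \<in> A" using p(2) that by blast
        with A(1) obtain v where "v \<in> F" "dg v = e" "fst v = pick A k" by auto
        then have "v = (pick A k, g k)" "int (snd v) = int (pick A k) + e"
          by (auto simp: dg_def g_def prod_eq_iff)
        with \<open>v \<in> F\<close> show ?thesis by auto
      qed
      have "incr t n g"
        unfolding incr_def
      proof (intro conjI allI impI)
        show "g k < n" if "k < t" for k using g[OF that] F by (auto simp: matrix_vars_def)
        show "g k < g l" if "k < l" "l < t" for k l
        proof -
          have "pick A k < pick A l" using p(1) that by (simp add: incr_def)
          with g[of k] g[of l] that show ?thesis by simp
        qed
      qed
      from no[OF p(1) this] g show False by blast
    qed
    \<comment> \<open>The first \<open>t - 1\<close> positions of the diagonal through
      \<open>(i, j)\<close>, counted from the border of the matrix; their smaller coordinate is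
      below \<open>t - 1\<close>.\<close>
    let ?h = "\<lambda>s. (i - min i j + s, j - min i j + s)"
    have "inj_on ?h {..<t - 1}" by (rule inj_onI) (simp only: prod.inject add_left_cancel)
    then have "t - 1 = card (?h ` {..<t - 1})" by (simp add: card_image)
    also have "\<dots> \<le> card {v \<in> G. dg v = e}"
    proof (rule card_mono)
      show "finite {v \<in> G. dg v = e}" using GV by (auto intro: finite_subset)
      show "?h ` {..<t - 1} \<subseteq> {v \<in> G. dg v = e}"
      proof (rule image_subsetI)
        fix s assume "s \<in> {..<t - 1}"
        then have "s < t - 1" by simp
        then show "?h s \<in> {v \<in> G. dg v = e}"
          using ijV ij(2) by (cases "i \<le> j") (simp_all add: G_def matrix_vars_def dg_def)
      qed
    qed
    finally show ?thesis using small by simp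
  qed
  have "card F \<le> card G"
    unfolding decomp[OF F] decomp[OF GV] by (rule sum_mono) (rule le)
  also have "card G = m * n - (m - t + 1) * (n - t + 1)"
  proof -
    have "G = matrix_vars m n - {t - 1..<m} \<times> {t - 1..<n}" by (auto simp: G_def matrix_vars_def)
    then have "card G = m * n - card ({t - 1..<m} \<times> {t - 1..<n})"
      by (simp add: card_Diff_subset matrix_vars_def card_cartesian_product Sigma_mono)
        (subst card_Diff_subset, auto simp: card_cartesian_product)
    moreover have "card ({t - 1..<m} \<times> {t - 1..<n}) = (m - t + 1) * (n - t + 1)"
      using t by (auto simp: card_cartesian_product Suc_diff_le diff_Suc_eq_diff_pred)
    ultimately show ?thesis by simp
  qed
  finally show ?thesis .
qed

section \<open>The initial ideal of a determinantal ideal\<close>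

definition degpart :: "nat \<Rightarrow> ('v, 'k::comm_ring_1) mpoly \<Rightarrow> ('v, 'k) mpoly" where
  "degpart j f = (\<Sum>u\<in>keys f. if mon_degree u = j then single u (lookup f u) else 0)"

lemma lookup_degpart: "lookup (degpart j f) u = (if mon_degree u = j then lookup f u else 0)"
proof -
  have "lookup (degpart j f) u = (\<Sum>w\<in>keys f. if w = u then (if mon_degree u = j then lookup f u else 0) else 0)"
    unfolding degpart_def lookup_sum by (intro sum.cong) (auto simp: lookup_single)
  then show ?thesis by (auto simp: in_keys_iff)
qed

lemma degpart_add: "degpart j (f + g) = degpart j f + degpart j g"
  by (rule poly_mapping_eqI) (simp add: lookup_degpart lookup_add)

lemma degpart_homog: "f \<in> homog_part V j \<Longrightarrow> degpart j f = f"
  by (rule poly_mapping_eqI) (auto simp: lookup_degpart homog_iff in_keys_iff)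

text \<open>In the lowest possible degree a multiplier acts through its constant term alone. Hence
  the lowest component of an ideal element is a linear combination, over the field, of the
  generators.\<close>

lemma degpart_mult:
  assumes "\<And>u. u \<in> keys f \<Longrightarrow> j \<le> mon_degree u"
  shows "degpart j (a * f) = scalar (lookup a 0) * degpart j f"
proof (rule poly_mapping_eqI)
  fix u
  show "lookup (degpart j (a * f)) u = lookup (scalar (lookup a 0) * degpart j f) u"
  proof (cases "mon_degree u = j")
    case True
    have "lookup (a * f) u = (\<Sum>b\<in>keys a. if b = 0 then \<Sum>c\<in>keys f. if c = u then lookup a b * lookup f c else 0 else 0)"
      unfolding lookup_times
    proof (intro sum.cong refl)
      fix b assume "b \<in> keys a"
      have eq: "u = b + c \<longleftrightarrow> b = 0 \<and> c = u" if c: "c \<in> keys f" for c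
      proof
        assume "u = b + c"
        then have "mon_degree b + mon_degree c = j" using True by (simp add: mon_degree_add)
        with assms[OF c] have "mon_degree b = 0" by linarith
        then have "b = 0" by simp
        with \<open>u = b + c\<close> show "b = 0 \<and> c = u" by simp
      qed auto
      show "(\<Sum>c\<in>keys f. if u = b + c then lookup a b * lookup f c else 0) =
        (if b = 0 then \<Sum>c\<in>keys f. if c = u then lookup a b * lookup f c else 0 else 0)"
        by (auto simp: eq intro!: sum.cong sum.neutral)
    qed
    also have "\<dots> = lookup a 0 * lookup f u" by (auto simp: in_keys_iff)
    finally show ?thesis using True by (simp add: lookup_degpart)
  qed (simp add: lookup_degpart)
qed

definition minor_pairs :: "nat \<Rightarrow> nat \<Rightarrow> nat \<Rightarrow> (nat set \<times> nat set) set" where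
  "minor_pairs m n t = {A. A \<subseteq> {..<m} \<and> card A = t} \<times> {B. B \<subseteq> {..<n} \<and> card B = t}"

definition pair_minor :: "nat \<Rightarrow> nat set \<times> nat set \<Rightarrow> (nat \<times> nat, 'k::comm_ring_1) mpoly" where
  "pair_minor t x = minor_of t (pick (fst x)) (pick (snd x))"

definition pair_diag :: "nat \<Rightarrow> nat set \<times> nat set \<Rightarrow> (nat \<times> nat) monomial" where
  "pair_diag t x = diag_mon t (pick (fst x)) (pick (snd x))"

lemma finite_minor_pairs [simp]: "finite (minor_pairs m n t)"
  unfolding minor_pairs_def by (intro finite_cartesian_product) (auto intro: finite_subset[of _ "Pow _"])

lemma card_minor_pairs: "card (minor_pairs m n t) = (m choose t) * (n choose t)"
  by (simp add: minor_pairs_def card_cartesian_product n_subsets)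

lemma minor_pairs_incr:
  "x \<in> minor_pairs m n t \<Longrightarrow> incr t m (pick (fst x))" "x \<in> minor_pairs m n t \<Longrightarrow> incr t n (pick (snd x))"
  by (auto simp: minor_pairs_def incr_pick)

lemma pair_diag_inj: "inj_on (pair_diag t) (minor_pairs m n t)"
proof (rule inj_onI)
  fix x y assume x: "x \<in> minor_pairs m n t" and y: "y \<in> minor_pairs m n t" and "pair_diag t x = pair_diag t y"
  then have "keys (pair_diag t x) = keys (pair_diag t y)" by simp
  then have "fst ` keys (pair_diag t x) = fst ` keys (pair_diag t y)" "snd ` keys (pair_diag t x) = snd ` keys (pair_diag t y)"
    by simp_all
  then have "pick (fst x) ` {..<t} = pick (fst y) ` {..<t}" "pick (snd x) ` {..<t} = pick (snd y) ` {..<t}"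
    by (simp_all add: pair_diag_def keys_diag_mon image_image)
  moreover have "pick (fst z) ` {..<t} = fst z" "pick (snd z) ` {..<t} = snd z" if "z \<in> minor_pairs m n t" for z
  proof -
    have "fst z \<subseteq> {..<m}" "card (fst z) = t" "snd z \<subseteq> {..<n}" "card (snd z) = t"
      using that by (auto simp: minor_pairs_def)
    then show "pick (fst z) ` {..<t} = fst z" "pick (snd z) ` {..<t} = snd z" using incr_pick(2) by blast+
  qed
  ultimately show "x = y" using x y by (simp add: prod_eq_iff)
qed

lemma incr_vars: "incr s m f \<Longrightarrow> incr s n g \<Longrightarrow> i < s \<Longrightarrow> j < s \<Longrightarrow> (f i, g j) \<in> matrix_vars m n"
  by (simp add: incr_def matrix_vars_def)

lemma minor_homog: "incr s m f \<Longrightarrow> incr s n g \<Longrightarrow> minor_of s f g \<in> homog_part (matrix_vars m n) s"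
  by (rule minor_of_homog) (rule incr_vars)

locale diag_init =
  fixes m n t :: nat and r :: "((nat \<times> nat) monomial \<times> (nat \<times> nat) monomial) set" and K :: "'k::field itself"
  assumes t: "2 \<le> t" "t \<le> m" "t \<le> n" and diag: "diagonal_order TYPE('k) m n r"
begin

abbreviation V :: "(nat \<times> nat) set" where "V \<equiv> matrix_vars m n"

abbreviation It :: "(nat \<times> nat, 'k) mpoly set" where "It \<equiv> determinantal_ideal m n t"

abbreviation inI :: "(nat \<times> nat, 'k) mpoly set" where "inI \<equiv> initial_ideal V r It"

sublocale mon_order V r
  using diag by unfold_locales (simp add: diagonal_order_def)

lemma minor_below:
  assumes s: "1 \<le> s" and fg: "incr s m f" "incr s n g"
  shows "below (diag_mon s f g) (minor_of s f g :: (nat \<times> nat, 'k) mpoly)"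
proof -
  let ?M = "minor_of s f g :: (nat \<times> nat, 'k) mpoly"
  have "monom_poly (initial_monomial r ?M) = (\<Prod>k<s. indet (f k, g k) :: (nat \<times> nat, 'k) mpoly)"
  proof -
    let ?X = "generic_matrix m n :: (nat \<times> nat, 'k) mpoly mat"
    have "monom_poly (initial_monomial r (det (submatrix ?X (f ` {..<s}) (g ` {..<s})))) =
      (\<Prod>k<s. submatrix ?X (f ` {..<s}) (g ` {..<s}) $$ (k, k))"
      using diag s incr_minor_index[OF fg, where 'a = 'k] unfolding diagonal_order_def Let_def by blast
    also have "\<dots> = (\<Prod>k<s. indet (f k, g k))"
      by (rule prod.cong) (simp_all add: det_submatrix_incr(2)[OF fg])
    finally show ?thesis by (simp only: det_submatrix_incr(1)[OF fg])
  qed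
  also have "\<dots> = monom_poly (diag_mon s f g)"
    by (simp add: diag_mon_def monom_poly_sum indet_def)
  finally have eq: "initial_monomial r ?M = diag_mon s f g" by simp
  have "?M \<noteq> 0" using lookup_diag_minor[OF fg, where 'k = 'k] by auto
  moreover have "?M \<in> polys V" using minor_homog[OF fg] homog_polys by blast
  ultimately show ?thesis
    using initial_monomial[of ?M] eq diag_mon_in[OF incr_vars[OF fg]] by (auto simp: below_def)
qed

lemma It_eq: "It = gen_ideal V {minor_of t f g | f g. incr t m f \<and> incr t n g}"
  by (simp add: determinantal_ideal_def minors_eq)

lemma minors_polys: "{minor_of t f g | f g. incr t m f \<and> incr t n g} \<subseteq> polys V"
  using minor_homog homog_polys by blast

lemma It_polys: "It \<subseteq> polys V"
  unfolding It_eq by (rule gen_ideal_polys[OF minors_polys])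

lemma is_ideal_It: "is_ideal V It"
  unfolding It_eq by (rule is_ideal_gen[OF minors_polys])

lemma minor_in_It: "incr t m f \<Longrightarrow> incr t n g \<Longrightarrow> minor_of t f g \<in> It"
  unfolding It_eq by (rule gen_idealI[OF minors_polys]) blast

lemma is_ideal_inI: "is_ideal V inI"
  by (rule is_ideal_initial[OF It_polys])

lemma inI_eq: "inI = {f \<in> polys V. \<forall>u\<in>keys f. \<exists>w\<in>init_mons It. \<exists>x\<in>monomials_in V. u = x + w}"
  by (rule initial_ideal_eq[OF It_polys])

lemma diag_in_init_mons: "incr t m f \<Longrightarrow> incr t n g \<Longrightarrow> diag_mon t f g \<in> init_mons It"
proof -
  assume fg: "incr t m f" "incr t n g"
  let ?M = "minor_of t f g :: (nat \<times> nat, 'k) mpoly"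
  have l: "lookup ?M (diag_mon t f g) = 1" by (rule lookup_diag_minor[OF fg])
  then have "initial_monomial r ?M = diag_mon t f g"
    using minor_below[of t f g] t fg by (intro initial_monomialI) (auto simp: below_def in_keys_iff)
  moreover have "?M \<noteq> 0" using l by auto
  ultimately show ?thesis using minor_in_It[OF fg] unfolding init_mons_def by force
qed

lemma diag_mult_in_inI: "incr t m f \<Longrightarrow> incr t n g \<Longrightarrow> x \<in> monomials_in V \<Longrightarrow> monom_poly (x + diag_mon t f g) \<in> inI"
  by (intro init_mons_monom_poly[OF It_polys] diag_in_init_mons)

text \<open>By \<open>card_no_chain\<close> so many variables contain the diagonal of a
  \<open>t\<close>-minor. This is the hypothesis under which the dimension is bounded by
  \<open>m * n - (m - t + 1) * (n - t + 1)\<close>.\<close>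

lemma sparse_in_inI:
  assumes u: "u \<in> monomials_in V" and "m * n - (m - t + 1) * (n - t + 1) < card (keys u)"
  shows "monom_poly u \<in> inI"
proof -
  have "\<exists>f g. incr t m f \<and> incr t n g \<and> (\<forall>k<t. (f k, g k) \<in> keys u)"
  proof (rule ccontr)
    assume "\<not> ?thesis"
    then have "card (keys u) \<le> m * n - (m - t + 1) * (n - t + 1)"
      using u t by (intro card_no_chain) (auto simp: monomials_in_def)
    with assms(2) show False by simp
  qed
  then obtain f g where fg: "incr t m f" "incr t n g" "\<And>k. k < t \<Longrightarrow> (f k, g k) \<in> keys u" by blast
  have "f i \<noteq> f j" if "i < j" "j < t" for i j using fg(1) that unfolding incr_def by (metis less_irrefl)
  then obtain x where x: "u = x + diag_mon t f g" using diag_mon_divides[of t f g u] fg(3) by blast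
  then have "x \<in> monomials_in V" using u by (auto simp: monomials_in_def keys_add_nat)
  with diag_mult_in_inI[OF fg(1,2)] x show ?thesis by simp
qed

lemma It_low_degree:
  assumes "f \<in> It"
  shows "\<And>u. u \<in> keys f \<Longrightarrow> t \<le> mon_degree u"
    and "\<exists>c. degpart t f = (\<Sum>x\<in>minor_pairs m n t. scalar (c x) * pair_minor t x)"
proof -
  let ?S = "\<lambda>c. \<Sum>x\<in>minor_pairs m n t. scalar (c x) * pair_minor t x :: (nat \<times> nat, 'k) mpoly"
  let ?P = "{f \<in> polys V. (\<forall>u\<in>keys f. t \<le> mon_degree u) \<and> (\<exists>c. degpart t f = ?S c)}"
  have "is_ideal V ?P"
  proof (rule is_idealI)
    show "0 \<in> ?P" by (auto simp: degpart_def intro!: exI[of _ "\<lambda>_. 0"])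
  next
    fix x y assume x: "x \<in> ?P" and y: "y \<in> ?P"
    from x y obtain c d where cd: "degpart t x = ?S c" "degpart t y = ?S d" by blast
    have "degpart t (x + y) = ?S (\<lambda>z. c z + d z)"
      by (simp add: degpart_add cd scalar_add distrib_right sum.distrib)
    with x y keys_add[of x y] show "x + y \<in> ?P" by (auto simp: polys_add)
  next
    fix a x :: "(nat \<times> nat, 'k) mpoly" assume a: "a \<in> polys V" and x: "x \<in> ?P"
    from x obtain c where c: "degpart t x = ?S c" by blast
    have "degpart t (a * x) = scalar (lookup a 0) * degpart t x"
      by (rule degpart_mult) (use x in auto)
    also have "\<dots> = ?S (\<lambda>z. lookup a 0 * c z)"
      by (simp add: c sum_distrib_left scalar_mult mult.assoc)
    finally have "\<exists>c. degpart t (a * x) = ?S c" by (intro exI[of _ "\<lambda>z. lookup a 0 * c z"])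
    moreover have "t \<le> mon_degree u" if "u \<in> keys (a * x)" for u
    proof -
      from that obtain b w where "u = b + w" "w \<in> keys x" using keys_mult[of a x] by blast
      with x show ?thesis by (auto simp: mon_degree_add intro: trans_le_add2)
    qed
    ultimately show "a * x \<in> ?P" using a x by (auto simp: polys_mult)
  qed auto
  moreover have "{minor_of t f g | f g. incr t m f \<and> incr t n g} \<subseteq> ?P"
  proof safe
    fix f g assume fg: "incr t m f" "incr t n g"
    have h: "(minor_of t f g :: (nat \<times> nat, 'k) mpoly) \<in> homog_part V t" by (rule minor_homog[OF fg])
    then show "(minor_of t f g :: (nat \<times> nat, 'k) mpoly) \<in> polys V" by (rule homog_polys)
    show "t \<le> mon_degree u" if "u \<in> keys (minor_of t f g :: (nat \<times> nat, 'k) mpoly)" for u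
      using h that by (simp add: homog_iff)
    let ?x = "(f ` {..<t}, g ` {..<t})"
    have x: "?x \<in> minor_pairs m n t"
      using fg card_image[OF incr_inj_on[OF fg(1)]] card_image[OF incr_inj_on[OF fg(2)]]
      by (auto simp: minor_pairs_def incr_def)
    have "mat t t (\<lambda>(p, q). indet (pick (f ` {..<t}) p, pick (g ` {..<t}) q)) =
      (mat t t (\<lambda>(p, q). indet (f p, g q)) :: (nat \<times> nat, 'k) mpoly mat)"
      by (intro eq_matI) (auto simp: pick_incr[OF fg(1)] pick_incr[OF fg(2)])
    then have "pair_minor t ?x = (minor_of t f g :: (nat \<times> nat, 'k) mpoly)"
      by (simp only: pair_minor_def minor_of_def fst_conv snd_conv)
    then have "degpart t (minor_of t f g) = ?S (\<lambda>z. if z = ?x then 1 else 0)"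
      using degpart_homog[OF h] x by (simp add: if_distrib[of scalar] if_distrib[of "\<lambda>a. a * _"] cong: if_cong)
    then show "\<exists>c. degpart t (minor_of t f g) = ?S c" by (intro exI[of _ "\<lambda>z. if z = ?x then 1 else 0"])
  qed
  ultimately have "It \<subseteq> ?P" unfolding It_eq by (rule gen_ideal_least)
  with assms show "\<And>u. u \<in> keys f \<Longrightarrow> t \<le> mon_degree u"
    "\<exists>c. degpart t f = (\<Sum>x\<in>minor_pairs m n t. scalar (c x) * pair_minor t x)" by auto
qed

text \<open>The order need not compare degrees first, so \<open>f\<close> may be inhomogeneous and
  its degree-\<open>t\<close> component is examined separately. That component is a combination of
  minors with pairwise distinct diagonals, and every other monomial of a minor is smaller than its
  diagonal. The largest diagonal involved therefore cannot cancel, and it must be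
  \<open>u\<close>.\<close>

lemma init_mons_low_degree:
  assumes "u \<in> init_mons It"
  shows "t \<le> mon_degree u" and "mon_degree u = t \<Longrightarrow> u \<in> pair_diag t ` minor_pairs m n t"
proof -
  from assms obtain f where f: "f \<in> It" "f \<noteq> 0" "u = initial_monomial r f" by (auto simp: init_mons_def)
  have fV: "f \<in> polys V" using f It_polys by blast
  have u: "u \<in> keys f" "\<And>w. w \<in> keys f \<Longrightarrow> w \<preceq> u" using initial_monomial[OF fV f(2)] f(3) by auto
  show "t \<le> mon_degree u" using It_low_degree(1)[OF f(1) u(1)] .
  assume du: "mon_degree u = t"
  let ?C = "minor_pairs m n t"
  obtain c where c: "degpart t f = (\<Sum>x\<in>?C. scalar (c x) * pair_minor t x)"
    using It_low_degree(2)[OF f(1)] by blast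
  have ex: "\<exists>x\<in>?C. c x \<noteq> 0 \<and> w \<in> keys (pair_minor t x :: (nat \<times> nat, 'k) mpoly)" if "lookup (degpart t f) w \<noteq> 0" for w
  proof (rule ccontr)
    assume "\<not> ?thesis"
    then have "lookup (degpart t f) w = 0" unfolding c lookup_sum
      by (intro sum.neutral) (auto simp: in_keys_iff)
    with that show False by simp
  qed
  define C' where "C' = {x \<in> ?C. c x \<noteq> 0}"
  have bel: "below (pair_diag t x) (pair_minor t x :: (nat \<times> nat, 'k) mpoly)" if "x \<in> ?C" for x
    unfolding pair_diag_def pair_minor_def by (rule minor_below) (use minor_pairs_incr[OF that] t in auto)
  have ulook: "lookup (degpart t f) u \<noteq> 0" using u du by (simp add: lookup_degpart in_keys_iff)
  from ex[OF ulook] have "C' \<noteq> {}" by (auto simp: C'_def)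
  moreover have "finite C'" "pair_diag t ` C' \<subseteq> monomials_in V" using bel by (auto simp: C'_def below_def)
  ultimately have "\<exists>w\<in>pair_diag t ` C'. \<forall>u\<in>pair_diag t ` C'. u \<preceq> w" by (intro finite_max) auto
  then obtain x0 where x0: "x0 \<in> C'" "\<And>x. x \<in> C' \<Longrightarrow> pair_diag t x \<preceq> pair_diag t x0" by blast
  have "lookup (degpart t f) (pair_diag t x0) = (\<Sum>x\<in>?C. if x = x0 then c x0 else 0)"
    unfolding c lookup_sum
  proof (rule sum.cong)
    fix x assume x: "x \<in> ?C"
    have "lookup (pair_minor t x0 :: (nat \<times> nat, 'k) mpoly) (pair_diag t x0) = 1"
      unfolding pair_diag_def pair_minor_def
      by (rule lookup_diag_minor) (use minor_pairs_incr[of x0 m n t] x0 in \<open>auto simp: C'_def\<close>)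
    moreover have "pair_diag t x0 \<notin> keys (pair_minor t x :: (nat \<times> nat, 'k) mpoly)" if "x \<in> C'" "x \<noteq> x0"
    proof
      assume "pair_diag t x0 \<in> keys (pair_minor t x :: (nat \<times> nat, 'k) mpoly)"
      with bel[OF x] x0(2)[OF that(1)] have "pair_diag t x = pair_diag t x0"
        by (auto simp: below_def intro: le_antisym)
      then show False using inj_onD[OF pair_diag_inj _ x, of x0] x0(1) that by (auto simp: C'_def)
    qed
    ultimately show "lookup (scalar (c x) * pair_minor t x) (pair_diag t x0) = (if x = x0 then c x0 else 0)"
      using x by (cases "x \<in> C'") (auto simp: C'_def in_keys_iff)
  qed simp
  then have "lookup (degpart t f) (pair_diag t x0) \<noteq> 0" using x0 by (simp add: C'_def)
  then have "pair_diag t x0 \<preceq> u" by (intro u) (simp add: lookup_degpart in_keys_iff split: if_splits)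
  moreover have "u \<preceq> pair_diag t x0"
  proof -
    from ex[OF ulook] obtain x where "x \<in> C'" "x \<in> ?C" "u \<in> keys (pair_minor t x :: (nat \<times> nat, 'k) mpoly)"
      by (auto simp: C'_def)
    then show ?thesis using bel[of x] x0(2)[of x] by (auto simp: below_def intro: le_trans)
  qed
  ultimately have "u = pair_diag t x0" by (rule le_antisym[rotated])
  then show "u \<in> pair_diag t ` ?C" using x0 by (auto simp: C'_def)
qed

lemma inI_low_degree:
  assumes "f \<in> inI" "u \<in> keys f"
  shows "t \<le> mon_degree u" and "mon_degree u = t \<Longrightarrow> u \<in> pair_diag t ` minor_pairs m n t"
proof -
  from assms obtain w x where w: "w \<in> init_mons It" "u = x + w" unfolding inI_eq by blast
  then have deg: "mon_degree u = mon_degree x + mon_degree w" by (simp add: mon_degree_add)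
  with init_mons_low_degree(1)[OF w(1)] show "t \<le> mon_degree u" by simp
  assume "mon_degree u = t"
  with deg init_mons_low_degree(1)[OF w(1)] have "mon_degree x = 0" "mon_degree w = t" by auto
  with init_mons_low_degree(2)[OF w(1)] w(2) show "u \<in> pair_diag t ` minor_pairs m n t" by simp
qed

end

section \<open>Matrices of rank below \<open>t\<close> and the box primes\<close>

definition skip_idx :: "nat \<Rightarrow> nat \<Rightarrow> nat \<Rightarrow> nat \<Rightarrow> nat" where
  "skip_idx t k N p = (if p < k then p else N - (t - 1) + p)"

definition insert_at :: "nat \<Rightarrow> (nat \<Rightarrow> nat) \<Rightarrow> nat \<Rightarrow> nat \<Rightarrow> nat" where
  "insert_at k a x p = (if p < k then a p else if p = k then x else a (p - 1))"

text \<open>The positions that can occupy place \<open>k\<close> on the main diagonal of a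
  \<open>t\<close>-minor, since an increasing selection of \<open>t\<close> rows has its
  \<open>k\<close>-th row between \<open>k\<close> and \<open>k + m - t\<close>. The
  \<open>t - 1\<close> rows or columns missed by the box are listed by
  \<open>skip_idx\<close>.\<close>

definition box :: "nat \<Rightarrow> nat \<Rightarrow> nat \<Rightarrow> nat \<Rightarrow> (nat \<times> nat) set" where
  "box t k m n = {k..k + m - t} \<times> {k..k + n - t}"

lemma incr_skip: "k < t \<Longrightarrow> t \<le> N \<Longrightarrow> incr (t - 1) N (skip_idx t k N)"
  by (auto simp: incr_def skip_idx_def)

lemma incr_insert: "k < t \<Longrightarrow> t \<le> N \<Longrightarrow> x \<in> {k..k + N - t} \<Longrightarrow> incr t N (insert_at k (skip_idx t k N) x)"
proof -
  assume a: "k < t" "t \<le> N" "x \<in> {k..k + N - t}"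
  then have *: "insert_at k (skip_idx t k N) x p = (if p < k then p else if p = k then x else N - t + p)" for p
    by (simp add: insert_at_def skip_idx_def)
  show ?thesis
    unfolding incr_def *
  proof (intro conjI allI impI)
    show "(if i < k then i else if i = k then x else N - t + i) < N" if "i < t" for i
      using a that by (auto split: if_split)
    show "(if i < k then i else if i = k then x else N - t + i) < (if j < k then j else if j = k then x else N - t + j)"
      if "i < j" "j < t" for i j
    proof (cases i k rule: linorder_cases)
      case less
      with a that show ?thesis by (cases j k rule: linorder_cases) simp_all
    qed (use a that in auto)
  qed
qed

lemma skip_cover: "k < t \<Longrightarrow> t \<le> N \<Longrightarrow> x < N \<Longrightarrow> x \<notin> {k..k + N - t} \<Longrightarrow> \<exists>p<t - 1. skip_idx t k N p = x"
proof -
  assume a: "k < t" "t \<le> N" "x < N" "x \<notin> {k..k + N - t}"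
  show ?thesis
  proof (cases "x < k")
    case True
    with a show ?thesis by (intro exI[of _ x]) (auto simp: skip_idx_def)
  next
    case False
    with a show ?thesis by (intro exI[of _ "x - (N - (t - 1))"]) (auto simp: skip_idx_def)
  qed
qed

lemma box_vars: "t \<le> m \<Longrightarrow> t \<le> n \<Longrightarrow> k < t \<Longrightarrow> box t k m n \<subseteq> matrix_vars m n"
  by (auto simp: box_def matrix_vars_def)

lemma finite_box [simp]: "finite (box t k m n)"
  by (simp add: box_def)

lemma card_box: "t \<le> m \<Longrightarrow> t \<le> n \<Longrightarrow> card (box t k m n) = (m - t + 1) * (n - t + 1)"
proof -
  assume "t \<le> m" "t \<le> n"
  then have "Suc (k + m - t) - k = m - t + 1" "Suc (k + n - t) - k = n - t + 1" by simp_all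
  then show ?thesis by (simp only: box_def card_cartesian_product card_atLeastAtMost)
qed

lemma diag_insert:
  assumes "k < t"
  shows "diag_mon t (insert_at k a i) (insert_at k b j) = diag_mon (t - 1) a b + single (i, j) 1"
proof -
  let ?f = "\<lambda>p. single (insert_at k a i p, insert_at k b j p) (1::nat)"
  let ?h = "\<lambda>p. if p < k then p else Suc p"
  have inj: "inj_on ?h {..<t - 1}" by (rule inj_onI) (auto split: if_splits)
  have "{..<t} = insert k (?h ` {..<t - 1})"
  proof (intro equalityI subsetI)
    fix p assume p: "p \<in> {..<t}"
    consider "p = k" | "p < k" | "k < p" by linarith
    then show "p \<in> insert k (?h ` {..<t - 1})"
    proof cases
      case 2
      with assms p show ?thesis by (intro insertI2 image_eqI[of _ _ p]) auto
    next
      case 3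
      with assms p show ?thesis by (intro insertI2 image_eqI[of _ _ "p - 1"]) auto
    qed simp
  qed (use assms in \<open>auto split: if_splits\<close>)
  moreover have "k \<notin> ?h ` {..<t - 1}" by (auto split: if_splits)
  ultimately have "diag_mon t (insert_at k a i) (insert_at k b j) = ?f k + (\<Sum>p\<in>?h ` {..<t - 1}. ?f p)"
    by (simp add: diag_mon_def)
  also have "(\<Sum>p\<in>?h ` {..<t - 1}. ?f p) = (\<Sum>p<t - 1. single (a p, b p) 1)"
    unfolding sum.reindex[OF inj] by (rule sum.cong) (auto simp: insert_at_def)
  finally show ?thesis by (simp add: diag_mon_def insert_at_def add.commute)
qed

context diag_init
begin

text \<open>A matrix of rank less than \<open>t\<close> with entries \<open>\<Delta> x\<^sub>i\<^sub>j\<close> outside the box, where \<open>\<Delta>\<close> is the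
  \<open>(t - 1)\<close>-minor avoiding the rows and columns of the box: inside the box the entry is
  determined by bordering \<open>\<Delta>\<close>.\<close>

definition bordered :: "nat \<Rightarrow> nat \<Rightarrow> nat \<Rightarrow> (nat \<times> nat, 'k) mpoly" where
  "bordered k i j = minor_of t (insert_at k (skip_idx t k m) i) (insert_at k (skip_idx t k n) j)"

definition corner :: "nat \<Rightarrow> (nat \<times> nat, 'k) mpoly" where
  "corner k = minor_of (t - 1) (skip_idx t k m) (skip_idx t k n)"

definition corner_mon :: "nat \<Rightarrow> (nat \<times> nat) monomial" where
  "corner_mon k = diag_mon (t - 1) (skip_idx t k m) (skip_idx t k n)"

definition low_rank :: "nat \<Rightarrow> nat \<times> nat \<Rightarrow> (nat \<times> nat, 'k) mpoly" where
  "low_rank k v = corner k * indet v - bordered k (fst v) (snd v)"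

text \<open>Expand the bordered minor along row \<open>k\<close>. The term at column
  \<open>k\<close> is \<open>corner k\<close> times the variable at \<open>(i, j)\<close> and is
  cancelled by \<open>low_rank\<close>; the others are \<open>t - 1\<close> entries of row
  \<open>i\<close> times coefficients depending on \<open>j\<close> only. This exhibits a
  factorisation of rank at most \<open>t - 1\<close>.\<close>

lemma low_rank_factor:
  assumes k: "k < t"
  shows "\<exists>Y. \<forall>i j. low_rank k (i, j) = (\<Sum>q<t - 1. indet (i, skip_idx t k n q) * Y q j)"
proof -
  let ?a = "skip_idx t k m" and ?b = "skip_idx t k n"
  define N where "N i j = mat t t (\<lambda>(p, q). indet (insert_at k ?a i p, insert_at k ?b j q) :: (nat \<times> nat, 'k) mpoly)" for i j
  have N: "N i j \<in> carrier_mat t t" for i j by (simp add: N_def)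
  \<comment> \<open>The index \<open>i\<close> enters \<open>N i j\<close> only through row
    \<open>k\<close>, which is deleted here. So the cofactors along that row depend on
    \<open>j\<close> alone, and \<open>0\<close> can stand for any row index.\<close>
  have del: "mat_delete (N i j) k q = mat_delete (N 0 j) k q" for i j q
    unfolding mat_delete_def N_def
    by (intro eq_matI) (auto simp: insert_at_def)
  have cof: "cofactor (N i j) k q = cofactor (N 0 j) k q" for i j q
    unfolding cofactor_def del[of i j q] ..
  have delk: "mat_delete (N i j) k k = mat (t - 1) (t - 1) (\<lambda>(p, q). indet (?a p, ?b q))" for i j
    unfolding mat_delete_def N_def using k by (intro eq_matI) (auto simp: insert_at_def)
  have cofk: "cofactor (N i j) k k = corner k" for i j
    by (simp add: cofactor_def delk corner_def minor_of_def flip: power_mult_distrib)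
  let ?h = "\<lambda>p. if p < k then p else Suc p"
  have inj: "inj_on ?h {..<t - 1}" by (rule inj_onI) (auto split: if_splits)
  have set: "{..<t} - {k} = ?h ` {..<t - 1}"
  proof (intro equalityI subsetI)
    fix p assume p: "p \<in> {..<t} - {k}"
    then consider "p < k" | "k < p" by fastforce
    then show "p \<in> ?h ` {..<t - 1}"
    proof cases
      case 1
      with k p show ?thesis by (intro image_eqI[of _ _ p]) auto
    next
      case 2
      with k p show ?thesis by (intro image_eqI[of _ _ "p - 1"]) auto
    qed
  qed (use k in \<open>auto split: if_splits\<close>)
  define Y where "Y q j = - cofactor (N 0 j) k (?h q)" for q j
  have "low_rank k (i, j) = (\<Sum>q<t - 1. indet (i, ?b q) * Y q j)" for i j
  proof -
    have "bordered k i j = (\<Sum>q<t. N i j $$ (k, q) * cofactor (N i j) k q)"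
      unfolding bordered_def minor_of_def N_def[symmetric] by (rule laplace_expansion_row[OF N k])
    also have "\<dots> = N i j $$ (k, k) * cofactor (N i j) k k + (\<Sum>q\<in>{..<t} - {k}. N i j $$ (k, q) * cofactor (N i j) k q)"
      using k by (subst sum.remove[of _ k]) auto
    also have "N i j $$ (k, k) * cofactor (N i j) k k = corner k * indet (i, j)"
    proof -
      have "N i j $$ (k, k) = indet (i, j)" using k by (simp add: N_def insert_at_def)
      then show ?thesis by (simp only: cofk mult.commute)
    qed
    also have "(\<Sum>q\<in>{..<t} - {k}. N i j $$ (k, q) * cofactor (N i j) k q) = - (\<Sum>q<t - 1. indet (i, ?b q) * Y q j)"
      unfolding set sum.reindex[OF inj] sum_negf[symmetric]
    proof (rule sum.cong)
      fix q assume "q \<in> {..<t - 1}"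
      then have "?h q < t" "N i j $$ (k, ?h q) = indet (i, ?b q)"
        using k by (auto simp: N_def insert_at_def)
      then show "((\<lambda>q. N i j $$ (k, q) * cofactor (N i j) k q) \<circ> ?h) q = - (indet (i, ?b q) * Y q j)"
        by (simp add: Y_def cof[of i j])
    qed simp
    finally show ?thesis by (simp add: low_rank_def)
  qed
  then show ?thesis by blast
qed

lemma low_rank_kills:
  assumes k: "k < t" and f: "f \<in> It"
  shows "subst (low_rank k) f = 0"
proof -
  obtain Y where Y: "\<And>i j. low_rank k (i, j) = (\<Sum>q<t - 1. indet (i, skip_idx t k n q) * Y q j)"
    using low_rank_factor[OF k] by blast
  have "subst (low_rank k) (minor_of t a b) = 0" for a b
    unfolding subst_minor_of
    by (rule det_low_rank[where L = "\<lambda>p q. indet (a p, skip_idx t k n q)" and Y = "\<lambda>q p. Y q (b p)"])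
      (use t in \<open>auto simp: Y\<close>)
  then have "{minor_of t f g | f g. incr t m f \<and> incr t n g} \<subseteq> {f \<in> polys V. subst (low_rank k) f = 0}"
    using minors_polys by blast
  then have "It \<subseteq> {f \<in> polys V. subst (low_rank k) f = 0}"
    unfolding It_eq by (rule gen_ideal_least[OF is_ideal_kernel])
  with f show ?thesis by blast
qed

lemma corner_below:
  assumes k: "k < t"
  shows "below (corner_mon k) (corner k)" "lookup (corner k) (corner_mon k) = 1" "corner k \<in> homog_part V (t - 1)"
proof -
  have i: "incr (t - 1) m (skip_idx t k m)" "incr (t - 1) n (skip_idx t k n)"
    using incr_skip k t by auto
  show "below (corner_mon k) (corner k)" unfolding corner_mon_def corner_def
    by (rule minor_below[OF _ i]) (use t in simp)
  show "lookup (corner k) (corner_mon k) = 1" unfolding corner_mon_def corner_def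
    by (rule lookup_diag_minor[OF i])
  show "corner k \<in> homog_part V (t - 1)" unfolding corner_def by (rule minor_homog[OF i])
qed

text \<open>Bordering by a row or column that already occurs in the corner minor repeats it, so the
  bordered minor is zero.\<close>

lemma low_rank_outside:
  assumes k: "k < t" and v: "v \<in> V" "v \<notin> box t k m n"
  shows "low_rank k v = corner k * indet v"
proof -
  obtain i j where ij: "v = (i, j)" "i < m" "j < n" using v(1) by (auto simp: matrix_vars_def)
  let ?f = "insert_at k (skip_idx t k m) i" and ?g = "insert_at k (skip_idx t k n) j"
  let ?N = "mat t t (\<lambda>(p, q). indet (?f p, ?g q)) :: (nat \<times> nat, 'k) mpoly mat"
  have dup: "\<exists>p<t. p \<noteq> k \<and> insert_at k a x p = insert_at k a x k" if "\<exists>p<t - 1. a p = x" for a x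
  proof -
    from that obtain p where p: "p < t - 1" "a p = x" by blast
    then show ?thesis
      by (intro exI[of _ "if p < k then p else Suc p"]) (auto simp: insert_at_def)
  qed
  have "bordered k i j = 0"
  proof (cases "i \<in> {k..k + m - t}")
    case False
    from skip_cover[OF k t(2) ij(2) this] dup obtain p where p: "p < t" "p \<noteq> k" "?f p = ?f k" by blast
    have "det ?N = 0"
      by (rule det_identical_rows[of _ t p k]) (use p k in \<open>auto intro!: eq_vecI\<close>)
    then show ?thesis by (simp add: bordered_def minor_of_def)
  next
    case True
    with v(2) ij have "j \<notin> {k..k + n - t}" by (auto simp: box_def)
    from skip_cover[OF k t(3) ij(3) this] dup obtain p where p: "p < t" "p \<noteq> k" "?g p = ?g k" by blast
    have "det ?N = 0"
      by (rule det_identical_columns[of _ t p k]) (use p k in \<open>auto intro!: eq_vecI\<close>)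
    then show ?thesis by (simp add: bordered_def minor_of_def)
  qed
  then show ?thesis by (simp add: low_rank_def ij)
qed

lemma low_rank_below:
  assumes k: "k < t" and v: "v \<in> V"
  shows "below (corner_mon k + single v 1) (low_rank k v)" "low_rank k v \<in> homog_part V t"
proof -
  note c = corner_below[OF k]
  have 1: "below (corner_mon k + single v 1) (corner k * indet v)"
    by (rule below_mult[OF c(1) below_indet[OF v]])
  have 2: "corner k * indet v \<in> homog_part V t"
    using homog_mult[OF c(3), of "indet v" 1] v t by simp
  show "below (corner_mon k + single v 1) (low_rank k v)" "low_rank k v \<in> homog_part V t"
  proof -
    have "below (corner_mon k + single v 1) (low_rank k v) \<and> low_rank k v \<in> homog_part V t"
    proof (cases "v \<in> box t k m n")
      case True
      then have i: "incr t m (insert_at k (skip_idx t k m) (fst v))" "incr t n (insert_at k (skip_idx t k n) (snd v))"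
        using incr_insert[OF k] t by (auto simp: box_def)
      have "below (corner_mon k + single v 1) (bordered k (fst v) (snd v))"
        using minor_below[OF _ i] diag_insert[OF k, of "skip_idx t k m" "fst v" "skip_idx t k n" "snd v"] t
        by (simp add: bordered_def corner_mon_def)
      moreover have "bordered k (fst v) (snd v) \<in> homog_part V t"
        unfolding bordered_def by (rule minor_homog[OF i])
      ultimately show ?thesis unfolding low_rank_def using 1 2 by (intro conjI below_minus homog_minus)
    next
      case False
      with 1 2 low_rank_outside[OF k v] show ?thesis by simp
    qed
    then show "below (corner_mon k + single v 1) (low_rank k v)" "low_rank k v \<in> homog_part V t" by auto
  qed
qed

text \<open>The bound for the image of \<open>u\<close> when each of its variables is replaced by
  the corresponding \<open>low_rank k\<close>. On monomials of one fixed degree it is a translation,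
  so it preserves the order strictly and is injective.\<close>

definition top_mon :: "nat \<Rightarrow> (nat \<times> nat) monomial \<Rightarrow> (nat \<times> nat) monomial" where
  "top_mon k u = u + (\<Sum>i<mon_degree u. corner_mon k)"

lemma top_mon_add: "mon_degree w = d \<Longrightarrow> top_mon k (w + single v 1) = top_mon k w + (corner_mon k + single v 1)"
proof -
  assume "mon_degree w = d"
  then have "mon_degree (w + single v 1) = Suc d" by (simp add: mon_degree_add)
  with \<open>mon_degree w = d\<close> show ?thesis by (simp add: top_mon_def ac_simps)
qed

lemma low_rank_mon:
  assumes k: "k < t" and u: "u \<in> monomials_in V"
  shows "below (top_mon k u) (mon_subst (low_rank k) u)"
    and "mon_subst (low_rank k) u \<in> homog_part V (t * mon_degree u)"
    and "keys u \<inter> box t k m n = {} \<Longrightarrow> lookup (mon_subst (low_rank k) u) (top_mon k u) = 1"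
proof -
  have "below (top_mon k u) (mon_subst (low_rank k) u) \<and> mon_subst (low_rank k) u \<in> homog_part V (t * mon_degree u) \<and>
    (keys u \<inter> box t k m n = {} \<longrightarrow> lookup (mon_subst (low_rank k) u) (top_mon k u) = 1)"
    using u
  proof (induction "mon_degree u" arbitrary: u)
    case 0
    then show ?case by (simp add: top_mon_def below_1 homog_1)
  next
    case (Suc d)
    obtain v w where vw: "v \<in> keys u" "u = w + single v 1" "mon_degree w = d"
      using mon_degree_Suc[of u d] Suc.hyps(2) by metis
    with Suc.prems have v: "v \<in> V" and w: "w \<in> monomials_in V"
      by (auto simp: monomials_in_def keys_add_nat)
    note IH = Suc.hyps(1)[of w]
    have eq: "mon_subst (low_rank k) u = mon_subst (low_rank k) w * low_rank k v"
      by (simp add: vw(2) mon_subst_add)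
    have deg: "t * mon_degree u = t * mon_degree w + t" by (simp add: vw(2) mon_degree_add distrib_left)
    have tm: "top_mon k u = top_mon k w + (corner_mon k + single v 1)"
      unfolding vw(2) by (rule top_mon_add[OF vw(3)])
    have bw: "below (top_mon k w) (mon_subst (low_rank k) w)" using IH vw(3) w by simp
    note b = below_mult[OF bw low_rank_below(1)[OF k v]]
    have "lookup (mon_subst (low_rank k) u) (top_mon k u) = 1" if "keys u \<inter> box t k m n = {}"
    proof -
      have "v \<notin> box t k m n" "keys w \<inter> box t k m n = {}" using that vw by (auto simp: keys_add_nat)
      then have "lookup (low_rank k v) (corner_mon k + single v 1) = 1"
        "lookup (mon_subst (low_rank k) w) (top_mon k w) = 1"
        using below_mult(2)[OF corner_below(1)[OF k] below_indet[OF v, where 'a = 'k]] corner_below(2)[OF k]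
          low_rank_outside[OF k v] IH vw(3) w by (simp_all add: indet_def lookup_monom_poly)
      with b(2) show ?thesis unfolding eq tm by simp
    qed
    moreover have "below (top_mon k u) (mon_subst (low_rank k) u)"
      using b(1) unfolding eq tm .
    moreover have "mon_subst (low_rank k) u \<in> homog_part V (t * mon_degree u)"
      unfolding eq deg using IH vw(3) w low_rank_below(2)[OF k v] by (intro homog_mult) auto
    ultimately show ?case by blast
  qed
  then show "below (top_mon k u) (mon_subst (low_rank k) u)"
    and "mon_subst (low_rank k) u \<in> homog_part V (t * mon_degree u)"
    and "keys u \<inter> box t k m n = {} \<Longrightarrow> lookup (mon_subst (low_rank k) u) (top_mon k u) = 1" by auto
qed

text \<open>If the initial monomial \<open>u\<close> of \<open>f\<close> avoided the box, its image
  would attain \<open>top_mon k u\<close> with coefficient 1. No other monomial of \<open>f\<close>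
  can cancel this: the evaluation multiplies degrees by \<open>t\<close>, which separates monomials
  of different degree, and smaller monomials of the same degree have smaller bounds. But
  \<open>f\<close> evaluates to zero by \<open>low_rank_kills\<close>.\<close>

lemma init_mons_meet_box:
  assumes k: "k < t" and u: "u \<in> init_mons It"
  shows "keys u \<inter> box t k m n \<noteq> {}"
proof
  assume disj: "keys u \<inter> box t k m n = {}"
  from u obtain f where f: "f \<in> It" "f \<noteq> 0" "u = initial_monomial r f" by (auto simp: init_mons_def)
  have fV: "f \<in> polys V" using f It_polys by blast
  have uf: "u \<in> keys f" "\<And>w. w \<in> keys f \<Longrightarrow> w \<preceq> u" using initial_monomial[OF fV f(2)] f(3) by auto
  have mV: "w \<in> monomials_in V" if "w \<in> keys f" for w using that fV by (auto simp: polys_def)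
  have "lookup (subst (low_rank k) f) (top_mon k u) = (\<Sum>w\<in>keys f. if w = u then lookup f u else 0)"
    unfolding subst_def lookup_sum lookup_scalar_mult
  proof (rule sum.cong)
    fix w assume w: "w \<in> keys f"
    show "lookup f w * lookup (mon_subst (low_rank k) w) (top_mon k u) = (if w = u then lookup f u else 0)"
    proof (cases "w = u")
      case True
      then show ?thesis using low_rank_mon(3)[OF k mV[OF uf(1)] disj] by simp
    next
      case False
      have "lookup (mon_subst (low_rank k) w) (top_mon k u) = 0"
      proof (rule ccontr)
        assume "\<not> ?thesis"
        then have key: "top_mon k u \<in> keys (mon_subst (low_rank k) w)" by (simp add: in_keys_iff)
        have "top_mon k u \<in> keys (mon_subst (low_rank k) u)"
          using low_rank_mon(3)[OF k mV[OF uf(1)] disj] by (simp add: in_keys_iff)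
        then have "mon_degree (top_mon k u) = t * mon_degree u"
          using low_rank_mon(2)[OF k mV[OF uf(1)]] by (simp add: homog_iff)
        moreover have "mon_degree (top_mon k u) = t * mon_degree w"
          using low_rank_mon(2)[OF k mV[OF w]] key by (simp add: homog_iff)
        ultimately have deg: "mon_degree w = mon_degree u" using t by simp
        have "top_mon k u \<preceq> top_mon k w" using low_rank_mon(1)[OF k mV[OF w]] key by (simp add: below_def)
        moreover have "top_mon k w \<preceq> top_mon k u"
        proof -
          have "(\<Sum>i<mon_degree u. corner_mon k) \<in> monomials_in V"
          proof -
            have "top_mon k u \<in> monomials_in V" using calculation le_in by blast
            then show ?thesis by (auto simp: top_mon_def monomials_in_def keys_add_nat)
          qed
          then show ?thesis unfolding top_mon_def deg by (intro le_add_right uf(2)[OF w])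
        qed
        ultimately have "top_mon k u = top_mon k w" by (rule le_antisym)
        then show False using False by (simp add: top_mon_def deg)
      qed
      with False show ?thesis by simp
    qed
  qed simp
  also have "\<dots> = lookup f u" by (auto simp: in_keys_iff)
  finally show False using low_rank_kills[OF k f(1)] uf(1) by (simp add: in_keys_iff)
qed

text \<open>Each initial monomial is divisible by a variable of the box. In other words, the initial
  ideal lies in the prime generated by these variables.\<close>

lemma subst_inI_zero:
  assumes k: "k < t" and f: "f \<in> inI" and \<rho>: "\<And>v. v \<in> box t k m n \<Longrightarrow> \<rho> v = 0"
  shows "subst \<rho> f = 0"
  unfolding subst_def
proof (rule sum.neutral, rule ballI)
  fix u assume "u \<in> keys f"
  with f obtain w x where w: "w \<in> init_mons It" "u = x + w" unfolding inI_eq by blast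
  from init_mons_meet_box[OF k w(1)] obtain v where v: "v \<in> keys w" "v \<in> box t k m n" by blast
  from in_keys_split[OF v(1)] obtain y where "w = y + single v 1" by blast
  with w(2) \<rho>[OF v(2)] show "scalar (lookup f u) * mon_subst \<rho> u = 0" by (simp add: mon_subst_add)
qed

end

section \<open>A socle element in degree \<open>t - 1\<close>\<close>

lemma mon_subst_const_0: "u \<noteq> 0 \<Longrightarrow> mon_subst (\<lambda>_. 0 :: ('w, 'k::comm_ring_1) mpoly) u = 0"
proof -
  assume "u \<noteq> 0"
  then obtain v where "v \<in> keys u" by fastforce
  from in_keys_split[OF this] obtain w where "u = w + single v 1" by blast
  then show ?thesis by (simp add: mon_subst_add)
qed

lemma subst_const_0_linear: "p \<in> homog_part V 1 \<Longrightarrow> subst (\<lambda>_. 0 :: ('w, 'k::comm_ring_1) mpoly) p = 0"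
  unfolding subst_def
proof (rule sum.neutral, rule ballI)
  fix u assume "p \<in> homog_part V 1" "u \<in> keys p"
  then have "u \<noteq> 0" by (auto simp: homog_iff)
  then show "scalar (lookup p u) * mon_subst (\<lambda>_. 0 :: ('w, 'k) mpoly) u = 0" by (simp add: mon_subst_const_0)
qed

lemma keys_subst: "u \<in> keys (subst \<rho> f) \<Longrightarrow> \<exists>w\<in>keys f. u \<in> keys (mon_subst \<rho> w)"
proof -
  assume "u \<in> keys (subst \<rho> f)"
  then have "u \<in> (\<Union>w\<in>keys f. keys (scalar (lookup f w) * mon_subst \<rho> w))"
    using keys_sum[of "\<lambda>w. scalar (lookup f w) * mon_subst \<rho> w" "keys f"] unfolding subst_def by blast
  then obtain w where "w \<in> keys f" "lookup (scalar (lookup f w) * mon_subst \<rho> w) u \<noteq> 0" by (auto simp: in_keys_iff)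
  then show ?thesis by (intro bexI[of _ w]) (auto simp: in_keys_iff)
qed

lemma homog_empty_1: "p \<in> homog_part {} 1 \<Longrightarrow> p = (0 :: ('v, 'k::comm_ring_1) mpoly)"
  using linear_form_expand[of "{}" p] by simp

lemma indet_nonzero [simp]: "indet v \<noteq> (0 :: ('v, 'k::comm_ring_1) mpoly)"
  by (metis indet_def keys_monom_poly keys_zero empty_not_insert)

lemma finite_list_card: "\<exists>xs. set xs = A \<and> length xs = card A" if "finite A"
  using finite_distinct_list[OF that] by (metis distinct_card)

lemma gen_ideal_subst_0:
  assumes "f \<in> gen_ideal V X" "X \<subseteq> polys V" "\<And>x. x \<in> X \<Longrightarrow> subst \<rho> x = 0"
  shows "subst \<rho> f = 0"
  using gen_ideal_least[OF is_ideal_kernel[of V \<rho>], of X] assms by blast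

context diag_init
begin

context
  fixes \<theta> :: "(nat \<times> nat, 'k) mpoly list"
  assumes \<theta>: "set \<theta> \<subseteq> homog_part V 1"
    and dim0: "krull_dim (mpoly_ring V Quot gen_ideal V (inI \<union> set \<theta>)) = 0"
    and len: "length \<theta> \<le> m * n - (m - t + 1) * (n - t + 1)"
begin

lemma \<theta>_polys: "set \<theta> \<subseteq> polys V"
  using \<theta> homog_polys by blast

lemma inI_\<theta>_polys: "inI \<union> set \<theta> \<subseteq> polys V"
  using \<theta>_polys is_ideal_polys[OF is_ideal_inI] by blast

text \<open>Otherwise some variable \<open>b\<close> survives after killing the box and \<theta>.
  The kernel \<open>P1\<close> of the resulting evaluation into polynomials in \<open>b\<close>, and
  the ideal \<open>P2\<close> of the origin, form a strict chain of primes above the ideal,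
  contradicting dimension zero.\<close>

lemma variables_generated:
  assumes k: "k < t" and v: "v \<in> V"
  shows "indet v \<in> gen_ideal V (set \<theta> \<union> indet ` box t k m n)"
proof -
  let ?b = "box t k m n"
  have bV: "?b \<subseteq> V" using box_vars k t by blast
  obtain bs where bs: "set bs = ?b" using finite_list_card[OF finite_box] by blast
  define ls where "ls = \<theta> @ map indet bs"
  have ls: "set ls = set \<theta> \<union> indet ` ?b" by (simp add: ls_def bs)
  have lsh: "set ls \<subseteq> homog_part V 1" using \<theta> bV by (auto simp: ls)
  obtain B \<rho> where B: "B \<subseteq> V" and \<rho>: "\<And>v. v \<in> V \<Longrightarrow> \<rho> v \<in> homog_part B 1" "\<And>b. b \<in> B \<Longrightarrow> \<rho> b = indet b"
    "\<And>l. l \<in> set ls \<Longrightarrow> subst \<rho> l = 0" "\<And>v. v \<in> V \<Longrightarrow> indet v - \<rho> v \<in> gen_ideal V (set ls)"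
    using linear_elim[OF finite_matrix_vars lsh] by blast
  have "B = {}"
  proof (rule ccontr)
    assume "B \<noteq> {}"
    then obtain b where b: "b \<in> B" by blast
    define \<sigma> where "\<sigma> = (\<lambda>v. if v = b then indet b else (0 :: (nat \<times> nat, 'k) mpoly))"
    define \<psi> where "\<psi> v = subst \<sigma> (\<rho> v)" for v
    have \<psi>: "subst \<psi> f = subst \<sigma> (subst \<rho> f)" for f by (simp add: subst_subst \<psi>_def[abs_def])
    define P1 where "P1 = {f \<in> polys V. subst \<psi> f = 0}"
    define P2 where "P2 = {f \<in> polys V. subst (\<lambda>_. 0 :: (nat \<times> nat, 'k) mpoly) f = 0}"
    have pr: "prime_ideal V P1" "prime_ideal V P2"
      unfolding P1_def P2_def by (rule prime_ideal_kernel)+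
    have "\<psi> v = 0" if "v \<in> ?b" for v
    proof -
      have "subst \<rho> (indet v) = 0" using \<rho>(3) that ls by blast
      then show ?thesis by (simp add: \<psi>_def)
    qed
    then have "inI \<subseteq> P1" using subst_inI_zero[OF k] is_ideal_polys[OF is_ideal_inI] by (auto simp: P1_def)
    moreover have "set \<theta> \<subseteq> P1" using \<rho>(3) \<theta>_polys by (auto simp: P1_def \<psi> ls)
    ultimately have J1: "gen_ideal V (inI \<union> set \<theta>) \<subseteq> P1"
      using pr(1) by (intro gen_ideal_least) (auto simp: prime_ideal_def)
    have "P1 \<subseteq> P2"
    proof
      fix f assume f: "f \<in> P1"
      have "subst (\<lambda>_. 0 :: (nat \<times> nat, 'k) mpoly) (\<psi> v) = 0" if "v \<in> V" for v
      proof -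
        have *: "subst (\<lambda>_. 0 :: (nat \<times> nat, 'k) mpoly) (\<sigma> w) = 0" for w by (simp add: \<sigma>_def)
        show ?thesis using subst_const_0_linear[OF \<rho>(1)[OF that]] by (simp add: \<psi>_def subst_subst *)
      qed
      then have "subst (\<lambda>_. 0 :: (nat \<times> nat, 'k) mpoly) (subst \<psi> f) = subst (\<lambda>_. 0 :: (nat \<times> nat, 'k) mpoly) f"
        unfolding subst_subst using f by (intro subst_cong[of f V]) (auto simp: P1_def)
      then show "f \<in> P2" using f by (simp add: P1_def P2_def)
    qed
    moreover have "indet b \<in> P2" "indet b \<notin> P1"
      using b B \<rho>(2)[OF b] by (auto simp: P1_def P2_def \<psi>_def \<sigma>_def)
    ultimately have "P1 \<subset> P2" by blast
    then have "prime_chain V (gen_ideal V (inI \<union> set \<theta>)) 1"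
      unfolding prime_chain_def
      by (intro exI[of _ "\<lambda>i. if i = 0 then P1 else P2"]) (use pr J1 in auto)
    then have "enat 1 \<le> krull_dim (mpoly_ring V Quot gen_ideal V (inI \<union> set \<theta>))"
      unfolding krull_dim_Quot[OF is_ideal_gen[OF inI_\<theta>_polys]] by (intro Sup_upper) blast
    with dim0 show False by (simp add: zero_enat_def)
  qed
  then have "\<rho> v = 0" using \<rho>(1)[OF v] homog_empty_1 by blast
  with \<rho>(4)[OF v] show ?thesis by (simp add: ls)
qed

text \<open>The position \<open>(i, i)\<close> belongs to box \<open>i\<close>. If its variable were
  generated by \<theta>, then \<theta> and the remaining \<open>c - 1\<close> variables of the box
  would generate all \<open>m * n\<close> variables, although they number fewer than
  \<open>m * n\<close>.\<close>

lemma diagonal_variable_notin: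
  assumes i: "i < t - 1"
  shows "indet (i, i) \<notin> gen_ideal V (set \<theta>)"
proof
  assume v: "indet (i, i) \<in> gen_ideal V (set \<theta>)"
  let ?b = "box t i m n"
  have bV: "?b \<subseteq> V" using box_vars[of t m n i] i t by auto
  have ib: "(i, i) \<in> ?b" using i t by (auto simp: box_def)
  obtain bs where bs: "set bs = ?b - {(i, i)}" "length bs = card (?b - {(i, i)})"
    using finite_list_card[of "?b - {(i, i)}"] by auto
  define ls where "ls = \<theta> @ map indet bs"
  have ls: "set ls = set \<theta> \<union> indet ` (?b - {(i, i)})" by (simp add: ls_def bs)
  have lsh: "set ls \<subseteq> homog_part V 1" using \<theta> bV by (auto simp: ls)
  have lsp: "set ls \<subseteq> polys V" using lsh homog_polys by blast
  have cb: "card ?b = (m - t + 1) * (n - t + 1)" using card_box t by blast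
  have "card ?b \<le> m * n" using card_mono[OF finite_matrix_vars bV] by simp
  moreover have "card ?b \<noteq> 0" using ib by auto
  moreover have "length ls = length \<theta> + (card ?b - 1)" using ib by (simp add: ls_def bs(2) card_Diff_singleton)
  moreover have "length \<theta> \<le> m * n - card ?b" using len by (simp only: cb)
  ultimately have "length ls < m * n" by linarith
  moreover obtain B \<rho> where B: "B \<subseteq> V" "card V \<le> card B + length ls" and \<rho>: "\<And>b. b \<in> B \<Longrightarrow> \<rho> b = indet b"
    "\<And>l. l \<in> set ls \<Longrightarrow> subst \<rho> l = 0"
    using linear_elim[OF finite_matrix_vars lsh] by blast
  ultimately have "card B \<noteq> 0" by auto
  then have "B \<noteq> {}" by auto
  then obtain b where b: "b \<in> B" by blast
  have it: "i < t" using i by simp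
  have "gen_ideal V (set \<theta> \<union> indet ` ?b) \<subseteq> gen_ideal V (set ls)"
  proof (rule gen_ideal_mono[OF lsp])
    have "gen_ideal V (set \<theta>) \<subseteq> gen_ideal V (set ls)" by (rule gen_ideal_mono'[OF lsp]) (auto simp: ls)
    with v have "indet (i, i) \<in> gen_ideal V (set ls)" by blast
    moreover have "set ls \<subseteq> gen_ideal V (set ls)" by (rule gen_ideal_superset[OF lsp])
    ultimately show "set \<theta> \<union> indet ` ?b \<subseteq> gen_ideal V (set ls)" by (auto simp: ls)
  qed
  then have "indet b \<in> gen_ideal V (set ls)" using variables_generated[OF it, of b] b B by blast
  then have "subst \<rho> (indet b) = 0" by (rule gen_ideal_subst_0[OF _ lsp \<rho>(2)])
  then show False using \<rho>(1)[OF b] by simp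
qed

definition corner_diag :: "(nat \<times> nat) monomial" where
  "corner_diag = diag_mon (t - 1) (\<lambda>i. i) (\<lambda>i. i)"

lemma corner_diag_homog: "monom_poly corner_diag \<in> homog_part V (t - 1)"
  unfolding corner_diag_def using t by (auto simp: matrix_vars_def intro!: diag_mon_in)

text \<open>After elimination of \<theta> the ideal has only terms of degree at least
  \<open>t\<close>. The product of degree \<open>t - 1\<close> becomes a product of linear forms,
  which vanishes in a domain only if one factor does, that is, if some \<open>indet (i, i)\<close>
  is generated by \<theta>.\<close>

lemma corner_diag_notin: "monom_poly corner_diag \<notin> gen_ideal V (inI \<union> set \<theta>)"
proof
  assume a: "monom_poly corner_diag \<in> gen_ideal V (inI \<union> set \<theta>)"
  obtain B \<rho> where B: "B \<subseteq> V" and \<rho>: "\<And>v. v \<in> V \<Longrightarrow> \<rho> v \<in> homog_part B 1"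
    "\<And>l. l \<in> set \<theta> \<Longrightarrow> subst \<rho> l = 0" "\<And>v. v \<in> V \<Longrightarrow> indet v - \<rho> v \<in> gen_ideal V (set \<theta>)"
    using linear_elim[OF finite_matrix_vars \<theta>] by blast
  let ?P = "{f \<in> polys V. \<forall>u\<in>keys (subst \<rho> f). t \<le> mon_degree u}"
  have "is_ideal V ?P"
  proof (rule is_idealI)
    fix x y assume "x \<in> ?P" "y \<in> ?P"
    then show "x + y \<in> ?P" using keys_add[of "subst \<rho> x" "subst \<rho> y"] by (auto simp: subst_add polys_add)
  next
    fix a x :: "(nat \<times> nat, 'k) mpoly" assume a: "a \<in> polys V" and x: "x \<in> ?P"
    have "t \<le> mon_degree u" if "u \<in> keys (subst \<rho> (a * x))" for u
    proof -
      from that obtain b w where "u = b + w" "w \<in> keys (subst \<rho> x)"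
        using keys_mult[of "subst \<rho> a" "subst \<rho> x"] by (auto simp: subst_mult)
      with x show ?thesis by (auto simp: mon_degree_add intro: trans_le_add2)
    qed
    with a x show "a * x \<in> ?P" by (auto simp: polys_mult)
  qed auto
  moreover have "inI \<subseteq> ?P"
  proof
    fix f assume f: "f \<in> inI"
    then have fV: "f \<in> polys V" using is_ideal_polys[OF is_ideal_inI] by blast
    have "t \<le> mon_degree u" if "u \<in> keys (subst \<rho> f)" for u
    proof -
      from keys_subst[OF that] obtain w where w: "w \<in> keys f" "u \<in> keys (mon_subst \<rho> w)" by blast
      have "mon_subst \<rho> w \<in> homog_part B (mon_degree w)"
        using fV w(1) by (intro homog_mon_subst \<rho>(1)) (auto simp: polys_def monomials_in_def)
      with w(2) have "mon_degree u = mon_degree w" by (simp add: homog_iff)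
      with inI_low_degree(1)[OF f w(1)] show ?thesis by simp
    qed
    with fV show "f \<in> ?P" by blast
  qed
  moreover have "set \<theta> \<subseteq> ?P" using \<rho>(2) \<theta>_polys by auto
  ultimately have "gen_ideal V (inI \<union> set \<theta>) \<subseteq> ?P" by (intro gen_ideal_least) auto
  with a have low: "\<forall>u\<in>keys (mon_subst \<rho> corner_diag). t \<le> mon_degree u" by auto
  have "subst \<rho> (monom_poly corner_diag) \<in> homog_part B (t - 1)"
    by (rule homog_subst[OF \<rho>(1) corner_diag_homog])
  then have "mon_degree u = t - 1" if "u \<in> keys (mon_subst \<rho> corner_diag)" for u
    using that by (simp add: homog_iff)
  with low t have "keys (mon_subst \<rho> corner_diag) = {}" by fastforce
  then have "mon_subst \<rho> corner_diag = 0" by simp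
  then have "(\<Prod>i<t - 1. \<rho> (i, i)) = 0"
    unfolding corner_diag_def diag_mon_def by (simp add: mon_subst_sum)
  then obtain i where i: "i < t - 1" "\<rho> (i, i) = 0" by auto
  have "(i, i) \<in> V" using i t by (auto simp: matrix_vars_def)
  from \<rho>(3)[OF this] i have "indet (i, i) \<in> gen_ideal V (set \<theta>)" by simp
  with diagonal_variable_notin[OF i(1)] show False by blast
qed

text \<open>Times a variable of the last box, \<open>corner_diag\<close> becomes the diagonal of a
  \<open>t\<close>-minor. These variables and \<theta> generate all linear forms by
  \<open>variables_generated\<close>.\<close>

lemma corner_diag_socle:
  assumes L: "L \<in> homog_part V 1"
  shows "L * monom_poly corner_diag \<in> gen_ideal V (inI \<union> set \<theta>)"
proof -
  let ?J = "gen_ideal V (inI \<union> set \<theta>)"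
  note J = is_ideal_gen[OF inI_\<theta>_polys]
  let ?P = "{f \<in> polys V. f * monom_poly corner_diag \<in> ?J}"
  have cV: "monom_poly corner_diag \<in> polys V" using corner_diag_homog homog_polys by blast
  have "is_ideal V ?P"
    by (rule is_idealI)
      (auto simp: distrib_right polys_add polys_mult mult.assoc intro: is_ideal_0[OF J] is_ideal_add[OF J] is_ideal_mult[OF J])
  moreover have "set \<theta> \<subseteq> ?P"
    using \<theta>_polys gen_ideal_superset[OF inI_\<theta>_polys] cV by (auto intro: is_ideal_mult_right[OF J])
  moreover have "indet ` box t (t - 1) m n \<subseteq> ?P"
  proof
    fix x :: "(nat \<times> nat, 'k) mpoly" assume "x \<in> indet ` box t (t - 1) m n"
    then obtain i j where x: "x = indet (i, j)" and "(i, j) \<in> box t (t - 1) m n" by auto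
    then have ij: "t - 1 \<le> i" "i < m" "t - 1 \<le> j" "j < n" using t by (auto simp: box_def)
    define f where "f p = (if p < t - 1 then p else i)" for p
    define g where "g p = (if p < t - 1 then p else j)" for p
    have fg: "incr t m f" "incr t n g" using ij t by (auto simp: incr_def f_def g_def)
    have "diag_mon t f g = diag_mon (t - 1) f g + single (i, j) 1"
      using diag_mon_Suc[of "t - 1" f g] t by (simp add: f_def g_def)
    also have "diag_mon (t - 1) f g = corner_diag"
      unfolding diag_mon_def corner_diag_def by (rule sum.cong) (auto simp: f_def g_def)
    finally have "x * monom_poly corner_diag = monom_poly (0 + diag_mon t f g)"
      by (simp add: x monom_poly_add indet_def mult.commute)
    also have "\<dots> \<in> inI" by (rule diag_mult_in_inI[OF fg monomials_in_zero])
    finally show "x \<in> ?P" using gen_ideal_superset[OF inI_\<theta>_polys] ij by (auto simp: x matrix_vars_def)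
  qed
  ultimately have sub: "gen_ideal V (set \<theta> \<union> indet ` box t (t - 1) m n) \<subseteq> ?P"
    by (intro gen_ideal_least) auto
  have LP: "L \<in> ?P"
  proof -
    have v: "indet v \<in> ?P" if "v \<in> V" for v
      using sub variables_generated[OF _ that, of "t - 1"] t by auto
    have "L = (\<Sum>v\<in>V. scalar (lookup L (single v 1)) * indet v)"
      by (rule linear_form_expand[OF finite_matrix_vars L])
    moreover have "\<dots> \<in> ?P"
      by (rule is_ideal_sum[OF \<open>is_ideal V ?P\<close>], rule is_ideal_mult[OF \<open>is_ideal V ?P\<close> polys_scalar v])
    ultimately show ?thesis by simp
  qed
  then show ?thesis by blast
qed

end

section \<open>Failure of surjectivity\<close>

definition diag_mons :: "(nat \<times> nat) monomial set" where
  "diag_mons = pair_diag t ` minor_pairs m n t"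

lemma diag_mons_I: "incr t m f \<Longrightarrow> incr t n g \<Longrightarrow> diag_mon t f g \<in> diag_mons"
proof -
  assume fg: "incr t m f" "incr t n g"
  let ?x = "(f ` {..<t}, g ` {..<t})"
  have "?x \<in> minor_pairs m n t"
    using fg card_image[OF incr_inj_on[OF fg(1)]] card_image[OF incr_inj_on[OF fg(2)]]
    by (auto simp: minor_pairs_def incr_def)
  moreover have "pair_diag t ?x = diag_mon t f g"
    unfolding pair_diag_def diag_mon_def
    by (rule sum.cong) (auto simp: pick_incr[OF fg(1)] pick_incr[OF fg(2)])
  ultimately show ?thesis unfolding diag_mons_def by (metis imageI)
qed

lemma diag_mons_E: "u \<in> diag_mons \<Longrightarrow> \<exists>f g. incr t m f \<and> incr t n g \<and> u = diag_mon t f g"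
  unfolding diag_mons_def pair_diag_def using minor_pairs_incr by blast

lemma card_diag_mons: "card diag_mons = (m choose t) * (n choose t)"
  unfolding diag_mons_def by (simp add: card_image[OF pair_diag_inj] card_minor_pairs)

lemma finite_diag_mons [simp]: "finite diag_mons"
  by (simp add: diag_mons_def)

text \<open>The linear functional on forms of degree \<open>t\<close> in the variables
  \<open>B\<close> with values \<phi> on the monomials. Failure of surjectivity is certified by a
  nonzero functional that vanishes on the image.\<close>

definition pairing :: "(nat \<times> nat) set \<Rightarrow> ((nat \<times> nat) monomial \<Rightarrow> 'k) \<Rightarrow> (nat \<times> nat, 'k) mpoly \<Rightarrow> 'k" where
  "pairing B \<phi> p = (\<Sum>u\<in>mons B t. \<phi> u * lookup p u)"

lemma pairing_add: "pairing B \<phi> (p + q) = pairing B \<phi> p + pairing B \<phi> q"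
  by (simp add: pairing_def lookup_add distrib_left sum.distrib)

lemma pairing_scalar: "pairing B \<phi> (scalar c * p) = c * pairing B \<phi> p"
  by (simp add: pairing_def sum_distrib_left mult.left_commute)

lemma pairing_sum: "pairing B \<phi> (\<Sum>i\<in>A. f i) = (\<Sum>i\<in>A. pairing B \<phi> (f i))"
  by (induction A rule: infinite_finite_induct) (auto simp: pairing_add, auto simp: pairing_def)

lemma pairing_exists:
  assumes "finite B" "finite Z" "card Z < card (mons B t)"
  shows "\<exists>\<phi>. (\<exists>u\<in>mons B t. \<phi> u \<noteq> 0) \<and> (\<forall>z\<in>Z. pairing B \<phi> z = 0)"
  using linear_relation[of Z "mons B t" "\<lambda>u z. lookup z u"] assms card_mons[OF assms(1), of t]
  by (auto simp: pairing_def)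

lemma pairing_linear_mult:
  assumes "finite B" "p \<in> homog_part B 1" "\<And>b. b \<in> B \<Longrightarrow> pairing B \<phi> (q * indet b) = 0"
  shows "pairing B \<phi> (q * p) = 0"
proof -
  have "q * p = (\<Sum>b\<in>B. scalar (lookup p (single b 1)) * (q * indet b))"
    by (subst linear_form_expand[OF assms(1,2)]) (simp add: sum_distrib_left mult_ac)
  then show ?thesis using assms(3) by (simp add: pairing_sum pairing_scalar)
qed

text \<open>The \<open>c\<close> diagonals extending the first \<open>t - 1\<close> entries of the main diagonal only impose
  \<open>c - 1\<close> conditions.\<close>

lemma pairing_kills_diagonals:
  assumes B: "finite B" "card B + 1 = (m - t + 1) * (n - t + 1)" and \<rho>: "\<And>v. v \<in> V \<Longrightarrow> \<rho> v \<in> homog_part B 1"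
    and N: "(m choose t) * (n choose t) \<le> card (mons B t)"
  shows "\<exists>\<phi>. (\<exists>u\<in>mons B t. \<phi> u \<noteq> 0) \<and> (\<forall>u\<in>diag_mons. pairing B \<phi> (mon_subst \<rho> u) = 0)"
proof -
  define T where "T = diag_mon (t - 1) (\<lambda>i. i) (\<lambda>i. i)"
  let ?b = "box t (t - 1) m n"
  define D where "D = (\<lambda>w. T + single w 1) ` ?b"
  have inj: "inj_on (\<lambda>w. T + single w (1::nat)) ?b"
    by (rule inj_onI) (simp only: add_left_cancel single_1_eq_iff)
  have cD: "card D = card B + 1" unfolding D_def card_image[OF inj] using card_box t B by simp
  have D: "D \<subseteq> diag_mons"
  proof
    fix u assume "u \<in> D"
    then obtain i j where u: "u = T + single (i, j) 1" and "(i, j) \<in> ?b" by (auto simp: D_def)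
    then have ij: "t - 1 \<le> i" "i < m" "t - 1 \<le> j" "j < n" using t by (auto simp: box_def)
    define f where "f p = (if p < t - 1 then p else i)" for p
    define g where "g p = (if p < t - 1 then p else j)" for p
    have fg: "incr t m f" "incr t n g" using ij t by (auto simp: incr_def f_def g_def)
    have "diag_mon t f g = diag_mon (t - 1) f g + single (i, j) 1"
      using diag_mon_Suc[of "t - 1" f g] t by (simp add: f_def g_def)
    also have "diag_mon (t - 1) f g = T"
      unfolding diag_mon_def T_def by (rule sum.cong) (auto simp: f_def g_def)
    finally show "u \<in> diag_mons" using diag_mons_I[OF fg] u by simp
  qed
  \<comment> \<open>All members of \<open>D\<close> become \<open>mon_subst \<rho> T\<close> times a
    linear form in \<open>B\<close>, so it is enough to kill the \<open>card B = c - 1\<close>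
    products with variables. The one condition saved gives a strict inequality even in case of a
    tie.\<close>
  define Z where "Z = mon_subst \<rho> ` (diag_mons - D) \<union> (\<lambda>b. mon_subst \<rho> T * indet b) ` B"
  have "card Z \<le> card (diag_mons - D) + card B"
    unfolding Z_def by (rule order_trans[OF card_Un_le add_mono]) (use B in \<open>auto intro: card_image_le\<close>)
  also have "card (diag_mons - D) = (m choose t) * (n choose t) - (card B + 1)"
    using D cD by (simp add: card_Diff_subset finite_subset[OF D] card_diag_mons)
  also have "\<dots> + card B < (m choose t) * (n choose t)"
    using card_mono[OF finite_diag_mons D] cD by (simp add: card_diag_mons)
  finally have "card Z < card (mons B t)" using N by simp
  moreover have "finite Z" using B by (simp add: Z_def)
  ultimately obtain \<phi> where \<phi>: "\<exists>u\<in>mons B t. \<phi> u \<noteq> 0" "\<And>z. z \<in> Z \<Longrightarrow> pairing B \<phi> z = 0"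
    using pairing_exists[OF B(1), of Z] by auto
  have "pairing B \<phi> (mon_subst \<rho> u) = 0" if "u \<in> diag_mons" for u
  proof (cases "u \<in> D")
    case False
    with that show ?thesis by (intro \<phi>(2)) (simp add: Z_def)
  next
    case True
    then obtain w where w: "w \<in> ?b" "u = T + single w 1" by (auto simp: D_def)
    have "pairing B \<phi> (mon_subst \<rho> T * \<rho> w) = 0"
      by (rule pairing_linear_mult[OF B(1) \<rho>])
        (use w box_vars[of t m n "t - 1"] t \<phi>(2) in \<open>auto simp: Z_def\<close>)
    then show ?thesis by (simp add: w mon_subst_add)
  qed
  with \<phi>(1) show ?thesis by blast
qed

text \<open>After \<theta> and \<open>L\<close> are eliminated, every element of the ideal has a
  degree-\<open>t\<close> part spanned by images of diagonals, and multiples of \<open>L\<close>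
  vanish. A functional killing these images but not some monomial separates that monomial from the
  image. Its existence is the hypothesis \<open>kill\<close>, because the regular and the
  exceptional case construct it differently.\<close>

lemma not_surjective:
  fixes \<theta> :: "(nat \<times> nat, 'k) mpoly list"
  assumes \<theta>: "set \<theta> \<subseteq> homog_part V 1" and len: "length \<theta> \<le> m * n - (m - t + 1) * (n - t + 1)"
    and L: "L \<in> homog_part V 1"
    and kill: "\<And>B \<rho>. B \<subseteq> V \<Longrightarrow> card B + 1 = (m - t + 1) * (n - t + 1) \<Longrightarrow> (\<And>v. v \<in> V \<Longrightarrow> \<rho> v \<in> homog_part B 1) \<Longrightarrow>
      \<exists>\<phi>. (\<exists>u\<in>mons B t. \<phi> u \<noteq> 0) \<and> (\<forall>u\<in>diag_mons. pairing B \<phi> (mon_subst \<rho> u) = 0)"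
  shows "\<exists>g\<in>homog_part V t. \<forall>f\<in>polys V. g - L * f \<notin> gen_ideal V (inI \<union> set \<theta>)"
proof -
  define c where "c = (m - t + 1) * (n - t + 1)"
  have "c \<le> m * n" unfolding c_def using card_mono[OF finite_matrix_vars box_vars[of t m n 0]] card_box[of t m n 0] t by simp
  moreover have "1 \<le> c" unfolding c_def by (simp add: Suc_le_eq flip: Suc_eq_plus1)
  moreover have lsh: "set (\<theta> @ [L]) \<subseteq> homog_part V 1" using \<theta> L by auto
  obtain B0 \<rho>0 where B0: "B0 \<subseteq> V" "card V \<le> card B0 + length (\<theta> @ [L])"
    and \<rho>0: "\<And>v. v \<in> V \<Longrightarrow> \<rho>0 v \<in> homog_part B0 1" "\<And>b. b \<in> B0 \<Longrightarrow> \<rho>0 b = indet b"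
      "\<And>l. l \<in> set (\<theta> @ [L]) \<Longrightarrow> subst \<rho>0 l = 0"
    using linear_elim[OF finite_matrix_vars lsh] by blast
  ultimately have "c - 1 \<le> card B0" using len unfolding c_def[symmetric] by simp
  \<comment> \<open>Elimination leaves at least \<open>c - 1\<close> variables. Exactly
    \<open>c - 1\<close> of them are kept and the others are set to zero by \<kappa>, since
    \<open>kill\<close> is stated for that number.\<close>
  then obtain B where B: "B \<subseteq> B0" "card B = c - 1" by (rule obtain_subset_with_card_n)
  define \<kappa> where "\<kappa> = (\<lambda>v. if v \<in> B then indet v else (0 :: (nat \<times> nat, 'k) mpoly))"
  define \<rho> where "\<rho> v = subst \<kappa> (\<rho>0 v)" for v
  have \<rho>eq: "subst \<rho> f = subst \<kappa> (subst \<rho>0 f)" for f by (simp add: subst_subst \<rho>_def[abs_def])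
  have BV: "B \<subseteq> V" using B B0 by blast
  have finB: "finite B" using finite_subset[OF BV] by simp
  have \<rho>h: "\<rho> v \<in> homog_part B 1" if "v \<in> V" for v
    unfolding \<rho>_def by (rule homog_subst[OF _ \<rho>0(1)[OF that]]) (simp add: \<kappa>_def)
  have \<rho>B: "\<rho> b = indet b" if "b \<in> B" for b using that B \<rho>0(2)[of b] by (auto simp: \<rho>_def \<kappa>_def)
  have \<rho>l: "subst \<rho> l = 0" if "l \<in> set (\<theta> @ [L])" for l using \<rho>0(3)[OF that] by (simp add: \<rho>eq)
  have "card B + 1 = (m - t + 1) * (n - t + 1)" using B(2) \<open>1 \<le> c\<close> by (simp add: c_def)
  then have "\<exists>\<phi>. (\<exists>u\<in>mons B t. \<phi> u \<noteq> 0) \<and> (\<forall>u\<in>diag_mons. pairing B \<phi> (mon_subst \<rho> u) = 0)"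
    by (intro kill[OF BV]) (use \<rho>h in auto)
  then obtain \<phi> u0 where u0: "u0 \<in> mons B t" "\<phi> u0 \<noteq> 0"
    and \<phi>: "\<And>u. u \<in> diag_mons \<Longrightarrow> pairing B \<phi> (mon_subst \<rho> u) = 0" by blast
  \<comment> \<open>The degree condition is what makes this an ideal: a multiplier then acts on the
    degree-\<open>t\<close> part by its constant term, so the functional remains zero.\<close>
  let ?P = "{f \<in> polys V. (\<forall>u\<in>keys (subst \<rho> f). t \<le> mon_degree u) \<and> pairing B \<phi> (subst \<rho> f) = 0}"
  have "is_ideal V ?P"
  proof (rule is_idealI)
    fix x y assume "x \<in> ?P" "y \<in> ?P"
    then show "x + y \<in> ?P" using keys_add[of "subst \<rho> x" "subst \<rho> y"] by (auto simp: subst_add polys_add pairing_add)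
  next
    fix a x :: "(nat \<times> nat, 'k) mpoly" assume a: "a \<in> polys V" and x: "x \<in> ?P"
    have "t \<le> mon_degree u" if "u \<in> keys (subst \<rho> (a * x))" for u
    proof -
      from that obtain b w where "u = b + w" "w \<in> keys (subst \<rho> x)"
        using keys_mult[of "subst \<rho> a" "subst \<rho> x"] by (auto simp: subst_mult)
      with x show ?thesis by (auto simp: mon_degree_add intro: trans_le_add2)
    qed
    moreover have "pairing B \<phi> (subst \<rho> (a * x)) = lookup (subst \<rho> a) 0 * pairing B \<phi> (subst \<rho> x)"
    proof -
      have dp: "degpart t (subst \<rho> a * subst \<rho> x) = scalar (lookup (subst \<rho> a) 0) * degpart t (subst \<rho> x)"
        by (rule degpart_mult) (use x in auto)
      have "lookup (subst \<rho> a * subst \<rho> x) u = lookup (subst \<rho> a) 0 * lookup (subst \<rho> x) u" if "u \<in> mons B t" for u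
        using arg_cong[OF dp, of "\<lambda>p. lookup p u"] that by (simp add: lookup_degpart mons_def)
      then show ?thesis by (simp add: pairing_def subst_mult sum_distrib_left mult_ac)
    qed
    ultimately show "a * x \<in> ?P" using a x by (auto simp: polys_mult)
  qed (auto simp: pairing_def)
  moreover have "inI \<subseteq> ?P"
  proof
    fix f assume f: "f \<in> inI"
    then have fV: "f \<in> polys V" using is_ideal_polys[OF is_ideal_inI] by blast
    have mh: "mon_subst \<rho> w \<in> homog_part B (mon_degree w)" if "w \<in> keys f" for w
      using fV that by (intro homog_mon_subst \<rho>h) (auto simp: polys_def monomials_in_def)
    have "t \<le> mon_degree u" if "u \<in> keys (subst \<rho> f)" for u
    proof -
      from keys_subst[OF that] obtain w where w: "w \<in> keys f" "u \<in> keys (mon_subst \<rho> w)" by blast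
      with mh have "mon_degree u = mon_degree w" by (simp add: homog_iff)
      with inI_low_degree(1)[OF f w(1)] show ?thesis by simp
    qed
    moreover have "pairing B \<phi> (mon_subst \<rho> w) = 0" if "w \<in> keys f" for w
    proof (cases "mon_degree w = t")
      case True
      with inI_low_degree(2)[OF f that] show ?thesis by (intro \<phi>) (simp add: diag_mons_def)
    next
      case False
      have "lookup (mon_subst \<rho> w) u = 0" if "u \<in> mons B t" for u
      proof -
        have "u \<notin> keys (mon_subst \<rho> w)" using mh[OF \<open>w \<in> keys f\<close>] that False by (auto simp: mons_def homog_iff)
        then show ?thesis by (simp add: in_keys_iff)
      qed
      then show ?thesis by (simp add: pairing_def)
    qed
    then have "pairing B \<phi> (subst \<rho> f) = 0" by (simp add: subst_def pairing_sum pairing_scalar)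
    ultimately show "f \<in> ?P" using fV by blast
  qed
  moreover have "set \<theta> \<subseteq> ?P"
  proof
    fix x assume "x \<in> set \<theta>"
    then show "x \<in> ?P" using \<rho>l[of x] \<theta> homog_polys[of x V 1] by (auto simp: pairing_def)
  qed
  ultimately have J: "gen_ideal V (inI \<union> set \<theta>) \<subseteq> ?P" by (intro gen_ideal_least) auto
  let ?g = "monom_poly u0 :: (nat \<times> nat, 'k) mpoly"
  have gB: "?g \<in> polys B" using u0 by (simp add: mons_def)
  have sg: "subst \<rho> ?g = ?g"
    using subst_cong[OF gB, of \<rho> indet] \<rho>B by simp
  have "?g - L * f \<notin> gen_ideal V (inI \<union> set \<theta>)" for f
  proof
    assume "?g - L * f \<in> gen_ideal V (inI \<union> set \<theta>)"
    with J have "pairing B \<phi> (subst \<rho> (?g - L * f)) = 0" by blast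
    then have "pairing B \<phi> ?g = 0" using \<rho>l[of L] sg by (simp add: subst_minus subst_mult del: subst_monom_poly)
    moreover have "pairing B \<phi> ?g = \<phi> u0"
    proof -
      have "pairing B \<phi> ?g = (\<Sum>u\<in>mons B t. if u = u0 then \<phi> u0 else 0)"
        unfolding pairing_def by (rule sum.cong) (auto simp: lookup_monom_poly)
      then show ?thesis using u0(1) card_mons[OF finB, of t] by simp
    qed
    ultimately show False using u0(2) by simp
  qed
  moreover have "?g \<in> homog_part V t" using u0(1) BV by (auto simp: mons_def monomials_in_def)
  ultimately show ?thesis by blast
qed

lemma not_weak_lefschetz:
  assumes kill: "\<And>B \<rho>. B \<subseteq> V \<Longrightarrow> card B + 1 = (m - t + 1) * (n - t + 1) \<Longrightarrow> (\<And>v. v \<in> V \<Longrightarrow> \<rho> v \<in> homog_part B 1) \<Longrightarrow>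
      \<exists>\<phi>. (\<exists>u\<in>mons B t. \<phi> u \<noteq> 0) \<and> (\<forall>u\<in>diag_mons. pairing B \<phi> (mon_subst \<rho> u) = 0)"
  shows "\<not> weak_lefschetz V inI"
proof
  assume "weak_lefschetz V inI"
  then obtain \<theta> L where sop: "linear_sop V inI \<theta>" and L: "L \<in> homog_part V 1"
    and max: "has_maximal_rank V (extended_ideal V inI \<theta>) L 1 (t - 1)"
    unfolding weak_lefschetz_def by blast
  have \<theta>: "set \<theta> \<subseteq> homog_part V 1" using sop by (simp add: linear_sop_def)
  have dim0: "krull_dim (mpoly_ring V Quot gen_ideal V (inI \<union> set \<theta>)) = 0"
    using sop by (simp add: linear_sop_def extended_ideal_def)
  have "enat (length \<theta>) = krull_dim (mpoly_ring V Quot inI)" using sop by (simp add: linear_sop_def)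
  also have "\<dots> \<le> enat (m * n - (m - t + 1) * (n - t + 1))"
    by (rule krull_dim_le[OF finite_matrix_vars is_ideal_inI sparse_in_inI])
  finally have len: "length \<theta> \<le> m * n - (m - t + 1) * (n - t + 1)" by simp
  let ?J = "gen_ideal V (inI \<union> set \<theta>)"
  have J: "is_ideal V ?J" by (rule is_ideal_gen[OF inI_\<theta>_polys[OF \<theta> dim0 len]])
  let ?\<phi> = "\<lambda>x. (coset V ?J L [^]\<^bsub>mpoly_ring V Quot ?J\<^esub> (1::nat)) \<otimes>\<^bsub>mpoly_ring V Quot ?J\<^esub> x"
  from max consider "inj_on ?\<phi> (coset V ?J ` homog_part V (t - 1))"
    | "?\<phi> ` coset V ?J ` homog_part V (t - 1) = coset V ?J ` homog_part V (t - 1 + 1)"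
    unfolding has_maximal_rank_def extended_ideal_def quot_part_def Let_def by blast
  then show False
  proof cases
    case 1
    then have "\<forall>f\<in>homog_part V (t - 1). L ^ 1 * f \<in> ?J \<longrightarrow> f \<in> ?J"
      by (simp only: has_maximal_rank_iff(1)[OF J L])
    then show False
      using corner_diag_homog[OF \<theta> dim0 len] corner_diag_notin[OF \<theta> dim0 len] corner_diag_socle[OF \<theta> dim0 len L]
      by auto
  next
    case 2
    then have "\<forall>g\<in>homog_part V (t - 1 + 1). \<exists>f\<in>homog_part V (t - 1). g - L ^ 1 * f \<in> ?J"
      by (simp only: has_maximal_rank_iff(2)[OF J L])
    moreover have "t - 1 + 1 = t" using t by simp
    ultimately have sur: "\<forall>g\<in>homog_part V t. \<exists>f\<in>homog_part V (t - 1). g - L * f \<in> ?J" by simp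
    have "\<exists>g\<in>homog_part V t. \<forall>f\<in>polys V. g - L * f \<notin> ?J"
      by (rule not_surjective[OF \<theta> len L]) (rule kill)
    with sur show False using homog_polys by blast
  qed
qed

end

section \<open>The numerical inequality\<close>

text \<open>The Pochhammer symbol, that is, \<open>fact t\<close> times the number of monomials of
  degree \<open>t\<close> in \<open>x\<close> variables. In this form binomial coefficients can be
  compared factor by factor.\<close>

definition rising :: "nat \<Rightarrow> nat \<Rightarrow> nat" where
  "rising x t = (\<Prod>i<t. x + i)"

lemma rising_Suc: "rising x (Suc t) = rising x t * (x + t)"
  by (simp add: rising_def)

lemma rising_pos: "0 < x \<Longrightarrow> 0 < rising x t"
  by (simp add: rising_def)

lemma choose_rising: "0 < x \<Longrightarrow> (x + t - 1 choose t) * fact t = rising x t"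
proof (induction t)
  case (Suc t)
  have "(x + t choose Suc t) * Suc t = (x + t) * (x + t - 1 choose t)"
    using Suc_times_binomial_eq[of "x + t - 1" t] Suc.prems by (simp add: mult.commute)
  then have "(x + t choose Suc t) * fact (Suc t) = (x + t) * ((x + t - 1 choose t) * fact t)"
    by (metis fact_Suc mult.assoc of_nat_id)
  with Suc show ?case by (simp add: rising_Suc)
qed (simp add: rising_def)

text \<open>For \<open>a = m - t + 1\<close> and \<open>b = n - t + 1\<close> this compares the
  number of \<open>t\<close>-minors with the number of monomials of degree \<open>t\<close> in
  \<open>a * b - 1\<close> variables, both multiplied by \<open>fact t * fact t\<close>.\<close>

definition rising_le :: "nat \<Rightarrow> nat \<Rightarrow> nat \<Rightarrow> bool" where
  "rising_le t a b \<longleftrightarrow> rising a t * rising b t \<le> rising (a * b - 1) t * fact t"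

lemma rising_le_commute: "rising_le t a b \<longleftrightarrow> rising_le t b a"
  by (simp add: rising_le_def mult.commute)

text \<open>When \<open>b\<close> increases, the \<open>i\<close>-th factor on the left grows by the
  ratio of \<open>b + 1 + i\<close> to \<open>b + i\<close>, and on the right by the ratio of
  \<open>a * b - 1 + a + i\<close> to \<open>a * b - 1 + i\<close>. The second ratio is at least as
  large because \<open>a * b - 1 + i \<le> a * (b + i)\<close>. So only minimal pairs
  \<open>a\<close>, \<open>b\<close> have to be checked.\<close>

lemma rising_le_Suc:
  assumes "rising_le t a b" "1 \<le> a" "1 \<le> b"
  shows "rising_le t a (Suc b)"
proof -
  have "rising (a * b - 1) t * rising (b + 1) t \<le> rising (a * Suc b - 1) t * rising b t"
    unfolding rising_def prod.distrib[symmetric]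
  proof (rule prod_mono, rule conjI)
    fix i
    define x where "x = a * b - 1"
    have "1 \<le> a * b" using mult_le_mono[OF assms(2,3)] by simp
    then have x: "a * Suc b - 1 = x + a" "x + 1 = a * b" by (simp_all add: x_def)
    have "i \<le> a * i" using assms(2) by simp
    then have "x + i \<le> a * (b + i)" using x(2) unfolding distrib_left by linarith
    then have "(x + i) * (b + 1 + i) \<le> (x + a + i) * (b + i)" by (simp add: algebra_simps)
    then show "(a * b - 1 + i) * (b + 1 + i) \<le> (a * Suc b - 1 + i) * (b + i)" by (simp only: x x_def[symmetric])
  qed simp
  then have "rising a t * rising b t * rising (b + 1) t \<le> rising (a * Suc b - 1) t * rising b t * fact t"
    using mult_right_mono[OF assms(1)[unfolded rising_le_def], of "rising (b + 1) t"]
    by (smt (verit, best) le_trans mult.commute mult.left_commute mult_le_mono2 zero_le)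
  then have "rising b t * (rising a t * rising (b + 1) t) \<le> rising b t * (rising (a * Suc b - 1) t * fact t)"
    by (simp add: mult_ac)
  moreover have "0 < rising b t" using assms(3) by (intro rising_pos) simp
  ultimately show ?thesis by (simp add: rising_le_def flip: Suc_eq_plus1)
qed

lemma rising_le_mono:
  assumes "rising_le t a b" "1 \<le> a" "1 \<le> b" "a \<le> a'" "b \<le> b'"
  shows "rising_le t a' b'"
proof -
  have 1: "rising_le t a b'" using assms(5)
    by (induction b' rule: dec_induct) (use assms rising_le_Suc in auto)
  have "rising_le t b' a'" using assms(4)
  proof (induction a' rule: dec_induct)
    case base
    show ?case using 1 by (simp add: rising_le_commute)
  next
    case (step k)
    then show ?case using assms by (intro rising_le_Suc) auto
  qed
  then show ?thesis by (simp add: rising_le_commute)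
qed

text \<open>The three values entering the pair \<open>a = 2\<close>, \<open>b = 3\<close>, for which
  \<open>a * b - 1 = 5\<close>.\<close>

lemma rising_small: "rising 2 t = fact (t + 1)" "2 * rising 3 t = fact (t + 2)" "24 * rising 5 t = fact (t + 4)"
proof (induction t)
  case 0
  show "rising 2 0 = fact (0 + 1)" "2 * rising 3 0 = fact (0 + 2)" "24 * rising 5 0 = fact (0 + 4)"
    by (simp_all add: rising_def fact_numeral)
next
  case (Suc t)
  show "rising 2 (Suc t) = fact (Suc t + 1)" using Suc(1) by (simp add: rising_Suc algebra_simps)
  have "2 * rising 3 (Suc t) = (2 * rising 3 t) * (3 + t)" by (simp add: rising_Suc)
  also have "\<dots> = fact (Suc t + 2)"
  proof -
    have "Suc (t + 2) = 3 + t" by simp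
    with fact_Suc[of "t + 2", where 'a = nat] show ?thesis
      by (simp only: Suc(2) add_Suc of_nat_id mult.commute)
  qed
  finally show "2 * rising 3 (Suc t) = fact (Suc t + 2)" .
  have "24 * rising 5 (Suc t) = (24 * rising 5 t) * (5 + t)" by (simp add: rising_Suc)
  also have "\<dots> = fact (Suc t + 4)"
  proof -
    have "Suc (t + 4) = 5 + t" by simp
    with fact_Suc[of "t + 4", where 'a = nat] show ?thesis
      by (simp only: Suc(3) add_Suc of_nat_id mult.commute)
  qed
  finally show "24 * rising 5 (Suc t) = fact (Suc t + 4)" .
qed

text \<open>After cancelling factorials the claim is
  \<open>12 * (t + 1) \<le> (t + 4) * (t + 3)\<close>, equivalently
  \<open>5 * t \<le> t * t\<close>. It is an equality for \<open>t = 5\<close> and fails for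
  \<open>t = 4\<close>, which is the origin of the exceptional case.\<close>

lemma rising_le_base_ge5: "5 \<le> t \<Longrightarrow> rising_le t 2 3"
proof -
  assume t: "5 \<le> t"
  have "Suc (t + 3) = t + 4" "Suc (t + 2) = t + 3" by simp_all
  with fact_Suc[of "t + 3", where 'a = nat] fact_Suc[of "t + 2", where 'a = nat]
  have f4: "fact (t + 4) = (t + 4) * ((t + 3) * fact (t + 2))" by (simp only: of_nat_id)
  have f1: "fact (t + 1) = (t + 1) * fact t" by (simp flip: Suc_eq_plus1)
  have "12 * (t + 1) \<le> (t + 4) * (t + 3)"
  proof -
    have "5 * t \<le> t * t" using t by (rule mult_right_mono) simp
    then show ?thesis by (simp add: algebra_simps)
  qed
  then have "12 * (t + 1) * (fact t * fact (t + 2)) \<le> (t + 4) * (t + 3) * (fact t * fact (t + 2))"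
    by (rule mult_right_mono) simp
  moreover have "24 * (rising 2 t * (2 * rising 3 t)) = 2 * (12 * (t + 1) * (fact t * fact (t + 2)))"
    unfolding rising_small f1 by simp
  moreover have "2 * (24 * rising 5 t) * fact t = 2 * ((t + 4) * (t + 3) * (fact t * fact (t + 2)))"
    unfolding rising_small f4 by simp
  ultimately have "24 * (rising 2 t * (2 * rising 3 t)) \<le> 2 * (24 * rising 5 t) * fact t" by linarith
  then have "48 * (rising 2 t * rising 3 t) \<le> 48 * (rising 5 t * fact t)" by (simp add: mult_ac)
  then show ?thesis by (simp add: rising_le_def)
qed

text \<open>The minimal pairs permitted by the bounds for \<open>t = 2, 3, 4\<close>, with the
  exceptional pair left out. Both inequalities for \<open>t = 2\<close> are equalities.\<close>

lemma rising_le_bases: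
  "rising_le 2 3 3" "rising_le 2 2 5" "rising_le 3 2 4" "rising_le 3 3 3" "rising_le 4 2 4" "rising_le 4 3 3"
  by (simp_all add: rising_le_def rising_def lessThan_nat_numeral fact_numeral One_nat_def)

lemma minors_le_monomials:
  assumes "2 \<le> t" "t < m" "t < n"
    and "(t = 2 \<and> m * n \<ge> 16) \<or> (t = 3 \<and> m * n \<ge> 24) \<or> (t \<ge> 4 \<and> m * n \<ge> (t + 1) * (t + 2))"
    and exc: "\<not> (t = 4 \<and> (m = 5 \<and> n = 6 \<or> m = 6 \<and> n = 5))"
  shows "(m choose t) * (n choose t) \<le> (((m - t + 1) * (n - t + 1)) + t - 2 choose t)"
proof -
  define a b where "a = m - t + 1" and "b = n - t + 1"
  have ab: "2 \<le> a" "2 \<le> b" "m = a + t - 1" "n = b + t - 1" using assms by (auto simp: a_def b_def)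
  have "rising_le t a b"
  proof -
    consider "t = 2" | "t = 3" | "t = 4" | "5 \<le> t" using assms(1) by linarith
    then show ?thesis
    proof cases
      case 1
      then have mn: "m = a + 1" "n = b + 1" using ab by simp_all
      from assms(4) \<open>t = 2\<close> have "16 \<le> m * n" by auto
      then have ge: "16 \<le> (a + 1) * (b + 1)" by (simp only: mn)
      consider "3 \<le> a \<and> 3 \<le> b" | "a = 2" | "b = 2" using ab by linarith
      then show ?thesis
      proof cases
        case 2
        with ge have "5 \<le> b" by simp
        with 2 show ?thesis using rising_le_mono[OF rising_le_bases(2), of a b] \<open>t = 2\<close> by simp
      next
        case 3
        with ge have "5 \<le> a" by simp
        with 3 show ?thesis using rising_le_mono[OF rising_le_bases(2), of b a] \<open>t = 2\<close> by (simp add: rising_le_commute)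
      qed (use rising_le_mono[OF rising_le_bases(1), of a b] \<open>t = 2\<close> in simp)
    next
      case 2
      then have mn: "m = a + 2" "n = b + 2" using ab by simp_all
      from assms(4) \<open>t = 3\<close> have "24 \<le> m * n" by auto
      then have ge: "24 \<le> (a + 2) * (b + 2)" by (simp only: mn)
      consider "3 \<le> a \<and> 3 \<le> b" | "a = 2" | "b = 2" using ab by linarith
      then show ?thesis
      proof cases
        case 2
        with ge have "4 \<le> b" by simp
        with 2 show ?thesis using rising_le_mono[OF rising_le_bases(3), of a b] \<open>t = 3\<close> by simp
      next
        case 3
        with ge have "4 \<le> a" by simp
        with 3 show ?thesis using rising_le_mono[OF rising_le_bases(3), of b a] \<open>t = 3\<close> by (simp add: rising_le_commute)
      qed (use rising_le_mono[OF rising_le_bases(4), of a b] \<open>t = 3\<close> in simp)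
    next
      case 3
      then have mn: "m = a + 3" "n = b + 3" using ab by simp_all
      from assms(4) \<open>t = 4\<close> have "30 \<le> m * n" by auto
      then have ge: "30 \<le> (a + 3) * (b + 3)" by (simp only: mn)
      have ne: "\<not> (a = 2 \<and> b = 3)" "\<not> (a = 3 \<and> b = 2)" using exc 3 ab by auto
      consider "3 \<le> a \<and> 3 \<le> b" | "a = 2" | "b = 2" using ab by linarith
      then show ?thesis
      proof cases
        case 2
        with ge ne have "4 \<le> b" by (cases "b = 2"; cases "b = 3") (use ab in auto)
        with 2 show ?thesis using rising_le_mono[OF rising_le_bases(5), of a b] \<open>t = 4\<close> by simp
      next
        case 3
        with ge ne have "4 \<le> a" by (cases "a = 2"; cases "a = 3") (use ab in auto)
        with 3 show ?thesis using rising_le_mono[OF rising_le_bases(5), of b a] \<open>t = 4\<close> by (simp add: rising_le_commute)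
      qed (use rising_le_mono[OF rising_le_bases(6), of a b] \<open>t = 4\<close> in simp)
    next
      case 4
      then have ge: "(t + 1) * (t + 2) \<le> (a + t - 1) * (b + t - 1)" using assms(4) ab by auto
      \<comment> \<open>For these \<open>t\<close> the bound on \<open>m * n\<close> excludes only
        the square matrix of size \<open>t + 1\<close>, so one of \<open>a\<close>, \<open>b\<close>
        is at least 3.\<close>
      have "\<not> (a = 2 \<and> b = 2)"
      proof
        assume "a = 2 \<and> b = 2"
        then have "a + t - 1 = t + 1" "b + t - 1 = t + 1" by simp_all
        with ge have "(t + 1) * (t + 2) \<le> (t + 1) * (t + 1)" by (simp only:)
        then show False unfolding mult_le_cancel1 by simp
      qed
      then consider "3 \<le> b" | "3 \<le> a" using ab by linarith
      then show ?thesis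
        using rising_le_mono[OF rising_le_base_ge5[OF 4], of a b] rising_le_mono[OF rising_le_base_ge5[OF 4], of b a] ab
        by cases (simp_all add: rising_le_commute)
    qed
  qed
  then have "((a + t - 1 choose t) * fact t) * ((b + t - 1 choose t) * fact t) \<le> ((a * b - 1 + t - 1 choose t) * fact t) * fact t"
    using choose_rising[of a t] choose_rising[of b t] choose_rising[of "a * b - 1" t] ab mult_le_mono[OF ab(1,2)]
    by (simp add: rising_le_def)
  then have "(fact t * fact t) * ((a + t - 1 choose t) * (b + t - 1 choose t)) \<le> (fact t * fact t) * (a * b - 1 + t - 1 choose t)"
    by (simp add: mult_ac)
  then have "(a + t - 1 choose t) * (b + t - 1 choose t) \<le> (a * b - 1 + t - 1 choose t)" by simp
  moreover have "a * b - 1 + t - 1 = a * b + t - 2" using mult_le_mono[OF ab(1,2)] by simp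
  ultimately have "(m choose t) * (n choose t) \<le> (a * b + t - 2 choose t)" using ab(3,4) by simp
  then show ?thesis unfolding a_def b_def .
qed

context diag_init
begin

lemma not_weak_lefschetz_regular:
  assumes "t < m" "t < n"
    and "(t = 2 \<and> m * n \<ge> 16) \<or> (t = 3 \<and> m * n \<ge> 24) \<or> (t \<ge> 4 \<and> m * n \<ge> (t + 1) * (t + 2))"
    and exc: "\<not> (t = 4 \<and> (m = 5 \<and> n = 6 \<or> m = 6 \<and> n = 5))"
  shows "\<not> weak_lefschetz V inI"
proof (rule not_weak_lefschetz)
  fix B and \<rho> :: "nat \<times> nat \<Rightarrow> (nat \<times> nat, 'k) mpoly"
  assume B: "B \<subseteq> V" "card B + 1 = (m - t + 1) * (n - t + 1)" and \<rho>: "\<And>v. v \<in> V \<Longrightarrow> \<rho> v \<in> homog_part B 1"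
  have fin: "finite B" using finite_subset[OF B(1)] by simp
  have "card (mons B t) = (card B + t - 1 choose t)" using card_mons[OF fin] by blast
  also have "card B + t - 1 = (m - t + 1) * (n - t + 1) + t - 2" using B(2) by simp
  finally have "(m choose t) * (n choose t) \<le> card (mons B t)"
    using minors_le_monomials[OF t(1) assms(1-3) exc] by simp
  then show "\<exists>\<phi>. (\<exists>u\<in>mons B t. \<phi> u \<noteq> 0) \<and> (\<forall>u\<in>diag_mons. pairing B \<phi> (mon_subst \<rho> u) = 0)"
    using pairing_kills_diagonals[OF fin B(2), of \<rho>] \<rho> by blast
qed

end

section \<open>The exceptional case \<open>t = 4\<close>, \<open>{m, n} = {5, 6}\<close>\<close>

lemma linear_form_drop:
  assumes "finite B" "p \<in> homog_part B 1" "lookup p (single b 1) = 0"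
  shows "p \<in> homog_part (B - {b}) 1"
proof -
  have "p = (\<Sum>v\<in>B. scalar (lookup p (single v 1)) * indet v)" by (rule linear_form_expand[OF assms(1,2)])
  also have "\<dots> = (\<Sum>v\<in>B - {b}. scalar (lookup p (single v 1)) * indet v)"
    by (rule sum.mono_neutral_right) (use assms in auto)
  also have "\<dots> \<in> homog_part (B - {b}) 1" by (intro homog_sum homog_scalar_mult) simp
  finally show ?thesis .
qed

lemma homog_monom_expand:
  assumes "q \<in> homog_part B j"
  shows "q = (\<Sum>u\<in>keys q. scalar (lookup q u) * monom_poly u)" "keys q \<subseteq> mons B j"
  using assms mpoly_expand[of q] by (auto simp: homog_iff polys_def mons_def)

text \<open>Each variable is congruent modulo \<open>l\<close> to a form without the pivot
  \<open>b\<close>, and the product of two such remainders avoids \<open>b\<close> as well. For five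
  variables this leaves quadrics in four, a space of dimension 10.\<close>

lemma quadric_division:
  fixes l q :: "('v, 'k::field) mpoly"
  assumes B: "finite B" and l: "l \<in> homog_part B 1" "lookup l (single b 1) \<noteq> 0" and q: "q \<in> homog_part B 2"
  shows "\<exists>h\<in>homog_part B 1. \<exists>z\<in>homog_part (B - {b}) 2. q = l * h + z"
proof -
  have div1: "\<exists>c. p - scalar c * l \<in> homog_part (B - {b}) 1" if "p \<in> homog_part B 1" for p
  proof -
    let ?c = "lookup p (single b 1) / lookup l (single b 1)"
    have "p - scalar ?c * l \<in> homog_part B 1" using that l by (intro homog_minus homog_scalar_mult)
    moreover have "lookup (p - scalar ?c * l) (single b 1) = 0" using l(2) by (simp add: lookup_minus)
    ultimately show ?thesis using linear_form_drop[OF B] by blast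
  qed
  have "\<exists>h z. h \<in> homog_part B 1 \<and> z \<in> homog_part (B - {b}) 2 \<and> monom_poly u = l * h + z"
    if "u \<in> mons B 2" for u
  proof -
    from that have u: "mon_degree u = Suc 1" "keys u \<subseteq> B" by (auto simp: mons_def monomials_in_def)
    obtain v w' where vw: "u = w' + single v 1" "mon_degree w' = 1" using mon_degree_Suc[OF u(1)] by blast
    obtain w where w: "w' = single w 1" using mon_degree_1[OF vw(2)] by blast
    have "v \<in> B" "w \<in> B" using u(2) by (auto simp: vw(1) w keys_add_nat)
    then have p: "(indet v :: ('v, 'k) mpoly) \<in> homog_part B 1" "(indet w :: ('v, 'k) mpoly) \<in> homog_part B 1" by auto
    obtain c d where cd: "indet v - scalar c * l \<in> homog_part (B - {b}) 1" "indet w - scalar d * l \<in> homog_part (B - {b}) 1"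
      using div1[OF p(1)] div1[OF p(2)] by blast
    let ?h = "scalar c * indet w + scalar d * (indet v - scalar c * l)"
    let ?z = "(indet v - scalar c * l) * (indet w - scalar d * l)"
    have "?h \<in> homog_part B 1" using p l(1) by (intro homog_add homog_scalar_mult homog_minus)
    moreover have "?z \<in> homog_part (B - {b}) 2" using homog_mult[OF cd] by simp
    moreover have "monom_poly u = l * ?h + ?z"
      by (simp add: vw(1) w monom_poly_add flip: indet_def) (simp add: algebra_simps)
    ultimately show ?thesis by blast
  qed
  then obtain h z where hz: "\<And>u. u \<in> mons B 2 \<Longrightarrow> h u \<in> homog_part B 1"
    "\<And>u. u \<in> mons B 2 \<Longrightarrow> z u \<in> homog_part (B - {b}) 2" "\<And>u. u \<in> mons B 2 \<Longrightarrow> monom_poly u = l * h u + z u"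
    by metis
  note e = homog_monom_expand[OF q]
  have "q = (\<Sum>u\<in>keys q. scalar (lookup q u) * (l * h u + z u))"
    by (subst e(1), rule sum.cong) (use e(2) hz(3) in auto)
  also have "\<dots> = l * (\<Sum>u\<in>keys q. scalar (lookup q u) * h u) + (\<Sum>u\<in>keys q. scalar (lookup q u) * z u)"
    by (simp add: distrib_left sum.distrib sum_distrib_left mult.left_commute)
  finally have "q = l * (\<Sum>u\<in>keys q. scalar (lookup q u) * h u) + (\<Sum>u\<in>keys q. scalar (lookup q u) * z u)" .
  moreover have "(\<Sum>u\<in>keys q. scalar (lookup q u) * h u) \<in> homog_part B 1"
    using e(2) hz(1) by (intro homog_sum homog_scalar_mult) auto
  moreover have "(\<Sum>u\<in>keys q. scalar (lookup q u) * z u) \<in> homog_part (B - {b}) 2"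
    using e(2) hz(2) by (intro homog_sum homog_scalar_mult) auto
  ultimately show ?thesis by blast
qed

text \<open>An explicit enumeration of \<open>minor_pairs\<close>, so that the counts in the
  exceptional case become closed computations.\<close>

definition pair_lists :: "nat \<Rightarrow> nat \<Rightarrow> nat \<Rightarrow> (nat list \<times> nat list) list" where
  "pair_lists m n t = List.product (filter (\<lambda>xs. length xs = t) (subseqs [0..<m])) (filter (\<lambda>xs. length xs = t) (subseqs [0..<n]))"

lemma minor_pairs_lists: "x \<in> minor_pairs m n t \<Longrightarrow> \<exists>p\<in>set (pair_lists m n t). x = (set (fst p), set (snd p))"
proof -
  assume x: "x \<in> minor_pairs m n t"
  have ex: "\<exists>xs\<in>set (filter (\<lambda>xs. length xs = t) (subseqs [0..<N])). A = set xs" if "A \<subseteq> {..<N}" "card A = t" for A N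
  proof -
    have "A \<in> set ` set (subseqs [0..<N])" using that by (simp add: subseqs_powset atLeast_upt lessThan_atLeast0)
    then obtain xs where xs: "xs \<in> set (subseqs [0..<N])" "A = set xs" by blast
    then have "length xs = t" using subseqs_distinctD[OF xs(1)] that by (simp add: distinct_card)
    with xs show ?thesis by auto
  qed
  have fs: "fst x \<subseteq> {..<m}" "card (fst x) = t" "snd x \<subseteq> {..<n}" "card (snd x) = t"
    using x by (auto simp: minor_pairs_def)
  obtain xs where "xs \<in> set (filter (\<lambda>xs. length xs = t) (subseqs [0..<m]))" "fst x = set xs"
    using ex[OF fs(1,2)] by blast
  moreover obtain ys where "ys \<in> set (filter (\<lambda>xs. length xs = t) (subseqs [0..<n]))" "snd x = set ys"
    using ex[OF fs(3,4)] by blast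
  ultimately show ?thesis unfolding pair_lists_def by (intro bexI[of _ "(xs, ys)"]) (auto simp: prod_eq_iff)
qed

lemma card_minor_pairs_filter:
  "card {x \<in> minor_pairs m n t. P (fst x) (snd x)} \<le> length (filter (\<lambda>p. P (set (fst p)) (set (snd p))) (pair_lists m n t))"
proof -
  let ?L = "filter (\<lambda>p. P (set (fst p)) (set (snd p))) (pair_lists m n t)"
  have "{x \<in> minor_pairs m n t. P (fst x) (snd x)} \<subseteq> (\<lambda>p. (set (fst p), set (snd p))) ` set ?L"
    using minor_pairs_lists by fastforce
  then have "card {x \<in> minor_pairs m n t. P (fst x) (snd x)} \<le> card ((\<lambda>p. (set (fst p), set (snd p))) ` set ?L)"
    by (rule card_mono[rotated]) simp
  also have "\<dots> \<le> length ?L" by (rule order_trans[OF card_image_le card_length]) simp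
  finally show ?thesis .
qed

text \<open>Required of both rows and columns, this puts \<open>(0, 0)\<close> and
  \<open>(1, 1)\<close> on the diagonal of the minor. The next two conditions similarly force the
  two extreme corners and the last two positions.\<close>

definition first_two :: "nat \<Rightarrow> nat set \<Rightarrow> bool" where "first_two m A \<longleftrightarrow> 0 \<in> A \<and> 1 \<in> A"

definition first_last :: "nat \<Rightarrow> nat set \<Rightarrow> bool" where "first_last m A \<longleftrightarrow> 0 \<in> A \<and> m - 1 \<in> A"

definition last_two :: "nat \<Rightarrow> nat set \<Rightarrow> bool" where "last_two m A \<longleftrightarrow> m - 2 \<in> A \<and> m - 1 \<in> A"

text \<open>Each of the three conditions holds for \<open>3 * 6 = 18\<close> of the 75 pairs, and
  together they cover 42.\<close>

lemma count_exceptional: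
  assumes "m = 5 \<and> n = 6 \<or> m = 6 \<and> n = 5"
  shows "card {x \<in> minor_pairs m n 4. \<not> (first_two m (fst x) \<and> first_two n (snd x))} \<le> 57"
    and "card {x \<in> minor_pairs m n 4. \<not> (first_two m (fst x) \<and> first_two n (snd x)) \<and>
      \<not> (first_last m (fst x) \<and> first_last n (snd x)) \<and> \<not> (last_two m (fst x) \<and> last_two n (snd x))} \<le> 33"
proof -
  have "length (filter (\<lambda>p. \<not> (first_two 5 (set (fst p)) \<and> first_two 6 (set (snd p)))) (pair_lists 5 6 4)) = 57"
    "length (filter (\<lambda>p. \<not> (first_two 6 (set (fst p)) \<and> first_two 5 (set (snd p)))) (pair_lists 6 5 4)) = 57"
    by code_simp+
  then show "card {x \<in> minor_pairs m n 4. \<not> (first_two m (fst x) \<and> first_two n (snd x))} \<le> 57"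
    using card_minor_pairs_filter[of m n 4 "\<lambda>A B. \<not> (first_two m A \<and> first_two n B)"] assms by auto
  have "length (filter (\<lambda>p. \<not> (first_two 5 (set (fst p)) \<and> first_two 6 (set (snd p))) \<and>
      \<not> (first_last 5 (set (fst p)) \<and> first_last 6 (set (snd p))) \<and> \<not> (last_two 5 (set (fst p)) \<and> last_two 6 (set (snd p)))) (pair_lists 5 6 4)) = 33"
    "length (filter (\<lambda>p. \<not> (first_two 6 (set (fst p)) \<and> first_two 5 (set (snd p))) \<and>
      \<not> (first_last 6 (set (fst p)) \<and> first_last 5 (set (snd p))) \<and> \<not> (last_two 6 (set (fst p)) \<and> last_two 5 (set (snd p)))) (pair_lists 6 5 4)) = 33"
    by code_simp+
  then show "card {x \<in> minor_pairs m n 4. \<not> (first_two m (fst x) \<and> first_two n (snd x)) \<and>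
      \<not> (first_last m (fst x) \<and> first_last n (snd x)) \<and> \<not> (last_two m (fst x) \<and> last_two n (snd x))} \<le> 33"
    using card_minor_pairs_filter[of m n 4 "\<lambda>A B. \<not> (first_two m A \<and> first_two n B) \<and>
      \<not> (first_last m A \<and> first_last n B) \<and> \<not> (last_two m A \<and> last_two n B)"] assms by auto
qed

lemma pick_first: "0 \<in> A \<Longrightarrow> pick A 0 = 0"
  using pick_card_in_set[of 0 A] by simp

lemma pick_second: "0 \<in> A \<Longrightarrow> 1 \<in> A \<Longrightarrow> pick A 1 = 1"
proof -
  assume a: "0 \<in> A" "1 \<in> A"
  then have "{a \<in> A. a < 1} = {0}" by auto
  then have "card {a \<in> A. a < 1} = 1" by simp
  with pick_card_in_set[OF a(2)] show ?thesis by (simp only:)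
qed

lemma pick_last: "A \<subseteq> {..<m} \<Longrightarrow> m - 1 \<in> A \<Longrightarrow> pick A (card A - 1) = m - 1"
proof -
  assume a: "A \<subseteq> {..<m}" "m - 1 \<in> A"
  have "a < m - 1 \<longleftrightarrow> a \<noteq> m - 1" if "a \<in> A" for a
  proof -
    have "a < m" using that a(1) by auto
    then show ?thesis by linarith
  qed
  then have "{a \<in> A. a < m - 1} = A - {m - 1}" by blast
  moreover have "finite A" using a(1) finite_subset by blast
  ultimately have "card {a \<in> A. a < m - 1} = card A - 1" using a(2) by simp
  with pick_card_in_set[OF a(2)] show ?thesis by (simp only:)
qed

lemma pick_last_but_one: "A \<subseteq> {..<m} \<Longrightarrow> 2 \<le> m \<Longrightarrow> m - 2 \<in> A \<Longrightarrow> m - 1 \<in> A \<Longrightarrow> pick A (card A - 2) = m - 2"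
proof -
  assume a: "A \<subseteq> {..<m}" "2 \<le> m" "m - 2 \<in> A" "m - 1 \<in> A"
  have "a < m - 2 \<longleftrightarrow> a \<noteq> m - 1 \<and> a \<noteq> m - 2" if "a \<in> A" for a
  proof -
    have "a < m" using that a(1) by auto
    with a(2) show ?thesis by linarith
  qed
  then have "{a \<in> A. a < m - 2} = A - {m - 1, m - 2}" by blast
  moreover have "finite A" using a(1) finite_subset by blast
  moreover have "m - 1 \<noteq> m - 2" using a(2) by simp
  then have "card {m - 1, m - 2} = 2" by simp
  ultimately have "card {a \<in> A. a < m - 2} = card A - 2" using a by (simp only: card_Diff_subset insert_subset empty_subsetI finite.intros simp_thms)
  with pick_card_in_set[OF a(3)] show ?thesis by (simp only:)
qed

context diag_init
begin

lemma pairing_mult_homog: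
  assumes "\<And>w. w \<in> mons B j \<Longrightarrow> pairing B' \<phi> (p * monom_poly w) = 0" "q \<in> homog_part B j"
  shows "pairing B' \<phi> (p * q) = 0"
proof -
  note e = homog_monom_expand[OF assms(2)]
  have "p * q = (\<Sum>u\<in>keys q. scalar (lookup q u) * (p * monom_poly u))"
    by (subst e(1)) (simp add: sum_distrib_left mult.left_commute)
  then show ?thesis using e(2) assms(1) by (auto simp: pairing_sum pairing_scalar intro!: sum.neutral)
qed

text \<open>Here \<open>75\<close> diagonals map to a space of dimension \<open>70\<close>. The \<open>18\<close> diagonals containing two prescribed
  extremal entries are multiples of a fixed product by a \<open>15\<close>-dimensional space of quadrics; two consecutive
  such spaces overlap in dimension \<open>5\<close>. This leaves at most \<open>33 + 15 + 10 + 10 = 68\<close> conditions.\<close>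

lemma pairing_kills_exceptional:
  assumes mn: "t = 4" "m = 5 \<and> n = 6 \<or> m = 6 \<and> n = 5"
    and B: "finite B" "card B = 5" and \<rho>: "\<And>v. v \<in> V \<Longrightarrow> \<rho> v \<in> homog_part B 1"
  shows "\<exists>\<phi>. (\<exists>u\<in>mons B t. \<phi> u \<noteq> 0) \<and> (\<forall>u\<in>diag_mons. pairing B \<phi> (mon_subst \<rho> u) = 0)"
proof -
  have dm: "diag_mons = pair_diag 4 ` minor_pairs m n 4" using diag_mons_def by (simp only: mn(1))
  have c70: "card (mons B t) = 70" using card_mons[OF B(1), of 4] by (simp add: mn(1) B(2)) (simp add: numeral_eq_Suc One_nat_def)
  define a0 a1 z1 z0 where "a0 = (0::nat, 0::nat)" and "a1 = (1::nat, 1::nat)"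
    and "z1 = (m - 2, n - 2)" and "z0 = (m - 1, n - 1)"
  have V: "a0 \<in> V" "a1 \<in> V" "z1 \<in> V" "z0 \<in> V" using mn by (auto simp: a0_def a1_def z1_def z0_def matrix_vars_def)
  have ne: "a0 \<noteq> a1" "a0 \<noteq> z0" "z1 \<noteq> z0" using mn by (auto simp: a0_def a1_def z1_def z0_def)
  have factor: "\<exists>q\<in>homog_part B 2. mon_subst \<rho> u = \<rho> a * \<rho> b * q"
    if u: "u \<in> diag_mons" "a \<in> keys u" "b \<in> keys u" "a \<noteq> b" for u a b
  proof -
    obtain f g where fg: "incr t m f" "incr t n g" "u = diag_mon t f g" using diag_mons_E[OF u(1)] by blast
    have uV: "keys u \<subseteq> V" unfolding fg(3) keys_diag_mon using incr_vars[OF fg(1,2)] by auto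
    obtain w where w: "u = w + single b 1" using in_keys_split[OF u(3)] by blast
    then have "a \<in> keys w" using u(2,4) by (auto simp: keys_add_nat)
    from in_keys_split[OF this] obtain x where x: "w = x + single a 1" by blast
    have "mon_degree u = 4" unfolding fg(3) mon_degree_diag by (rule mn(1))
    moreover have "mon_degree u = mon_degree x + 1 + 1" unfolding w x mon_degree_add mon_degree_simps ..
    ultimately have d2: "mon_degree x = 2" by linarith
    have "mon_subst \<rho> x \<in> homog_part B (mon_degree x)"
    proof (rule homog_mon_subst, rule \<rho>)
      fix v assume "v \<in> keys x"
      then have "v \<in> keys u" by (simp add: w x keys_add_nat)
      with uV show "v \<in> V" by blast
    qed
    then have "mon_subst \<rho> x \<in> homog_part B 2" unfolding d2 .
    moreover have "mon_subst \<rho> u = \<rho> a * \<rho> b * mon_subst \<rho> x"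
    proof -
      have "mon_subst \<rho> u = mon_subst \<rho> x * \<rho> a * \<rho> b"
        unfolding w x mon_subst_add mon_subst_single by (simp only: power_one_right)
      then show ?thesis by (simp only: mult_ac)
    qed
    ultimately show ?thesis by (rule bexI[rotated])
  qed
  have pairs: "A \<subseteq> {..<m}" "card A = 4" "C \<subseteq> {..<n}" "card C = 4" if "(A, C) \<in> minor_pairs m n 4" for A C
    using that by (auto simp: minor_pairs_def)
  have keys_pd: "keys (pair_diag 4 (A, C)) = (\<lambda>k. (pick A k, pick C k)) ` {..<4}" for A C
    by (simp add: pair_diag_def keys_diag_mon)
  have keysI: "v \<in> keys (pair_diag 4 (A, C))" if "v = (pick A k, pick C k)" "k < 4" for v A C k
    unfolding keys_pd using that by blast
  have k20: "a0 \<in> keys (pair_diag 4 x) \<and> a1 \<in> keys (pair_diag 4 x)"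
    if "x \<in> minor_pairs m n 4" "first_two m (fst x)" "first_two n (snd x)" for x
  proof -
    obtain A C where x: "x = (A, C)" by force
    have "a0 = (pick A 0, pick C 0)" "a1 = (pick A 1, pick C 1)"
      using that by (auto simp: x first_two_def a0_def a1_def pick_first pick_second)
    then show ?thesis unfolding x using keysI[of _ A 0 C] keysI[of _ A 1 C] by simp
  qed
  have k11: "a0 \<in> keys (pair_diag 4 x) \<and> z0 \<in> keys (pair_diag 4 x)"
    if "x \<in> minor_pairs m n 4" "first_last m (fst x)" "first_last n (snd x)" for x
  proof -
    obtain A C where x: "x = (A, C)" by force
    note p = pairs[OF that(1)[unfolded x]]
    have "a0 = (pick A 0, pick C 0)" "z0 = (pick A 3, pick C 3)"
      using that pick_last[OF p(1)] pick_last[OF p(3)] p by (auto simp: x first_last_def a0_def z0_def pick_first)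
    then show ?thesis unfolding x using keysI[of _ A 0 C] keysI[of _ A 3 C] by simp
  qed
  have k02: "z1 \<in> keys (pair_diag 4 x) \<and> z0 \<in> keys (pair_diag 4 x)"
    if "x \<in> minor_pairs m n 4" "last_two m (fst x)" "last_two n (snd x)" for x
  proof -
    obtain A C where x: "x = (A, C)" by force
    note p = pairs[OF that(1)[unfolded x]]
    have "2 \<le> m" "2 \<le> n" using mn by auto
    then have "z1 = (pick A 2, pick C 2)" "z0 = (pick A 3, pick C 3)"
      using that pick_last[OF p(1)] pick_last[OF p(3)] pick_last_but_one[OF p(1)] pick_last_but_one[OF p(3)] p
      by (auto simp: x last_two_def z1_def z0_def)
    then show ?thesis unfolding x using keysI[of _ A 2 C] keysI[of _ A 3 C] by simp
  qed
  show ?thesis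
  \<comment> \<open>If one of the two forms vanishes, the 18 diagonals through both positions
    vanish, and 57 conditions are already fewer than 70. Otherwise both forms are available as
    divisors of quadrics.\<close>
  proof (cases "\<rho> a0 = 0 \<or> \<rho> a1 = 0")
    case True
    let ?D = "{x \<in> minor_pairs m n 4. \<not> (first_two m (fst x) \<and> first_two n (snd x))}"
    let ?Z = "(\<lambda>x. mon_subst \<rho> (pair_diag 4 x)) ` ?D"
    have fin: "finite ?D" by simp
    have "card ?Z \<le> 57" using card_image_le[OF fin] count_exceptional(1)[OF mn(2)] by (rule order_trans)
    then have "card ?Z < card (mons B t)" using c70 by linarith
    then have "\<exists>\<phi>. (\<exists>u\<in>mons B t. \<phi> u \<noteq> 0) \<and> (\<forall>z\<in>?Z. pairing B \<phi> z = 0)"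
      by (intro pairing_exists B(1) finite_imageI fin)
    then obtain \<phi> where \<phi>: "\<exists>u\<in>mons B t. \<phi> u \<noteq> 0" "\<And>z. z \<in> ?Z \<Longrightarrow> pairing B \<phi> z = 0"
      by blast
    have "pairing B \<phi> (mon_subst \<rho> u) = 0" if u: "u \<in> diag_mons" for u
    proof -
      obtain x where x: "x \<in> minor_pairs m n 4" "u = pair_diag 4 x" using u unfolding dm by blast
      show ?thesis
      proof (cases "x \<in> ?D")
        case False
        then have "a0 \<in> keys u \<and> a1 \<in> keys u" using x k20 by auto
        then obtain q where "mon_subst \<rho> u = \<rho> a0 * \<rho> a1 * q" using factor[OF u _ _ ne(1)] by blast
        with True have "mon_subst \<rho> u = 0" by auto
        then show ?thesis by (simp add: pairing_def)
      qed (use x \<phi>(2) in blast)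
    qed
    with \<phi>(1) show ?thesis by blast
  next
    case False
    have ex: "\<exists>b\<in>B. lookup p (single b 1) \<noteq> 0" if "p \<in> homog_part B 1" "p \<noteq> 0" for p :: "(nat \<times> nat, 'k) mpoly"
    proof (rule ccontr)
      assume "\<not> ?thesis"
      then have "p = 0" by (subst linear_form_expand[OF B(1) that(1)]) simp
      with that(2) show False by simp
    qed
    obtain b0 b1 where b: "b0 \<in> B" "lookup (\<rho> a0) (single b0 1) \<noteq> 0" "b1 \<in> B" "lookup (\<rho> a1) (single b1 1) \<noteq> 0"
      using ex[OF \<rho>[OF V(1)]] ex[OF \<rho>[OF V(2)]] False by blast
    let ?D = "{x \<in> minor_pairs m n 4. \<not> (first_two m (fst x) \<and> first_two n (snd x)) \<and>
      \<not> (first_last m (fst x) \<and> first_last n (snd x)) \<and> \<not> (last_two m (fst x) \<and> last_two n (snd x))}"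
    \<comment> \<open>In a cofactor of \<open>\<rho> a0 * \<rho> z0\<close>, multiples of
      \<open>\<rho> a1\<close> are already handled by \<open>Z1\<close>, so quadrics without its
      pivot \<open>b1\<close> suffice in \<open>Z2\<close>. In the same way, multiples of
      \<open>\<rho> a0\<close> in a cofactor of \<open>\<rho> z1 * \<rho> z0\<close> fall under the
      preceding family, and \<open>Z3\<close> can omit \<open>b0\<close>.\<close>
    define Z0 Z1 Z2 Z3 where "Z0 = (\<lambda>x. mon_subst \<rho> (pair_diag 4 x)) ` ?D"
      and "Z1 = (\<lambda>w. \<rho> a0 * \<rho> a1 * monom_poly w) ` mons B 2"
      and "Z2 = (\<lambda>w. \<rho> a0 * \<rho> z0 * monom_poly w) ` mons (B - {b1}) 2"
      and "Z3 = (\<lambda>w. \<rho> z1 * \<rho> z0 * monom_poly w) ` mons (B - {b0}) 2"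
    have fin: "finite ?D" by simp
    have m2: "finite (mons B 2)" "card (mons B 2) = 15" using card_mons[OF B(1), of 2] B(2)
      by (auto simp: numeral_eq_Suc One_nat_def)
    have m2': "finite (mons (B - {b}) 2)" "card (mons (B - {b}) 2) = 10" if "b \<in> B" for b
      using card_mons[of "B - {b}" 2] B that by (auto simp: numeral_eq_Suc One_nat_def)
    have cZ: "card Z0 \<le> 33" "card Z1 \<le> 15" "card Z2 \<le> 10" "card Z3 \<le> 10"
      using card_image_le[OF fin, of "\<lambda>x. mon_subst \<rho> (pair_diag 4 x)"] count_exceptional(2)[OF mn(2)]
        card_image_le[OF m2(1), of "\<lambda>w. \<rho> a0 * \<rho> a1 * monom_poly w"] m2(2)
        card_image_le[OF m2'(1)[OF b(3)], of "\<lambda>w. \<rho> a0 * \<rho> z0 * monom_poly w"] m2'(2)[OF b(3)]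
        card_image_le[OF m2'(1)[OF b(1)], of "\<lambda>w. \<rho> z1 * \<rho> z0 * monom_poly w"] m2'(2)[OF b(1)]
      unfolding Z0_def Z1_def Z2_def Z3_def by linarith+
    let ?Z = "Z0 \<union> Z1 \<union> Z2 \<union> Z3"
    have "card ?Z \<le> card Z0 + card Z1 + card Z2 + card Z3"
      by (intro order_trans[OF card_Un_le] add_right_mono order_refl)
    then have "card ?Z < card (mons B t)" using cZ c70 by linarith
    moreover have "finite ?Z" using fin m2 m2' b by (simp add: Z0_def Z1_def Z2_def Z3_def)
    ultimately obtain \<phi> where \<phi>: "\<exists>u\<in>mons B t. \<phi> u \<noteq> 0" "\<And>z. z \<in> ?Z \<Longrightarrow> pairing B \<phi> z = 0"
      using pairing_exists[OF B(1), of ?Z] by auto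
    have K1: "pairing B \<phi> (\<rho> a0 * \<rho> a1 * q) = 0" if "q \<in> homog_part B 2" for q
      by (rule pairing_mult_homog[OF _ that]) (intro \<phi>(2), unfold Z1_def, blast)
    have K2: "pairing B \<phi> (\<rho> a0 * \<rho> z0 * q) = 0" if q: "q \<in> homog_part B 2" for q
    proof -
      obtain h z where hz: "h \<in> homog_part B 1" "z \<in> homog_part (B - {b1}) 2" "q = \<rho> a1 * h + z"
        using quadric_division[OF B(1) \<rho>[OF V(2)] b(4) q] by blast
      have "\<rho> z0 * h \<in> homog_part B 2" using homog_mult[OF \<rho>[OF V(4)] hz(1)] by simp
      moreover have "\<rho> a0 * \<rho> z0 * q = \<rho> a0 * \<rho> a1 * (\<rho> z0 * h) + \<rho> a0 * \<rho> z0 * z"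
        by (simp add: hz(3) algebra_simps)
      moreover have "pairing B \<phi> (\<rho> a0 * \<rho> z0 * z) = 0"
        by (rule pairing_mult_homog[OF _ hz(2)]) (intro \<phi>(2), unfold Z2_def, blast)
      ultimately show ?thesis using K1 by (simp add: pairing_add)
    qed
    have K3: "pairing B \<phi> (\<rho> z1 * \<rho> z0 * q) = 0" if q: "q \<in> homog_part B 2" for q
    proof -
      obtain h z where hz: "h \<in> homog_part B 1" "z \<in> homog_part (B - {b0}) 2" "q = \<rho> a0 * h + z"
        using quadric_division[OF B(1) \<rho>[OF V(1)] b(2) q] by blast
      have "\<rho> z1 * h \<in> homog_part B 2" using homog_mult[OF \<rho>[OF V(3)] hz(1)] by simp
      moreover have "\<rho> z1 * \<rho> z0 * q = \<rho> a0 * \<rho> z0 * (\<rho> z1 * h) + \<rho> z1 * \<rho> z0 * z"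
        by (simp add: hz(3) algebra_simps)
      moreover have "pairing B \<phi> (\<rho> z1 * \<rho> z0 * z) = 0"
        by (rule pairing_mult_homog[OF _ hz(2)]) (intro \<phi>(2), unfold Z3_def, blast)
      ultimately show ?thesis using K2 by (simp add: pairing_add)
    qed
    have "pairing B \<phi> (mon_subst \<rho> u) = 0" if u: "u \<in> diag_mons" for u
    proof -
      obtain x where x: "x \<in> minor_pairs m n 4" "u = pair_diag 4 x" using u unfolding dm by blast
      consider "x \<in> ?D" | "a0 \<in> keys u \<and> a1 \<in> keys u" | "a0 \<in> keys u \<and> z0 \<in> keys u" | "z1 \<in> keys u \<and> z0 \<in> keys u"
        using k20[OF x(1)] k11[OF x(1)] k02[OF x(1)] x by blast
      then show ?thesis
      proof cases
        case 1
        then show ?thesis by (intro \<phi>(2)) (simp add: Z0_def x)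
      next
        case 2
        then show ?thesis using factor[OF u _ _ ne(1)] K1 by force
      next
        case 3
        then show ?thesis using factor[OF u _ _ ne(2)] K2 by force
      next
        case 4
        then show ?thesis using factor[OF u _ _ ne(3)] K3 by force
      qed
    qed
    with \<phi>(1) show ?thesis by blast
  qed
qed

lemma not_weak_lefschetz_range:
  assumes "t < m" "t < n"
    and "(t = 2 \<and> m * n \<ge> 16) \<or> (t = 3 \<and> m * n \<ge> 24) \<or> (t \<ge> 4 \<and> m * n \<ge> (t + 1) * (t + 2))"
  shows "\<not> weak_lefschetz V inI"
proof (cases "t = 4 \<and> (m = 5 \<and> n = 6 \<or> m = 6 \<and> n = 5)")
  case True
  show ?thesis
  proof (rule not_weak_lefschetz)
    fix B and \<rho> :: "nat \<times> nat \<Rightarrow> (nat \<times> nat, 'k) mpoly"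
    assume B: "B \<subseteq> V" "card B + 1 = (m - t + 1) * (n - t + 1)" and \<rho>: "\<And>v. v \<in> V \<Longrightarrow> \<rho> v \<in> homog_part B 1"
    have "finite B" using finite_subset[OF B(1)] by simp
    moreover have "card B = 5" using B(2) True by auto
    ultimately show "\<exists>\<phi>. (\<exists>u\<in>mons B t. \<phi> u \<noteq> 0) \<and> (\<forall>u\<in>diag_mons. pairing B \<phi> (mon_subst \<rho> u) = 0)"
      using pairing_kills_exceptional[of B \<rho>] \<rho> True by blast
  qed
next
  case False
  with not_weak_lefschetz_regular[OF assms] show ?thesis by blast
qed

end

section \<open>Maximal minors: standard monomials are independent\<close>

definition restr :: "'v set \<Rightarrow> 'v monomial \<Rightarrow> 'v monomial" where
  "restr A u = (\<Sum>v\<in>keys u. if v \<in> A then single v (lookup u v) else 0)"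

lemma lookup_restr: "lookup (restr A u) v = (if v \<in> A then lookup u v else 0)"
proof -
  have "lookup (restr A u) v = (\<Sum>w\<in>keys u. if w = v then (if v \<in> A then lookup u v else 0) else 0)"
    unfolding restr_def lookup_sum by (intro sum.cong) (auto simp: lookup_single)
  then show ?thesis by (auto simp: in_keys_iff)
qed

lemma keys_restr: "keys (restr A u) = keys u \<inter> A"
  by (auto simp: in_keys_iff lookup_restr split: if_splits)

lemma scalar_of_nat: "scalar (of_nat c) = (of_nat c :: ('v, 'k::comm_ring_1) mpoly)"
  by (simp add: scalar_def)

text \<open>Regard the sum as a polynomial in the variables \<open>A\<close> with coefficients in
  the remaining variables, and compare the coefficients of \<open>w0\<close>.\<close>

lemma coefficient_extraction:
  fixes F :: "'s \<Rightarrow> ('v, 'k::comm_ring_1) mpoly"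
  assumes "finite S" and w: "\<And>s. s \<in> S \<Longrightarrow> keys (w s) \<subseteq> A" "keys w0 \<subseteq> A"
    and F: "\<And>s. s \<in> S \<Longrightarrow> F s \<in> polys (- A)" and sum0: "(\<Sum>s\<in>S. monom_poly (w s) * F s) = 0"
  shows "(\<Sum>s\<in>{s \<in> S. w s = w0}. F s) = 0"
proof (rule poly_mapping_eqI)
  fix z
  show "lookup (\<Sum>s\<in>{s \<in> S. w s = w0}. F s) z = lookup 0 z"
  proof (cases "z \<in> monomials_in (- A)")
    case False
    then have "lookup (F s) z = 0" if "s \<in> S" for s
      using F[OF that] by (auto simp: polys_def in_keys_iff)
    then show ?thesis by (simp add: lookup_sum)
  next
    case True
    have "lookup (monom_poly (w s) * F s) (w0 + z) = (if w s = w0 then lookup (F s) z else 0)" if s: "s \<in> S" for s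
    proof (cases "w s = w0")
      case True
      then show ?thesis by (simp add: lookup_monom_mult)
    next
      case False
      have "w0 + z \<notin> keys (monom_poly (w s) * F s)"
      proof
        assume "w0 + z \<in> keys (monom_poly (w s) * F s)"
        then obtain y where y: "w0 + z = w s + y" "y \<in> keys (F s)"
          using keys_mult[of "monom_poly (w s)" "F s"] by auto
        have yA: "keys y \<subseteq> - A" using F[OF s] y(2) by (auto simp: polys_def monomials_in_def)
        have zA: "keys z \<subseteq> - A" using True by (simp add: monomials_in_def)
        have "w0 = w s"
        proof (rule poly_mapping_eqI)
          fix v
          show "lookup w0 v = lookup (w s) v"
          proof (cases "v \<in> A")
            case True
            then have "v \<notin> keys z" "v \<notin> keys y" using yA zA by auto
            with arg_cong[OF y(1), of "\<lambda>u. lookup u v"] show ?thesis by (simp add: lookup_add in_keys_iff)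
          next
            case False
            then have "v \<notin> keys w0" "v \<notin> keys (w s)" using w s by auto
            then show ?thesis by (simp add: in_keys_iff)
          qed
        qed
        with False show False by simp
      qed
      with False show ?thesis by (simp add: in_keys_iff)
    qed
    then have "0 = (\<Sum>s\<in>S. if w s = w0 then lookup (F s) z else 0)"
      using arg_cong[OF sum0, of "\<lambda>p. lookup p (w0 + z)"] by (simp add: lookup_sum)
    also have "\<dots> = (\<Sum>s\<in>{s \<in> S. w s = w0}. lookup (F s) z)"
      by (rule sum.inter_filter[OF assms(1), symmetric])
    finally show ?thesis by (simp add: lookup_sum)
  qed
qed

text \<open>The two instances used are \<open>pos i j = (i, j)\<close> and
  \<open>pos i j = (j, i)\<close>. They treat \<open>t = m\<close> and \<open>t = n\<close> alike:
  the first argument, called the row, always runs along the short side.\<close>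

locale matrix_pos =
  fixes pos :: "nat \<Rightarrow> nat \<Rightarrow> nat \<times> nat"
  assumes pos_inj [simp]: "pos i j = pos i' j' \<longleftrightarrow> i = i' \<and> j = j'"
begin

text \<open>Divisibility by the main diagonal of a minor on \<open>s\<close> consecutive rows. The
  monomials without a chain through all \<open>t\<close> rows are the standard monomials of the
  maximal minors.\<close>

primrec chain :: "nat \<Rightarrow> nat \<Rightarrow> nat \<Rightarrow> (nat \<times> nat) monomial \<Rightarrow> bool" where
  "chain 0 i b u \<longleftrightarrow> True"
| "chain (Suc s) i b u \<longleftrightarrow> (\<exists>j\<ge>b. pos i j \<in> keys u \<and> chain s (Suc i) (Suc j) u)"

lemma chain_mono: "chain s i b u \<Longrightarrow> b' \<le> b \<Longrightarrow> keys u \<subseteq> keys w \<Longrightarrow> chain s i b' w"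
proof (induction s arbitrary: i b b')
  case (Suc s)
  then obtain j where j: "b \<le> j" "pos i j \<in> keys u" "chain s (Suc i) (Suc j) u" by auto
  then show ?case using Suc.prems Suc.IH[OF j(3)] by (auto intro!: exI[of _ j])
qed simp

lemma chain_cong: "(\<And>r j. i \<le> r \<Longrightarrow> pos r j \<in> keys u \<longleftrightarrow> pos r j \<in> keys w) \<Longrightarrow> chain s i b u \<longleftrightarrow> chain s i b w"
  by (induction s arbitrary: i b) auto

lemma chain_last: "chain (Suc s) i b u \<Longrightarrow> \<exists>j\<ge>b. pos (i + s) j \<in> keys u"
proof (induction s arbitrary: i b)
  case (Suc s)
  from Suc.prems obtain j where j: "b \<le> j" "chain (Suc s) (Suc i) (Suc j) u" by auto
  from Suc.IH[OF j(2)] obtain j' where "Suc j \<le> j'" "pos (Suc i + s) j' \<in> keys u" by blast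
  with j(1) show ?case by (intro exI[of _ j']) auto
qed auto

text \<open>The last row becomes a generic linear combination of the rows \<open>i, \<dots>, l - 1\<close>; the
  coefficients are the variables of row \<open>l + 1\<close>.\<close>

definition comb :: "nat \<Rightarrow> nat \<Rightarrow> nat \<times> nat \<Rightarrow> (nat \<times> nat, 'k::comm_ring_1) mpoly" where
  "comb l i v = (if \<exists>j. v = pos l j
     then \<Sum>k=i..<l. indet (pos (Suc l) k) * indet (pos k (THE j. v = pos l j)) else indet v)"

lemma comb_last: "comb l i (pos l j) = (\<Sum>k=i..<l. indet (pos (Suc l) k) * indet (pos k j))"
  by (simp add: comb_def)

lemma comb_other: "(\<And>j. v \<noteq> pos l j) \<Longrightarrow> comb l i v = indet v"
  by (simp add: comb_def)

definition last_part :: "nat \<Rightarrow> nat \<Rightarrow> (nat \<Rightarrow> nat) \<Rightarrow> (nat \<times> nat) monomial" where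
  "last_part l N g = (\<Sum>j<N. single (pos l j) (g j))"

lemma lookup_last_part: "lookup (last_part l N g) v = (if \<exists>j<N. v = pos l j then g (THE j. v = pos l j) else 0)"
proof (cases "\<exists>j<N. v = pos l j")
  case True
  then obtain j where j: "j < N" "v = pos l j" by blast
  have "lookup (last_part l N g) v = (\<Sum>k<N. if k = j then g j else 0)"
    unfolding last_part_def lookup_sum by (rule sum.cong) (auto simp: j lookup_single)
  with j show ?thesis by simp
qed (auto simp: last_part_def lookup_sum lookup_single intro!: sum.neutral)

definition rest_part :: "nat \<Rightarrow> nat \<Rightarrow> (nat \<times> nat) monomial \<Rightarrow> (nat \<times> nat) monomial" where
  "rest_part l i u = restr (- (range (pos i) \<union> range (pos l))) u"

definition row_part :: "nat \<Rightarrow> (nat \<times> nat) monomial \<Rightarrow> (nat \<times> nat) monomial" where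
  "row_part i u = restr (range (pos i)) u"

lemma split_monomial:
  assumes "i \<noteq> l" "\<And>j. pos l j \<in> keys u \<Longrightarrow> j < N"
  shows "u = row_part i u + last_part l N (\<lambda>j. lookup u (pos l j)) + rest_part l i u"
proof (rule poly_mapping_eqI)
  fix v
  consider j where "v = pos i j" | j where "v = pos l j" | "v \<notin> range (pos i)" "v \<notin> range (pos l)" by auto
  then show "lookup u v = lookup (row_part i u + last_part l N (\<lambda>j. lookup u (pos l j)) + rest_part l i u) v"
  proof cases
    case (2 j)
    then show ?thesis using assms
      by (auto simp: lookup_add row_part_def rest_part_def lookup_restr lookup_last_part in_keys_iff)
  qed (use assms in \<open>auto simp: lookup_add row_part_def rest_part_def lookup_restr lookup_last_part\<close>)
qed

text \<open>What \<open>q j\<close> factors of the last row in column \<open>j\<close> contribute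
  when the summand of row \<open>i\<close> is chosen: the multiplier variable
  \<open>pos (Suc l) i\<close> and the entry \<open>pos i j\<close>, each \<open>q j\<close>
  times.\<close>

definition moved :: "nat \<Rightarrow> nat \<Rightarrow> nat \<Rightarrow> (nat \<Rightarrow> nat) \<Rightarrow> (nat \<times> nat) monomial" where
  "moved l i N q = (\<Sum>j<N. single (pos (Suc l) i) (q j) + single (pos i j) (q j))"

lemma lookup_moved:
  assumes "i < l"
  shows "lookup (moved l i N q) (pos (Suc l) i) = (\<Sum>j<N. q j)"
    and "j < N \<Longrightarrow> lookup (moved l i N q) (pos i j) = q j"
    and "keys (moved l i N q) \<subseteq> insert (pos (Suc l) i) (range (pos i))"
proof -
  show "lookup (moved l i N q) (pos (Suc l) i) = (\<Sum>j<N. q j)"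
    unfolding moved_def lookup_sum by (rule sum.cong) (use assms in \<open>auto simp: lookup_add lookup_single\<close>)
  have "lookup (moved l i N q) (pos i j) = (\<Sum>k<N. if k = j then q j else 0)" for j
    unfolding moved_def lookup_sum by (rule sum.cong) (use assms in \<open>auto simp: lookup_add lookup_single\<close>)
  then show "j < N \<Longrightarrow> lookup (moved l i N q) (pos i j) = q j" by simp
  show "keys (moved l i N q) \<subseteq> insert (pos (Suc l) i) (range (pos i))"
  proof
    fix v assume "v \<in> keys (moved l i N q)"
    then have "(\<Sum>j<N. lookup (single (pos (Suc l) i) (q j) + single (pos i j) (q j)) v) \<noteq> 0"
      by (simp add: moved_def lookup_sum in_keys_iff)
    then obtain j where "lookup (single (pos (Suc l) i) (q j) + single (pos i j) (q j)) v \<noteq> 0"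
      by (meson sum.not_neutral_contains_not_neutral)
    then show "v \<in> insert (pos (Suc l) i) (range (pos i))"
      by (auto simp: lookup_add lookup_single when_def split: if_splits)
  qed
qed

text \<open>Split off the summand of row \<open>i\<close> from the combination and apply the
  binomial theorem in every column. The factors not moved are again evaluated by a combination, now
  starting at row \<open>Suc i\<close>.\<close>

lemma mon_subst_comb_expand:
  assumes il: "i < l" and u: "\<forall>j. pos l j \<in> keys u \<longrightarrow> j < N"
  defines "g \<equiv> \<lambda>j. lookup u (pos l j)"
  shows "mon_subst (comb l i) u = (\<Sum>q\<in>PiE {..<N} (\<lambda>j. {..g j}). of_nat (\<Prod>j<N. g j choose q j) *
    (monom_poly (row_part i u + moved l i N q) *
     mon_subst (comb l (Suc i)) (last_part l N (\<lambda>j. g j - q j) + rest_part l i u)) :: (nat \<times> nat, 'k::comm_ring_1) mpoly)"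
proof -
  let ?c = "comb l i :: nat \<times> nat \<Rightarrow> (nat \<times> nat, 'k) mpoly" and ?c' = "comb l (Suc i) :: nat \<times> nat \<Rightarrow> (nat \<times> nat, 'k) mpoly"
  let ?m = "\<lambda>j. indet (pos (Suc l) i) * indet (pos i j) :: (nat \<times> nat, 'k) mpoly"
  have row: "mon_subst ?c (row_part i u) = monom_poly (row_part i u)"
  proof (rule trans[OF mon_subst_cong[of _ _ indet] mon_subst_indet])
    fix v assume "v \<in> keys (row_part i u)"
    then obtain j where "v = pos i j" by (auto simp: row_part_def keys_restr)
    with il show "?c v = indet v" by (intro comb_other) simp
  qed
  have rest: "mon_subst ?c (rest_part l i u) = mon_subst ?c' (rest_part l i u)"
    by (rule mon_subst_cong) (auto simp: rest_part_def keys_restr comb_def)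
  have last: "mon_subst ?c (last_part l N g) =
    (\<Sum>q\<in>PiE {..<N} (\<lambda>j. {..g j}). \<Prod>j<N. of_nat (g j choose q j) * ?m j ^ q j * ?c' (pos l j) ^ (g j - q j))"
  proof -
    have "?c (pos l j) = ?m j + ?c' (pos l j)" for j
      unfolding comb_last using il by (subst sum.atLeast_Suc_lessThan) auto
    then have "mon_subst ?c (last_part l N g) = (\<Prod>j<N. (?m j + ?c' (pos l j)) ^ g j)"
      by (simp add: last_part_def mon_subst_sum)
    also have "\<dots> = (\<Prod>j<N. \<Sum>k\<in>{..g j}. of_nat (g j choose k) * ?m j ^ k * ?c' (pos l j) ^ (g j - k))"
      by (simp add: binomial_ring)
    also have "\<dots> = (\<Sum>q\<in>PiE {..<N} (\<lambda>j. {..g j}). \<Prod>j<N. of_nat (g j choose q j) * ?m j ^ q j * ?c' (pos l j) ^ (g j - q j))"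
      by (rule prod_sum_PiE) auto
    finally show ?thesis .
  qed
  have trm: "(\<Prod>j<N. of_nat (g j choose q j) * ?m j ^ q j * ?c' (pos l j) ^ (g j - q j)) =
    of_nat (\<Prod>j<N. g j choose q j) * (monom_poly (moved l i N q) * mon_subst ?c' (last_part l N (\<lambda>j. g j - q j)))" for q
  proof -
    have "?m j ^ q j = monom_poly (single (pos (Suc l) i) (q j) + single (pos i j) (q j))" for j
      by (simp add: power_mult_distrib indet_power monom_poly_add)
    then show ?thesis
      by (simp add: prod.distrib of_nat_prod moved_def last_part_def monom_poly_sum mon_subst_sum mult.assoc)
  qed
  have "mon_subst ?c u = mon_subst ?c (row_part i u) * mon_subst ?c (last_part l N g) * mon_subst ?c (rest_part l i u)"
    unfolding g_def by (subst split_monomial[of i l u N]) (use il u in \<open>auto simp: mon_subst_add\<close>)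
  also have "\<dots> = (\<Sum>q\<in>PiE {..<N} (\<lambda>j. {..g j}). of_nat (\<Prod>j<N. g j choose q j) *
    (monom_poly (row_part i u + moved l i N q) *
     mon_subst (comb l (Suc i)) (last_part l N (\<lambda>j. g j - q j) + rest_part l i u)))"
    unfolding row rest last trm by (simp add: sum_distrib_left sum_distrib_right monom_poly_add mon_subst_add mult_ac)
  finally show ?thesis .
qed

text \<open>The quantities \<open>T j\<close> are nonnegative: to the right of \<open>b1\<close>
  nothing is moved by \<open>Q\<close>, and to the left a nonzero \<open>q j\<close> meets an empty
  place of \<rho>, so it is at most \<open>Q j\<close>. As the totals agree, the sum of the
  \<open>T j\<close> is the difference of the two weights and hence at most zero. So
  \<open>q\<close> and \<open>Q\<close> agree away from \<open>b1\<close>, and then also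
  there.\<close>

lemma minimal_move:
  fixes q Q R \<rho> :: "nat \<Rightarrow> nat"
  assumes eq: "\<And>j. j < N \<Longrightarrow> R j + q j = \<rho> j + Q j" and tot: "(\<Sum>j<N. q j) = (\<Sum>j<N. Q j)"
    and wt: "(\<Sum>j<N. j * \<rho> j) \<le> (\<Sum>j<N. j * R j)"
    and Q: "\<And>j. j < N \<Longrightarrow> b1 < j \<Longrightarrow> Q j = 0"
    and low: "\<And>j. j < N \<Longrightarrow> j < b1 \<Longrightarrow> q j \<noteq> 0 \<Longrightarrow> \<rho> j = 0"
    and j: "j < N"
  shows "q j = Q j"
proof -
  define T where "T j = (int j - int b1) * (int (q j) - int (Q j))" for j
  have T0: "0 \<le> T j" if "j < N" for j
  proof -
    consider "j < b1" | "j = b1" | "b1 < j" by linarith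
    then show ?thesis
    proof cases
      case 1
      have "q j \<le> Q j" using eq[OF that] low[OF that 1] by (cases "q j = 0") auto
      with 1 show ?thesis by (simp add: T_def mult_nonpos_nonpos)
    qed (use Q[OF that] in \<open>auto simp: T_def\<close>)
  qed
  have "(\<Sum>j<N. T j) = ((\<Sum>j<N. int j * int (q j)) - (\<Sum>j<N. int j * int (Q j))) - int b1 * ((\<Sum>j<N. int (q j)) - (\<Sum>j<N. int (Q j)))"
    by (simp add: T_def algebra_simps sum.distrib sum_subtractf sum_distrib_left)
  also have "(\<Sum>j<N. int (q j)) - (\<Sum>j<N. int (Q j)) = 0"
    using tot by (simp flip: of_nat_sum)
  also have "(\<Sum>j<N. int j * int (q j)) - (\<Sum>j<N. int j * int (Q j)) = (\<Sum>j<N. int j * int (\<rho> j)) - (\<Sum>j<N. int j * int (R j))"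
  proof -
    have "(\<Sum>j<N. int j * int (R j)) + (\<Sum>j<N. int j * int (q j)) = (\<Sum>j<N. int j * int (\<rho> j)) + (\<Sum>j<N. int j * int (Q j))"
      unfolding sum.distrib[symmetric] distrib_left[symmetric] of_nat_add[symmetric] by (rule sum.cong) (simp_all add: eq)
    then show ?thesis by linarith
  qed
  also have "\<dots> = int (\<Sum>j<N. j * \<rho> j) - int (\<Sum>j<N. j * R j)" by simp
  finally have "(\<Sum>j<N. T j) = int (\<Sum>j<N. j * \<rho> j) - int (\<Sum>j<N. j * R j)" by (simp del: of_nat_sum)
  moreover have "int (\<Sum>j<N. j * \<rho> j) \<le> int (\<Sum>j<N. j * R j)" using wt by (simp only: of_nat_le_iff)
  ultimately have "(\<Sum>j<N. T j) \<le> 0" by linarith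
  moreover have "0 \<le> (\<Sum>j<N. T j)" using T0 by (intro sum_nonneg) auto
  ultimately have "(\<Sum>j<N. T j) = 0" by simp
  then have Tz: "T j = 0" if "j < N" for j
    using sum_nonneg_eq_0_iff[of "{..<N}" T] T0 that by auto
  have ne: "q k = Q k" if "k < N" "k \<noteq> b1" for k using Tz[OF that(1)] that(2) by (auto simp: T_def)
  show ?thesis
  proof (cases "j = b1")
    case True
    have "(\<Sum>k\<in>{..<N} - {j}. q k) = (\<Sum>k\<in>{..<N} - {j}. Q k)" by (rule sum.cong) (use ne True in auto)
    then show ?thesis using tot j by (simp add: sum.remove[of "{..<N}" j])
  qed (use ne j in auto)
qed

text \<open>Induction on the number of rows that are combined. A suitable coefficient with respect
  to row \<open>i\<close> and its multiplier isolates a part of \<open>f\<close> in which row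
  \<open>i\<close> and the last-row entries up to its first occupied column have been stripped off.
  The rest is a polynomial of the same type on the rows from \<open>Suc i\<close>, with the column
  bound moved past that column; it would be nonzero, contradicting the induction hypothesis.\<close>

lemma standard_independent:
  fixes f :: "(nat \<times> nat, 'k::field_char_0) mpoly"
  assumes "i + s = l"
    and "\<And>u v. u \<in> keys f \<Longrightarrow> v \<in> keys u \<Longrightarrow> \<exists>k j. i \<le> k \<and> k \<le> l \<and> v = pos k j"
    and "\<And>u j. u \<in> keys f \<Longrightarrow> pos l j \<in> keys u \<Longrightarrow> b \<le> j"
    and "\<And>u. u \<in> keys f \<Longrightarrow> \<not> chain (Suc s) i b u"
    and "subst (comb l i) f = 0"
  shows "f = 0"
  using assms
proof (induction s arbitrary: i b f)
  case 0
  have "keys u = {}" if u: "u \<in> keys f" for u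
  proof (rule ccontr)
    assume "keys u \<noteq> {}"
    then obtain v where v: "v \<in> keys u" by blast
    with "0.prems"(2)[OF u v] "0.prems"(1) obtain j where j: "v = pos l j" by auto
    with "0.prems"(3)[OF u] v "0.prems"(4)[OF u] "0.prems"(1) show False by auto
  qed
  then have "f \<in> polys {}" by (auto simp: polys_def monomials_in_def)
  then have "subst (comb l i) f = subst indet f" by (rule subst_cong) simp
  with "0.prems"(5) show ?case by simp
next
  case (Suc s)
  have il: "i < l" using Suc.prems(1) by simp
  show ?case
  proof (rule ccontr)
    assume "f \<noteq> 0"
    then have ne: "keys f \<noteq> {}" by simp
    define C where "C = (\<Union>u\<in>keys f. pos i -` keys u \<union> pos l -` keys u)"
    have "finite (pos k -` keys u)" for k and u :: "(nat \<times> nat) monomial"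
      by (rule finite_vimageI[OF finite_keys]) (simp add: inj_def)
    then have "finite C" unfolding C_def by (intro finite_UN_I finite_keys finite_UnI)
    then obtain N where CN: "\<forall>j\<in>C. j < N" using finite_nat_set_iff_bounded[of C] by blast
    have N: "j < N" if "u \<in> keys f" "pos i j \<in> keys u \<or> pos l j \<in> keys u" for u j
      using that by (intro CN[rule_format]) (auto simp: C_def)
    define R where "R u j = lookup u (pos i j)" for u :: "(nat \<times> nat) monomial" and j
    define g where "g u j = lookup u (pos l j)" for u :: "(nat \<times> nat) monomial" and j
    \<comment> \<open>The coefficient to be extracted is fixed by two extremal choices: here a part
      in row \<open>i\<close> lying as far left as possible, and below, through \<open>p\<close>, as
      many movable last-row factors as possible.\<close>
    define wt where "wt u = (\<Sum>j<N. j * R u j)" for u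
    have "\<exists>u0\<in>keys f. \<forall>u\<in>keys f. wt u0 \<le> wt u"
      using ne by (metis arg_min_if_finite(1) arg_min_least finite_keys)
    then obtain u0 where u0: "u0 \<in> keys f" "\<And>u. u \<in> keys f \<Longrightarrow> wt u0 \<le> wt u" by blast
    define \<rho> where "\<rho> = R u0"
    \<comment> \<open>The first occupied column of row \<open>i\<close> from \<open>b\<close> on. A
      chain in the following rows strictly beyond it extends by \<open>pos i b1\<close>. If there is
      no such column, \<open>N\<close> lies to the right of all last-row entries, so no chain can
      follow.\<close>
    define b1 where "b1 = (if \<exists>j\<ge>b. \<rho> j \<noteq> 0 then LEAST j. b \<le> j \<and> \<rho> j \<noteq> 0 else N)"
    have b1_ex: "b \<le> b1 \<and> \<rho> b1 \<noteq> 0" if "\<exists>j\<ge>b. \<rho> j \<noteq> 0"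
      using that LeastI_ex[of "\<lambda>j. b \<le> j \<and> \<rho> j \<noteq> 0"] by (auto simp: b1_def)
    have b1_low: "\<rho> j = 0" if "b \<le> j" "j < b1" for j
      using that not_less_Least[of j "\<lambda>j. b \<le> j \<and> \<rho> j \<noteq> 0"] by (auto simp: b1_def split: if_splits)
    define p where "p u = (\<Sum>j\<in>{j. j < N \<and> j \<le> b1}. g u j)" for u
    define E where "E = {u \<in> keys f. R u = \<rho>}"
    have "finite E" "E \<noteq> {}" using u0 by (auto simp: E_def \<rho>_def)
    then have "Max (p ` E) \<in> p ` E" by (intro Max_in) auto
    then obtain u1 where u1: "u1 \<in> E" "p u1 = Max (p ` E)" by auto
    have u1max: "p u \<le> p u1" if "u \<in> E" for u using \<open>finite E\<close> that by (simp add: u1(2))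
    \<comment> \<open>Move exactly the last-row factors in columns up to \<open>b1\<close> into row
      \<open>i\<close>.\<close>
    define Q where "Q = restrict (\<lambda>j. if j \<le> b1 then g u1 j else 0) {..<N}"
    have Qj: "j < N \<Longrightarrow> Q j = (if j \<le> b1 then g u1 j else 0)" for j by (simp add: Q_def)
    have sumQ: "(\<Sum>j<N. Q j) = p u1"
    proof -
      have "(\<Sum>j<N. Q j) = (\<Sum>j<N. if j \<le> b1 then g u1 j else 0)" by (rule sum.cong) (auto simp: Qj)
      also have "\<dots> = (\<Sum>j\<in>{j \<in> {..<N}. j \<le> b1}. g u1 j)" by (rule sum.inter_filter[symmetric]) simp
      finally show ?thesis by (simp add: p_def)
    qed
    have u1f: "u1 \<in> keys f" "R u1 = \<rho>" using u1 by (auto simp: E_def)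
    define S where "S = Sigma (keys f) (\<lambda>u. PiE {..<N} (\<lambda>j. {..g u j}))"
    define bin where "bin u q = (\<Prod>j<N. g u j choose q j)" for u q
    define W where "W u q = row_part i u + moved l i N q" for u q
    define Rp where "Rp u q = last_part l N (\<lambda>j. g u j - q j) + rest_part l i u" for u q
    define F where "F x = scalar (lookup f (fst x) * of_nat (bin (fst x) (snd x))) *
      mon_subst (comb l (Suc i)) (Rp (fst x) (snd x))" for x
    define A where "A = insert (pos (Suc l) i) (range (pos i))"
    have finS: "finite S" unfolding S_def by (intro finite_SigmaI finite_PiE) auto
    have uNl: "j < N" if "u \<in> keys f" "pos l j \<in> keys u" for u j using N that by blast
    have keysRp: "keys (Rp u q) \<subseteq> keys u - A" if u: "u \<in> keys f" for u q
    proof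
      fix v assume "v \<in> keys (Rp u q)"
      then consider "v \<in> keys (last_part l N (\<lambda>j. g u j - q j))" | "v \<in> keys (rest_part l i u)"
        by (auto simp: Rp_def keys_add_nat)
      then show "v \<in> keys u - A"
      proof cases
        case 1
        then obtain j where "v = pos l j" "g u j - q j \<noteq> 0" by (auto simp: in_keys_iff lookup_last_part split: if_splits)
        then show ?thesis using il by (auto simp: g_def in_keys_iff A_def)
      next
        case 2
        then have "v \<in> keys u" "v \<notin> range (pos i)" by (auto simp: rest_part_def keys_restr)
        moreover have "v \<noteq> pos (Suc l) i" using Suc.prems(2)[OF u \<open>v \<in> keys u\<close>] by auto
        ultimately show ?thesis by (auto simp: A_def)
      qed
    qed
    have comb_polys: "comb l (Suc i) v \<in> polys (- A)" if "v \<notin> A" for v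
    proof (cases "\<exists>j. v = pos l j")
      case True
      then obtain j where "v = pos l j" by blast
      then show ?thesis unfolding \<open>v = pos l j\<close> comb_last
        by (intro polys_sum polys_mult) (auto simp: A_def)
    next
      case False
      then show ?thesis using that by (simp add: comb_def)
    qed
    have "subst (comb l i) f = (\<Sum>u\<in>keys f. \<Sum>q\<in>PiE {..<N} (\<lambda>j. {..g u j}). monom_poly (W u q) * F (u, q))"
      unfolding subst_def
    proof (rule sum.cong)
      fix u assume u: "u \<in> keys f"
      then have uN: "\<forall>j. pos l j \<in> keys u \<longrightarrow> j < N" using uNl by blast
      show "scalar (lookup f u) * mon_subst (comb l i) u = (\<Sum>q\<in>PiE {..<N} (\<lambda>j. {..g u j}). monom_poly (W u q) * F (u, q))"
        unfolding mon_subst_comb_expand[OF il uN] sum_distrib_left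
        unfolding g_def[symmetric] bin_def[symmetric] F_def W_def Rp_def
        by (rule sum.cong) (simp_all only: scalar_mult scalar_of_nat fst_conv snd_conv mult_ac)
    qed simp
    also have "\<dots> = (\<Sum>x\<in>S. monom_poly (W (fst x) (snd x)) * F x)"
      unfolding S_def by (subst sum.Sigma) (auto intro!: finite_PiE simp: case_prod_beta)
    finally have sum0: "(\<Sum>x\<in>S. monom_poly (W (fst x) (snd x)) * F x) = 0" using Suc.prems(5) by simp
    have WA: "keys (W u q) \<subseteq> A" for u q
      using lookup_moved(3)[OF il, of N q] by (auto simp: W_def keys_add_nat row_part_def keys_restr A_def)
    have FA: "F x \<in> polys (- A)" if "x \<in> S" for x
    proof -
      have xf: "fst x \<in> keys f" using that unfolding S_def by (cases x) simp
      have vA: "v \<notin> A" if "v \<in> keys (Rp (fst x) (snd x))" for v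
        using subsetD[OF keysRp[OF xf] that] by simp
      show ?thesis unfolding F_def
        by (rule polys_mult[OF polys_scalar polys_mon_subst[OF comb_polys]]) (rule vA)
    qed
    define w0 where "w0 = W u1 Q"
    have ext: "(\<Sum>x\<in>{x \<in> S. W (fst x) (snd x) = w0}. F x) = 0"
      by (rule coefficient_extraction[OF finS _ _ FA sum0]) (auto simp: WA w0_def)
    have Wq: "lookup (W u q) (pos i j) = R u j + q j" if "j < N" for u q j
      using that lookup_moved(2)[OF il] by (simp add: W_def lookup_add row_part_def lookup_restr R_def)
    have Wa: "lookup (W u q) (pos (Suc l) i) = (\<Sum>j<N. q j)" if "u \<in> keys f" for u q
      using lookup_moved(1)[OF il] il by (auto simp: W_def lookup_add row_part_def lookup_restr)
    have RN: "R u j = 0" if "u \<in> keys f" "\<not> j < N" for u j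
      using N[OF that(1), of j] that(2) unfolding R_def in_keys_iff by blast
    \<comment> \<open>By \<open>minimal_move\<close> only monomials with row part \<rho> and the
      move \<open>Q\<close> produce the coefficient \<open>w0\<close>. A further last-row factor up
      to \<open>b1\<close> would contradict the maximality of \<open>p u1\<close>, so all of them
      are moved; in particular the binomial coefficients are 1.\<close>
    have contrib: "u \<in> E \<and> q = Q \<and> (\<forall>j<N. j \<le> b1 \<longrightarrow> g u j = Q j)"
      if x: "(u, q) \<in> S" "W u q = w0" for u q
    proof -
      from x(1) have u: "u \<in> keys f" and q: "q \<in> PiE {..<N} (\<lambda>j. {..g u j})" by (auto simp: S_def)
      have eq: "R u j + q j = \<rho> j + Q j" if "j < N" for j
        using Wq[OF that, of u q] Wq[OF that, of u1 Q] x(2) u1f(2) by (simp add: w0_def)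
      have tot: "(\<Sum>j<N. q j) = (\<Sum>j<N. Q j)"
        using arg_cong[OF x(2), of "\<lambda>w. lookup w (pos (Suc l) i)"] Wa[OF u, of q] Wa[OF u1f(1), of Q]
        by (simp add: w0_def)
      have qQ: "q j = Q j" if "j < N" for j
      proof (rule minimal_move[OF eq tot _ _ _ that])
        show "(\<Sum>j<N. j * \<rho> j) \<le> (\<Sum>j<N. j * R u j)" using u0(2)[OF u] by (simp add: wt_def \<rho>_def)
        show "Q j = 0" if "j < N" "b1 < j" for j using that by (simp add: Qj)
        show "\<rho> j = 0" if "j < N" "j < b1" "q j \<noteq> 0" for j
        proof (rule b1_low[OF _ that(2)])
          have "g u j \<noteq> 0" using q that by (auto simp: PiE_def Pi_def)
          then show "b \<le> j" using Suc.prems(3)[OF u, of j] by (simp add: g_def in_keys_iff)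
        qed
      qed
      have "q = Q"
        using q qQ by (intro PiE_ext[of q "{..<N}" "\<lambda>j. {..g u j}" Q]) (auto simp: Q_def PiE_def Pi_def)
      have "R u j = \<rho> j" for j
      proof (cases "j < N")
        case True
        then show ?thesis using eq[OF True] qQ[OF True] by simp
      next
        case False
        then show ?thesis using RN[OF u False] RN[OF u0(1) False] by (simp add: \<rho>_def)
      qed
      then have uE: "u \<in> E" using u by (auto simp: E_def)
      have le: "Q j \<le> g u j" if "j < N" for j using q qQ[OF that] that by (auto simp: PiE_def Pi_def)
      have "g u j = Q j" if j: "j < N" "j \<le> b1" for j
      proof (rule ccontr)
        assume "g u j \<noteq> Q j"
        with le[OF j(1)] have lt: "Q j < g u j" by simp
        have "(\<Sum>j\<in>{j. j < N \<and> j \<le> b1}. Q j) < (\<Sum>j\<in>{j. j < N \<and> j \<le> b1}. g u j)"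
          by (rule sum_strict_mono_ex1) (use le lt j in auto)
        also have "\<dots> \<le> p u1" using u1max[OF uE] by (simp add: p_def)
        also have "p u1 = (\<Sum>j\<in>{j. j < N \<and> j \<le> b1}. Q j)" unfolding p_def by (rule sum.cong) (auto simp: Qj)
        finally show False by simp
      qed
      with uE \<open>q = Q\<close> show ?thesis by blast
    qed
    define U where "U = {u. (u, Q) \<in> S \<and> W u Q = w0}"
    have US: "{x \<in> S. W (fst x) (snd x) = w0} = (\<lambda>u. (u, Q)) ` U"
      using contrib by (auto simp: U_def)
    have Uf: "u \<in> keys f" if "u \<in> U" for u using that by (auto simp: U_def S_def)
    have finU: "finite U" using Uf by (auto intro: finite_subset[of U "keys f"])
    have UE: "R u = \<rho>" "\<And>j. j < N \<Longrightarrow> j \<le> b1 \<Longrightarrow> g u j = Q j" if "u \<in> U" for u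
      using contrib[of u Q] that by (auto simp: U_def E_def)
    have u1U: "u1 \<in> U"
      using u1f by (auto simp: U_def S_def w0_def Q_def)
    have bin1: "bin u Q = 1" if "u \<in> U" for u
      unfolding bin_def
    proof (rule prod.neutral, rule ballI)
      fix j assume "j \<in> {..<N}"
      then show "g u j choose Q j = 1" using UE(2)[OF that, of j] by (cases "j \<le> b1") (auto simp: Qj)
    qed
    define f' where "f' = (\<Sum>u\<in>U. scalar (lookup f u) * monom_poly (Rp u Q))"
    have "subst (comb l (Suc i)) f' = (\<Sum>u\<in>U. F (u, Q))"
      unfolding f'_def subst_sum by (rule sum.cong) (auto simp: F_def bin1 subst_mult)
    also have "\<dots> = 0"
      using ext unfolding US by (subst (asm) sum.reindex) (auto intro: inj_onI)
    finally have f'0: "subst (comb l (Suc i)) f' = 0" .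
    have injRp: "inj_on (\<lambda>u. Rp u Q) U"
    proof (rule inj_onI)
      fix u u' assume uu: "u \<in> U" "u' \<in> U" "Rp u Q = Rp u' Q"
      have recover: "v = row_part i v + last_part l N Q + Rp v Q" if v: "v \<in> U" for v
      proof -
        have "Q j \<le> g v j" if "j < N" for j using v that by (auto simp: U_def S_def PiE_def Pi_def)
        then have "last_part l N (g v) = last_part l N Q + last_part l N (\<lambda>j. g v j - Q j)"
          unfolding last_part_def sum.distrib[symmetric] by (intro sum.cong) (auto simp flip: single_add)
        then show ?thesis using split_monomial[of i l v N] il uNl[OF Uf[OF v]]
          by (simp add: Rp_def g_def[abs_def] add.assoc)
      qed
      have "row_part i u = row_part i u'"
      proof (rule poly_mapping_eqI)
        fix v show "lookup (row_part i u) v = lookup (row_part i u') v"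
          using fun_cong[OF trans[OF UE(1)[OF uu(1)] UE(1)[OF uu(2), symmetric]]]
          by (auto simp: row_part_def lookup_restr R_def)
      qed
      then show "u = u'" using recover[OF uu(1)] recover[OF uu(2)] uu(3) by simp
    qed
    have "lookup f' (Rp u1 Q) = (\<Sum>u\<in>U. if u = u1 then lookup f u1 else 0)"
      unfolding f'_def lookup_sum
      by (rule sum.cong) (use inj_onD[OF injRp _ _ u1U] in \<open>auto simp: lookup_monom_poly\<close>)
    then have "lookup f' (Rp u1 Q) \<noteq> 0" using u1U finU u1f(1) by (simp add: in_keys_iff)
    moreover have "f' = 0"
    proof (rule Suc.IH[of "Suc i" f' "Suc b1", OF _ _ _ _ f'0])
      show "Suc i + s = l" using Suc.prems(1) by simp
      have key: "\<exists>u\<in>U. x = Rp u Q" if "x \<in> keys f'" for x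
      proof -
        have "x \<in> (\<Union>u\<in>U. keys (scalar (lookup f u) * monom_poly (Rp u Q)))"
          using that keys_sum[of "\<lambda>u. scalar (lookup f u) * monom_poly (Rp u Q)" U] unfolding f'_def by blast
        then show ?thesis by (auto simp: in_keys_iff lookup_monom_poly split: if_splits)
      qed
      show "\<exists>k j. Suc i \<le> k \<and> k \<le> l \<and> v = pos k j" if x: "x \<in> keys f'" and v: "v \<in> keys x" for x v
      proof -
        obtain u where u: "u \<in> U" "x = Rp u Q" using key[OF x] by blast
        then have vu: "v \<in> keys u" "v \<notin> range (pos i)" using keysRp[OF Uf[OF u(1)]] v by (auto simp: A_def)
        obtain k j where "i \<le> k" "k \<le> l" "v = pos k j" using Suc.prems(2)[OF Uf[OF u(1)] vu(1)] by blast
        with vu(2) show ?thesis by (intro exI[of _ k] exI[of _ j]) (auto simp: le_less)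
      qed
      show big: "Suc b1 \<le> j" if x: "x \<in> keys f'" and j: "pos l j \<in> keys x" for x j
      proof (rule ccontr)
        assume small: "\<not> Suc b1 \<le> j"
        obtain u where u: "u \<in> U" "x = Rp u Q" using key[OF x] by blast
        have "pos l j \<in> keys u" using keysRp[OF Uf[OF u(1)]] j u(2) by blast
        then have jN: "j < N" by (rule uNl[OF Uf[OF u(1)]])
        have "lookup x (pos l j) = g u j - Q j"
          using jN by (auto simp: u(2) Rp_def lookup_add lookup_last_part rest_part_def lookup_restr)
        with UE(2)[OF u(1) jN] small j show False by (simp add: in_keys_iff)
      qed
      show "\<not> chain (Suc s) (Suc i) (Suc b1) x" if x: "x \<in> keys f'" for x
      proof
        assume c: "chain (Suc s) (Suc i) (Suc b1) x"
        obtain u where u: "u \<in> U" "x = Rp u Q" using key[OF x] by blast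
        have xu: "keys x \<subseteq> keys u" using keysRp[OF Uf[OF u(1)]] u(2) by blast
        have cu: "chain (Suc s) (Suc i) (Suc b1) u" by (rule chain_mono[OF c _ xu]) simp
        show False
        proof (cases "\<exists>j\<ge>b. \<rho> j \<noteq> 0")
          case True
          from b1_ex[OF True] UE(1)[OF u(1)] have "b \<le> b1" "pos i b1 \<in> keys u"
            by (auto simp: R_def in_keys_iff fun_eq_iff)
          with cu have "chain (Suc (Suc s)) i b u" unfolding chain.simps(2)[of "Suc s"] by blast
          with Suc.prems(4)[OF Uf[OF u(1)]] show False by blast
        next
          case False
          then have "b1 = N" by (auto simp: b1_def)
          from chain_last[OF cu] Suc.prems(1) obtain j where "Suc b1 \<le> j" "pos l j \<in> keys u" by auto
          with uNl[OF Uf[OF u(1)]] \<open>b1 = N\<close> show False by fastforce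
        qed
      qed
    qed
    ultimately show False by simp
  qed
qed

end

section \<open>Weakly regular sequences\<close>

text \<open>Regularity without properness. The induction below passes through colon ideals that can
  be the whole ring.\<close>

definition weakly_regular :: "'v set \<Rightarrow> ('v, 'k::comm_ring_1) mpoly set \<Rightarrow> ('v, 'k) mpoly list \<Rightarrow> bool" where
  "weakly_regular V I fs \<longleftrightarrow> (\<forall>i<length fs. \<forall>x\<in>polys V.
     fs ! i * x \<in> gen_ideal V (I \<union> set (take i fs)) \<longrightarrow> x \<in> gen_ideal V (I \<union> set (take i fs)))"

lemma gen_ideal_insert:
  fixes f z :: "('v, 'k::comm_ring_1) mpoly"
  assumes "X \<subseteq> polys V" "f \<in> polys V"
  shows "z \<in> gen_ideal V (insert f X) \<longleftrightarrow> z \<in> polys V \<and> (\<exists>h\<in>polys V. z - f * h \<in> gen_ideal V X)"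
proof
  note G = is_ideal_gen[OF assms(1)]
  let ?P = "{z \<in> polys V. \<exists>h\<in>polys V. z - f * h \<in> gen_ideal V X}"
  have "is_ideal V ?P"
  proof (rule is_idealI)
    show "0 \<in> ?P" using is_ideal_0[OF G] by (auto intro!: bexI[of _ 0])
  next
    fix x y :: "('v, 'k) mpoly" assume "x \<in> ?P" "y \<in> ?P"
    then obtain h k where hk: "x \<in> polys V" "h \<in> polys V" "x - f * h \<in> gen_ideal V X"
      "y \<in> polys V" "k \<in> polys V" "y - f * k \<in> gen_ideal V X" by blast
    have "(x + y) - f * (h + k) = (x - f * h) + (y - f * k)" by (simp add: algebra_simps)
    also have "\<dots> \<in> gen_ideal V X" using hk by (intro is_ideal_add[OF G])
    finally show "x + y \<in> ?P" using hk by (auto intro!: bexI[of _ "h + k"] polys_add)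
  next
    fix a x :: "('v, 'k) mpoly" assume a: "a \<in> polys V" and "x \<in> ?P"
    then obtain h where hk: "x \<in> polys V" "h \<in> polys V" "x - f * h \<in> gen_ideal V X" by blast
    have "a * x - f * (a * h) = a * (x - f * h)" by (simp add: algebra_simps)
    also have "\<dots> \<in> gen_ideal V X" using hk a by (intro is_ideal_mult[OF G])
    finally show "a * x \<in> ?P" using hk a by (auto intro!: bexI[of _ "a * h"] polys_mult)
  qed auto
  moreover have "insert f X \<subseteq> ?P"
  proof -
    have "f - f * 1 \<in> gen_ideal V X" using is_ideal_0[OF G] by simp
    moreover have "x - f * 0 \<in> gen_ideal V X" if "x \<in> X" for x using gen_ideal_superset[OF assms(1)] that by auto
    ultimately show ?thesis using assms polys_0 polys_1 by blast
  qed
  ultimately have "gen_ideal V (insert f X) \<subseteq> ?P" by (rule gen_ideal_least)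
  then show "z \<in> gen_ideal V (insert f X) \<Longrightarrow> z \<in> polys V \<and> (\<exists>h\<in>polys V. z - f * h \<in> gen_ideal V X)" by blast
next
  have sub: "insert f X \<subseteq> polys V" using assms by blast
  note G = is_ideal_gen[OF sub]
  assume "z \<in> polys V \<and> (\<exists>h\<in>polys V. z - f * h \<in> gen_ideal V X)"
  then obtain h where h: "h \<in> polys V" "z - f * h \<in> gen_ideal V X" by blast
  have "gen_ideal V X \<subseteq> gen_ideal V (insert f X)" by (rule gen_ideal_mono'[OF sub]) blast
  moreover have "f * h \<in> gen_ideal V (insert f X)"
    by (rule is_ideal_mult_right[OF G h(1)]) (rule gen_idealI[OF sub], simp)
  ultimately show "z \<in> gen_ideal V (insert f X)" using h(2) is_ideal_diff_cancel[OF G, of z "f * h"] by blast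
qed

lemma gen_ideal_gen_Un:
  assumes "X \<subseteq> polys V" "Y \<subseteq> polys V"
  shows "gen_ideal V (gen_ideal V X \<union> Y) = gen_ideal V (X \<union> Y)"
proof (rule antisym)
  have 1: "X \<union> Y \<subseteq> polys V" "gen_ideal V X \<union> Y \<subseteq> polys V" using assms gen_ideal_polys by blast+
  show "gen_ideal V (gen_ideal V X \<union> Y) \<subseteq> gen_ideal V (X \<union> Y)"
    using gen_ideal_mono'[OF 1(1), of X] gen_ideal_superset[OF 1(1)] by (intro gen_ideal_mono[OF 1(1)]) blast
  show "gen_ideal V (X \<union> Y) \<subseteq> gen_ideal V (gen_ideal V X \<union> Y)"
    by (rule gen_ideal_mono'[OF 1(2)]) (use gen_ideal_superset[OF assms(1)] in blast)
qed

text \<open>With \<open>S\<close> the polynomial ring, multiplication by \<open>x\<close> embeds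
  \<open>S/(J : x)\<close> into \<open>S/J\<close> with cokernel \<open>S/(J, x)\<close>. A sequence
  that is weakly regular on both ends of this exact sequence is weakly regular in the
  middle.\<close>

lemma weakly_regular_split:
  fixes J :: "('v, 'k::comm_ring_1) mpoly set"
  assumes J: "is_ideal V J" and x: "x \<in> polys V" and fs: "set fs \<subseteq> polys V"
    and colon: "weakly_regular V {f \<in> polys V. x * f \<in> J} fs"
    and sum: "weakly_regular V (gen_ideal V (insert x J)) fs"
  shows "weakly_regular V J fs"
proof -
  let ?Jx = "{f \<in> polys V. x * f \<in> J}" and ?J' = "gen_ideal V (insert x J)"
  have JV: "J \<subseteq> polys V" using is_ideal_polys[OF J] by blast
  have tkV: "set (take i fs) \<subseteq> polys V" for i using fs set_take_subset[of i fs] by blast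
  define G where "G I i = gen_ideal V (I \<union> set (take i fs))" for I i
  have subJ: "J \<union> set (take i fs) \<subseteq> polys V" and subJx: "?Jx \<union> set (take i fs) \<subseteq> polys V" for i
    using JV tkV by blast+
  note GJ = is_ideal_gen[OF subJ] and GJx = is_ideal_gen[OF subJx]
  have Jx_ideal: "is_ideal V ?Jx"
  proof (rule is_idealI)
    fix a y :: "('v, 'k) mpoly" assume "a \<in> polys V" "y \<in> ?Jx"
    then show "a * y \<in> ?Jx" using is_ideal_mult[OF J, of a "x * y"] by (auto simp: mult.left_commute polys_mult)
  qed (use is_ideal_0[OF J] is_ideal_add[OF J] in \<open>auto simp: distrib_left polys_add\<close>)
  have GJ': "G ?J' i = gen_ideal V (insert x (J \<union> set (take i fs)))" for i
    unfolding G_def using gen_ideal_gen_Un[of "insert x J" V "set (take i fs)"] JV x tkV by simp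
  have inGJ': "z \<in> G ?J' i \<longleftrightarrow> z \<in> polys V \<and> (\<exists>h\<in>polys V. z - x * h \<in> G J i)" for z i
    unfolding GJ' unfolding G_def by (rule gen_ideal_insert[OF subJ x])
  have Suc_iff: "z \<in> G I (Suc i) \<longleftrightarrow> z \<in> polys V \<and> (\<exists>h\<in>polys V. z - fs ! i * h \<in> G I i)"
    if "i < length fs" "I \<union> set (take i fs) \<subseteq> polys V" for z I i
  proof -
    have "I \<union> set (take (Suc i) fs) = insert (fs ! i) (I \<union> set (take i fs))"
      using that(1) by (auto simp: take_Suc_conv_app_nth)
    moreover have "fs ! i \<in> polys V" using fs that(1) nth_mem by blast
    ultimately show ?thesis unfolding G_def using gen_ideal_insert[OF that(2)] by simp
  qed
  have GJ0: "G J 0 = J" unfolding G_def using gen_ideal_ideal[OF J] by simp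
  have GJx0: "G ?Jx 0 = ?Jx" unfolding G_def using gen_ideal_ideal[OF Jx_ideal] by simp
  have J'reg: "z \<in> G ?J' i" if "i < length fs" "z \<in> polys V" "fs ! i * z \<in> G ?J' i" for i z
    using sum that by (auto simp: weakly_regular_def G_def)
  have Jxreg: "z \<in> G ?Jx i" if "i < length fs" "z \<in> polys V" "fs ! i * z \<in> G ?Jx i" for i z
    using colon that by (auto simp: weakly_regular_def G_def)
  have lift: "G J i \<subseteq> G ?J' i" for i
  proof
    fix z assume z: "z \<in> G J i"
    then have "z \<in> polys V" using is_ideal_polys[OF GJ] by (auto simp: G_def)
    then show "z \<in> G ?J' i" using z inGJ'[of z i] by (auto intro!: bexI[of _ 0])
  qed
  have xG: "x * h \<in> G ?J' i" if "h \<in> polys V" for h i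
    using inGJ'[of "x * h" i] that x is_ideal_0[OF GJ, of i] by (auto intro!: bexI[of _ h] polys_mult simp: G_def)
  have GJ'_ideal: "is_ideal V (G ?J' i)" for i
    unfolding GJ' by (rule is_ideal_gen) (use subJ x in blast)
  \<comment> \<open>The embedding of the colon quotient remains injective modulo the first
    \<open>i\<close> members of the sequence. This is the vanishing of a Tor module, a consequence
    of regularity on \<open>S/(J, x)\<close>.\<close>
  have tor: "h \<in> G ?Jx i" if "i \<le> length fs" "h \<in> polys V" "x * h \<in> G J i" for i h
    using that
  proof (induction i arbitrary: h)
    case 0
    then show ?case by (simp add: GJ0 GJx0)
  next
    case (Suc i)
    then have il: "i < length fs" by simp
    have fi: "fs ! i \<in> polys V" using fs il nth_mem by blast
    from Suc.prems(3) Suc_iff[OF il subJ] obtain k where k: "k \<in> polys V" "x * h - fs ! i * k \<in> G J i" by blast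
    have "x * h - (x * h - fs ! i * k) \<in> G ?J' i"
      by (rule is_ideal_minus[OF GJ'_ideal xG[OF Suc.prems(2)]]) (use k lift in blast)
    then have "k \<in> G ?J' i" using J'reg[OF il k(1)] by simp
    then obtain h' where h': "h' \<in> polys V" "k - x * h' \<in> G J i" using inGJ' by blast
    have "x * (h - fs ! i * h') = (x * h - fs ! i * k) + fs ! i * (k - x * h')" by (simp add: algebra_simps)
    also have "\<dots> \<in> G J i"
      using k h' fi unfolding G_def by (intro is_ideal_add[OF GJ] is_ideal_mult[OF GJ]) auto
    finally have "h - fs ! i * h' \<in> G ?Jx i"
      using Suc.IH[of "h - fs ! i * h'"] il Suc.prems(2) fi h'(1) by (simp add: polys_minus polys_mult)
    then show ?case using Suc_iff[OF il subJx] Suc.prems(2) h'(1) by blast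
  qed
  show ?thesis
    unfolding weakly_regular_def
  proof (intro allI impI ballI)
    fix i f assume il: "i < length fs" and f: "f \<in> polys V" and mem: "fs ! i * f \<in> gen_ideal V (J \<union> set (take i fs))"
    have fi: "fs ! i \<in> polys V" using fs il nth_mem by blast
    from mem have mem': "fs ! i * f \<in> G J i" by (simp add: G_def)
    then have "f \<in> G ?J' i" using J'reg[OF il f] lift by blast
    then obtain g where g: "g \<in> polys V" "f - x * g \<in> G J i" using inGJ' by blast
    have "x * (fs ! i * g) = fs ! i * f - fs ! i * (f - x * g)" by (simp add: algebra_simps)
    also have "\<dots> \<in> G J i"
      using is_ideal_minus[OF GJ mem'[unfolded G_def] is_ideal_mult[OF GJ fi g(2)[unfolded G_def]]] unfolding G_def .
    finally have "fs ! i * g \<in> G ?Jx i" using tor[of i] il fi g(1) by (simp add: polys_mult)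
    then have gx: "g \<in> G ?Jx i" by (rule Jxreg[OF il g(1)])
    have "G ?Jx i \<subseteq> {h \<in> polys V. x * h \<in> G J i}"
      unfolding G_def
    proof (rule gen_ideal_least)
      show "is_ideal V {h \<in> polys V. x * h \<in> gen_ideal V (J \<union> set (take i fs))}"
      proof (rule is_idealI)
        fix a y :: "('v, 'k) mpoly" assume "a \<in> polys V" "y \<in> {h \<in> polys V. x * h \<in> gen_ideal V (J \<union> set (take i fs))}"
        then show "a * y \<in> {h \<in> polys V. x * h \<in> gen_ideal V (J \<union> set (take i fs))}"
          using is_ideal_mult[OF GJ, of a "x * y"] by (auto simp: mult.left_commute polys_mult)
      qed (use is_ideal_0[OF GJ] is_ideal_add[OF GJ] in \<open>auto simp: distrib_left polys_add\<close>)
      show "?Jx \<union> set (take i fs) \<subseteq> {h \<in> polys V. x * h \<in> gen_ideal V (J \<union> set (take i fs))}"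
        using gen_ideal_superset[OF subJ, of i] tkV[of i] is_ideal_mult[OF GJ x, of _ i] by blast
    qed
    with gx have "x * g \<in> G J i" by blast
    with g(2) show "f \<in> gen_ideal V (J \<union> set (take i fs))"
      using is_ideal_diff_cancel[OF GJ] unfolding G_def by blast
  qed
qed

text \<open>As many linear forms as variables, generating all variables, are independent. So each
  \<open>fs ! i\<close> stays nonzero in the polynomial ring left after its predecessors are
  eliminated, and that ring is a domain.\<close>

lemma weakly_regular_linear:
  fixes fs :: "('v::linorder, 'k::field) mpoly list"
  assumes V: "finite V" and C: "C \<subseteq> V" and fs: "set fs \<subseteq> homog_part V 1"
    and len: "card C + length fs = card V"
    and gen: "\<And>v. v \<in> V \<Longrightarrow> indet v \<in> gen_ideal V (indet ` C \<union> set fs)"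
  shows "weakly_regular V (gen_ideal V (indet ` C)) fs"
  unfolding weakly_regular_def
proof (intro allI impI ballI)
  fix i x assume i: "i < length fs" and x: "x \<in> polys V"
    and mem: "fs ! i * x \<in> gen_ideal V (gen_ideal V (indet ` C) \<union> set (take i fs))"
  have CV: "indet ` C \<subseteq> (polys V :: ('v, 'k) mpoly set)" using C by auto
  have fsV: "set fs \<subseteq> polys V" using fs homog_polys by blast
  have tkV: "set (take i fs) \<subseteq> polys V" using fsV set_take_subset[of i fs] by blast
  obtain cs where cs: "set cs = C" "length cs = card C" using finite_list_card[of C] V C finite_subset by metis
  define ls where "ls = map indet cs @ take i fs"
  have ls: "set ls = indet ` C \<union> set (take i fs)" by (simp add: ls_def cs)
  have lsV: "set ls \<subseteq> polys V" unfolding ls using CV tkV by blast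
  have lsh: "set ls \<subseteq> homog_part V 1" unfolding ls using C fs set_take_subset[of i fs] by auto
  have geq: "gen_ideal V (gen_ideal V (indet ` C) \<union> set (take i fs)) = gen_ideal V (set ls)"
    unfolding ls by (rule gen_ideal_gen_Un[OF CV tkV])
  obtain B \<rho> where B: "B \<subseteq> V" and \<rho>: "\<And>v. v \<in> V \<Longrightarrow> \<rho> v \<in> homog_part B 1" "\<And>l. l \<in> set ls \<Longrightarrow> subst \<rho> l = 0"
    "\<And>v. v \<in> V \<Longrightarrow> indet v - \<rho> v \<in> gen_ideal V (set ls)"
    using linear_elim[OF V lsh] by blast
  have ker: "f \<in> gen_ideal V (set ls)" if "f \<in> polys V" "subst \<rho> f = 0" for f
  proof -
    have "\<rho> v \<in> polys V" if "v \<in> V" for v using \<rho>(1)[OF that] homog_mono[OF B] homog_polys by blast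
    then have "f - subst \<rho> f \<in> gen_ideal V (set ls)"
      by (intro subst_diff_ideal[OF is_ideal_gen[OF lsV] _ \<rho>(3) that(1)])
    then show ?thesis using that(2) by simp
  qed
  have "subst \<rho> (fs ! i) * subst \<rho> x = 0"
    using gen_ideal_subst_0[OF mem[unfolded geq] lsV \<rho>(2)] by (simp add: subst_mult)
  moreover have "subst \<rho> (fs ! i) \<noteq> 0"
  proof
    assume "subst \<rho> (fs ! i) = 0"
    moreover have "fs ! i \<in> polys V" using fsV i nth_mem by blast
    ultimately have fi: "fs ! i \<in> gen_ideal V (set ls)" by (intro ker)
    define ls' where "ls' = ls @ drop (Suc i) fs"
    have ls'h: "set ls' \<subseteq> homog_part V 1" using lsh fs set_drop_subset[of "Suc i" fs] by (auto simp: ls'_def)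
    then have ls'V: "set ls' \<subseteq> polys V" using homog_polys by blast
    have len': "length ls' < card V" using len i by (simp add: ls'_def ls_def cs(2))
    obtain B' \<rho>' where B': "B' \<subseteq> V" "card V \<le> card B' + length ls'" and \<rho>': "\<And>b. b \<in> B' \<Longrightarrow> \<rho>' b = indet b"
      "\<And>l. l \<in> set ls' \<Longrightarrow> subst \<rho>' l = 0" using linear_elim[OF V ls'h] by blast
    have "B' \<noteq> {}" using B'(2) len' by auto
    then obtain b where b: "b \<in> B'" by blast
    have "indet ` C \<union> set fs \<subseteq> gen_ideal V (set ls')"
    proof -
      have fs_eq: "fs = take i fs @ fs ! i # drop (Suc i) fs" by (rule id_take_nth_drop[OF i])
      have "set fs = set (take i fs) \<union> {fs ! i} \<union> set (drop (Suc i) fs)"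
        by (subst fs_eq) (simp only: set_append list.set Un_insert_left Un_empty_left Un_insert_right Un_empty_right Un_assoc)
      moreover have "fs ! i \<in> gen_ideal V (set ls')"
        using gen_ideal_mono'[OF ls'V, of "set ls"] fi by (auto simp: ls'_def)
      ultimately show ?thesis using gen_ideal_superset[OF ls'V] by (auto simp: ls'_def ls)
    qed
    then have "gen_ideal V (indet ` C \<union> set fs) \<subseteq> gen_ideal V (set ls')" by (rule gen_ideal_mono[OF ls'V])
    then have "indet b \<in> gen_ideal V (set ls')" using gen[of b] b B'(1) by blast
    then have "subst \<rho>' (indet b) = 0" by (rule gen_ideal_subst_0[OF _ ls'V \<rho>'(2)])
    with \<rho>'(1)[OF b] show False by simp
  qed
  ultimately have "subst \<rho> x = 0" by simp
  then show "x \<in> gen_ideal V (gen_ideal V (indet ` C) \<union> set (take i fs))" unfolding geq by (rule ker[OF x])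
qed

definition mono_ideal :: "'v set \<Rightarrow> ('v monomial \<Rightarrow> bool) \<Rightarrow> ('v, 'k::comm_ring_1) mpoly set" where
  "mono_ideal V P = {f \<in> polys V. \<forall>u\<in>keys f. P u}"

lemma is_ideal_mono_ideal:
  assumes "\<And>u w. P u \<Longrightarrow> P (w + u)"
  shows "is_ideal V (mono_ideal V P :: ('v, 'k::comm_ring_1) mpoly set)"
proof (rule is_idealI)
  fix x y assume "x \<in> (mono_ideal V P :: ('v, 'k) mpoly set)" "y \<in> (mono_ideal V P :: ('v, 'k) mpoly set)"
  then show "x + y \<in> mono_ideal V P" using keys_add[of x y] by (auto simp: mono_ideal_def polys_add)
next
  fix a x :: "('v, 'k) mpoly" assume "a \<in> polys V" "x \<in> mono_ideal V P"
  then show "a * x \<in> mono_ideal V P" using keys_mult[of a x] assms by (fastforce simp: mono_ideal_def polys_mult)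
qed (auto simp: mono_ideal_def)

lemma keys_indet_mult: "keys (indet v * f :: ('v, 'k::comm_ring_1) mpoly) = (\<lambda>u. single v 1 + u) ` keys f"
proof
  show "keys (indet v * f) \<subseteq> (\<lambda>u. single v 1 + u) ` keys f"
    using keys_mult[of "indet v" f] by (auto simp: indet_def)
  show "(\<lambda>u. single v 1 + u) ` keys f \<subseteq> keys (indet v * f)"
    by (auto simp: in_keys_iff indet_def lookup_monom_mult)
qed

lemma mono_ideal_expand:
  assumes "f \<in> polys V" "is_ideal V Q" "\<And>u. u \<in> keys f \<Longrightarrow> monom_poly u \<in> Q"
  shows "f \<in> Q"
  by (subst mpoly_expand) (intro is_ideal_sum[OF assms(2)] is_ideal_mult[OF assms(2)] polys_scalar assms(3))

section \<open>The maximal diagonals as a Cohen--Macaulay ideal\<close>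

locale wide_matrix = matrix_pos +
  fixes t N :: nat and VV :: "(nat \<times> nat) set"
  assumes tN: "1 \<le> t" "t \<le> N" and VV: "VV = (\<lambda>(i, j). pos i j) ` ({..<t} \<times> {..<N})"
begin

text \<open>Also the number of diagonals of the matrix that meet all \<open>t\<close> rows, hence
  the number of variables left in the Artinian reduction.\<close>

definition codim :: nat where "codim = N - t + 1"

lemma finite_VV [simp]: "finite VV" and card_VV: "card VV = t * N"
proof -
  have "inj_on (\<lambda>(i, j). pos i j) ({..<t} \<times> {..<N})" by (rule inj_onI) auto
  then show "card VV = t * N" unfolding VV by (simp add: card_image card_cartesian_product)
qed (simp add: VV)

lemma pos_VV [simp]: "pos i j \<in> VV \<longleftrightarrow> i < t \<and> j < N"
  unfolding VV by (auto simp: image_iff)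

lemma VV_cases: "v \<in> VV \<Longrightarrow> (\<And>i j. v = pos i j \<Longrightarrow> i < t \<Longrightarrow> j < N \<Longrightarrow> thesis) \<Longrightarrow> thesis"
  unfolding VV by auto

definition first_entries :: "(nat \<times> nat) set" where
  "first_entries = (\<lambda>d. pos 0 d) ` {..<codim}"

text \<open>Differences of neighbours along the full diagonals, and the variable itself in the two
  corners. Indexing the forms by positions outside \<open>first_entries\<close> leaves one
  representative per full diagonal.\<close>

definition sop_form :: "nat \<times> nat \<Rightarrow> (nat \<times> nat, 'k::comm_ring_1) mpoly" where
  "sop_form v = indet v - (if \<exists>i d. v = pos (Suc i) (Suc i + d) \<and> d < codim
     then indet (THE w. \<exists>i d. v = pos (Suc i) (Suc i + d) \<and> w = pos i (i + d)) else 0)"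

lemma sop_form_diagonal: "d < codim \<Longrightarrow> sop_form (pos (Suc i) (Suc i + d)) = indet (pos (Suc i) (Suc i + d)) - indet (pos i (i + d))"
proof -
  assume d: "d < codim"
  have "(THE w. \<exists>i' d'. pos (Suc i) (Suc i + d) = pos (Suc i') (Suc i' + d') \<and> w = pos i' (i' + d')) = pos i (i + d)"
    by (rule the_equality) auto
  then show ?thesis using d by (auto simp: sop_form_def)
qed

lemma sop_form_corner: "j < i \<or> i + codim \<le> j \<Longrightarrow> sop_form (pos i j) = indet (pos i j)"
  by (auto simp: sop_form_def)

lemma sop_form_homog: "v \<in> VV \<Longrightarrow> sop_form v \<in> (homog_part VV 1 :: (nat \<times> nat, 'k::comm_ring_1) mpoly set)"
proof -
  assume v: "v \<in> VV"
  show ?thesis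
  proof (cases "\<exists>i d. v = pos (Suc i) (Suc i + d) \<and> d < codim")
    case True
    then obtain i d where "v = pos (Suc i) (Suc i + d)" "d < codim" by blast
    then have "indet v - indet (pos i (i + d)) \<in> (homog_part VV 1 :: (nat \<times> nat, 'k::comm_ring_1) mpoly set)"
      using v by (intro homog_minus homog_indet) auto
    then show ?thesis unfolding \<open>v = _\<close> sop_form_diagonal[OF \<open>d < codim\<close>] .
  next
    case False
    then have "sop_form v = (indet v :: (nat \<times> nat, 'k) mpoly)" unfolding sop_form_def by (simp only: if_False diff_zero)
    then show ?thesis using v by (simp only: homog_indet)
  qed
qed

definition is_sop :: "(nat \<times> nat, 'k::comm_ring_1) mpoly list \<Rightarrow> bool" where
  "is_sop fs \<longleftrightarrow> set fs = sop_form ` (VV - first_entries) \<and> length fs = t * N - codim"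

lemma sop_exists: "\<exists>fs :: (nat \<times> nat, 'k::comm_ring_1) mpoly list. is_sop fs"
proof -
  obtain vs where vs: "set vs = VV - first_entries" "length vs = card (VV - first_entries)"
    using finite_list_card[of "VV - first_entries"] by auto
  have "inj_on (pos 0) {..<codim}" by (rule inj_onI) simp
  then have "card first_entries = codim" by (simp add: first_entries_def card_image)
  moreover have "first_entries \<subseteq> VV" using tN by (auto simp: first_entries_def codim_def)
  ultimately have "length vs = t * N - codim" by (simp add: vs(2) card_Diff_subset finite_subset[OF _ finite_VV] card_VV)
  then show ?thesis using vs(1) by (intro exI[of _ "map sop_form vs"]) (simp add: is_sop_def)
qed

lemma chain_too_long: "u \<in> monomials_in VV \<Longrightarrow> 0 < s \<Longrightarrow> N < b + s \<Longrightarrow> \<not> chain s i b u"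
proof (induction s arbitrary: i b)
  case (Suc s)
  show ?case
  proof
    assume "chain (Suc s) i b u"
    then obtain j where j: "b \<le> j" "pos i j \<in> keys u" "chain s (Suc i) (Suc j) u" by auto
    then have "j < N" using Suc.prems(1) by (auto simp: monomials_in_def dest!: subsetD)
    with j Suc.prems(3) have "0 < s" "N < Suc j + s" by auto
    with Suc.IH[of "Suc j" "Suc i"] Suc.prems(1) j(3) show False by blast
  qed
qed simp

text \<open>This shape is stable under the two operations of the induction on the variable at
  \<open>pos i b\<close>, the leftmost possible start of a chain: the colon ideal drops row
  \<open>i\<close> from the chains, and the sum puts the variable into \<open>C\<close> and raises
  \<open>b\<close>.\<close>

definition blocked :: "nat \<Rightarrow> nat \<Rightarrow> nat \<Rightarrow> (nat \<times> nat) set \<Rightarrow> (nat \<times> nat) monomial \<Rightarrow> bool" where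
  "blocked s i b C u \<longleftrightarrow> (\<exists>v\<in>C. v \<in> keys u) \<or> chain s i b u"

lemma blocked_add: "blocked s i b C u \<Longrightarrow> blocked s i b C (w + u)"
  using chain_mono[of s i b u b "w + u"] by (auto simp: blocked_def keys_add_nat)

context
  fixes fs :: "(nat \<times> nat, 'k::field) mpoly list"
  assumes sop: "is_sop fs"
begin

lemma sop_homog: "set fs \<subseteq> homog_part VV 1"
  using sop sop_form_homog by (auto simp: is_sop_def)

lemma sop_polys: "set fs \<subseteq> polys VV"
  using sop_homog homog_polys by blast

lemma sop_corner: "i < t \<Longrightarrow> j < N \<Longrightarrow> j < i \<or> i + codim \<le> j \<Longrightarrow> indet (pos i j) \<in> set fs"
proof -
  assume ij: "i < t" "j < N" "j < i \<or> i + codim \<le> j"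
  then have "pos i j \<in> VV - first_entries" by (auto simp: first_entries_def)
  then have "sop_form (pos i j) \<in> set fs" using sop unfolding is_sop_def by blast
  then show ?thesis using sop_form_corner[OF ij(3)] by metis
qed

lemma sop_diagonal: "Suc i < t \<Longrightarrow> d < codim \<Longrightarrow> indet (pos (Suc i) (Suc i + d)) - indet (pos i (i + d)) \<in> set fs"
proof -
  assume id: "Suc i < t" "d < codim"
  then have "Suc i + d < N" using tN by (simp add: codim_def)
  then have "pos (Suc i) (Suc i + d) \<in> VV - first_entries" using id(1) by (auto simp: first_entries_def)
  then have "sop_form (pos (Suc i) (Suc i + d)) \<in> set fs" using sop unfolding is_sop_def by blast
  then show ?thesis using sop_form_diagonal[OF id(2), of i] by metis
qed

lemma diagonal_congruent:
  assumes Q: "is_ideal VV Q" "set fs \<subseteq> Q" and "i < t" "d < codim"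
  shows "indet (pos i (i + d)) - indet (pos 0 d) \<in> Q"
  using assms(3)
proof (induction i)
  case 0
  then show ?case using is_ideal_0[OF Q(1)] by simp
next
  case (Suc i)
  then have "indet (pos i (i + d)) - indet (pos 0 d) \<in> Q" by simp
  moreover have "indet (pos (Suc i) (Suc i + d)) - indet (pos i (i + d)) \<in> Q"
    using sop_diagonal[OF Suc.prems assms(4)] Q(2) by blast
  ultimately show ?case using is_ideal_add[OF Q(1)] by fastforce
qed

text \<open>The last hypotheses say that \<open>C\<close> has one variable on each of the first
  \<open>b - i\<close> full diagonals. For \<open>s = 0\<close> the ideal is the whole ring. For
  \<open>b - i = codim\<close> no chain fits any more, and the ideal is generated by
  \<open>C\<close>, which together with the identifications in \<open>fs\<close> generates all
  variables. In between, \<open>weakly_regular_split\<close> at \<open>pos i b\<close> decreases the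
  measure on both sides.\<close>

lemma weakly_regular_blocked:
  assumes "i + s = t" "i \<le> b" "b - i \<le> codim" "card C = b - i" "C \<subseteq> VV" "\<And>d. d < b - i \<Longrightarrow> \<exists>r<t. pos r (r + d) \<in> C"
    "\<And>r j. pos r j \<in> C \<Longrightarrow> \<exists>d<b - i. j = r + d"
  shows "weakly_regular VV (mono_ideal VV (blocked s i b C) :: (nat \<times> nat, 'k) mpoly set) fs"
  using assms
proof (induction "s + (codim - (b - i))" arbitrary: s i b C rule: less_induct)
  case less
  let ?Q = "mono_ideal VV (blocked s i b C) :: (nat \<times> nat, 'k) mpoly set"
  note IH = less.hyps and prems = less.prems
  have Qid: "is_ideal VV ?Q" by (rule is_ideal_mono_ideal) (rule blocked_add)
  have QV: "?Q \<subseteq> polys VV" by (auto simp: mono_ideal_def)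
  consider "s = 0" | "0 < s" "b - i = codim" | "0 < s" "b - i < codim" using prems(3) by linarith
  then show ?case
  proof cases
    case 1
    then have Q: "?Q = polys VV" by (auto simp: mono_ideal_def blocked_def)
    show ?thesis unfolding weakly_regular_def Q
    proof (intro allI impI ballI)
      fix k x assume x: "x \<in> (polys VV :: (nat \<times> nat, 'k) mpoly set)"
      have "polys VV \<union> set (take k fs) \<subseteq> polys VV" using sop_polys set_take_subset[of k fs] by blast
      from gen_ideal_superset[OF this] x show "x \<in> gen_ideal VV (polys VV \<union> set (take k fs))" by blast
    qed
  next
    case 2
    have CV: "indet ` C \<subseteq> (polys VV :: (nat \<times> nat, 'k) mpoly set)" using prems(5) by auto
    have "?Q = gen_ideal VV (indet ` C)"
    proof (rule gen_ideal_eqI[OF Qid, symmetric])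
      show "indet ` C \<subseteq> ?Q" using prems(5) by (auto simp: mono_ideal_def blocked_def indet_def monomials_in_def)
      show "?Q \<subseteq> gen_ideal VV (indet ` C)"
      proof
        fix f assume f: "f \<in> ?Q"
        then have fV: "f \<in> polys VV" by (simp add: mono_ideal_def)
        show "f \<in> gen_ideal VV (indet ` C)"
        proof (rule mono_ideal_expand[OF fV is_ideal_gen[OF CV]])
          fix u assume u: "u \<in> keys f"
          have uV: "u \<in> monomials_in VV" using fV u by (auto simp: polys_def)
          have "N < b + s" using 2 prems(1,2) tN by (simp add: codim_def)
          then have "\<not> chain s i b u" using chain_too_long[OF uV 2(1)] by blast
          then obtain v where v: "v \<in> C" "v \<in> keys u" using f u by (auto simp: mono_ideal_def blocked_def)
          obtain w where w: "u = w + single v 1" using in_keys_split[OF v(2)] by blast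
          have "w \<in> monomials_in VV" using uV by (auto simp: w monomials_in_def keys_add_nat)
          then have wp: "monom_poly w \<in> (polys VV :: (nat \<times> nat, 'k) mpoly set)" by simp
          have "indet v \<in> (gen_ideal VV (indet ` C) :: (nat \<times> nat, 'k) mpoly set)" by (rule gen_idealI[OF CV imageI[OF v(1)]])
          from is_ideal_mult[OF is_ideal_gen[OF CV] wp this]
          show "monom_poly u \<in> (gen_ideal VV (indet ` C) :: (nat \<times> nat, 'k) mpoly set)" unfolding w monom_poly_add indet_def[symmetric] .
        qed
      qed
    qed
    moreover have "weakly_regular VV (gen_ideal VV (indet ` C)) fs"
    proof (rule weakly_regular_linear[OF finite_VV prems(5) sop_homog])
      have "codim \<le> t * N" using tN le_trans[of codim N "t * N"] by (simp add: codim_def)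
      then show "card C + length fs = card VV" using sop 2 prems(4) by (simp add: is_sop_def card_VV)
      fix v assume v: "v \<in> VV"
      let ?G = "gen_ideal VV (indet ` C \<union> set fs)"
      have sub: "indet ` C \<union> set fs \<subseteq> polys VV" using CV sop_polys by blast
      note G = is_ideal_gen[OF sub] and GI = gen_ideal_superset[OF sub]
      obtain r j where rj: "v = pos r j" "r < t" "j < N" using v by (rule VV_cases)
      show "indet v \<in> ?G"
      proof (cases "j < r \<or> r + codim \<le> j")
        case True
        then show ?thesis using sop_corner[OF rj(2,3)] GI rj(1) by blast
      next
        case False
        define d where "d = j - r"
        have d: "j = r + d" "d < codim" using False by (auto simp: d_def)
        obtain r0 where r0: "r0 < t" "pos r0 (r0 + d) \<in> C" using prems(6)[of d] 2(2) d(2) by auto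
        have fsG: "set fs \<subseteq> ?G" using GI by blast
        have "indet (pos r0 (r0 + d)) \<in> ?G" using GI r0(2) by blast
        from is_ideal_minus[OF G this diagonal_congruent[OF G fsG r0(1) d(2)]]
        have "indet (pos 0 d) \<in> ?G" by simp
        from is_ideal_add[OF G diagonal_congruent[OF G fsG rj(2) d(2)] this]
        show ?thesis by (simp add: rj(1) d(1))
      qed
    qed
    ultimately show ?thesis by simp
  next
    case 3
    define x where "x = (indet (pos i b) :: (nat \<times> nat, 'k) mpoly)"
    obtain s' where s': "s = Suc s'" using 3(1) by (cases s) auto
    have it: "i < t" using prems(1) 3(1) by simp
    have bN: "b < N" using 3(2) prems(2) it tN by (simp add: codim_def)
    have xV: "x \<in> polys VV" using it bN by (simp add: x_def)
    have nC: "pos i b \<notin> C" using prems(7)[of i b] prems(2) by auto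
    \<comment> \<open>Once the leftmost start \<open>pos i b\<close> is present, every chain may
      begin there, and this leaves the most room for the rest.\<close>
    have colon: "{f \<in> polys VV. x * f \<in> ?Q} = mono_ideal VV (blocked s' (Suc i) (Suc b) C)"
    proof -
      have "blocked s i b C (single (pos i b) 1 + u) \<longleftrightarrow> blocked s' (Suc i) (Suc b) C u" for u
      proof -
        let ?u = "single (pos i b) 1 + u"
        have ku: "keys ?u = insert (pos i b) (keys u)" by (simp add: keys_add_nat)
        have "chain s i b ?u \<longleftrightarrow> chain s' (Suc i) (Suc b) ?u"
        proof
          assume "chain s i b ?u"
          then obtain j where "b \<le> j" "chain s' (Suc i) (Suc j) ?u" unfolding s' chain.simps(2) by blast
          then show "chain s' (Suc i) (Suc b) ?u" using chain_mono[of s' "Suc i" "Suc j" ?u "Suc b" ?u] by blast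
        next
          assume "chain s' (Suc i) (Suc b) ?u"
          moreover have "pos i b \<in> keys ?u" using ku by blast
          ultimately show "chain s i b ?u" unfolding s' chain.simps(2) by blast
        qed
        also have "\<dots> \<longleftrightarrow> chain s' (Suc i) (Suc b) u" by (rule chain_cong) (auto simp: ku)
        finally have c: "chain s i b ?u \<longleftrightarrow> chain s' (Suc i) (Suc b) u" .
        show ?thesis unfolding blocked_def c ku using nC by blast
      qed
      then have "(\<forall>u\<in>keys (x * f). blocked s i b C u) \<longleftrightarrow> (\<forall>u\<in>keys f. blocked s' (Suc i) (Suc b) C u)" for f
        unfolding x_def keys_indet_mult by simp
      moreover have "x * f \<in> polys VV" if "f \<in> polys VV" for f using xV that by (rule polys_mult)
      ultimately have "f \<in> polys VV \<and> x * f \<in> ?Q \<longleftrightarrow> f \<in> mono_ideal VV (blocked s' (Suc i) (Suc b) C)" for f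
        by (auto simp only: mono_ideal_def mem_Collect_eq)
      then show ?thesis by blast
    qed
    have sum: "gen_ideal VV (insert x ?Q) = mono_ideal VV (blocked s i (Suc b) (insert (pos i b) C))" (is "_ = ?R")
    proof (rule gen_ideal_eqI)
      show "is_ideal VV ?R" by (rule is_ideal_mono_ideal) (rule blocked_add)
      have "blocked s i (Suc b) (insert (pos i b) C) u" if "blocked s i b C u" for u
      proof (cases "pos i b \<in> keys u")
        case False
        have "chain s i (Suc b) u" if c: "chain s i b u"
        proof -
          from c obtain j where j: "b \<le> j" "pos i j \<in> keys u" "chain s' (Suc i) (Suc j) u" unfolding s' chain.simps(2) by blast
          with False have "Suc b \<le> j" by (metis Suc_leI le_neq_implies_less)
          with j(2,3) show ?thesis unfolding s' chain.simps(2) by blast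
        qed
        then show ?thesis using that unfolding blocked_def by blast
      qed (simp add: blocked_def)
      then have "?Q \<subseteq> ?R" unfolding mono_ideal_def by blast
      moreover have "x \<in> ?R" using xV by (simp add: mono_ideal_def x_def indet_def monom_poly_def blocked_def)
      ultimately show "insert x ?Q \<subseteq> ?R" by blast
      show "?R \<subseteq> gen_ideal VV (insert x ?Q)"
      proof
        fix f assume f: "f \<in> ?R"
        then have fV: "f \<in> polys VV" by (simp add: mono_ideal_def)
        have sub: "insert x ?Q \<subseteq> polys VV" using xV QV by blast
        note G = is_ideal_gen[OF sub]
        show "f \<in> gen_ideal VV (insert x ?Q)"
        proof (rule mono_ideal_expand[OF fV G])
          fix u assume u: "u \<in> keys f"
          have uV: "u \<in> monomials_in VV" using fV u by (auto simp: polys_def)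
          show "monom_poly u \<in> gen_ideal VV (insert x ?Q)"
          proof (cases "pos i b \<in> keys u")
            case True
            from in_keys_split[OF True] obtain w where w: "u = w + single (pos i b) 1" by blast
            have "w \<in> monomials_in VV" using uV by (auto simp: w monomials_in_def keys_add_nat)
            then have wp: "monom_poly w \<in> (polys VV :: (nat \<times> nat, 'k) mpoly set)" by simp
            have "x \<in> gen_ideal VV (insert x ?Q)" by (rule gen_idealI[OF sub]) simp
            from is_ideal_mult[OF G wp this]
            show ?thesis unfolding w monom_poly_add indet_def[symmetric] x_def[symmetric] .
          next
            case False
            then have "blocked s i b C u" using f u chain_mono[of s i "Suc b" u b u]
              by (auto simp: mono_ideal_def blocked_def)
            then have "monom_poly u \<in> ?Q" using uV by (simp add: mono_ideal_def)
            then show ?thesis by (intro gen_idealI[OF sub]) blast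
          qed
        qed
      qed
    qed
    have Cfin: "finite C" by (rule finite_subset[OF prems(5)]) simp
    show ?thesis
    proof (rule weakly_regular_split[OF Qid xV sop_polys])
      show "weakly_regular VV {f \<in> polys VV. x * f \<in> ?Q} fs"
        unfolding colon by (rule IH) (use prems s' in auto)
      show "weakly_regular VV (gen_ideal VV (insert x ?Q)) fs"
        unfolding sum
      proof (rule IH)
        show "s + (codim - (Suc b - i)) < s + (codim - (b - i))" using 3 prems(2) by linarith
        show "card (insert (pos i b) C) = Suc b - i" using nC Cfin prems(2,4) by simp
        show "\<exists>r<t. pos r (r + d) \<in> insert (pos i b) C" if "d < Suc b - i" for d
        proof (cases "d = b - i")
          case True
          then show ?thesis using it prems(2) by (intro exI[of _ i]) auto
        next
          case False
          then have "d < b - i" using that prems(2) by linarith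
          from prems(6)[OF this] show ?thesis by blast
        qed
        show "\<exists>d<Suc b - i. j = r + d" if rj: "pos r j \<in> insert (pos i b) C" for r j
        proof (cases "pos r j \<in> C")
          case True
          from prems(7)[OF this] prems(2) show ?thesis by (metis Suc_diff_le less_Suc_eq)
        next
          case False
          with rj prems(2) show ?thesis by (intro exI[of _ "b - i"]) auto
        qed
      qed (use prems it bN 3 in auto)
    qed
  qed
qed

lemma weakly_regular_chain: "weakly_regular VV (mono_ideal VV (chain t 0 0) :: (nat \<times> nat, 'k) mpoly set) fs"
  using weakly_regular_blocked[of 0 t 0 "{}"] by (simp add: blocked_def[abs_def])

end

end

section \<open>The Artinian reduction of the chain ideal and its Lefschetz property\<close>

context matrix_pos
begin

lemma chain_iff:
  "chain s i b u \<longleftrightarrow> (\<exists>c. (\<forall>k<s. b \<le> c k \<and> pos (i + k) (c k) \<in> keys u) \<and> (\<forall>k l. k < l \<longrightarrow> l < s \<longrightarrow> c k < c l))"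
proof
  show "chain s i b u \<Longrightarrow> \<exists>c. (\<forall>k<s. b \<le> c k \<and> pos (i + k) (c k) \<in> keys u) \<and> (\<forall>k l. k < l \<longrightarrow> l < s \<longrightarrow> c k < c l)"
  proof (induction s arbitrary: i b)
    case (Suc s)
    then obtain j where j: "b \<le> j" "pos i j \<in> keys u" "chain s (Suc i) (Suc j) u" by auto
    from Suc.IH[OF j(3)] obtain c where c: "\<And>k. k < s \<Longrightarrow> Suc j \<le> c k \<and> pos (Suc i + k) (c k) \<in> keys u"
      "\<And>k l. k < l \<Longrightarrow> l < s \<Longrightarrow> c k < c l" by blast
    show ?case
    proof (intro exI[of _ "case_nat j c"] conjI allI impI)
      fix k assume k: "k < Suc s"
      show "b \<le> case_nat j c k" "pos (i + k) (case_nat j c k) \<in> keys u"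
        using c(1)[of "k - 1"] j k by (cases k; simp)+
    next
      fix k l assume "k < l" "l < Suc s"
      then show "case_nat j c k < case_nat j c l"
        using c(1)[of "l - 1"] c(2)[of "k - 1" "l - 1"] by (cases k; cases l) (auto simp: Suc_le_eq)
    qed
  qed simp
  show "\<exists>c. (\<forall>k<s. b \<le> c k \<and> pos (i + k) (c k) \<in> keys u) \<and> (\<forall>k l. k < l \<longrightarrow> l < s \<longrightarrow> c k < c l) \<Longrightarrow> chain s i b u"
  proof (induction s arbitrary: i b)
    case (Suc s)
    then obtain c where c: "\<And>k. k < Suc s \<Longrightarrow> b \<le> c k \<and> pos (i + k) (c k) \<in> keys u"
      "\<And>k l. k < l \<Longrightarrow> l < Suc s \<Longrightarrow> c k < c l" by blast
    have "chain s (Suc i) (Suc (c 0)) u"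
    proof (rule Suc.IH, intro exI[of _ "\<lambda>k. c (Suc k)"] conjI allI impI)
      fix k assume "k < s"
      then show "Suc (c 0) \<le> c (Suc k)" "pos (Suc i + k) (c (Suc k)) \<in> keys u"
        using c(1)[of "Suc k"] c(2)[of 0 "Suc k"] by auto
    qed (use c(2) in auto)
    then show ?case using c(1)[of 0] by auto
  qed simp
qed

lemma chain_degree: "chain s i b u \<Longrightarrow> s \<le> mon_degree u"
proof (induction s arbitrary: i b u)
  case (Suc s)
  then obtain j where j: "pos i j \<in> keys u" "chain s (Suc i) (Suc j) u" by auto
  from in_keys_split[OF j(1)] obtain w where w: "u = w + single (pos i j) 1" by blast
  have "chain s (Suc i) (Suc j) w \<longleftrightarrow> chain s (Suc i) (Suc j) u"
    by (rule chain_cong) (auto simp: w keys_add_nat)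
  with j(2) have "s \<le> mon_degree w" by (intro Suc.IH) simp
  then show ?case by (simp add: w mon_degree_add)
qed simp

end

lemma monomial_list: "\<exists>xs. u = (\<Sum>v\<leftarrow>xs. single v 1) \<and> length xs = mon_degree u"
proof (induction "mon_degree u" arbitrary: u)
  case 0
  then show ?case by (intro exI[of _ "[]"]) simp
next
  case (Suc k)
  obtain v w where vw: "u = w + single v 1" "mon_degree w = k" using mon_degree_Suc[of u k] Suc.hyps(2) by metis
  with Suc.hyps(1)[of w] obtain xs where "w = (\<Sum>v\<leftarrow>xs. single v 1)" "length xs = k" by auto
  with vw Suc.hyps(2) show ?case by (intro exI[of _ "v # xs"]) (simp add: add.commute)
qed

lemma mon_subst_sum_list: "mon_subst \<rho> (\<Sum>v\<leftarrow>xs. single v 1) = (\<Prod>v\<leftarrow>xs. \<rho> v)"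
  by (induction xs) (auto simp: mon_subst_add)

lemma prod_list_map_sort: "(\<Prod>d\<leftarrow>sort ds. f d) = (\<Prod>d\<leftarrow>ds. f d :: 'a::comm_monoid_mult)"
  by (metis mset_map mset_sort prod_mset_prod_list)

context wide_matrix
begin

abbreviation chain_ideal :: "(nat \<times> nat, 'k::comm_ring_1) mpoly set" where
  "chain_ideal \<equiv> mono_ideal VV (chain t 0 0)"

lemma is_ideal_chain: "is_ideal VV (chain_ideal :: (nat \<times> nat, 'k::comm_ring_1) mpoly set)"
proof (rule is_ideal_mono_ideal)
  show "chain t 0 0 u \<Longrightarrow> chain t 0 0 (w + u)" for u w :: "(nat \<times> nat) monomial"
    by (rule chain_mono[of t 0 0 u 0 "w + u"]) (auto simp: keys_add_nat)
qed

lemma chain_ideal_polys: "chain_ideal \<subseteq> (polys VV :: (nat \<times> nat, 'k::comm_ring_1) mpoly set)"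
  by (auto simp: mono_ideal_def)

text \<open>The evaluation that collapses every full diagonal to its first entry and kills the
  corners. It presents the quotient by the parameters as a polynomial ring in \<open>codim\<close>
  variables.\<close>

definition diag_class :: "nat \<times> nat \<Rightarrow> (nat \<times> nat, 'k::comm_ring_1) mpoly" where
  "diag_class v = (if \<exists>i d. v = pos i (i + d) \<and> d < codim then indet (pos 0 (THE d. \<exists>i. v = pos i (i + d))) else 0)"

lemma diag_class_diag: "d < codim \<Longrightarrow> diag_class (pos i (i + d)) = indet (pos 0 d)"
proof -
  assume d: "d < codim"
  have "(THE d'. \<exists>i'. pos i (i + d) = pos i' (i' + d')) = d" by (rule the_equality) auto
  then show ?thesis using d by (auto simp: diag_class_def)
qed

lemma diag_class_corner: "j < i \<or> i + codim \<le> j \<Longrightarrow> diag_class (pos i j) = 0"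
  by (auto simp: diag_class_def)

lemma pos_diag_cases:
  obtains (corner) "j < i \<or> i + codim \<le> j" | (diag) d where "j = i + d" "d < codim"
proof (cases "j < i \<or> i + codim \<le> j")
  case False
  then have "j = i + (j - i)" "j - i < codim" by linarith+
  then show thesis by (rule that(2))
qed (use that in blast)

lemma diag_class_homog: "v \<in> VV \<Longrightarrow> diag_class v \<in> homog_part VV 1"
proof (erule VV_cases)
  fix i j assume v: "v = pos i j"
  have "1 \<le> t" "codim \<le> N" using tN by (auto simp: codim_def)
  then show ?thesis unfolding v by (cases i j rule: pos_diag_cases) (auto simp: diag_class_diag diag_class_corner)
qed

context
  fixes fs :: "(nat \<times> nat, 'k::field_char_0) mpoly list"
  assumes sop: "is_sop fs"
    and sparse: "\<And>u. u \<in> monomials_in VV \<Longrightarrow> t * N - codim < card (keys u) \<Longrightarrow> chain t 0 0 u"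
begin

abbreviation CI :: "(nat \<times> nat, 'k) mpoly set" where "CI \<equiv> chain_ideal"

abbreviation E :: "(nat \<times> nat, 'k) mpoly set" where "E \<equiv> gen_ideal VV (CI \<union> set fs)"

lemma E_sub: "CI \<union> set fs \<subseteq> polys VV"
  using chain_ideal_polys sop_polys[OF sop] by blast

lemma is_ideal_E: "is_ideal VV E"
  by (rule is_ideal_gen[OF E_sub])

lemma fs_E: "set fs \<subseteq> E" and CI_E: "CI \<subseteq> E"
  using gen_ideal_superset[OF E_sub] by auto

lemma diag_class_fs: "f \<in> set fs \<Longrightarrow> subst diag_class f = 0"
proof -
  assume "f \<in> set fs"
  then obtain v where v: "f = sop_form v" "v \<in> VV" "v \<notin> first_entries" using sop by (auto simp: is_sop_def)
  obtain i j where ij: "v = pos i j" "i < t" "j < N" using v(2) by (rule VV_cases)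
  show ?thesis
  proof (cases i j rule: pos_diag_cases)
    case corner
    then show ?thesis by (simp add: v(1) ij(1) sop_form_corner diag_class_corner)
  next
    case (diag d)
    then obtain i' where "i = Suc i'" using v(3) ij(1) by (cases i) (auto simp: first_entries_def)
    then have "v = pos (Suc i') (Suc i' + d)" using ij(1) diag(1) by simp
    then show ?thesis unfolding v(1)
      by (simp only: sop_form_diagonal[OF diag(2)] subst_minus subst_indet diag_class_diag[OF diag(2)] diff_self)
  qed
qed

lemma diag_class_congruent:
  assumes Q: "is_ideal VV Q" "set fs \<subseteq> Q" and v: "v \<in> VV"
  shows "indet v - diag_class v \<in> Q"
proof -
  obtain i j where ij: "v = pos i j" "i < t" "j < N" using v by (rule VV_cases)
  show ?thesis
  proof (cases i j rule: pos_diag_cases)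
    case corner
    then show ?thesis using sop_corner[OF sop ij(2,3)] Q(2) by (auto simp: ij(1) diag_class_corner)
  next
    case (diag d)
    then show ?thesis using diagonal_congruent[OF sop Q ij(2) diag(2)] by (simp add: ij(1) diag_class_diag)
  qed
qed

lemma diag_class_diff:
  assumes "is_ideal VV Q" "set fs \<subseteq> Q" "f \<in> polys VV"
  shows "f - subst diag_class f \<in> Q"
  by (rule subst_diff_ideal[OF assms(1) _ diag_class_congruent[OF assms(1,2)] assms(3)])
    (use diag_class_homog homog_polys in blast)

text \<open>If the diagonals \<open>ds ! k\<close> weakly increase, the columns
  \<open>k + ds ! k\<close> strictly increase. The entries of these diagonals in the successive rows
  form a full chain, and \<open>diag_class\<close> sends it to the product. Since factors can be
  sorted, all products of degree \<open>t\<close> are reached.\<close>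

lemma sorted_product_in_E:
  assumes "sorted ds" "length ds = t" "set ds \<subseteq> {..<codim}"
  shows "(\<Prod>d\<leftarrow>ds. indet (pos 0 d)) \<in> E"
proof -
  define w where "w = (\<Sum>k<t. single (pos k (k + ds ! k)) (1::nat))"
  have dk: "ds ! k < codim" if "k < t" for k using assms(2,3) that nth_mem by fastforce
  have kw: "keys w = (\<lambda>k. pos k (k + ds ! k)) ` {..<t}"
    by (auto simp: w_def in_keys_iff lookup_sum lookup_single when_def image_iff split: if_splits) (metis lessThan_iff)
  have "k + ds ! k < N" if "k < t" for k using dk[OF that] that tN by (simp add: codim_def)
  then have wV: "w \<in> monomials_in VV" by (auto simp: monomials_in_def kw)
  have "chain t 0 0 w" unfolding chain_iff
  proof (intro exI[of _ "\<lambda>k. k + ds ! k"] conjI allI impI)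
    fix k l assume kl: "k < l" "l < t"
    then have "ds ! k \<le> ds ! l" using assms(1,2) by (intro sorted_nth_mono) auto
    with kl show "k + ds ! k < l + ds ! l" by linarith
  qed (auto simp: kw)
  then have "monom_poly w \<in> CI" using wV by (simp add: mono_ideal_def)
  then have wE: "monom_poly w \<in> E" using CI_E by blast
  have "mon_subst diag_class w = (\<Prod>k<t. indet (pos 0 (ds ! k)) :: (nat \<times> nat, 'k) mpoly)"
    unfolding w_def mon_subst_sum by (rule prod.cong) (auto simp: diag_class_diag dk)
  also have "\<dots> = (\<Prod>d\<leftarrow>ds. indet (pos 0 d))"
    by (simp add: prod.list_conv_set_nth assms(2) atLeast0LessThan)
  finally have s: "mon_subst diag_class w = (\<Prod>d\<leftarrow>ds. indet (pos 0 d) :: (nat \<times> nat, 'k) mpoly)" .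
  have "monom_poly w - subst diag_class (monom_poly w) \<in> E"
    by (rule diag_class_diff[OF is_ideal_E fs_E]) (use wV in simp)
  from is_ideal_minus[OF is_ideal_E wE this] show ?thesis by (simp add: s)
qed

lemma degree_t_in_E:
  assumes u: "u \<in> monomials_in VV" "mon_degree u = t"
  shows "monom_poly u \<in> E"
proof -
  obtain xs where xs: "u = (\<Sum>v\<leftarrow>xs. single v 1)" "length xs = t" using monomial_list[of u] u(2) by auto
  have s: "mon_subst diag_class u = (\<Prod>v\<leftarrow>xs. diag_class v :: (nat \<times> nat, 'k) mpoly)"
    unfolding xs(1) by (rule mon_subst_sum_list)
  have "mon_subst diag_class u \<in> E"
  proof (cases "\<exists>v\<in>set xs. diag_class v = (0 :: (nat \<times> nat, 'k) mpoly)")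
    case True
    then have "(\<Prod>v\<leftarrow>xs. diag_class v :: (nat \<times> nat, 'k) mpoly) = 0" by (subst prod_list_zero_iff) auto
    then show ?thesis unfolding s using is_ideal_0[OF is_ideal_E] by (simp only:)
  next
    case False
    have "\<exists>d<codim. diag_class v = (indet (pos 0 d) :: (nat \<times> nat, 'k) mpoly)" if "v \<in> set xs" for v
    proof -
      have "v \<in> keys u" unfolding xs(1) using that by (induction xs) (auto simp: keys_add_nat)
      then have "v \<in> VV" using u(1) by (auto simp: monomials_in_def)
      then obtain i j where ij: "v = pos i j" by (rule VV_cases)
      show ?thesis
      proof (cases i j rule: pos_diag_cases)
        case corner
        then show ?thesis using False that by (auto simp: ij diag_class_corner)
      next
        case (diag d)
        then show ?thesis by (auto simp: ij diag_class_diag)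
      qed
    qed
    then obtain d where d: "\<And>v. v \<in> set xs \<Longrightarrow> d v < codim \<and> diag_class v = (indet (pos 0 (d v)) :: (nat \<times> nat, 'k) mpoly)"
      by metis
    have "(\<Prod>v\<leftarrow>xs. diag_class v :: (nat \<times> nat, 'k) mpoly) = (\<Prod>d\<leftarrow>map d xs. indet (pos 0 d))"
      using d by (simp add: comp_def cong: map_cong)
    also have "\<dots> = (\<Prod>d\<leftarrow>sort (map d xs). indet (pos 0 d))" by (rule prod_list_map_sort[symmetric])
    also have "\<dots> \<in> E" by (rule sorted_product_in_E) (use xs(2) d in auto)
    finally show ?thesis using s by simp
  qed
  moreover have "monom_poly u - subst diag_class (monom_poly u) \<in> E"
    by (rule diag_class_diff[OF is_ideal_E fs_E]) (use u in simp)
  ultimately show ?thesis using is_ideal_diff_cancel[OF is_ideal_E, of "monom_poly u" "mon_subst diag_class u"] by simp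
qed

lemma high_degree_in_E:
  assumes f: "f \<in> homog_part VV e" and e: "t \<le> e"
  shows "f \<in> E"
proof (rule mono_ideal_expand[OF homog_polys[OF f] is_ideal_E])
  fix u assume "u \<in> keys f"
  then have u: "u \<in> monomials_in VV" "mon_degree u = e" using f by (auto simp: homog_iff polys_def)
  obtain xs where xs: "u = (\<Sum>v\<leftarrow>xs. single v 1)" "length xs = e" using monomial_list[of u] u(2) by auto
  define x w where "x = (\<Sum>v\<leftarrow>take t xs. single v (1::nat))" and "w = (\<Sum>v\<leftarrow>drop t xs. single v (1::nat))"
  have xw: "u = w + x"
    unfolding xs(1) x_def w_def by (metis add.commute append_take_drop_id map_append sum_list_append)
  have "mon_degree (\<Sum>v\<leftarrow>ys. single v 1) = length ys" for ys :: "(nat \<times> nat) list"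
    by (induction ys) (auto simp: mon_degree_add)
  then have "mon_degree x = t" using xs(2) e by (simp add: x_def)
  moreover have "x \<in> monomials_in VV" "w \<in> monomials_in VV" using u(1) by (auto simp: xw monomials_in_def keys_add_nat)
  ultimately show "monom_poly u \<in> E"
    unfolding xw monom_poly_add by (intro is_ideal_mult[OF is_ideal_E] degree_t_in_E) auto
qed

text \<open>Chains have degree at least \<open>t\<close> and the parameters vanish under
  \<open>diag_class\<close>, so nothing of smaller degree is lost. With
  \<open>high_degree_in_E\<close> this identifies the quotient as a polynomial ring modulo the
  \<open>t\<close>-th power of its irrelevant ideal.\<close>

lemma low_degree_E:
  assumes f: "f \<in> E" "f \<in> homog_part VV e" and e: "e < t"
  shows "subst diag_class f = 0"
proof -
  let ?P = "{f \<in> polys VV. \<forall>u\<in>keys (subst diag_class f). t \<le> mon_degree u} :: (nat \<times> nat, 'k) mpoly set"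
  have "is_ideal VV ?P"
  proof (rule is_idealI)
    fix x y :: "(nat \<times> nat, 'k) mpoly" assume "x \<in> ?P" "y \<in> ?P"
    then show "x + y \<in> ?P" using keys_add[of "subst diag_class x" "subst diag_class y"] by (auto simp: subst_add polys_add)
  next
    fix a x :: "(nat \<times> nat, 'k) mpoly" assume a: "a \<in> polys VV" "x \<in> ?P"
    have "t \<le> mon_degree u" if "u \<in> keys (subst diag_class a * subst diag_class x)" for u
    proof -
      from that obtain b c where "u = b + c" "c \<in> keys (subst diag_class x)"
        using keys_mult[of "subst diag_class a" "subst diag_class x"] by blast
      with a(2) show ?thesis by (auto simp: mon_degree_add intro: trans_le_add2)
    qed
    with a show "a * x \<in> ?P" by (auto simp: subst_mult polys_mult)
  qed (simp_all add: subset_iff)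
  moreover have "CI \<subseteq> ?P"
  proof
    fix f assume f: "f \<in> CI"
    have "t \<le> mon_degree u" if "u \<in> keys (subst diag_class f)" for u
    proof -
      from keys_subst[OF that] obtain w where w: "w \<in> keys f" "u \<in> keys (mon_subst diag_class w :: (nat \<times> nat, 'k) mpoly)" by blast
      have "keys w \<subseteq> VV" using f w(1) by (auto simp: mono_ideal_def polys_def monomials_in_def)
      then have "mon_subst diag_class w \<in> (homog_part VV (mon_degree w) :: (nat \<times> nat, 'k) mpoly set)"
        by (intro homog_mon_subst diag_class_homog) blast
      then have "mon_degree u = mon_degree w" using w(2) unfolding homog_iff by blast
      moreover have "chain t 0 0 w" using f w(1) by (simp add: mono_ideal_def)
      ultimately show ?thesis using chain_degree by simp
    qed
    with f show "f \<in> ?P" by (simp add: mono_ideal_def)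
  qed
  moreover have "set fs \<subseteq> ?P" using diag_class_fs sop_polys[OF sop] by auto
  ultimately have "E \<subseteq> ?P" by (intro gen_ideal_least) auto
  then have "\<forall>u\<in>keys (subst diag_class f). t \<le> mon_degree u" using f(1) by blast
  moreover have "subst diag_class f \<in> homog_part VV e" by (rule homog_subst[OF diag_class_homog f(2)])
  ultimately have "keys (subst diag_class f) = {}" using e unfolding homog_iff by (metis ex_in_conv leD)
  then show ?thesis by simp
qed

text \<open>From degree \<open>t\<close> on the target is zero. Below degree \<open>t\<close> the
  quotient agrees with a polynomial ring, where multiplication by a power of a variable is
  injective.\<close>

lemma maximal_rank_E: "has_maximal_rank VV E (indet (pos 0 0)) s j"
proof -
  have p00: "pos 0 0 \<in> VV" using tN by simp
  then have L: "indet (pos 0 0) \<in> (homog_part VV 1 :: (nat \<times> nat, 'k) mpoly set)" by simp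
  have dc: "diag_class (pos 0 0) = (indet (pos 0 0) :: (nat \<times> nat, 'k) mpoly)"
    using diag_class_diag[of 0 0] tN by (simp add: codim_def)
  have Ls: "indet (pos 0 0) ^ s * f \<in> (homog_part VV (j + s) :: (nat \<times> nat, 'k) mpoly set)" if "f \<in> homog_part VV j" for f
    using homog_mult[OF homog_power[OF L, of s] that] by (simp add: add.commute)
  show ?thesis
  proof (cases "t \<le> j + s")
    case True
    have "\<forall>g\<in>homog_part VV (j + s). \<exists>f\<in>homog_part VV j. g - indet (pos 0 0) ^ s * f \<in> E"
      using high_degree_in_E[OF _ True] by (auto intro!: bexI[of _ 0])
    with has_maximal_rank_iff(2)[OF is_ideal_E L, of s j] show ?thesis
      unfolding has_maximal_rank_def quot_part_def Let_def by blast
  next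
    case False
    have "f \<in> E" if f: "f \<in> homog_part VV j" "indet (pos 0 0) ^ s * f \<in> E" for f
    proof -
      have "subst diag_class (indet (pos 0 0) ^ s * f) = 0"
        by (rule low_degree_E[OF f(2) Ls[OF f(1)]]) (use False in simp)
      then have "indet (pos 0 0) ^ s * subst diag_class f = 0"
        unfolding subst_mult subst_power subst_indet dc .
      then have "subst diag_class f = 0" by simp
      with diag_class_diff[OF is_ideal_E fs_E homog_polys[OF f(1)]] show ?thesis by simp
    qed
    with has_maximal_rank_iff(1)[OF is_ideal_E L, of s j] show ?thesis
      unfolding has_maximal_rank_def quot_part_def Let_def by blast
  qed
qed

text \<open>A prime above \<open>E\<close> contains the \<open>t\<close>-th power of each variable,
  hence all variables, and so it is the maximal irrelevant ideal.\<close>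

lemma krull_dim_E: "krull_dim (mpoly_ring VV Quot E) = 0"
proof -
  have "l = 0" if "prime_chain VV E l" for l
  proof (rule ccontr)
    assume "l \<noteq> 0"
    with that obtain P Q where P: "prime_ideal VV P" "E \<subseteq> P" "P \<subset> Q" "prime_ideal VV Q"
      unfolding prime_chain_def by (metis One_nat_def gr_zeroI le0 less_one less_imp_le_nat nat_neq_iff not_less_zero Suc_leI)
    then have id: "is_ideal VV P" "is_ideal VV Q" by (auto simp: prime_ideal_def)
    have vP: "indet v \<in> P" if v: "v \<in> VV" for v
    proof -
      have "indet v ^ t \<in> E" using v high_degree_in_E[OF _ order_refl, of "indet v ^ t"] homog_power[of "indet v" VV 1 t] by simp
      then have "indet v ^ t \<in> P" using P(2) by blast
      then show ?thesis
      proof (induction t)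
        case 0
        then show ?case using P(1) by (simp add: prime_ideal_def)
      next
        case (Suc k)
        then show ?case using P(1) v unfolding prime_ideal_def by (metis polys_indet polys_power power_Suc)
      qed
    qed
    obtain x where x: "x \<in> Q" "x \<notin> P" using P(3) by blast
    have xV: "x \<in> polys VV" using is_ideal_polys[OF id(2) x(1)] .
    have "x - subst (\<lambda>_. 0) x \<in> P" by (rule subst_diff_ideal[OF id(1) _ _ xV]) (use vP in auto)
    moreover have s0: "subst (\<lambda>_. 0 :: (nat \<times> nat, 'k) mpoly) x = scalar (lookup x 0)"
    proof -
      have "subst (\<lambda>_. 0 :: (nat \<times> nat, 'k) mpoly) x = (\<Sum>u\<in>keys x. if u = 0 then scalar (lookup x 0) else 0)"
        unfolding subst_def by (rule sum.cong) (auto simp: mon_subst_const_0)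
      then show ?thesis by (cases "lookup x 0 = 0") (simp_all add: in_keys_iff)
    qed
    ultimately have d: "x - scalar (lookup x 0) \<in> P" by simp
    have "lookup x 0 \<noteq> 0"
    proof
      assume "lookup x 0 = 0"
      with d have "x \<in> P" by (simp only: scalar_simps diff_zero)
      with x(2) show False ..
    qed
    have "x - (x - scalar (lookup x 0)) \<in> Q" by (rule is_ideal_minus[OF id(2) x(1) psubsetD[OF P(3) d]])
    then have "scalar (lookup x 0) \<in> Q" by simp
    then have "scalar (inverse (lookup x 0)) * scalar (lookup x 0) \<in> Q" by (rule is_ideal_mult[OF id(2) polys_scalar])
    then have "1 \<in> Q" using \<open>lookup x 0 \<noteq> 0\<close> by (simp flip: scalar_mult)
    with P(4) show False by (simp add: prime_ideal_def)
  qed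
  then have "krull_dim (mpoly_ring VV Quot E) \<le> 0"
    unfolding krull_dim_Quot[OF is_ideal_E] by (intro Sup_least) (auto simp: zero_enat_def)
  then show ?thesis by simp
qed

lemma chain_ideal_sparse: "u \<in> monomials_in VV \<Longrightarrow> t * N - codim < card (keys u) \<Longrightarrow> monom_poly u \<in> CI"
  using sparse by (simp add: mono_ideal_def)

lemma chain_meets_first_entries: "u \<in> monomials_in VV \<Longrightarrow> chain t 0 0 u \<Longrightarrow> \<exists>v\<in>first_entries. v \<in> keys u"
proof -
  assume u: "u \<in> monomials_in VV" "chain t 0 0 u"
  obtain t' where t': "t = Suc t'" using tN(1) by (cases t) auto
  obtain j where j: "pos 0 j \<in> keys u" "chain t' (Suc 0) (Suc j) u" using u(2) unfolding t' by auto
  have "Suc j + t' \<le> N"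
  proof (cases "t' = 0")
    case True
    then show ?thesis using u(1) j(1) by (auto simp: monomials_in_def dest!: subsetD)
  next
    case False
    with chain_too_long[OF u(1), of t' "Suc j" "Suc 0"] j(2) show ?thesis by linarith
  qed
  then have "j < codim" unfolding codim_def using t' by linarith
  with j(1) show ?thesis by (auto simp: first_entries_def)
qed

text \<open>Every full chain begins in \<open>first_entries\<close>, so the prime generated by these
  variables contains the chain ideal. Killing the remaining variables one after another gives the
  required length.\<close>

lemma prime_chain_chain_ideal: "prime_chain VV CI (t * N - codim)"
proof -
  let ?G = "VV - first_entries"
  have "finite ?G" by simp
  then obtain vs where vs: "set vs = ?G" "distinct vs" using finite_distinct_list by blast
  have "inj_on (pos 0) {..<codim}" by (rule inj_onI) simp
  then have "card first_entries = codim" by (simp add: first_entries_def card_image)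
  moreover have "first_entries \<subseteq> VV" using tN by (auto simp: first_entries_def codim_def)
  ultimately have "card ?G = t * N - codim" by (simp add: card_Diff_subset finite_subset[OF _ finite_VV] card_VV)
  then have len: "length vs = t * N - codim" using distinct_card[OF vs(2)] vs(1) by simp
  define \<rho> where "\<rho> i v = (if v \<in> set (drop i vs) then indet v else 0 :: (nat \<times> nat, 'k) mpoly)" for i v
  define P where "P i = {f \<in> polys VV. subst (\<rho> i) f = 0}" for i
  show ?thesis
    unfolding prime_chain_def
  proof (intro exI[of _ P] conjI allI impI)
    show "prime_ideal VV (P i)" for i unfolding P_def by (rule prime_ideal_kernel)
    show "CI \<subseteq> P i" for i
    proof
      fix f assume f: "f \<in> CI"
      then have fV: "f \<in> polys VV" by (simp add: mono_ideal_def)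
      have id: "is_ideal VV (P i)" unfolding P_def by (rule is_ideal_kernel)
      show "f \<in> P i"
      proof (rule mono_ideal_expand[OF fV id])
        fix u assume u: "u \<in> keys f"
        have uV: "u \<in> monomials_in VV" using fV u by (auto simp: polys_def)
        have "chain t 0 0 u" using f u by (simp add: mono_ideal_def)
        then obtain v where v: "v \<in> first_entries" "v \<in> keys u" using chain_meets_first_entries[OF uV] by blast
        then have "\<rho> i v = 0" using vs(1) set_drop_subset[of i vs] by (auto simp: \<rho>_def)
        moreover from in_keys_split[OF v(2)] obtain w where "u = w + single v 1" by blast
        ultimately show "monom_poly u \<in> P i" using uV by (simp add: P_def mon_subst_add)
      qed
    qed
    fix i assume i: "i < t * N - codim"
    have dr: "drop i vs = vs ! i # drop (Suc i) vs" using i len by (simp add: Cons_nth_drop_Suc)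
    have v: "vs ! i \<in> VV" using vs(1) i len nth_mem by fastforce
    have nv: "vs ! i \<notin> set (drop (Suc i) vs)" using distinct_drop[OF vs(2), of i] unfolding dr by simp
    have "P i \<subseteq> P (Suc i)"
    proof
      fix f assume f: "f \<in> P i"
      have "subst (\<rho> (Suc i)) (subst (\<rho> i) f) = subst (\<rho> (Suc i)) f"
        unfolding subst_subst
      proof (rule subst_cong[where V = UNIV])
        show "subst (\<rho> (Suc i)) (\<rho> i v) = \<rho> (Suc i) v" for v unfolding \<rho>_def dr by simp
      qed simp
      with f show "f \<in> P (Suc i)" by (simp add: P_def)
    qed
    moreover have "indet (vs ! i) \<in> P (Suc i)" using v nv by (simp add: P_def \<rho>_def)
    moreover have "indet (vs ! i) \<notin> P i" by (simp add: P_def \<rho>_def dr)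
    ultimately show "P i \<subset> P (Suc i)" by blast
  qed
qed

lemma krull_dim_chain_ideal: "krull_dim (mpoly_ring VV Quot CI) = enat (t * N - codim)"
proof (rule antisym)
  show "krull_dim (mpoly_ring VV Quot CI) \<le> enat (t * N - codim)"
    by (rule krull_dim_le[OF finite_VV is_ideal_chain chain_ideal_sparse])
  show "enat (t * N - codim) \<le> krull_dim (mpoly_ring VV Quot CI)"
    unfolding krull_dim_Quot[OF is_ideal_chain] by (rule Sup_upper) (use prime_chain_chain_ideal in blast)
qed

lemma graded_depth_chain_ideal: "graded_depth VV CI = enat (t * N - codim)"
proof (rule antisym)
  show "graded_depth VV CI \<le> enat (t * N - codim)"
    by (rule graded_depth_le[OF finite_VV is_ideal_chain chain_ideal_sparse])
  have "1 \<notin> E"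
  proof
    assume one: "1 \<in> E"
    have "subst (\<lambda>_. 0 :: (nat \<times> nat, 'k) mpoly) x = 0" if x: "x \<in> CI \<union> set fs" for x
    proof (cases "x \<in> CI")
      case True
      have "u \<noteq> 0" if "u \<in> keys x" for u
        using chain_degree[of t 0 0 u] True that tN by (auto simp: mono_ideal_def)
      then show ?thesis unfolding subst_def by (intro sum.neutral) (auto simp: mon_subst_const_0)
    next
      case False
      then show ?thesis using x sop_homog[OF sop] by (intro subst_const_0_linear) auto
    qed
    from gen_ideal_subst_0[OF one E_sub this] show False by simp
  qed
  then have "regular_sequence (mpoly_ring VV Quot CI) (map (coset VV CI) fs)"
    unfolding regular_sequence_Quot[OF is_ideal_chain sop_polys[OF sop]]
    using weakly_regular_chain[OF sop] by (simp add: weakly_regular_def)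
  moreover have "set (map (coset VV CI) fs) \<subseteq> coset VV CI ` irrelevant_ideal VV"
  proof -
    have "f \<in> irrelevant_ideal VV" if "f \<in> set fs" for f
    proof -
      have "f \<in> homog_part VV 1" using sop_homog[OF sop] that by blast
      then have "f \<in> polys VV" "0 \<notin> keys f" by (auto simp: homog_iff)
      then show ?thesis by (simp add: irrelevant_iff in_keys_iff)
    qed
    then show ?thesis by auto
  qed
  ultimately have "enat (length (map (coset VV CI) fs)) \<le> graded_depth VV CI"
    unfolding graded_depth_def by (intro Sup_upper) blast
  then show "enat (t * N - codim) \<le> graded_depth VV CI" using sop by (simp add: is_sop_def)
qed

lemma strong_lefschetz_chain_ideal': "strong_lefschetz VV CI"
  unfolding strong_lefschetz_def
proof (intro conjI exI[of _ fs] exI[of _ "indet (pos 0 0)"] allI impI)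
  show "cohen_macaulay VV CI" by (simp add: cohen_macaulay_def krull_dim_chain_ideal graded_depth_chain_ideal)
  show "linear_sop VV CI fs"
    unfolding linear_sop_def extended_ideal_def
    using sop_homog[OF sop] krull_dim_E sop by (simp add: krull_dim_chain_ideal is_sop_def)
  show "indet (pos 0 0) \<in> (homog_part VV 1 :: (nat \<times> nat, 'k) mpoly set)" using tN by simp
  show "has_maximal_rank VV (extended_ideal VV CI fs) (indet (pos 0 0)) s j" for s j
    unfolding extended_ideal_def by (rule maximal_rank_E)
qed

end

lemma strong_lefschetz_chain_ideal:
  assumes "\<And>u. u \<in> monomials_in VV \<Longrightarrow> t * N - codim < card (keys u) \<Longrightarrow> chain t 0 0 u"
  shows "strong_lefschetz VV (chain_ideal :: (nat \<times> nat, 'k::field_char_0) mpoly set)"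
  using sop_exists strong_lefschetz_chain_ideal'[OF _ assms] by blast

end

section \<open>The initial ideal of the maximal minors\<close>

lemma incr_self:
  assumes "incr s s f" "i < s"
  shows "f i = i"
proof -
  have "f ` {..<s} = {..<s}"
    by (rule card_subset_eq) (use assms(1) card_image[OF incr_inj_on[OF assms(1)]] in \<open>auto simp: incr_def\<close>)
  moreover have "incr s s id" by (simp add: incr_def)
  then have "pick ({..<s}) i = i" using pick_incr[of s s id i] assms(2) by simp
  ultimately show ?thesis using pick_incr[OF assms] by simp
qed

locale maximal_minors = diag_init m n t r K + wide_matrix pos t N "matrix_vars m n"
  for m n t r and K :: "'k::field_char_0 itself" and pos N +
  assumes pos_cases: "(pos = Pair \<and> m = t \<and> n = N) \<or> (pos = (\<lambda>i j. (j, i)) \<and> n = t \<and> m = N)"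
begin

definition max_minor :: "(nat \<Rightarrow> nat) \<Rightarrow> (nat \<times> nat, 'k) mpoly" where
  "max_minor c = (if pos = Pair then minor_of t id c else minor_of t c id)"

definition max_diag :: "(nat \<Rightarrow> nat) \<Rightarrow> (nat \<times> nat) monomial" where
  "max_diag c = (\<Sum>k<t. single (pos k (c k)) 1)"

lemma Pair_neq_swap: "Pair \<noteq> (\<lambda>i j :: nat. (j, i))"
  by (metis Pair_inject zero_neq_one)

lemma max_minor_props:
  assumes c: "incr t N c"
  shows "max_minor c \<in> It" "max_minor c \<in> homog_part V t" "below (max_diag c) (max_minor c)"
    "lookup (max_minor c) (max_diag c) = 1" "max_diag c \<in> init_mons It" "max_diag c \<in> monomials_in V"
proof -
  have "\<exists>f g. incr t m f \<and> incr t n g \<and> max_minor c = minor_of t f g \<and> max_diag c = diag_mon t f g"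
    using pos_cases
  proof
    assume p: "pos = Pair \<and> m = t \<and> n = N"
    show ?thesis unfolding max_minor_def max_diag_def diag_mon_def
      by (rule exI[of _ id], rule exI[of _ c]) (use p c in \<open>simp add: incr_def\<close>)
  next
    assume p: "pos = (\<lambda>i j. (j, i)) \<and> n = t \<and> m = N"
    then have np: "pos \<noteq> Pair" using Pair_neq_swap by metis
    show ?thesis unfolding max_minor_def max_diag_def diag_mon_def
      by (rule exI[of _ c], rule exI[of _ id]) (use p np c in \<open>simp add: incr_def\<close>)
  qed
  then obtain f g where fg: "incr t m f" "incr t n g" and eq: "max_minor c = minor_of t f g" "max_diag c = diag_mon t f g" by blast
  have t1: "1 \<le> t" using t(1) by simp
  show "max_minor c \<in> It" "max_minor c \<in> homog_part V t" "below (max_diag c) (max_minor c)"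
    "lookup (max_minor c) (max_diag c) = 1" "max_diag c \<in> init_mons It" "max_diag c \<in> monomials_in V"
    unfolding eq using minor_in_It[OF fg] minor_homog[OF fg] minor_below[OF t1 fg] lookup_diag_minor[OF fg]
      diag_in_init_mons[OF fg] diag_mon_in[OF incr_vars[OF fg]] by auto
qed

lemma chain_split:
  assumes u: "u \<in> monomials_in V" "chain t 0 0 u"
  obtains x c where "incr t N c" "x \<in> monomials_in V" "u = x + max_diag c"
proof -
  from u(2) obtain c where c: "\<And>k. k < t \<Longrightarrow> pos k (c k) \<in> keys u" "\<And>k l. k < l \<Longrightarrow> l < t \<Longrightarrow> c k < c l"
    unfolding chain_iff by auto
  have "c k < N" if "k < t" for k using c(1)[OF that] u(1) pos_VV[of k "c k"] by (auto simp: monomials_in_def)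
  then have ic: "incr t N c" using c(2) by (simp add: incr_def)
  have "max_diag c + (u - max_diag c) = u"
  proof (rule poly_mapping_eqI)
    fix v
    have "lookup (max_diag c) v \<le> lookup u v"
    proof (cases "\<exists>k<t. v = pos k (c k)")
      case True
      then obtain k where k: "k < t" "v = pos k (c k)" by blast
      have "lookup (max_diag c) v = (\<Sum>l<t. if l = k then 1 else 0)"
        unfolding max_diag_def lookup_sum by (rule sum.cong) (auto simp: k lookup_single when_def)
      also have "\<dots> = 1" using k(1) by simp
      also have "1 \<le> lookup u v" using c(1)[OF k(1)] by (simp add: k(2) in_keys_iff)
      finally show ?thesis .
    next
      case False
      then have "lookup (max_diag c) v = 0"
        unfolding max_diag_def lookup_sum by (intro sum.neutral) (auto simp: lookup_single when_def)
      then show ?thesis by simp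
    qed
    then show "lookup (max_diag c + (u - max_diag c)) v = lookup u v" by (simp add: lookup_add lookup_minus)
  qed
  then have eq: "u = (u - max_diag c) + max_diag c" by (simp add: add.commute)
  then have "keys (u - max_diag c) \<subseteq> keys u" by (metis Un_upper1 keys_add_nat)
  then have "u - max_diag c \<in> monomials_in V" using u(1) by (auto simp: monomials_in_def)
  then show thesis using that[OF ic _ eq] by blast
qed

text \<open>The evaluated matrix has its last row among the combinations of the other
  \<open>t - 1\<close>, so its maximal minors vanish.\<close>

lemma comb_kills_It:
  assumes "f \<in> It"
  shows "subst (comb (t - 1) 0) f = 0"
proof -
  let ?\<rho> = "comb (t - 1) 0 :: nat \<times> nat \<Rightarrow> (nat \<times> nat, 'k) mpoly"
  define L :: "nat \<Rightarrow> nat \<Rightarrow> (nat \<times> nat, 'k) mpoly" where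
    "L p k = (if p = t - 1 then indet (pos t k) else if p = k then 1 else 0)" for p k
  have entry: "?\<rho> (pos p j) = (\<Sum>k<t - 1. L p k * indet (pos k j))" if "p < t" for p j
  proof (cases "p = t - 1")
    case True
    then show ?thesis using t(1) comb_last[of "t - 1" 0 j] by (simp add: L_def atLeast0LessThan)
  next
    case False
    then have "(\<Sum>k<t - 1. L p k * indet (pos k j)) = (\<Sum>k<t - 1. if k = p then indet (pos p j) else 0)"
      by (intro sum.cong) (auto simp: L_def)
    also have "\<dots> = indet (pos p j)" using False that by simp
    finally show ?thesis using False comb_other[of "pos p j" "t - 1" 0] by simp
  qed
  have rk: "det (mat t t (\<lambda>(p, q). ?\<rho> (pos p (c q)))) = 0" for c
    by (rule det_low_rank[where L = L and Y = "\<lambda>k q. indet (pos k (c q))"]) (use entry t(1) in auto)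
  have "subst ?\<rho> (minor_of t f g) = 0" if fg: "incr t m f" "incr t n g" for f g
    using pos_cases
  proof
    assume p: "pos = Pair \<and> m = t \<and> n = N"
    then have "mat t t (\<lambda>(p, q). ?\<rho> (f p, g q)) = mat t t (\<lambda>(p, q). ?\<rho> (pos p (g q)))"
      using incr_self[of t f] fg by (intro eq_matI) auto
    then show ?thesis using rk[of g] by (simp only: subst_minor_of)
  next
    assume p: "pos = (\<lambda>i j. (j, i)) \<and> n = t \<and> m = N"
    have "det (mat t t (\<lambda>(p, q). ?\<rho> (f p, g q))) = det (transpose_mat (mat t t (\<lambda>(p, q). ?\<rho> (f p, g q))))"
      by (rule det_transpose[symmetric, where n = t]) simp
    also have "transpose_mat (mat t t (\<lambda>(p, q). ?\<rho> (f p, g q))) = mat t t (\<lambda>(p, q). ?\<rho> (pos p (f q)))"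
      using p incr_self[of t g] fg by (intro eq_matI) auto
    finally show ?thesis using rk[of f] by (simp only: subst_minor_of)
  qed
  then show ?thesis by (intro gen_ideal_subst_0[OF assms[unfolded It_eq] minors_polys]) blast
qed

lemma standard_in_It:
  assumes f: "f \<in> It" and std: "\<And>u. u \<in> keys f \<Longrightarrow> \<not> chain t 0 0 u"
  shows "f = 0"
proof (rule standard_independent[of 0 "t - 1" "t - 1" f 0])
  have St: "Suc (t - 1) = t" using t(1) by simp
  show "\<not> chain (Suc (t - 1)) 0 0 u" if "u \<in> keys f" for u using std[OF that] by (simp only: St not_False_eq_True)
  show "\<exists>k j. 0 \<le> k \<and> k \<le> t - 1 \<and> v = pos k j" if "u \<in> keys f" "v \<in> keys u" for u v
  proof -
    have "v \<in> V" using that It_polys f by (auto simp: polys_def monomials_in_def)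
    then obtain i j where "v = pos i j" "i < t" by (rule VV_cases)
    then show ?thesis by (intro exI[of _ i] exI[of _ j]) auto
  qed
  show "subst (comb (t - 1) 0) f = 0" by (rule comb_kills_It[OF f])
qed simp_all

text \<open>Subtracting a multiple of a maximal minor trades a nonstandard monomial for smaller ones
  of the same degree, of which there are finitely many. The last clause keeps standard monomials
  untouched, as needed to follow a coefficient in \<open>init_mons_chain\<close>.\<close>

lemma straighten_monomial:
  assumes "w \<in> monomials_in V"
  shows "\<exists>q\<in>polys V. monom_poly w - q \<in> It \<and> (\<forall>u\<in>keys q. \<not> chain t 0 0 u \<and> u \<preceq> w) \<and> (\<not> chain t 0 0 w \<longrightarrow> q = monom_poly w)"
  using assms
proof (induction "card {u \<in> monomials_in V. mon_degree u = mon_degree w \<and> u \<preceq> w \<and> u \<noteq> w}" arbitrary: w rule: less_induct)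
  case less
  show ?case
  proof (cases "chain t 0 0 w")
    case False
    then show ?thesis using less.prems is_ideal_0[OF is_ideal_It] le_refl[OF less.prems]
      by (intro bexI[of _ "monom_poly w"]) auto
  next
    case True
    obtain x c where c: "incr t N c" and x: "x \<in> monomials_in V" and w: "w = x + max_diag c"
      by (rule chain_split[OF less.prems True])
    note M = max_minor_props[OF c]
    define p where "p = monom_poly w - monom_poly x * max_minor c"
    have bel: "below w (monom_poly x * max_minor c)" and one: "lookup (monom_poly x * max_minor c) w = 1"
      using below_mult[of x "monom_poly x" "max_diag c" "max_minor c"] M(3,4) x le_refl[OF x]
      by (auto simp: w below_def lookup_monom_poly)
    have hom: "monom_poly x * max_minor c \<in> homog_part V (mon_degree w)"
      using homog_mult[of "monom_poly x" V "mon_degree x" "max_minor c" t] M(2) x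
      by (simp add: w mon_degree_add max_diag_def mon_degree_sum)
    have pk: "u \<in> monomials_in V \<and> mon_degree u = mon_degree w \<and> u \<preceq> w \<and> u \<noteq> w" if "u \<in> keys p" for u
    proof -
      have u: "u \<noteq> w" using that one by (auto simp: p_def in_keys_iff lookup_minus lookup_monom_poly)
      then have "u \<in> keys (monom_poly x * max_minor c)" using that by (auto simp: p_def in_keys_iff lookup_minus lookup_monom_poly)
      with u bel hom show ?thesis unfolding below_def homog_iff polys_def by blast
    qed
    have fin: "finite {u \<in> monomials_in V. mon_degree u = mon_degree w \<and> u \<preceq> w \<and> u \<noteq> w}"
    proof (rule finite_subset)
      show "{u \<in> monomials_in V. mon_degree u = mon_degree w \<and> u \<preceq> w \<and> u \<noteq> w} \<subseteq> {u \<in> monomials_in V. mon_degree u \<le> mon_degree w}"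
        by auto
    qed (simp add: finite_mons_le)
    have "\<exists>q\<in>polys V. monom_poly u - q \<in> It \<and> (\<forall>y\<in>keys q. \<not> chain t 0 0 y \<and> y \<preceq> u)" if "u \<in> keys p" for u
    proof -
      have "card {y \<in> monomials_in V. mon_degree y = mon_degree u \<and> y \<preceq> u \<and> y \<noteq> u} <
        card {u \<in> monomials_in V. mon_degree u = mon_degree w \<and> u \<preceq> w \<and> u \<noteq> w}"
        by (rule psubset_card_mono[OF fin]) (use pk[OF that] in \<open>auto intro: le_trans dest: le_antisym\<close>)
      from less.hyps[OF this] pk[OF that] show ?thesis by blast
    qed
    then obtain q where q: "\<And>u. u \<in> keys p \<Longrightarrow> q u \<in> polys V" "\<And>u. u \<in> keys p \<Longrightarrow> monom_poly u - q u \<in> It"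
      "\<And>u y. u \<in> keys p \<Longrightarrow> y \<in> keys (q u) \<Longrightarrow> \<not> chain t 0 0 y \<and> y \<preceq> u" by metis
    define s where "s = (\<Sum>u\<in>keys p. scalar (lookup p u) * q u)"
    have "p - s = (\<Sum>u\<in>keys p. scalar (lookup p u) * (monom_poly u - q u))"
      unfolding s_def by (subst mpoly_expand[of p]) (simp add: sum_subtractf right_diff_distrib)
    also have "\<dots> \<in> It" by (intro is_ideal_sum[OF is_ideal_It] is_ideal_mult[OF is_ideal_It] q polys_scalar)
    finally have "p - s \<in> It" .
    moreover have "monom_poly x * max_minor c \<in> It" using M(1) x by (intro is_ideal_mult[OF is_ideal_It]) auto
    ultimately have "(p - s) + monom_poly x * max_minor c \<in> It" by (rule is_ideal_add[OF is_ideal_It])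
    then have "monom_poly w - s \<in> It" by (simp add: p_def)
    moreover have "s \<in> polys V" unfolding s_def by (intro polys_sum polys_mult q polys_scalar)
    moreover have "\<not> chain t 0 0 y \<and> y \<preceq> w" if "y \<in> keys s" for y
    proof -
      have "y \<in> (\<Union>u\<in>keys p. keys (scalar (lookup p u) * q u))"
        using that keys_sum[of "\<lambda>u. scalar (lookup p u) * q u" "keys p"] unfolding s_def by blast
      then obtain u where u: "u \<in> keys p" "y \<in> keys (q u)" by (auto simp: in_keys_iff)
      then show ?thesis using q(3)[OF u] pk[OF u(1)] by (auto intro: le_trans)
    qed
    ultimately show ?thesis using True by blast
  qed
qed

text \<open>Suppose \<open>w\<close> were standard. Straightening all monomials of \<open>f\<close>
  keeps the coefficient of \<open>w\<close>, because the remainders of the smaller monomials stay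
  below them. The result is a standard polynomial in the determinantal ideal, so it is zero by
  \<open>standard_in_It\<close>.\<close>

lemma init_mons_chain:
  assumes "w \<in> init_mons It"
  shows "chain t 0 0 w"
proof (rule ccontr)
  assume nc: "\<not> chain t 0 0 w"
  from assms obtain f where f: "f \<in> It" "f \<noteq> 0" "w = initial_monomial r f" by (auto simp: init_mons_def)
  have fV: "f \<in> polys V" using f(1) It_polys by blast
  have w: "w \<in> keys f" "\<And>u. u \<in> keys f \<Longrightarrow> u \<preceq> w" using initial_monomial[OF fV f(2)] f(3) by auto
  have "\<exists>q\<in>polys V. monom_poly u - q \<in> It \<and> (\<forall>y\<in>keys q. \<not> chain t 0 0 y \<and> y \<preceq> u) \<and> (\<not> chain t 0 0 u \<longrightarrow> q = monom_poly u)"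
    if "u \<in> keys f" for u
    by (rule straighten_monomial) (use fV that in \<open>auto simp: polys_def\<close>)
  then obtain q where q: "\<And>u. u \<in> keys f \<Longrightarrow> monom_poly u - q u \<in> It"
    "\<And>u y. u \<in> keys f \<Longrightarrow> y \<in> keys (q u) \<Longrightarrow> \<not> chain t 0 0 y \<and> y \<preceq> u"
    "\<And>u. u \<in> keys f \<Longrightarrow> \<not> chain t 0 0 u \<Longrightarrow> q u = monom_poly u" by metis
  define s where "s = (\<Sum>u\<in>keys f. scalar (lookup f u) * q u)"
  have "f - s = (\<Sum>u\<in>keys f. scalar (lookup f u) * (monom_poly u - q u))"
    unfolding s_def by (subst mpoly_expand[of f]) (simp add: sum_subtractf right_diff_distrib)
  also have "\<dots> \<in> It" by (intro is_ideal_sum[OF is_ideal_It] is_ideal_mult[OF is_ideal_It] q polys_scalar)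
  finally have "f - (f - s) \<in> It" by (rule is_ideal_minus[OF is_ideal_It f(1)])
  then have "s \<in> It" by simp
  moreover have "\<not> chain t 0 0 y" if "y \<in> keys s" for y
  proof -
    have "y \<in> (\<Union>u\<in>keys f. keys (scalar (lookup f u) * q u))"
      using that keys_sum[of "\<lambda>u. scalar (lookup f u) * q u" "keys f"] unfolding s_def by blast
    then obtain u where u: "u \<in> keys f" "y \<in> keys (q u)" by (auto simp: in_keys_iff)
    then show ?thesis using q(2)[OF u] by blast
  qed
  ultimately have "s = 0" by (rule standard_in_It)
  have "lookup s w = (\<Sum>u\<in>keys f. if u = w then lookup f w else 0)"
    unfolding s_def lookup_sum
  proof (rule sum.cong)
    fix u assume u: "u \<in> keys f"
    have "w \<notin> keys (q u)" if "u \<noteq> w"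
      using q(2)[OF u, of w] w(2)[OF u] that by (auto dest: le_antisym)
    then show "lookup (scalar (lookup f u) * q u) w = (if u = w then lookup f w else 0)"
      using q(3)[OF u] nc by (auto simp: in_keys_iff lookup_monom_poly)
  qed simp
  also have "\<dots> = lookup f w" using w(1) by simp
  finally show False using \<open>s = 0\<close> w(1) by (simp add: in_keys_iff)
qed

lemma inI_chain_ideal: "inI = chain_ideal"
proof (rule antisym)
  show "inI \<subseteq> chain_ideal"
  proof
    fix f assume f: "f \<in> inI"
    have "chain t 0 0 u" if "u \<in> keys f" for u
    proof -
      from f that obtain w x where w: "w \<in> init_mons It" "u = x + w" unfolding inI_eq by blast
      show ?thesis by (rule chain_mono[OF init_mons_chain[OF w(1)]]) (auto simp: w(2) keys_add_nat)
    qed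
    then show "f \<in> chain_ideal" using is_ideal_polys[OF is_ideal_inI f] by (simp add: mono_ideal_def)
  qed
  show "chain_ideal \<subseteq> inI"
  proof
    fix f :: "(nat \<times> nat, 'k) mpoly" assume f: "f \<in> chain_ideal"
    then have fV: "f \<in> polys V" by (simp add: mono_ideal_def)
    show "f \<in> inI"
    proof (rule mono_ideal_expand[OF fV is_ideal_inI])
      fix u assume u: "u \<in> keys f"
      have "u \<in> monomials_in V" using fV u by (auto simp: polys_def)
      moreover have "chain t 0 0 u" using f u by (simp add: mono_ideal_def)
      ultimately obtain x c where "incr t N c" "x \<in> monomials_in V" "u = x + max_diag c" by (rule chain_split)
      then show "monom_poly u \<in> inI"
        using init_mons_monom_poly[OF It_polys max_minor_props(5)] by blast
    qed
  qed
qed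

lemma strong_lefschetz_inI: "strong_lefschetz V inI"
  unfolding inI_chain_ideal
proof (rule strong_lefschetz_chain_ideal)
  fix u assume u: "u \<in> monomials_in V" "t * N - codim < card (keys u)"
  \<comment> \<open>One side of the matrix equals \<open>t\<close>, so one of the two factors is 1
    and the general bound becomes \<open>t * N - codim\<close>.\<close>
  have "m * n - (m - t + 1) * (n - t + 1) = t * N - codim"
    using pos_cases by (auto simp: codim_def mult.commute)
  then have "monom_poly u \<in> inI" using u sparse_in_inI by simp
  then show "chain t 0 0 u" unfolding inI_chain_ideal by (simp add: mono_ideal_def)
qed

end

theorem mainTheorem1:
  fixes m n t :: nat
    and r :: "((nat \<times> nat) monomial \<times> (nat \<times> nat) monomial) set"
  assumes "0 < m" and "0 < n" and "2 \<le> t" and "t \<le> min m n" and "t < max m n"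
    and "diagonal_order TYPE('k::field_char_0) m n r"
  shows "let V = matrix_vars m n;
             in_I = initial_ideal V r
               (determinantal_ideal m n t :: (nat \<times> nat, 'k) mpoly set)
         in (t = min m n \<longrightarrow> strong_lefschetz V in_I) \<and>
            (t < min m n \<longrightarrow>
               (t = 2 \<and> m * n \<ge> 16) \<or>
               (t = 3 \<and> m * n \<ge> 24) \<or>
               (t \<ge> 4 \<and> m * n \<ge> (t + 1) * (t + 2)) \<longrightarrow>
               \<not> weak_lefschetz V in_I)"
proof -
  interpret D: diag_init m n t r "TYPE('k)"
    using assms by unfold_locales auto
  have a: "strong_lefschetz D.V D.inI" if tm: "t = min m n"
  proof (cases "t = m")
    case True
    interpret maximal_minors m n t r "TYPE('k)" Pair n
      by unfold_locales (use True assms in \<open>auto simp: matrix_vars_def\<close>)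
    show ?thesis by (rule strong_lefschetz_inI)
  next
    case False
    then have tn: "t = n" using tm by (simp add: min_def split: if_splits)
    \<comment> \<open>Positions are transposed here, so that the columns play the part of the short
      side.\<close>
    interpret maximal_minors m n t r "TYPE('k)" "\<lambda>i j. (j, i)" m
      by unfold_locales (use tn assms in \<open>auto simp: matrix_vars_def\<close>)
    show ?thesis by (rule strong_lefschetz_inI)
  qed
  have b: "\<not> weak_lefschetz D.V D.inI"
    if "t < min m n" "(t = 2 \<and> m * n \<ge> 16) \<or> (t = 3 \<and> m * n \<ge> 24) \<or> (t \<ge> 4 \<and> m * n \<ge> (t + 1) * (t + 2))"
    using D.not_weak_lefschetz_range that by simp
  show ?thesis unfolding Let_def using a b by blast
qed

end
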